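(* Let $(M,g)$ be a smooth Riemannian surface and let $p_0\in M$ be a point such that each of the functions $I_3$ and $I_{4b}$ is either identically zero near $p_0$ or nonzero at $p_0$. Then $\dim\mathcal J_2=3$ (locally there are exactly 3 linearly independent quadratic integrals, the Hamiltonian included) if and only if $I_3\neq0$, $I_{4b}\ne0$ at $p_0$ and the following 4 relations hold identically in a neighbourhood of $p_0$: $$\begin{aligned} I_{6a}=\tfrac1{175I_3^2I_{4b}}\bigl(&700I_3^5I_{4b}-825I_2I_3^4I_{5b}+50I_2I_3^3I_{4b}(31I_{4a}-18I_{4c})\\ &+6I_{4b}(I_{4a}-I_{4c})(6I_{4a}^2+49I_{4b}^2-37I_{4a}I_{4c}+6I_{4c}^2)-25I_3^2I_{5b}(-8I_{5a}+I_{5c})\\ &-5I_3(48I_{4a}^2I_{5b}-27I_{5b}I_{4c}^2+2I_{4b}I_{4c}(-11I_{5a}+46I_{5c})\\ &+I_{4a}(-43I_{5a}I_{4b}-21I_{5b}I_{4c}+8I_{4b}I_{5c})+7I_{4b}^2(4I_{5b}-11I_{5d}))\bigr), \end{aligned}$$ $$\begin{aligned} I_{6b}=\tfrac1{175I_3^2I_{4b}}\bigl(&1505I_2I_3^3I_{4b}^2+72I_{4a}^2I_{4b}^2+245I_3I_{5a}I_{4b}^2+588I_{4b}^4+225I_3^2I_{5b}^2\\ &+405I_3I_{4b}I_{5b}I_{4c}+72I_{4b}^2I_{4c}^2-6I_{4a}I_{4b}(55I_3I_{5b}+74I_{4b}I_{4c})-490I_3I_{4b}^2I_{5c}\bigr),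 \end{aligned}$$ $$\begin{aligned} I_{6c}=\tfrac1{175I_3^2I_{4b}}\bigl(&-175I_3^5I_{4b}+300I_2I_3^4I_{5b}-25I_3^2I_{5a}I_{5b}-100I_2I_3^3I_{4b}(5I_{4a}-9I_{4c})\\ &-6I_{4b}(I_{4a}-I_{4c})(6I_{4a}^2+49I_{4b}^2-37I_{4a}I_{4c}+6I_{4c}^2)+200I_3^2I_{5b}I_{5c}\\ &+5I_3(6I_{4a}^2I_{5b}+36I_{5b}I_{4c}^2-I_{4b}I_{4c}(I_{5a}+34I_{5c})\\ &+6I_{4a}(I_{5a}I_{4b}-7I_{5b}I_{4c}-I_{4b}I_{5c})+7I_{4b}^2(8I_{5b}-I_{5d}))\bigr), \end{aligned}$$ $$\begin{aligned} I_{6d}=\tfrac1{175I_3^2I_{4b}}\bigl(&1500I_2^2I_3^6+36I_{4a}^4+25I_3^2I_{5a}^2+245I_3I_{5a}I_{4b}^2+588I_{4b}^4+225I_3^2I_{5b}^2\\ &-294I_{4a}^3I_{4c}+895I_3I_{4b}I_{5b}I_{4c}-185I_3I_{5a}I_{4c}^2+366I_{4b}^2I_{4c}^2+36I_{4c}^4\\ &+6I_{4a}^2(61I_{4b}^2+86I_{4c}^2-5I_3(2I_{5a}-9I_{5c}))-225I_3^2I_{5a}I_{5c}-490I_3I_{4b}^2I_{5c}\\ &+220I_3I_{4c}^2I_{5c}+200I_3^2I_{5c}^2+5I_2I_3^3(102I_{4a}^2-294I_{4a}I_{4c}+4(49I_{4b}^2+48I_{4c}^2)\\ &+I_3(-85I_{5a}+260I_{5c}))-245I_3I_{4b}I_{4c}I_{5d}-I_{4a}(6I_{4c}(172I_{4b}^2+49I_{4c}^2)\\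 &+5I_3(-49I_{4c}(I_{5a}-2I_{5c})+I_{4b}(164I_{5b}-49I_{5d})))\bigr). \end{aligned}$$
   Context: Let $H=\sum g^{ij}p_ip_j$ be the Hamiltonian of the geodesic flow of $g$ on $T^*M$. Everything is local: $\mathcal J_n=\mathcal J_n(g)$ denotes the real vector space of germs at $p_0$ of integrals homogeneous of degree $n$ in momenta, i.e. of functions $F=\sum_{i+j=n}u_{ij}(x,y)p_x^ip_y^j$ defined on $T^*U$ for some neighbourhood $U$ of $p_0$, with smooth $u_{ij}$, such that $\{H,F\}=0$ (canonical Poisson bracket). Differential invariants: $K$ is the Gaussian curvature, $\nabla$ the Levi-Civita connection, $\operatorname{grad}K$ the $g$-gradient of $K$, and $\operatorname{sgrad}K$ its rotation by $\pi/2$ (a local orientation is fixed). Put $d_\nabla^{\otimes1}K=dK$ and $(d_\nabla^{\otimes l}K)(\xi_1,\dots,\xi_l)=(\nabla_{\xi_1}d_\nabla^{\otimes(l-1)}K)(\xi_2,\dots,\xi_l)$. Set $I_2=K$, $I_3=|\operatorname{grad}K|^2$, and for $i=l+2\ge4$, $0\le j\le l$, $$I_{ij}=d_\nabla^{\otimes l}K(\underbrace{\operatorname{grad}K,\dots,\operatorname{grad}K}_{l-j},\underbrace{\operatorname{sgrad}K,\dots,\operatorname{sgrad}K}_{j}),$$ with the index $j=0,1,2,3,4,\dots$ written as a letter $a,b,c,d,e,\dots$ (e.g. $I_{4b}=I_{41}$, $I_{5d}=I_{53}$, $I_{6a}=I_{60}$). *)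

theory Defs
  imports "HOL-Analysis.Analysis"
begin

text \<open>
  Everything is local, so a Riemannian surface is given by the matrix field
  \<open>g\<close> of its metric in a positively oriented chart, an open subset of \<open>\<real>\<^sup>2\<close>.
  Momenta are the canonical fibre coordinates on the cotangent bundle, so a
  function on it has type \<open>real^2 \<Rightarrow> real^2 \<Rightarrow> real\<close> (base point first).
\<close>

type_synonym scalar_field = "real^2 \<Rightarrow> real"
type_synonym vector_field = "real^2 \<Rightarrow> real^2"
type_synonym metric = "real^2 \<Rightarrow> real^2^2"
type_synonym phase_function = "real^2 \<Rightarrow> real^2 \<Rightarrow> real"

definition pd :: "2 \<Rightarrow> scalar_field \<Rightarrow> scalar_field" where
  "pd i f x = frechet_derivative f (at x) (axis i 1)"

definition smooth_on :: "(real^2) set \<Rightarrow> scalar_field \<Rightarrow> bool" where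
  "smooth_on S f \<longleftrightarrow> (\<forall>is. foldr pd is f differentiable_on S)"

definition riemannian_metric_on :: "(real^2) set \<Rightarrow> metric \<Rightarrow> bool" where
  "riemannian_metric_on U g \<longleftrightarrow>
     (\<forall>i j. smooth_on U (\<lambda>x. g x $ i $ j)) \<and>
     (\<forall>x\<in>U. transpose (g x) = g x) \<and>
     (\<forall>x\<in>U. \<forall>v. v \<noteq> 0 \<longrightarrow> v \<bullet> (g x *v v) > 0)"

definition christoffel :: "metric \<Rightarrow> 2 \<Rightarrow> 2 \<Rightarrow> 2 \<Rightarrow> scalar_field" where
  "christoffel g k i j x =
     (1/2) * (\<Sum>l\<in>UNIV. matrix_inv (g x) $ k $ l *
        (pd i (\<lambda>y. g y $ j $ l) x + pd j (\<lambda>y. g y $ i $ l) x - pd l (\<lambda>y. g y $ i $ j) x))"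

definition dir_deriv :: "vector_field \<Rightarrow> scalar_field \<Rightarrow> scalar_field" where
  "dir_deriv X f x = frechet_derivative f (at x) (X x)"

definition cov_deriv :: "metric \<Rightarrow> vector_field \<Rightarrow> vector_field \<Rightarrow> vector_field" where
  "cov_deriv g X Y x = (\<chi> k. dir_deriv X (\<lambda>y. Y y $ k) x +
     (\<Sum>i\<in>UNIV. \<Sum>j\<in>UNIV. christoffel g k i j x * X x $ i * Y x $ j))"

definition metric_inner :: "metric \<Rightarrow> real^2 \<Rightarrow> real^2 \<Rightarrow> real^2 \<Rightarrow> real" where
  "metric_inner g x v w = v \<bullet> (g x *v w)"

definition coord_field :: "2 \<Rightarrow> vector_field" where
  "coord_field i = (\<lambda>x. axis i 1)"

text \<open>
  The curvature operator is
  \<open>R(X,Y)Z = \<nabla>\<^sub>X\<nabla>\<^sub>Y Z - \<nabla>\<^sub>Y\<nabla>\<^sub>X Z - \<nabla>\<^bsub>[X,Y]\<^esub> Z\<close> and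
  \<open>K = g(R(e1,e2)e2, e1) / det g\<close> for the coordinate fields \<open>e1\<close>, \<open>e2\<close>, which commute.
  With this sign round spheres have positive curvature.
\<close>

definition gauss_curvature :: "metric \<Rightarrow> scalar_field" where
  "gauss_curvature g x =
     (let e1 = coord_field 1; e2 = coord_field 2 in
      metric_inner g x
        (cov_deriv g e1 (cov_deriv g e2 e2) x - cov_deriv g e2 (cov_deriv g e1 e2) x) (e1 x)
      / det (g x))"

definition grad :: "metric \<Rightarrow> scalar_field \<Rightarrow> vector_field" where
  "grad g f x = matrix_inv (g x) *v (\<chi> i. pd i f x)"

text \<open>
  Rotation by \<open>\<pi>/2\<close>: \<open>rot90 g x v\<close> is \<open>g\<close>-orthogonal to \<open>v\<close>, has the same
  \<open>g\<close>-length, and \<open>(v, rot90 g x v)\<close> is positively oriented for \<open>v \<noteq> 0\<close>.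
\<close>

definition rot90 :: "metric \<Rightarrow> real^2 \<Rightarrow> real^2 \<Rightarrow> real^2" where
  "rot90 g x v = (1 / sqrt (det (g x))) *\<^sub>R vector [- ((g x *v v) $ 2), (g x *v v) $ 1]"

definition sgrad :: "metric \<Rightarrow> scalar_field \<Rightarrow> vector_field" where
  "sgrad g f x = rot90 g x (grad g f x)"

text \<open>
  \<open>cov_differential g f [X1, ..., Xl]\<close> is the \<open>l\<close>-th iterated covariant differential
  of \<open>f\<close> evaluated on vector fields; the step is the Leibniz rule
  \<open>(\<nabla>\<^sub>X T)(Y1,...,Yl) = X(T(Y1,...,Yl)) - \<Sum>\<^sub>m T(Y1,...,\<nabla>\<^sub>X Ym,...,Yl)\<close>.
\<close>

fun cov_differential :: "metric \<Rightarrow> scalar_field \<Rightarrow> vector_field list \<Rightarrow> scalar_field" where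
  "cov_differential g f [] = f"
| "cov_differential g f (X # Ys) = (\<lambda>x.
     dir_deriv X (cov_differential g f Ys) x -
     (\<Sum>m<length Ys. cov_differential g f (Ys[m := cov_deriv g X (Ys ! m)]) x))"

definition inv2 :: "metric \<Rightarrow> scalar_field" where
  "inv2 g = gauss_curvature g"

definition inv3 :: "metric \<Rightarrow> scalar_field" where
  "inv3 g x = (let v = grad g (gauss_curvature g) x in metric_inner g x v v)"

text \<open>
  \<open>dinv g i j\<close> is \<open>I\<^sub>i\<^sub>j\<close>, for \<open>i \<ge> 4\<close> and \<open>j \<le> i - 2\<close>; the letters
  \<open>a\<close>, \<open>b\<close>, \<open>c\<close>, \<open>d\<close> in the second index correspond to \<open>j = 0, 1, 2, 3\<close>.
\<close>

definition dinv :: "metric \<Rightarrow> nat \<Rightarrow> nat \<Rightarrow> scalar_field" where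
  "dinv g i j =
     (let K = gauss_curvature g in
      cov_differential g K (replicate (i - 2 - j) (grad g K) @ replicate j (sgrad g K)))"

definition hamiltonian :: "metric \<Rightarrow> phase_function" where
  "hamiltonian g x p = p \<bullet> (matrix_inv (g x) *v p)"

definition poisson :: "phase_function \<Rightarrow> phase_function \<Rightarrow> phase_function" where
  "poisson H F x p =
     (\<Sum>i\<in>UNIV. pd i (H x) p * pd i (\<lambda>y. F y p) x - pd i (\<lambda>y. H y p) x * pd i (F x) p)"

definition homogeneous_integral_near :: "metric \<Rightarrow> real^2 \<Rightarrow> nat \<Rightarrow> phase_function \<Rightarrow> bool" where
  "homogeneous_integral_near g p0 n F \<longleftrightarrow>
     (\<exists>V u. open V \<and> p0 \<in> V \<and> (\<forall>i\<le>n. smooth_on V (u i)) \<and>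
        (\<forall>x\<in>V. \<forall>p. F x p = (\<Sum>i\<le>n. u i x * (p $ 1) ^ i * (p $ 2) ^ (n - i))) \<and>
        (\<forall>x\<in>V. \<forall>p. poisson (hamiltonian g) F x p = 0))"

text \<open>
  Germs, along the whole fibre over a base point, of functions on the cotangent bundle.
  The type is that of germs at the base point \<open>0\<close>; germs at other points are
  represented in it by translation.
\<close>

quotient_type phase_germ = phase_function / "\<lambda>F G. \<forall>\<^sub>F x in nhds 0. F x = G x"
proof (rule equivpI)
  show "reflp (\<lambda>F G :: phase_function. \<forall>\<^sub>F x in nhds 0. F x = G x)"
    by (simp add: reflp_def)
  show "symp (\<lambda>F G :: phase_function. \<forall>\<^sub>F x in nhds 0. F x = G x)"
    by (simp add: symp_def eq_commute)
  show "transp (\<lambda>F G :: phase_function. \<forall>\<^sub>F x in nhds 0. F x = G x)"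
    by (rule transpI) (auto elim: eventually_elim2)
qed

instantiation phase_germ :: real_vector
begin

lift_definition zero_phase_germ :: phase_germ is "\<lambda>x p. 0" .

lift_definition plus_phase_germ :: "phase_germ \<Rightarrow> phase_germ \<Rightarrow> phase_germ"
  is "\<lambda>F G x p. F x p + G x p"
  by (auto elim: eventually_elim2)

lift_definition minus_phase_germ :: "phase_germ \<Rightarrow> phase_germ \<Rightarrow> phase_germ"
  is "\<lambda>F G x p. F x p - G x p"
  by (auto elim: eventually_elim2)

lift_definition uminus_phase_germ :: "phase_germ \<Rightarrow> phase_germ"
  is "\<lambda>F x p. - F x p"
  by (auto elim: eventually_mono)

lift_definition scaleR_phase_germ :: "real \<Rightarrow> phase_germ \<Rightarrow> phase_germ"
  is "\<lambda>c F x p. c * F x p"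
  by (auto elim: eventually_mono)

instance
  by standard (transfer; simp add: algebra_simps)+

end

lift_definition germ_at :: "real^2 \<Rightarrow> phase_function \<Rightarrow> phase_germ"
  is "\<lambda>p0 F x. F (p0 + x)" .

lemma germ_at_eq_iff: "germ_at p0 F = germ_at p0 G \<longleftrightarrow> (\<forall>\<^sub>F x in nhds p0. F x = G x)"
proof -
  have "nhds 0 = filtermap (\<lambda>x. x - p0) (nhds p0)"
    by (simp add: filtermap_nhds_shift)
  then show ?thesis
    by transfer (simp add: eventually_filtermap)
qed

definition integral_germs :: "metric \<Rightarrow> real^2 \<Rightarrow> nat \<Rightarrow> phase_germ set" where
  "integral_germs g p0 n = {germ_at p0 F |F. homogeneous_integral_near g p0 n F}"

end

theory Submission
  imports Defs
begin

text \<open>In an orthonormal frame \<open>e1\<close>, \<open>e2\<close> a quadratic integral has a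
  trace \<tau> and a trace-free part (v, \<beta>). The bracket of H and F is a binary cubic in the
  frame momenta; its four coefficients say that (v, \<beta>) satisfies a system of Cauchy-Riemann
  type and determines d\<tau> (\<open>integral_iff_killing_fields\<close>). Let X and Y be the
  covariant derivatives of \<beta>. Equality of mixed derivatives determines all second-order jets
  but one, called R, and then both derivatives of R (\<open>killing_D_0\<close>,
  \<open>killing_D_1\<close>, \<open>killing_D_2\<close>). Integrals are thus the parallel sections
  of a connection on a bundle of rank 6, and an integral whose six jets vanish at a point is zero
  (\<open>killing_fields_unique\<close>). In the other direction, solutions of flat linear total
  differential systems are supplied by a Frobenius theorem (\<open>local_frobenius\<close>,
  \<open>frame_frobenius\<close>).

  If I3 vanishes near p0, then K is locally constant, the connection is flat and the dimension is
  not 3 (\<open>dim_constant_curvature\<close>). Otherwise let e1 point along grad K, put k = |grad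
  K|, and let h, t, q denote the frame components of the second, third and fourth covariant
  derivatives of K. In this frame I3, I4, I5, I6 become k^2, k^2 h, k^3 t, k^4 q, and the Hessian
  contains the connection coefficients: a k = h2 and b k = h3. The connection has one integrability
  condition, \<open>first_constraint\<close>, which is linear in X, v, \<beta>. Its derivative along
  e1 brings in Y, with coefficient 35 k h2 after simplification, and its derivative along e2 brings
  in R.

  Suppose that I4b, that is h2, is nonzero. Then v, \<beta>, \<tau> at one point determine the
  integral. The derivatives of the second constraint become, after elimination of X, Y, R, two
  linear equations for (v, \<beta>): one with coefficients 2 \<open>rel_b\<close> and
  \<open>rel_c\<close> - \<open>rel_a\<close>, the other with 2 \<open>rel_c\<close> and
  \<open>rel_d\<close> - \<open>rel_b\<close>, where \<open>rel_a\<close> to \<open>rel_d\<close>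
  are the four relations with denominators cleared. Three independent integrals realise all values
  of (v, \<beta>) at each point, so the four polynomials vanish
  (\<open>relations_necessary\<close>). Conversely, substituting the solved X and Y into the Killing
  equations leaves a rank 3 system for v, \<beta>, \<tau>, whose curvature vanishes by the same four
  relations (\<open>gen_flat\<close>); Frobenius then gives exactly three integrals
  (\<open>relations_sufficient\<close>).

  If h2 vanishes identically, the first constraint says X = u \<beta>, and its consequences have the
  form f \<beta> = 0. Three independent integrals force each such f to vanish
  (\<open>common_factor_zero\<close>); then the remaining system for v, \<beta>, \<tau>, Y is flat
  and has four independent solutions, so dimension three is impossible
  (\<open>dim_degenerate\<close>).\<close>

section \<open>Partial derivatives and smooth functions on open subsets of the plane\<close>

lemma has_derivative_cong_open:
  assumes "open S" "x \<in> S" "\<And>y. y \<in> S \<Longrightarrow> f y = g y" "(f has_derivative D) (at x)"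
  shows "(g has_derivative D) (at x)"
  by (rule has_derivative_transform_within_open[OF assms(4,1,2,3)])

text \<open>Differentiability is not at issue: both functions have the same set of derivatives at
  \<open>x\<close>, so the choice operator inside \<open>frechet_derivative\<close> picks the same
  value in any case.\<close>

lemma pd_cong:
  assumes "open S" "x \<in> S" "\<And>y. y \<in> S \<Longrightarrow> f y = g y"
  shows "pd i f x = pd i g x"
proof -
  have "(f has_derivative D) (at x) \<longleftrightarrow> (g has_derivative D) (at x)" for D
    by (intro iffI) (erule has_derivative_cong_open[OF assms(1,2), rotated], simp add: assms)+
  then show ?thesis
    by (simp add: pd_def frechet_derivative_def)
qed

lemma foldr_pd_cong:
  assumes "open S" "\<And>y. y \<in> S \<Longrightarrow> f y = g y" "x \<in> S"
  shows "foldr pd is f x = foldr pd is g x"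
  using assms(3)
proof (induction "is" arbitrary: x)
  case Nil
  then show ?case using assms by simp
next
  case (Cons i "is")
  then show ?case using pd_cong[OF assms(1) Cons.prems Cons.IH] by simp
qed

lemma differentiable_on_open_cong:
  assumes "open S" "\<And>y. y \<in> S \<Longrightarrow> f y = g y" "f differentiable_on S"
  shows "g differentiable_on S"
  unfolding differentiable_on_eq_differentiable_at[OF assms(1)]
proof
  fix x assume x: "x \<in> S"
  then obtain D where "(f has_derivative D) (at x)"
    using assms by (auto simp: differentiable_on_eq_differentiable_at differentiable_def)
  then have "(g has_derivative D) (at x)"
    by (intro has_derivative_cong_open[OF assms(1) x assms(2)])
  then show "g differentiable (at x)" by (rule differentiableI)
qed

lemma smooth_on_cong:
  assumes "open S" "\<And>y. y \<in> S \<Longrightarrow> f y = g y"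
  shows "smooth_on S f \<longleftrightarrow> smooth_on S g"
proof -
  have "foldr pd is f differentiable_on S \<longleftrightarrow> foldr pd is g differentiable_on S" for "is"
    using differentiable_on_open_cong[OF assms(1), of "foldr pd is f" "foldr pd is g"]
      differentiable_on_open_cong[OF assms(1), of "foldr pd is g" "foldr pd is f"]
      foldr_pd_cong[OF assms] by auto
  then show ?thesis by (simp add: smooth_on_def)
qed

lemma smooth_on_differentiable_on: "smooth_on S f \<Longrightarrow> f differentiable_on S"
  unfolding smooth_on_def by (drule spec[of _ "[]"]) simp

lemma smooth_on_differentiable: "smooth_on S f \<Longrightarrow> open S \<Longrightarrow> x \<in> S \<Longrightarrow> f differentiable (at x)"
  using smooth_on_differentiable_on[of S f] differentiable_on_eq_differentiable_at[of S f] by simp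

lemma smooth_on_pd: "smooth_on S f \<Longrightarrow> smooth_on S (pd i f)"
  unfolding smooth_on_def
proof
  fix js assume "\<forall>is. foldr pd is f differentiable_on S"
  then have "foldr pd (js @ [i]) f differentiable_on S" by blast
  then show "foldr pd js (pd i f) differentiable_on S" by simp
qed

lemma smooth_on_subset: "smooth_on S f \<Longrightarrow> T \<subseteq> S \<Longrightarrow> smooth_on T f"
  unfolding smooth_on_def by (meson differentiable_on_subset)

lemma smooth_on_continuous_on: "smooth_on S f \<Longrightarrow> continuous_on S f"
  by (simp add: smooth_on_differentiable_on differentiable_imp_continuous_on)

text \<open>Grades smoothness by order, so that closure under products, inverses and square roots
  can be proved by induction on \<open>n\<close>; \<open>smooth_on_iff_Ck_on\<close> leads back to
  smoothness.\<close>

fun Ck_on :: "(real^2) set \<Rightarrow> nat \<Rightarrow> scalar_field \<Rightarrow> bool" where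
  "Ck_on S 0 f \<longleftrightarrow> f differentiable_on S"
| "Ck_on S (Suc n) f \<longleftrightarrow> f differentiable_on S \<and> (\<forall>i. Ck_on S n (pd i f))"

lemma Ck_on_cong:
  assumes "open S" "\<And>y. y \<in> S \<Longrightarrow> f y = g y" "Ck_on S n f"
  shows "Ck_on S n g"
  using assms(2,3)
proof (induction n arbitrary: f g)
  case 0
  then show ?case using differentiable_on_open_cong[OF assms(1), of f g] by simp
next
  case (Suc n)
  have "Ck_on S n (pd i g)" for i
  proof (rule Suc.IH[of "pd i f"])
    show "pd i f y = pd i g y" if "y \<in> S" for y
      by (rule pd_cong[OF assms(1) that Suc.prems(1)])
    show "Ck_on S n (pd i f)" using Suc.prems(2) by simp
  qed
  then show ?case using Suc.prems differentiable_on_open_cong[OF assms(1), of f g]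
    by simp
qed

lemma Ck_on_mono: "Ck_on S (Suc n) f \<Longrightarrow> Ck_on S n f"
  by (induction n arbitrary: f) auto

lemma smooth_on_iff_Ck_on: "smooth_on S f \<longleftrightarrow> (\<forall>n. Ck_on S n f)"
proof
  assume "smooth_on S f"
  then have "Ck_on S n f" for n
  proof (induction n arbitrary: f)
    case 0
    then show ?case by (simp add: smooth_on_differentiable_on)
  next
    case (Suc n)
    then show ?case by (simp add: smooth_on_differentiable_on smooth_on_pd)
  qed
  then show "\<forall>n. Ck_on S n f" ..
next
  assume ck: "\<forall>n. Ck_on S n f"
  have "foldr pd is f differentiable_on S \<and> (\<forall>n. Ck_on S n (foldr pd is f))" for "is"
  proof (induction "is")
    case Nil
    from ck have "Ck_on S 0 f" by blast
    with ck show ?case by simp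
  next
    case (Cons i "is")
    then have "Ck_on S (Suc n) (foldr pd is f)" for n by blast
    then have "Ck_on S n (pd i (foldr pd is f))" for n by simp
    moreover from this[of 0] have "pd i (foldr pd is f) differentiable_on S" by simp
    ultimately show ?case by simp
  qed
  then show "smooth_on S f" by (simp add: smooth_on_def)
qed

lemma has_derivative_pd:
  assumes "f differentiable (at x)"
  shows "(f has_derivative (\<lambda>h. \<Sum>i\<in>UNIV. h $ i * pd i f x)) (at x)"
proof -
  define D where "D = frechet_derivative f (at x)"
  have D: "(f has_derivative D) (at x)"
    using assms by (simp add: D_def frechet_derivative_works)
  then interpret D: bounded_linear D by (rule has_derivative_bounded_linear)
  have "D h = (\<Sum>i\<in>UNIV. h $ i * pd i f x)" for h
  proof -
    have "D h = D (\<Sum>i\<in>UNIV. (h $ i) *\<^sub>R axis i 1)"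
      using basis_expansion[of h] by (simp add: scalar_mult_eq_scaleR)
    also have "\<dots> = (\<Sum>i\<in>UNIV. h $ i * D (axis i 1))"
      by (simp add: D.sum D.scaleR)
    finally show ?thesis by (simp add: pd_def D_def)
  qed
  then have "D = (\<lambda>h. \<Sum>i\<in>UNIV. h $ i * pd i f x)" by auto
  then show ?thesis using D by simp
qed

lemma pd_eqI: "(f has_derivative D) (at x) \<Longrightarrow> pd i f x = D (axis i 1)"
  unfolding pd_def using frechet_derivative_at by metis

lemma differentiableI_pd:
  "f differentiable (at x) \<Longrightarrow> (f has_derivative (\<lambda>h. frechet_derivative f (at x) h)) (at x)"
  by (simp add: frechet_derivative_works)

lemma pd_const [simp]: "pd i (\<lambda>x. c) x = 0"
  by (rule pd_eqI[where D="\<lambda>h. 0"]) auto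

lemma pd_add:
  assumes "f differentiable (at x)" "g differentiable (at x)"
  shows "pd i (\<lambda>x. f x + g x) x = pd i f x + pd i g x"
proof -
  have "((\<lambda>x. f x + g x) has_derivative (\<lambda>h. frechet_derivative f (at x) h + frechet_derivative g (at x) h)) (at x)"
    by (intro has_derivative_add differentiableI_pd assms)
  from pd_eqI[OF this] show ?thesis by (simp add: pd_def)
qed

lemma pd_diff:
  assumes "f differentiable (at x)" "g differentiable (at x)"
  shows "pd i (\<lambda>x. f x - g x) x = pd i f x - pd i g x"
proof -
  have "((\<lambda>x. f x - g x) has_derivative (\<lambda>h. frechet_derivative f (at x) h - frechet_derivative g (at x) h)) (at x)"
    by (intro has_derivative_diff differentiableI_pd assms)
  from pd_eqI[OF this] show ?thesis by (simp add: pd_def)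
qed

lemma pd_minus:
  assumes "f differentiable (at x)"
  shows "pd i (\<lambda>x. - f x) x = - pd i f x"
proof -
  have "((\<lambda>x. - f x) has_derivative (\<lambda>h. - frechet_derivative f (at x) h)) (at x)"
    by (intro has_derivative_minus differentiableI_pd assms)
  from pd_eqI[OF this] show ?thesis by (simp add: pd_def)
qed

lemma pd_mult:
  assumes "f differentiable (at x)" "g differentiable (at x)"
  shows "pd i (\<lambda>x. f x * g x) x = f x * pd i g x + pd i f x * g x"
proof -
  have "((\<lambda>x. f x * g x) has_derivative (\<lambda>h. f x * frechet_derivative g (at x) h + frechet_derivative f (at x) h * g x)) (at x)"
    by (intro has_derivative_mult differentiableI_pd assms)
  from pd_eqI[OF this] show ?thesis by (simp add: pd_def)
qed

lemma pd_inverse: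
  assumes "f differentiable (at x)" "f x \<noteq> 0"
  shows "pd i (\<lambda>x. inverse (f x)) x = - (inverse (f x) * pd i f x * inverse (f x))"
proof -
  have "((\<lambda>x. inverse (f x)) has_derivative (\<lambda>h. - (inverse (f x) * frechet_derivative f (at x) h * inverse (f x)))) (at x)"
    by (intro Deriv.has_derivative_inverse differentiableI_pd assms)
  from pd_eqI[OF this] show ?thesis by (simp add: pd_def)
qed

lemma pd_sqrt:
  assumes "f differentiable (at x)" "f x > 0"
  shows "pd i (\<lambda>x. sqrt (f x)) x = pd i f x * (inverse (sqrt (f x)) * (1/2))"
proof -
  have "((\<lambda>x. sqrt (f x)) has_derivative
      (\<lambda>h. frechet_derivative f (at x) h * (inverse (sqrt (f x)) / 2))) (at x)"
    by (rule DERIV_compose_FDERIV[OF DERIV_real_sqrt])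
       (use assms in \<open>auto intro: differentiableI_pd\<close>)
  from pd_eqI[OF this] show ?thesis by (simp add: pd_def)
qed

context
  fixes S :: "(real^2) set"
  assumes S: "open S"
begin

lemma Ck_on_differentiable_on: "Ck_on S n f \<Longrightarrow> f differentiable_on S"
  by (cases n) auto

lemma Ck_on_const: "Ck_on S n (\<lambda>x. c)"
proof (induction n arbitrary: c)
  case (Suc n)
  have "Ck_on S n (pd i (\<lambda>x. c))" for i
    by (rule Ck_on_cong[OF S _ Suc[of 0]]) simp
  then show ?case by simp
qed simp

lemma Ck_on_add: "Ck_on S n f \<Longrightarrow> Ck_on S n g \<Longrightarrow> Ck_on S n (\<lambda>x. f x + g x)"
proof (induction n arbitrary: f g)
  case (Suc n)
  have "Ck_on S n (pd i (\<lambda>x. f x + g x))" for i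
    by (rule Ck_on_cong[OF S _ Suc.IH[of "pd i f" "pd i g"]])
       (use Suc.prems in \<open>auto simp: differentiable_on_eq_differentiable_at[OF S] pd_add\<close>)
  moreover have "(\<lambda>x. f x + g x) differentiable_on S"
    using Suc.prems by (intro differentiable_on_add) (simp_all)
  ultimately show ?case by simp
qed (auto simp: differentiable_on_add)

lemma Ck_on_mult: "Ck_on S n f \<Longrightarrow> Ck_on S n g \<Longrightarrow> Ck_on S n (\<lambda>x. f x * g x)"
proof (induction n arbitrary: f g)
  case (Suc n)
  have "Ck_on S n (pd i (\<lambda>x. f x * g x))" for i
  proof (rule Ck_on_cong[OF S])
    show "Ck_on S n (\<lambda>x. f x * pd i g x + pd i f x * g x)"
      using Suc.prems Ck_on_mono[of S n] by (intro Ck_on_add Suc.IH) auto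
  qed (use Suc.prems in \<open>auto simp: differentiable_on_eq_differentiable_at[OF S] pd_mult\<close>)
  moreover have "(\<lambda>x. f x * g x) differentiable_on S"
    using Suc.prems by (intro differentiable_on_mult) (simp_all)
  ultimately show ?case by simp
qed (auto simp: differentiable_on_mult)

lemma Ck_on_inverse:
  assumes "\<And>x. x \<in> S \<Longrightarrow> f x \<noteq> 0"
  shows "Ck_on S n f \<Longrightarrow> Ck_on S n (\<lambda>x. inverse (f x))"
proof (induction n)
  case (Suc n)
  have "Ck_on S n (pd i (\<lambda>x. inverse (f x)))" for i
  proof (rule Ck_on_cong[OF S])
    show "Ck_on S n (\<lambda>x. (-1) * (inverse (f x) * pd i f x * inverse (f x)))"
      using Suc Ck_on_mono[of S n] by (intro Ck_on_mult Ck_on_const) auto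
  qed (use Suc.prems assms in \<open>auto simp: differentiable_on_eq_differentiable_at[OF S] pd_inverse\<close>)
  moreover have "(\<lambda>x. inverse (f x)) differentiable_on S"
    using Suc.prems assms by (intro differentiable_on_inverse) (auto simp: Ck_on_differentiable_on)
  ultimately show ?case by simp
qed (use assms in \<open>auto intro: differentiable_on_inverse\<close>)

lemma differentiable_on_sqrt:
  "f differentiable_on S \<Longrightarrow> (\<And>x. x \<in> S \<Longrightarrow> f x > 0) \<Longrightarrow> (\<lambda>x. sqrt (f x)) differentiable_on S"
  unfolding differentiable_on_eq_differentiable_at[OF S]
  by (blast intro: DERIV_compose_FDERIV[OF DERIV_real_sqrt] differentiableI_pd differentiableI)

lemma Ck_on_sqrt:
  assumes "\<And>x. x \<in> S \<Longrightarrow> f x > 0"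
  shows "Ck_on S n f \<Longrightarrow> Ck_on S n (\<lambda>x. sqrt (f x))"
proof (induction n)
  case (Suc n)
  have "Ck_on S n (pd i (\<lambda>x. sqrt (f x)))" for i
  proof (rule Ck_on_cong[OF S])
    \<comment> \<open>The derivative contains \<open>sqrt (f x)\<close> again, but only to order
      \<open>n\<close>, where the induction hypothesis covers it.\<close>
    show "Ck_on S n (\<lambda>x. pd i f x * (inverse (sqrt (f x)) * (1/2)))"
      using Suc Ck_on_mono[of S n] assms
      by (intro Ck_on_mult Ck_on_const Ck_on_inverse) (auto simp: less_imp_neq[symmetric] dest: assms)
  qed (use Suc.prems assms in \<open>auto simp: differentiable_on_eq_differentiable_at[OF S] pd_sqrt\<close>)
  then show ?case using differentiable_on_sqrt[OF _ assms] Suc.prems by simp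
qed (use assms differentiable_on_sqrt in auto)

lemma smooth_on_const: "smooth_on S (\<lambda>x. c)"
  by (simp add: smooth_on_iff_Ck_on Ck_on_const)

lemma smooth_on_add: "smooth_on S f \<Longrightarrow> smooth_on S g \<Longrightarrow> smooth_on S (\<lambda>x. f x + g x)"
  by (simp add: smooth_on_iff_Ck_on Ck_on_add)

lemma smooth_on_mult: "smooth_on S f \<Longrightarrow> smooth_on S g \<Longrightarrow> smooth_on S (\<lambda>x. f x * g x)"
  by (simp add: smooth_on_iff_Ck_on Ck_on_mult)

lemma smooth_on_minus: "smooth_on S f \<Longrightarrow> smooth_on S (\<lambda>x. - f x)"
  using smooth_on_mult[OF smooth_on_const[of "-1"]] by simp

lemma smooth_on_diff: "smooth_on S f \<Longrightarrow> smooth_on S g \<Longrightarrow> smooth_on S (\<lambda>x. f x - g x)"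
  using smooth_on_add[OF _ smooth_on_minus, of f g] by simp

lemma smooth_on_power: "smooth_on S f \<Longrightarrow> smooth_on S (\<lambda>x. f x ^ n)"
  by (induction n) (auto intro: smooth_on_const smooth_on_mult)

lemma smooth_on_sum: "(\<And>j. j \<in> I \<Longrightarrow> smooth_on S (f j)) \<Longrightarrow> smooth_on S (\<lambda>x. \<Sum>j\<in>I. f j x)"
  by (induction I rule: infinite_finite_induct) (auto intro: smooth_on_const smooth_on_add)

lemma smooth_on_divide:
  "smooth_on S f \<Longrightarrow> smooth_on S g \<Longrightarrow> (\<And>x. x \<in> S \<Longrightarrow> g x \<noteq> 0) \<Longrightarrow> smooth_on S (\<lambda>x. f x / g x)"
  unfolding divide_inverse by (intro smooth_on_mult) (auto simp: smooth_on_iff_Ck_on Ck_on_inverse)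

lemma smooth_on_sqrt:
  "smooth_on S f \<Longrightarrow> (\<And>x. x \<in> S \<Longrightarrow> f x > 0) \<Longrightarrow> smooth_on S (\<lambda>x. sqrt (f x))"
  by (auto simp: smooth_on_iff_Ck_on Ck_on_sqrt)

text \<open>Bootstrapping: a differentiable solution of a linear system with smooth coefficients is smooth.\<close>

lemma smooth_on_linear_system:
  fixes A :: "2 \<Rightarrow> 'n::finite \<Rightarrow> 'n \<Rightarrow> scalar_field"
  assumes "\<And>l i j. smooth_on S (A l i j)" "\<And>i. W i differentiable_on S"
    and "\<And>l i x. x \<in> S \<Longrightarrow> pd l (W i) x = (\<Sum>j\<in>UNIV. A l i j x * W j x)"
  shows "smooth_on S (W i)"
proof -
  have sumI: "Ck_on S n (\<lambda>x. \<Sum>j\<in>I. f j x)" if "\<And>j. Ck_on S n (f j)"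
    for n and I :: "'n set" and f
    by (induction I rule: infinite_finite_induct) (auto intro: Ck_on_const Ck_on_add that)
  have "Ck_on S n (W i)" for n i
  proof (induction n arbitrary: i)
    case (Suc n)
    have "Ck_on S n (pd l (W i))" for l
    proof (rule Ck_on_cong[OF S])
      show "Ck_on S n (\<lambda>x. \<Sum>j\<in>UNIV. A l i j x * W j x)"
        using assms(1) Suc by (intro sumI Ck_on_mult) (auto simp: smooth_on_iff_Ck_on)
    qed (simp add: assms(3))
    then show ?case using assms(2) by simp
  qed (simp add: assms(2))
  then show ?thesis by (simp add: smooth_on_iff_Ck_on)
qed

end

lemma has_field_derivative_along_line:
  assumes "open S" "f differentiable_on S" "x + s *\<^sub>R axis i 1 \<in> S"
  shows "((\<lambda>s. f (x + s *\<^sub>R axis i 1)) has_real_derivative pd i f (x + s *\<^sub>R axis i 1)) (at s)"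
proof -
  have "f differentiable (at (x + s *\<^sub>R axis i 1))"
    using assms by (simp add: differentiable_on_eq_differentiable_at)
  have "((\<lambda>s. x + s *\<^sub>R axis i (1::real)) has_derivative (\<lambda>h. h *\<^sub>R axis i 1)) (at s)"
    by (auto intro!: derivative_eq_intros)
  from has_derivative_compose[where g=f, OF this differentiableI_pd[OF \<open>f differentiable _\<close>]]
  have "((\<lambda>s. f (x + s *\<^sub>R axis i 1)) has_derivative
      (\<lambda>h. frechet_derivative f (at (x + s *\<^sub>R axis i 1)) (h *\<^sub>R axis i 1))) (at s)" .
  moreover have "frechet_derivative f (at (x + s *\<^sub>R axis i 1)) (h *\<^sub>R axis i 1) =
      pd i f (x + s *\<^sub>R axis i 1) * h" for h
    using linear_frechet_derivative[OF \<open>f differentiable _\<close>]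
    by (simp add: linear_scale pd_def)
  ultimately show ?thesis by (simp add: has_field_derivative_def)
qed

text \<open>The second difference of \<open>f\<close> over a small parallelogram is \<open>h\<^sup>2\<close> times
  a second partial derivative at an interior point, in either order.\<close>

lemma second_difference_mean_value:
  assumes S: "open S" and f: "smooth_on S f" and h: "h > 0"
    and sub: "\<And>s t. 0 \<le> s \<Longrightarrow> s \<le> h \<Longrightarrow> 0 \<le> t \<Longrightarrow> t \<le> h \<Longrightarrow> x + s *\<^sub>R axis i 1 + t *\<^sub>R axis j 1 \<in> S"
  obtains s t where "0 < s" "s < h" "0 < t" "t < h"
    "f (x + h *\<^sub>R axis i 1 + h *\<^sub>R axis j 1) - f (x + h *\<^sub>R axis i 1) - (f (x + h *\<^sub>R axis j 1) - f x)
      = h * h * pd j (pd i f) (x + s *\<^sub>R axis i 1 + t *\<^sub>R axis j 1)"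
proof -
  define \<phi> where "\<phi> s = f ((x + h *\<^sub>R axis j 1) + s *\<^sub>R axis i 1) - f (x + s *\<^sub>R axis i 1)" for s
  have d: "f differentiable_on S" "pd i f differentiable_on S"
    using f by (auto simp: smooth_on_differentiable_on smooth_on_pd)
  have "DERIV \<phi> s :> pd i f ((x + h *\<^sub>R axis j 1) + s *\<^sub>R axis i 1) - pd i f (x + s *\<^sub>R axis i 1)"
    if "0 \<le> s" "s \<le> h" for s
    unfolding \<phi>_def
    using sub[of s h] sub[of s 0] that h
    by (intro DERIV_diff has_field_derivative_along_line[OF S d(1)]) (simp_all add: algebra_simps)
  from MVT2[OF h, of \<phi>, OF this] obtain s where s: "0 < s" "s < h"
    "\<phi> h - \<phi> 0 = h * (pd i f ((x + h *\<^sub>R axis j 1) + s *\<^sub>R axis i 1) - pd i f (x + s *\<^sub>R axis i 1))"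
    by auto
  have "DERIV (\<lambda>t. pd i f ((x + s *\<^sub>R axis i 1) + t *\<^sub>R axis j 1)) t :> pd j (pd i f) ((x + s *\<^sub>R axis i 1) + t *\<^sub>R axis j 1)"
    if "0 \<le> t" "t \<le> h" for t
    using sub[of s t] that s by (intro has_field_derivative_along_line[OF S d(2)]) auto
  from MVT2[OF h this] obtain t where t: "0 < t" "t < h"
    "pd i f ((x + s *\<^sub>R axis i 1) + h *\<^sub>R axis j 1) - pd i f ((x + s *\<^sub>R axis i 1) + 0 *\<^sub>R axis j 1) = 
      h * pd j (pd i f) ((x + s *\<^sub>R axis i 1) + t *\<^sub>R axis j 1)"
    by auto
  show thesis
    by (rule that[OF s(1,2) t(1,2)]) (use s(3) t(3) in \<open>simp add: \<phi>_def algebra_simps\<close>)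
qed

text \<open>Schwarz's theorem: the second difference is symmetric in the two directions, so the two
  mixed derivatives agree at suitable points of an arbitrarily small square, and continuity carries
  the equality to \<open>x\<close>.\<close>

lemma pd_commute:
  assumes S: "open S" and f: "smooth_on S f" and x: "x \<in> S"
  shows "pd i (pd j f) x = pd j (pd i f) x"
proof (rule ccontr)
  \<comment> \<open>Half the supposed gap: values within \<open>e\<close> of the two mixed
    derivatives cannot coincide.\<close>
  define e where "e = \<bar>pd i (pd j f) x - pd j (pd i f) x\<bar> / 2"
  assume "pd i (pd j f) x \<noteq> pd j (pd i f) x"
  then have e: "e > 0" by (simp add: e_def)
  have c: "continuous_on S (pd i (pd j f))" "continuous_on S (pd j (pd i f))"
    using f by (auto intro!: smooth_on_continuous_on smooth_on_pd)
  from S x obtain d0 where d0: "d0 > 0" "ball x d0 \<subseteq> S" using open_contains_ball by blast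
  from c(1) x e obtain d1 where d1: "d1 > 0" "\<And>y. y \<in> S \<Longrightarrow> dist y x < d1 \<Longrightarrow> dist (pd i (pd j f) y) (pd i (pd j f) x) < e"
    unfolding continuous_on_iff by metis
  from c(2) x e obtain d2 where d2: "d2 > 0" "\<And>y. y \<in> S \<Longrightarrow> dist y x < d2 \<Longrightarrow> dist (pd j (pd i f) y) (pd j (pd i f) x) < e"
    unfolding continuous_on_iff by metis
  \<comment> \<open>Two steps of length at most \<open>h\<close> then stay inside all three
    radii.\<close>
  define h where "h = min d0 (min d1 d2) / 3"
  have h: "h > 0" using d0 d1 d2 by (simp add: h_def)
  have near: "dist (x + s *\<^sub>R axis i 1 + t *\<^sub>R axis j 1) x < min d0 (min d1 d2)"
    if "0 \<le> s" "s \<le> h" "0 \<le> t" "t \<le> h" for s t and i j :: 2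
  proof -
    have "dist (x + s *\<^sub>R axis i 1 + t *\<^sub>R axis j 1) x = norm (s *\<^sub>R axis i (1::real) + t *\<^sub>R axis j 1)"
      by (simp add: dist_norm algebra_simps)
    also have "\<dots> \<le> norm (s *\<^sub>R axis i (1::real)) + norm (t *\<^sub>R axis j (1::real))"
      by (rule norm_triangle_ineq)
    also have "\<dots> \<le> h + h" using that by (simp add: norm_axis_1)
    also have "\<dots> < min d0 (min d1 d2)" using h unfolding h_def by linarith
    finally show ?thesis .
  qed
  have sub: "x + s *\<^sub>R axis i 1 + t *\<^sub>R axis j 1 \<in> S"
    if "0 \<le> s" "s \<le> h" "0 \<le> t" "t \<le> h" for s t and i j :: 2
    using near[OF that, of i j] d0(2) by (auto simp: dist_commute)
  obtain s t where st: "0 < s" "s < h" "0 < t" "t < h"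
    "f (x + h *\<^sub>R axis i 1 + h *\<^sub>R axis j 1) - f (x + h *\<^sub>R axis i 1) - (f (x + h *\<^sub>R axis j 1) - f x)
      = h * h * pd j (pd i f) (x + s *\<^sub>R axis i 1 + t *\<^sub>R axis j 1)"
    by (rule second_difference_mean_value[OF S f h sub[of _ _ i j]])
  obtain s' t' where st': "0 < s'" "s' < h" "0 < t'" "t' < h"
    "f (x + h *\<^sub>R axis j 1 + h *\<^sub>R axis i 1) - f (x + h *\<^sub>R axis j 1) - (f (x + h *\<^sub>R axis i 1) - f x)
      = h * h * pd i (pd j f) (x + s' *\<^sub>R axis j 1 + t' *\<^sub>R axis i 1)"
    by (rule second_difference_mean_value[OF S f h sub[of _ _ j i]])
  have "h * h * pd j (pd i f) (x + s *\<^sub>R axis i 1 + t *\<^sub>R axis j 1)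
      = h * h * pd i (pd j f) (x + s' *\<^sub>R axis j 1 + t' *\<^sub>R axis i 1)"
    using st(5) st'(5) by (simp add: algebra_simps)
  then have eq: "pd j (pd i f) (x + s *\<^sub>R axis i 1 + t *\<^sub>R axis j 1)
      = pd i (pd j f) (x + s' *\<^sub>R axis j 1 + t' *\<^sub>R axis i 1)"
    using h by simp
  have "dist (pd j (pd i f) (x + s *\<^sub>R axis i 1 + t *\<^sub>R axis j 1)) (pd j (pd i f) x) < e"
    using st near[of s t i j] sub[of s t i j] by (intro d2) auto
  moreover have "dist (pd i (pd j f) (x + s' *\<^sub>R axis j 1 + t' *\<^sub>R axis i 1)) (pd i (pd j f) x) < e"
    using st' near[of s' t' j i] sub[of s' t' j i] by (intro d1) auto
  ultimately show False using eq by (simp add: e_def dist_real_def abs_if split: if_splits)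
qed

lemma dir_deriv_eq_pd:
  "f differentiable (at x) \<Longrightarrow> dir_deriv X f x = (\<Sum>i\<in>UNIV. X x $ i * pd i f x)"
  unfolding dir_deriv_def by (simp add: frechet_derivative_at[OF has_derivative_pd, symmetric])

section \<open>Linear total differential systems in the plane: existence and uniqueness\<close>

text \<open>The oriented integral of \<open>f\<close> from \<open>u\<close> to \<open>t\<close>,
  pulled back to the unit interval: this covers \<open>t < u\<close> and keeps the domain fixed when
  the limits or the integrand depend on parameters.\<close>

definition sint :: "real \<Rightarrow> (real \<Rightarrow> 'a::euclidean_space) \<Rightarrow> real \<Rightarrow> 'a" where
  "sint u f t = (t - u) *\<^sub>R integral {0..1} (\<lambda>\<theta>. f (u + \<theta> * (t - u)))"

lemma segment_in_interval:
  fixes u t \<theta> :: real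
  assumes "u \<in> {l..h}" "t \<in> {l..h}" "\<theta> \<in> {0..1}"
  shows "u + \<theta> * (t - u) \<in> {l..h}"
proof -
  have "(1 - \<theta>) *\<^sub>R u + \<theta> *\<^sub>R t \<in> {l..h}"
    using assms by (intro convexD_alt) auto
  then show ?thesis by (simp add: algebra_simps)
qed

lemma continuous_on_along_segment:
  fixes f :: "real \<Rightarrow> 'a::euclidean_space"
  assumes "continuous_on {l..h} f" "u \<in> {l..h}" "t \<in> {l..h}"
  shows "continuous_on {0..1} (\<lambda>\<theta>. f (u + \<theta> * (t - u)))"
  by (rule continuous_on_compose2[OF assms(1)])
     (use segment_in_interval[OF assms(2,3)] in \<open>auto intro!: continuous_intros\<close>)

lemma sint_same [simp]: "sint u f u = 0"
  by (simp add: sint_def)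

lemma sint_eq_diff_integral:
  fixes f :: "real \<Rightarrow> 'a::euclidean_space"
  assumes f: "continuous_on {l..h} f" and u: "u \<in> {l..h}" and t: "t \<in> {l..h}"
  shows "sint u f t = integral {l..t} f - integral {l..u} f"
proof -
  define G where "G t = integral {l..t} f" for t
  have G: "(G has_vector_derivative f x) (at x within {l..h})" if "x \<in> {l..h}" for x
    unfolding G_def using integral_has_vector_derivative[OF f that] .
  have "((\<lambda>\<theta>. (t - u) *\<^sub>R f (u + \<theta> * (t - u))) has_integral
      (G \<circ> (\<lambda>\<theta>. u + \<theta> * (t - u))) 1 - (G \<circ> (\<lambda>\<theta>. u + \<theta> * (t - u))) 0) {0..1}"
  proof (rule fundamental_theorem_of_calculus)
    fix \<theta> :: real assume \<theta>: "\<theta> \<in> {0..1}"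
    have "(G has_vector_derivative f (u + \<theta> * (t - u)))
        (at (u + \<theta> * (t - u)) within (\<lambda>\<theta>. u + \<theta> * (t - u)) ` {0..1})"
      by (rule has_vector_derivative_within_subset[OF G])
         (use segment_in_interval[OF u t] \<theta> in auto)
    then show "((G \<circ> (\<lambda>\<theta>. u + \<theta> * (t - u))) has_vector_derivative (t - u) *\<^sub>R f (u + \<theta> * (t - u)))
        (at \<theta> within {0..1})"
      by (intro vector_diff_chain_within) (auto intro!: derivative_eq_intros)
  qed simp
  from integral_unique[OF this] show ?thesis by (simp add: sint_def G_def)
qed

lemma has_vector_derivative_sint:
  fixes f :: "real \<Rightarrow> 'a::euclidean_space"
  assumes f: "continuous_on {l..h} f" and u: "u \<in> {l..h}" and t: "t \<in> {l..h}"
  shows "(sint u f has_vector_derivative f t) (at t within {l..h})"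
proof (rule has_vector_derivative_transform[OF t])
  show "((\<lambda>t. integral {l..t} f - integral {l..u} f) has_vector_derivative f t) (at t within {l..h})"
    using integral_has_vector_derivative[OF f t] by (auto intro!: derivative_eq_intros)
qed (simp add: sint_eq_diff_integral[OF f u])

lemma sint_eq_of_has_vector_derivative:
  fixes F :: "real \<Rightarrow> 'a::euclidean_space"
  assumes F: "\<And>t. t \<in> {l..h} \<Longrightarrow> (F has_vector_derivative f t) (at t within {l..h})"
    and f: "continuous_on {l..h} f" and u: "u \<in> {l..h}" and t: "t \<in> {l..h}"
  shows "sint u f t = F t - F u"
proof -
  have "integral {l..x} f = F x - F l" if "x \<in> {l..h}" for x
    by (rule integral_unique, rule fundamental_theorem_of_calculus)
       (use that in \<open>auto intro!: has_vector_derivative_within_subset[OF F]\<close>)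
  then show ?thesis using sint_eq_diff_integral[OF f u t] u t by simp
qed

lemma norm_sint_le:
  fixes f :: "real \<Rightarrow> 'a::euclidean_space"
  assumes f: "continuous_on {l..h} f" and u: "u \<in> {l..h}" and t: "t \<in> {l..h}"
    and B: "\<And>x. x \<in> {l..h} \<Longrightarrow> norm (f x) \<le> B"
  shows "norm (sint u f t) \<le> (h - l) * B"
proof -
  have "norm (integral {0..1} (\<lambda>\<theta>. f (u + \<theta> * (t - u)))) \<le> B * (1 - 0)"
    by (rule integral_bound[OF _ continuous_on_along_segment[OF f u t]])
       (use B segment_in_interval[OF u t] in auto)
  moreover have "\<bar>t - u\<bar> \<le> h - l" "0 \<le> B" using u t order_trans[OF norm_ge_zero B[OF u]] by auto
  ultimately show ?thesis unfolding sint_def norm_scaleR by (intro mult_mono) auto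
qed

lemma sint_diff:
  fixes f :: "real \<Rightarrow> 'a::euclidean_space"
  assumes "continuous_on {l..h} f" "continuous_on {l..h} g" "u \<in> {l..h}" "t \<in> {l..h}"
  shows "sint u (\<lambda>x. f x - g x) t = sint u f t - sint u g t"
  unfolding sint_def
  by (subst Henstock_Kurzweil_Integration.integral_diff)
     (use assms in \<open>auto intro!: integrable_continuous_real continuous_on_along_segment[of l h] simp: scaleR_diff_right\<close>)

text \<open>The upper limit may vary with the parameter as well; this is what makes the Picard
  operator preserve continuity in both variables.\<close>

lemma continuous_on_sint:
  fixes H :: "'p::topological_space \<Rightarrow> real \<Rightarrow> 'a::euclidean_space"
  assumes H: "continuous_on (P \<times> {l..h}) (\<lambda>(p, x). H p x)" and u: "u \<in> {l..h}"
    and \<tau>: "continuous_on P \<tau>" "\<And>p. p \<in> P \<Longrightarrow> \<tau> p \<in> {l..h}"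
  shows "continuous_on P (\<lambda>p. sint u (H p) (\<tau> p))"
proof -
  have "continuous_on (P \<times> cbox 0 1) (\<lambda>(p, \<theta>). H p (u + \<theta> * (\<tau> p - u)))"
  proof -
    have "continuous_on (P \<times> cbox 0 1) (\<lambda>q. (\<lambda>(p, x). H p x) (fst q, u + snd q * (\<tau> (fst q) - u)))"
    proof (rule continuous_on_compose2[OF H])
      show "continuous_on (P \<times> cbox 0 1) (\<lambda>q. (fst q, u + snd q * (\<tau> (fst q) - u)))"
        by (intro continuous_intros continuous_on_compose2[OF \<tau>(1)]) auto
      show "(\<lambda>q. (fst q, u + snd q * (\<tau> (fst q) - u))) ` (P \<times> cbox 0 1) \<subseteq> P \<times> {l..h}"
        using segment_in_interval[OF u \<tau>(2)] by auto
    qed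
    then show ?thesis by (simp add: case_prod_unfold)
  qed
  from integral_continuous_on_param[OF this] \<tau>(1) show ?thesis
    unfolding sint_def by (auto intro!: continuous_intros)
qed

text \<open>Differentiation under the integral sign, carried out on the fixed domain of the rescaled
  integral.\<close>

lemma has_vector_derivative_sint_param:
  fixes H :: "real \<Rightarrow> real \<Rightarrow> 'a::euclidean_space"
  assumes H: "\<And>t x. t \<in> T \<Longrightarrow> x \<in> {l..h} \<Longrightarrow> ((\<lambda>t. H t x) has_vector_derivative H' t x) (at t within T)"
    and cH: "\<And>t. t \<in> T \<Longrightarrow> continuous_on {l..h} (H t)"
    and cH': "continuous_on (T \<times> {l..h}) (\<lambda>(t, x). H' t x)"
    and T: "convex T" "t \<in> T" and u: "u \<in> {l..h}" and s: "s \<in> {l..h}"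
  shows "((\<lambda>t. sint u (H t) s) has_vector_derivative sint u (H' t) s) (at t within T)"
proof -
  have "continuous_on (T \<times> cbox 0 1) (\<lambda>(t, \<theta>). H' t (u + \<theta> * (s - u)))"
  proof -
    have "continuous_on (T \<times> cbox 0 1) (\<lambda>q. (\<lambda>(t, x). H' t x) (fst q, u + snd q * (s - u)))"
    proof (rule continuous_on_compose2[OF cH'])
      show "(\<lambda>q. (fst q, u + snd q * (s - u))) ` (T \<times> cbox 0 1) \<subseteq> T \<times> {l..h}"
        using segment_in_interval[OF u s] by auto
    qed (intro continuous_intros)
    then show ?thesis by (simp add: case_prod_unfold)
  qed
  then have "((\<lambda>t. integral (cbox 0 1) (\<lambda>\<theta>. H t (u + \<theta> * (s - u)))) has_vector_derivative
      integral (cbox 0 1) (\<lambda>\<theta>. H' t (u + \<theta> * (s - u)))) (at t within T)"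
    using T continuous_on_along_segment[OF cH u s] segment_in_interval[OF u s]
    by (intro leibniz_rule_vector_derivative H) (auto intro!: integrable_continuous_real)
  then show ?thesis unfolding sint_def by (auto intro!: derivative_eq_intros)
qed

text \<open>Picard's method for the integral equation obtained by integrating first along the
  first and then along the second coordinate axis.\<close>

lemma path_integral_equation_solution:
  fixes A B :: "real \<Rightarrow> real \<Rightarrow> 'b::euclidean_space \<Rightarrow>\<^sub>L 'b" and c :: 'b
  assumes u: "u1 \<in> {l1..h1}" "u2 \<in> {l2..h2}"
    and A: "continuous_on ({l1..h1} \<times> {l2..h2}) (\<lambda>(s, t). A s t)"
    and B: "continuous_on ({l1..h1} \<times> {l2..h2}) (\<lambda>(s, t). B s t)"
    and L: "\<And>s t. s \<in> {l1..h1} \<Longrightarrow> t \<in> {l2..h2} \<Longrightarrow> norm (A s t) \<le> L"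
           "\<And>s t. s \<in> {l1..h1} \<Longrightarrow> t \<in> {l2..h2} \<Longrightarrow> norm (B s t) \<le> L"
    and small: "((h1 - l1) + (h2 - l2)) * L < 1"
  shows "\<exists>w. continuous_on UNIV w \<and> (\<forall>s\<in>{l1..h1}. \<forall>t\<in>{l2..h2}.
      w (s, t) = c + sint u1 (\<lambda>x. A x u2 (w (x, u2))) s + sint u2 (\<lambda>y. B s y (w (s, y))) t)"
proof -
  define T where "T w z = c + sint u1 (\<lambda>x. A x u2 (w (x, u2))) (fst z)
      + sint u2 (\<lambda>y. B (fst z) y (w (fst z, y))) (snd z)" for w :: "real \<times> real \<Rightarrow> 'b" and z
  let ?a = "(l1, l2)" and ?b = "(h1, h2)"
  let ?R = "{l1..h1} \<times> {l2..h2}"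
  have box: "cbox ?a ?b = ?R" by (auto simp: cbox_Pair_eq)
  have L0: "0 \<le> L" using L(1)[OF u] norm_ge_zero order_trans by blast
  have contA: "continuous_on {l1..h1} (\<lambda>x. A x u2 (w (x, u2)))" if "continuous_on UNIV w" for w :: "real \<times> real \<Rightarrow> 'b"
  proof -
    have "continuous_on {l1..h1} (\<lambda>x. (\<lambda>(s, t). A s t) (x, u2))"
      by (rule continuous_on_compose2[OF A]) (use u in \<open>auto intro!: continuous_intros\<close>)
    moreover have "continuous_on {l1..h1} (\<lambda>x. w (x, u2))"
      by (rule continuous_on_compose2[OF that]) (auto intro!: continuous_intros)
    ultimately show ?thesis by (auto intro!: continuous_intros)
  qed
  have contB2: "continuous_on (?R \<times> {l2..h2}) (\<lambda>(z, y). B (fst z) y (w (fst z, y)))"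
    if "continuous_on UNIV w" for w :: "real \<times> real \<Rightarrow> 'b"
  proof -
    have "continuous_on (?R \<times> {l2..h2}) (\<lambda>q. (\<lambda>(s, t). B s t) (fst (fst q), snd q))"
      by (rule continuous_on_compose2[OF B]) (auto intro!: continuous_intros)
    moreover have "continuous_on (?R \<times> {l2..h2}) (\<lambda>q. w (fst (fst q), snd q))"
      by (rule continuous_on_compose2[OF that]) (auto intro!: continuous_intros)
    ultimately show ?thesis by (auto intro!: continuous_intros simp: case_prod_unfold)
  qed
  have contB: "continuous_on {l2..h2} (\<lambda>y. B s y (w (s, y)))"
    if "continuous_on UNIV w" "s \<in> {l1..h1}" for w :: "real \<times> real \<Rightarrow> 'b" and s
  proof -
    have "continuous_on {l2..h2} (\<lambda>y. (\<lambda>(z, y). B (fst z) y (w (fst z, y))) ((s, u2), y))"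
      by (rule continuous_on_compose2[OF contB2[OF that(1)]])
         (use u that in \<open>auto intro!: continuous_intros\<close>)
    then show ?thesis by simp
  qed
  have contT: "continuous_on ?R (T w)" if "continuous_on UNIV w" for w
    unfolding T_def
  proof (intro continuous_on_add continuous_on_const)
    have "continuous_on {l1..h1} (sint u1 (\<lambda>x. A x u2 (w (x, u2))))"
      using has_vector_derivative_sint[OF contA[OF that] u(1)]
      by (meson continuous_on_eq_continuous_within has_vector_derivative_continuous)
    then show "continuous_on ?R (\<lambda>z. sint u1 (\<lambda>x. A x u2 (w (x, u2))) (fst z))"
      by (rule continuous_on_compose2) (auto intro!: continuous_intros)
    show "continuous_on ?R (\<lambda>z. sint u2 (\<lambda>y. B (fst z) y (w (fst z, y))) (snd z))"
      by (rule continuous_on_sint[OF contB2[OF that] u(2)]) (auto intro!: continuous_intros)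
  qed
  \<comment> \<open>Clamping to the box turns \<open>T w\<close> into a bounded continuous function
    on the whole plane, so that Banach's fixed point theorem applies in the complete space of such
    functions.\<close>
  define \<Phi> where "\<Phi> W = Bcontfun (\<lambda>z. T (apply_bcontfun W) (clamp ?a ?b z))" for W :: "(real \<times> real) \<Rightarrow>\<^sub>C 'b"
  have \<Phi>: "apply_bcontfun (\<Phi> W) z = T (apply_bcontfun W) (clamp ?a ?b z)" for W z
  proof -
    have c: "continuous_on (cbox ?a ?b) (T (apply_bcontfun W))"
      unfolding box by (rule contT) (simp add: continuous_on_apply_bcontfun)
    then have "bounded (T (apply_bcontfun W) ` cbox ?a ?b)"
      by (intro compact_imp_bounded compact_continuous_image compact_cbox)
    with c have "(\<lambda>z. T (apply_bcontfun W) (clamp ?a ?b z)) \<in> bcontfun"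
      unfolding bcontfun_def by (intro CollectI conjI clamp_continuous_on clamp_bounded)
    then show ?thesis by (simp add: \<Phi>_def Bcontfun_inverse)
  qed
  have lip: "dist (\<Phi> V) (\<Phi> W) \<le> ((h1 - l1) + (h2 - l2)) * L * dist V W" for V W
  proof (rule dist_bound)
    fix z :: "real \<times> real"
    obtain s t where st: "clamp ?a ?b z = (s, t)" by (cases "clamp ?a ?b z")
    have "clamp ?a ?b z \<in> cbox ?a ?b"
      using u by (intro clamp_in_interval) (auto simp: Basis_prod_def)
    then have s: "s \<in> {l1..h1}" and t: "t \<in> {l2..h2}" unfolding st box by auto
    have cV: "continuous_on UNIV (apply_bcontfun V)" and cW: "continuous_on UNIV (apply_bcontfun W)"
      by (simp_all add: continuous_on_apply_bcontfun)
    have n: "norm (Q (V p) - Q (W p)) \<le> L * dist V W" if "norm Q \<le> L" for Q :: "'b \<Rightarrow>\<^sub>L 'b" and p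
    proof -
      have "norm (Q (V p) - Q (W p)) \<le> norm Q * norm (V p - W p)"
        by (metis blinfun.diff_right norm_blinfun)
      also have "\<dots> \<le> L * dist V W"
        using that dist_bounded[of V p W] L0 by (intro mult_mono) (auto simp: dist_norm)
      finally show ?thesis .
    qed
    have "T V (s, t) - T W (s, t) =
       sint u1 (\<lambda>x. A x u2 (V (x, u2)) - A x u2 (W (x, u2))) s
       + sint u2 (\<lambda>y. B s y (V (s, y)) - B s y (W (s, y))) t"
      by (simp add: T_def sint_diff[OF contA[OF cV] contA[OF cW] u(1) s] sint_diff[OF contB[OF cV s] contB[OF cW s] u(2) t])
    also have "norm \<dots> \<le> (h1 - l1) * (L * dist V W) + (h2 - l2) * (L * dist V W)"
      by (intro norm_triangle_mono norm_sint_le continuous_on_diff contA contB cV cW u s t n L)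
    finally show "dist (apply_bcontfun (\<Phi> V) z) (apply_bcontfun (\<Phi> W) z) \<le> ((h1 - l1) + (h2 - l2)) * L * dist V W"
      by (simp add: \<Phi> st dist_norm algebra_simps)
  qed
  have "0 \<le> ((h1 - l1) + (h2 - l2)) * L" using u L0 by auto
  with banach_fix_type[OF this small] lip obtain W where W: "\<Phi> W = W" by blast
  show ?thesis
  proof (intro exI[of _ "apply_bcontfun W"] conjI ballI)
    show "continuous_on UNIV (apply_bcontfun W)" by (simp add: continuous_on_apply_bcontfun)
    fix s t assume st: "s \<in> {l1..h1}" "t \<in> {l2..h2}"
    then have "clamp ?a ?b (s, t) = (s, t)" by (intro clamp_cancel_cbox) (simp add: box)
    with \<Phi>[of W "(s, t)"] W show "apply_bcontfun W (s, t) = c + sint u1 (\<lambda>x. A x u2 (apply_bcontfun W (x, u2))) s + sint u2 (\<lambda>y. B s y (apply_bcontfun W (s, y))) t"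
      by (simp add: T_def)
  qed
qed

text \<open>With zero curvature the solution also satisfies the integral equation along every
  horizontal segment: the defect \<open>D\<close> obeys a homogeneous linear Volterra equation, so it vanishes.
  No differentiability of \<open>w\<close> in the first variable is needed for this.\<close>

lemma flat_integral_equation:
  fixes A B A' B' :: "real \<Rightarrow> real \<Rightarrow> 'b::euclidean_space \<Rightarrow>\<^sub>L 'b" and c :: 'b
  assumes u: "u1 \<in> {l1..h1}" "u2 \<in> {l2..h2}"
    and A: "continuous_on ({l1..h1} \<times> {l2..h2}) (\<lambda>(s, t). A s t)"
    and B: "continuous_on ({l1..h1} \<times> {l2..h2}) (\<lambda>(s, t). B s t)"
    and A': "continuous_on ({l1..h1} \<times> {l2..h2}) (\<lambda>(s, t). A' s t)"
    and B': "continuous_on ({l1..h1} \<times> {l2..h2}) (\<lambda>(s, t). B' s t)"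
    and dA: "\<And>s t. s \<in> {l1..h1} \<Longrightarrow> t \<in> {l2..h2} \<Longrightarrow>
       ((\<lambda>t. A s t) has_vector_derivative A' s t) (at t within {l2..h2})"
    and dB: "\<And>s t. s \<in> {l1..h1} \<Longrightarrow> t \<in> {l2..h2} \<Longrightarrow>
       ((\<lambda>s. B s t) has_vector_derivative B' s t) (at s within {l1..h1})"
    and flat: "\<And>s t. s \<in> {l1..h1} \<Longrightarrow> t \<in> {l2..h2} \<Longrightarrow>
       B' s t - A' s t + ((B s t o\<^sub>L A s t) - (A s t o\<^sub>L B s t)) = 0"
    and L: "\<And>s t. s \<in> {l1..h1} \<Longrightarrow> t \<in> {l2..h2} \<Longrightarrow> norm (B s t) \<le> L"
           "\<And>s t. s \<in> {l1..h1} \<Longrightarrow> t \<in> {l2..h2} \<Longrightarrow> norm (B' s t) \<le> L"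
    and small: "(h2 - l2) * (L + (h1 - l1) * L) < 1"
    and w: "continuous_on UNIV w"
      "\<And>s t. s \<in> {l1..h1} \<Longrightarrow> t \<in> {l2..h2} \<Longrightarrow>
      w (s, t) = c + sint u1 (\<lambda>x. A x u2 (w (x, u2))) s + sint u2 (\<lambda>y. B s y (w (s, y))) t"
    and st: "s \<in> {l1..h1}" "t \<in> {l2..h2}"
  shows "w (s, t) = w (u1, t) + sint u1 (\<lambda>x. A x t (w (x, t))) s"
proof -
  let ?I = "{l1..h1}" and ?J = "{l2..h2}"
  have cmp: "continuous_on S (\<lambda>p. Q (f p) (g p))"
    if "continuous_on (?I \<times> ?J) (\<lambda>(s, t). Q s t)" "continuous_on S f" "continuous_on S g"
      "\<And>p. p \<in> S \<Longrightarrow> f p \<in> ?I" "\<And>p. p \<in> S \<Longrightarrow> g p \<in> ?J"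
    for Q :: "real \<Rightarrow> real \<Rightarrow> 'b \<Rightarrow>\<^sub>L 'b" and S :: "'c::topological_space set" and f g
  proof -
    have "continuous_on S (\<lambda>p. (\<lambda>(s, t). Q s t) (f p, g p))"
    proof (rule continuous_on_compose2[OF that(1)])
      show "(\<lambda>p. (f p, g p)) ` S \<subseteq> ?I \<times> ?J" using that(4,5) by blast
    qed (intro continuous_on_Pair that)
    then show ?thesis by simp
  qed
  have cw: "continuous_on S (\<lambda>p. w (f p, g p))" if "continuous_on S f" "continuous_on S g"
    for S :: "'c::topological_space set" and f g
    by (rule continuous_on_compose2[OF w(1)]) (use that in \<open>auto intro!: continuous_intros\<close>)
  note ci = blinfun.continuous_on cmp[OF A] cmp[OF B] cmp[OF A'] cmp[OF B'] cw continuous_on_fst continuous_on_snd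
     continuous_on_const continuous_on_id continuous_on_add
  have dw: "((\<lambda>t. w (s, t)) has_vector_derivative B s t (w (s, t))) (at t within ?J)"
    if s: "s \<in> ?I" and t: "t \<in> ?J" for s t
  proof (rule has_vector_derivative_transform[OF t])
    show "((\<lambda>t. c + sint u1 (\<lambda>x. A x u2 (w (x, u2))) s + sint u2 (\<lambda>y. B s y (w (s, y))) t)
       has_vector_derivative B s t (w (s, t))) (at t within ?J)"
    proof -
      have "continuous_on ?J (\<lambda>y. B s y (w (s, y)))" by (intro ci) (use s in auto)
      from has_vector_derivative_sint[OF this u(2) t] show ?thesis
        by (auto intro!: derivative_eq_intros)
    qed
  qed (rule w(2)[OF s])
  \<comment> \<open>The defect of the integral equation along the horizontal segment at height
    \<open>t\<close>.\<close>
  define D where "D s t = w (s, t) - (w (u1, t) + sint u1 (\<lambda>x. A x t (w (x, t))) s)" for s t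
  \<comment> \<open>The derivative of \<open>D\<close> in \<open>t\<close>, as will be seen; it is
    linear in \<open>D\<close> itself, which gives the Volterra estimate.\<close>
  define E where "E s t = B s t (D s t) - sint u1 (\<lambda>x. B' x t (D x t)) s" for s t
  have cDt: "continuous_on ?I (\<lambda>x. D x t)" if t: "t \<in> ?J" for t
    unfolding D_def
  proof (intro continuous_on_diff continuous_on_add cw continuous_on_const continuous_on_id)
    have "continuous_on ?I (\<lambda>x. A x t (w (x, t)))" by (intro ci) (use t in auto)
    from has_vector_derivative_sint[OF this u(1)]
    show "continuous_on ?I (sint u1 (\<lambda>x. A x t (w (x, t))))"
      by (meson continuous_on_eq_continuous_within has_vector_derivative_continuous)
  qed
  have cD: "continuous_on (?I \<times> ?J) (\<lambda>z. D (fst z) (snd z))"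
    unfolding D_def
  proof (intro continuous_on_diff continuous_on_add cw ci)
    have "continuous_on ((?I \<times> ?J) \<times> ?I) (\<lambda>q. A (snd q) (snd (fst q)) (w (snd q, snd (fst q))))"
      by (intro ci) auto
    then show "continuous_on (?I \<times> ?J) (\<lambda>z. sint u1 (\<lambda>x. A x (snd z) (w (x, snd z))) (fst z))"
      by (intro continuous_on_sint[where l=l1 and h=h1] u) (auto intro!: ci simp: case_prod_unfold)
  qed
  have dD: "((\<lambda>t. D s t) has_vector_derivative E s t) (at t within ?J)"
    if s: "s \<in> ?I" and t: "t \<in> ?J" for s t
  proof -
    define V where "V x = w (u1, t) + sint u1 (\<lambda>x. A x t (w (x, t))) x" for x
    have cAw: "continuous_on ?I (\<lambda>x. A x t (w (x, t)))" by (intro ci) (use t in auto)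
    have dV: "(V has_vector_derivative A x t (w (x, t))) (at x within ?I)" if x: "x \<in> ?I" for x
      unfolding V_def using has_vector_derivative_sint[OF cAw u(1) x]
      by (auto intro!: derivative_eq_intros)
    have cV: "continuous_on ?I V"
      using dV by (meson continuous_on_eq_continuous_within has_vector_derivative_continuous)
    have VD: "V x = w (x, t) - D x t" for x by (simp add: V_def D_def)
    have "((\<lambda>t. sint u1 (\<lambda>x. A x t (w (x, t))) s) has_vector_derivative
        sint u1 (\<lambda>x. A x t (B x t (w (x, t))) + A' x t (w (x, t))) s) (at t within ?J)"
    proof (rule has_vector_derivative_sint_param[where l=l1 and h=h1])
      show "((\<lambda>t. A x t (w (x, t))) has_vector_derivative A x t (B x t (w (x, t))) + A' x t (w (x, t)))
          (at t within ?J)" if "t \<in> ?J" "x \<in> ?I" for t x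
        using bounded_bilinear.has_vector_derivative[OF bounded_bilinear_blinfun_apply dA[OF that(2,1)] dw[OF that(2,1)]] .
      show "continuous_on ?I (\<lambda>x. A x t (w (x, t)))" if "t \<in> ?J" for t
        by (intro ci) (use that in auto)
      show "continuous_on (?J \<times> ?I) (\<lambda>(t, x). A x t (B x t (w (x, t))) + A' x t (w (x, t)))"
        unfolding case_prod_unfold by (intro ci) auto
    qed (use s t u in auto)
    then have 1: "((\<lambda>t. D s t) has_vector_derivative B s t (w (s, t)) - (B u1 t (w (u1, t)) +
        sint u1 (\<lambda>x. A x t (B x t (w (x, t))) + A' x t (w (x, t))) s)) (at t within ?J)"
      unfolding D_def by (intro has_vector_derivative_diff has_vector_derivative_add dw s t u)
    \<comment> \<open>Integrates the derivative of \<open>B V\<close> in \<open>x\<close>, where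
      \<open>V\<close> is the right-hand side under test. Subtracted from the
      \<open>t\<close>-derivative of the integral of \<open>A w\<close>, it leaves by flatness only
      the integral of \<open>B' D\<close>.\<close>
    have "sint u1 (\<lambda>x. B x t (A x t (w (x, t))) + B' x t (V x)) s = B s t (V s) - B u1 t (V u1)"
    proof (rule sint_eq_of_has_vector_derivative[where l=l1 and h=h1])
      show "((\<lambda>x. B x t (V x)) has_vector_derivative B x t (A x t (w (x, t))) + B' x t (V x)) (at x within ?I)"
        if "x \<in> ?I" for x
        using bounded_bilinear.has_vector_derivative[OF bounded_bilinear_blinfun_apply dB[OF that t] dV[OF that]] .
      show "continuous_on ?I (\<lambda>x. B x t (A x t (w (x, t))) + B' x t (V x))"
        by (intro ci cV) (use t in auto)
    qed (use s u in auto)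
    moreover have "sint u1 (\<lambda>x. A x t (B x t (w (x, t))) + A' x t (w (x, t))) s
        - sint u1 (\<lambda>x. B x t (A x t (w (x, t))) + B' x t (V x)) s
        = sint u1 (\<lambda>x. A x t (B x t (w (x, t))) + A' x t (w (x, t)) - (B x t (A x t (w (x, t))) + B' x t (V x))) s"
      by (subst sint_diff[where l=l1 and h=h1]) (use s t u in \<open>auto intro!: ci cV\<close>)
    moreover have "\<dots> = sint u1 (\<lambda>x. B' x t (D x t)) s"
    proof -
      have "A x t (B x t (w (x, t))) + A' x t (w (x, t)) - (B x t (A x t (w (x, t))) + B' x t (V x))
          = B' x t (D x t)" if "x \<in> ?I" for x
      proof -
        have "blinfun_apply (B' x t - A' x t + ((B x t o\<^sub>L A x t) - (A x t o\<^sub>L B x t))) (w (x, t)) = 0"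
          by (subst flat[OF that t]) simp
        then have "B' x t (w (x, t)) - A' x t (w (x, t)) + (B x t (A x t (w (x, t))) - A x t (B x t (w (x, t)))) = 0"
          by (simp only: blinfun.add_left blinfun.diff_left blinfun_apply_blinfun_compose)
        then show ?thesis by (simp add: VD blinfun.diff_right algebra_simps)
      qed
      then show ?thesis unfolding sint_def using segment_in_interval[OF u(1) s]
        by (intro arg_cong[of _ _ "\<lambda>i. (s - u1) *\<^sub>R i"] Henstock_Kurzweil_Integration.integral_cong) auto
    qed
    ultimately have "B s t (w (s, t)) - (B u1 t (w (u1, t)) +
        sint u1 (\<lambda>x. A x t (B x t (w (x, t))) + A' x t (w (x, t))) s) = E s t"
      by (simp add: E_def VD blinfun.diff_right V_def algebra_simps) (simp add: D_def algebra_simps blinfun.diff_right)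
    with 1 show ?thesis by simp
  qed
  \<comment> \<open>The maximum \<open>M\<close> of \<open>norm D\<close> over the compact box obeys
    an inequality \<open>M <= c * M\<close> with \<open>c < 1\<close>, because \<open>D\<close>
    vanishes on the line at height \<open>u2\<close>.\<close>
  obtain z0 where z0: "z0 \<in> ?I \<times> ?J" "\<And>z. z \<in> ?I \<times> ?J \<Longrightarrow> norm (D (fst z) (snd z)) \<le> norm (D (fst z0) (snd z0))"
  proof -
    have "\<exists>z\<in>?I \<times> ?J. \<forall>y\<in>?I \<times> ?J. norm (D (fst y) (snd y)) \<le> norm (D (fst z) (snd z))"
      using u by (intro continuous_attains_sup compact_Times compact_Icc continuous_on_norm cD) auto
    then show thesis using that by blast
  qed
  define M where "M = norm (D (fst z0) (snd z0))"
  have M: "norm (D s t) \<le> M" if "s \<in> ?I" "t \<in> ?J" for s t using z0(2)[of "(s, t)"] that by (simp add: M_def)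
  have L0: "0 \<le> L" using L(1)[OF u] norm_ge_zero order_trans by blast
  have Ebound: "norm (E s t) \<le> (L + (h1 - l1) * L) * M" if s: "s \<in> ?I" and t: "t \<in> ?J" for s t
  proof -
    have q: "norm (Q (D x t)) \<le> L * M" if "norm Q \<le> L" "x \<in> ?I" for Q :: "'b \<Rightarrow>\<^sub>L 'b" and x
      using norm_blinfun[of Q "D x t"] mult_mono[OF that(1) M[OF that(2) t] L0 norm_ge_zero] by linarith
    have "norm (sint u1 (\<lambda>x. B' x t (D x t)) s) \<le> (h1 - l1) * (L * M)"
      by (rule norm_sint_le) (use t s u in \<open>auto intro!: ci cDt q L\<close>)
    moreover have "norm (B s t (D s t)) \<le> L * M" using q L(1)[OF s t] s by blast
    ultimately have "norm (E s t) \<le> L * M + (h1 - l1) * (L * M)"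
      unfolding E_def using norm_triangle_ineq4 by (smt (verit))
    then show ?thesis by (simp add: algebra_simps)
  qed
  have D0: "D s u2 = 0" if "s \<in> ?I" for s
    using w(2)[OF that u(2)] w(2)[OF u(1) u(2)] by (simp add: D_def)
  have "norm (D s t) \<le> (L + (h1 - l1) * L) * M * (h2 - l2)" if s: "s \<in> ?I" and t: "t \<in> ?J" for s t
  proof -
    have "norm (D s t - D s u2) \<le> (L + (h1 - l1) * L) * M * norm (t - u2)"
    proof (rule differentiable_bound[where S="?J" and f'="\<lambda>t h. h *\<^sub>R E s t"])
      show "(D s has_derivative (\<lambda>h. h *\<^sub>R E s x)) (at x within ?J)" if "x \<in> ?J" for x
        using dD[OF s that] by (simp add: has_vector_derivative_def)
      show "onorm (\<lambda>h. h *\<^sub>R E s x) \<le> (L + (h1 - l1) * L) * M" if "x \<in> ?J" for x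
      proof (rule onorm_bound)
        show "0 \<le> (L + (h1 - l1) * L) * M" using Ebound[OF s that] norm_ge_zero order_trans by blast
        show "norm (h *\<^sub>R E s x) \<le> (L + (h1 - l1) * L) * M * norm h" for h
          using mult_left_mono[OF Ebound[OF s that] abs_ge_zero[of h]] by (simp add: mult.commute)
      qed
    qed (use t u in auto)
    also have "\<dots> \<le> (L + (h1 - l1) * L) * M * (h2 - l2)"
      using t u order_trans[OF norm_ge_zero Ebound[OF s t]] by (intro mult_left_mono) auto
    finally show ?thesis using D0[OF s] by simp
  qed
  from this[of "fst z0" "snd z0"] z0(1) have "M \<le> ((h2 - l2) * (L + (h1 - l1) * L)) * M"
    unfolding M_def by (auto simp: algebra_simps mem_Times_iff)
  moreover have "0 \<le> M" by (simp add: M_def)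
  ultimately have "M = 0" using small mult_strict_right_mono[OF small, of M] by fastforce
  then have "D s t = 0" using M[OF st] by simp
  then show ?thesis by (simp add: D_def)
qed

lemma vector_2_eq_axis: "(vector [s, t] :: real^2) = s *\<^sub>R axis 1 1 + t *\<^sub>R axis 2 1"
  by (simp add: vec_eq_iff forall_2 axis_def)

lemma vector_2_add_axis:
  "(vector [s, t] :: real^2) = vector [0, t] + s *\<^sub>R axis 1 1"
  "(vector [s, t] :: real^2) = vector [s, 0] + t *\<^sub>R axis 2 1"
  by (simp_all add: vector_2_eq_axis)

lemma has_vector_derivative_coordinate:
  assumes "open V" "smooth_on V f" "vector [s, t] \<in> V"
  shows "((\<lambda>s. f (vector [s, t])) has_vector_derivative pd 1 f (vector [s, t])) (at s within I)"
    and "((\<lambda>t. f (vector [s, t])) has_vector_derivative pd 2 f (vector [s, t])) (at t within I)"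
proof -
  note l = has_field_derivative_along_line[OF assms(1) smooth_on_differentiable_on[OF assms(2)]]
  have "((\<lambda>s. f (vector [s, t])) has_real_derivative pd 1 f (vector [s, t])) (at s)"
    using l[of "vector [0, t]" s 1] assms(3) by (simp flip: vector_2_add_axis(1))
  then show "((\<lambda>s. f (vector [s, t])) has_vector_derivative pd 1 f (vector [s, t])) (at s within I)"
    by (simp add: has_real_derivative_iff_has_vector_derivative has_vector_derivative_at_within)
  have "((\<lambda>t. f (vector [s, t])) has_real_derivative pd 2 f (vector [s, t])) (at t)"
    using l[of "vector [s, 0]" t 2] assms(3) by (simp flip: vector_2_add_axis(2))
  then show "((\<lambda>t. f (vector [s, t])) has_vector_derivative pd 2 f (vector [s, t])) (at t within I)"
    by (simp add: has_real_derivative_iff_has_vector_derivative has_vector_derivative_at_within)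
qed

lemma continuous_on_vector_2:
  assumes "continuous_on V f" "\<And>s t. s \<in> I \<Longrightarrow> t \<in> J \<Longrightarrow> vector [s, t] \<in> V"
  shows "continuous_on (I \<times> J) (\<lambda>(s, t). f (vector [s, t] :: real^2))"
proof -
  have "continuous_on (I \<times> J) (\<lambda>z. vector [fst z, snd z] :: real^2)"
    unfolding vector_2_eq_axis by (intro continuous_intros)
  then have "continuous_on (I \<times> J) (\<lambda>z. f (vector [fst z, snd z]))"
    by (rule continuous_on_compose2[OF assms(1)]) (use assms(2) in auto)
  then show ?thesis by (simp add: case_prod_unfold)
qed

definition matrix_unit :: "'n::finite \<Rightarrow> 'n \<Rightarrow> (real^'n) \<Rightarrow>\<^sub>L (real^'n)" where
  "matrix_unit i j = Blinfun (\<lambda>v. axis i (v $ j))"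

lemma matrix_unit_apply:
  fixes i j :: "'n::finite"
  shows "blinfun_apply (matrix_unit i j) v = axis i (v $ j)"
  unfolding matrix_unit_def
proof (subst bounded_linear_Blinfun_apply)
  have "linear (\<lambda>v::real^'n. axis i (v $ j))"
    by (rule linearI) (auto simp: vec_eq_iff axis_def)
  then show "bounded_linear (\<lambda>v::real^'n. axis i (v $ j))" by (rule linear_conv_bounded_linear[THEN iffD1])
qed simp

text \<open>Written as a combination of constant operators, so that continuity and derivatives in a
  parameter are inherited from the entries.\<close>

definition matrix_blinfun :: "('n::finite \<Rightarrow> 'n \<Rightarrow> real) \<Rightarrow> (real^'n) \<Rightarrow>\<^sub>L (real^'n)" where
  "matrix_blinfun a = (\<Sum>i\<in>UNIV. \<Sum>j\<in>UNIV. a i j *\<^sub>R matrix_unit i j)"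

lemma matrix_blinfun_apply:
  fixes a :: "'n::finite \<Rightarrow> 'n \<Rightarrow> real"
  shows "blinfun_apply (matrix_blinfun a) v $ i = (\<Sum>j\<in>UNIV. a i j * v $ j)"
proof -
  have "blinfun_apply (matrix_blinfun a) v $ i = (\<Sum>k\<in>UNIV. \<Sum>j\<in>UNIV. a k j * axis k (v $ j) $ i)"
    by (simp add: matrix_blinfun_def blinfun.sum_left blinfun.scaleR_left matrix_unit_apply)
  also have "\<dots> = (\<Sum>k\<in>UNIV. if k = i then \<Sum>j\<in>UNIV. a i j * v $ j else 0)"
    by (intro sum.cong) (auto simp: axis_def)
  finally show ?thesis by simp
qed

lemma has_vector_derivative_matrix_blinfun:
  fixes a :: "'n::finite \<Rightarrow> 'n \<Rightarrow> real \<Rightarrow> real"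
  assumes "\<And>i j. (a i j has_vector_derivative a' i j) (at t within I)"
  shows "((\<lambda>t. matrix_blinfun (\<lambda>i j. a i j t)) has_vector_derivative matrix_blinfun a') (at t within I)"
  unfolding matrix_blinfun_def
  by (intro has_vector_derivative_sum bounded_linear.has_vector_derivative[OF bounded_linear_scaleR_left] assms)

lemma matrix_blinfun_compose:
  "(matrix_blinfun a o\<^sub>L matrix_blinfun b) = matrix_blinfun (\<lambda>i j. \<Sum>k\<in>UNIV. a i k * b k j)"
proof (rule blinfun_eqI)
  fix v
  show "blinfun_apply (matrix_blinfun a o\<^sub>L matrix_blinfun b) v =
      blinfun_apply (matrix_blinfun (\<lambda>i j. \<Sum>k\<in>UNIV. a i k * b k j)) v"
    unfolding vec_eq_iff blinfun_apply_blinfun_compose matrix_blinfun_apply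
    by (simp add: sum_distrib_left sum_distrib_right mult.assoc) (subst sum.swap, simp)
qed

lemma matrix_blinfun_add_diff:
  "matrix_blinfun a + matrix_blinfun b = matrix_blinfun (\<lambda>i j. a i j + b i j)"
  "matrix_blinfun a - matrix_blinfun b = matrix_blinfun (\<lambda>i j. a i j - b i j)"
  by (simp_all add: matrix_blinfun_def sum.distrib sum_subtractf scaleR_left_distrib scaleR_left_diff_distrib)

lemma open_coordinate_box: "open {x :: real^2. \<bar>x $ 1 - a\<bar> < d \<and> \<bar>x $ 2 - b\<bar> < d}"
  by (intro open_Collect_conj open_Collect_less continuous_intros)

lemma convex_coordinate_box: "convex {x :: real^2. \<bar>x $ 1 - a\<bar> < d \<and> \<bar>x $ 2 - b\<bar> < d}"
proof -
  have "{x :: real^2. \<bar>x $ 1 - a\<bar> < d \<and> \<bar>x $ 2 - b\<bar> < d} = box (vector [a - d, b - d]) (vector [a + d, b + d])"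
    by (auto simp: mem_box_cart forall_2 abs_less_iff)
  then show ?thesis by (simp add: convex_box)
qed

text \<open>Frobenius for a linear system of vanishing curvature. Integrating first horizontally and
  then vertically gives a solution of the second equation; by flatness it satisfies the first one
  along every horizontal segment too. The neighbourhood \<open>S\<close> is fixed before the initial
  value \<open>c\<close>, so that solutions for different initial values live on a common
  domain.\<close>

theorem local_frobenius:
  fixes A :: "2 \<Rightarrow> 'n::finite \<Rightarrow> 'n \<Rightarrow> scalar_field"
  assumes V: "open V" "p0 \<in> V" and A: "\<And>l i j. smooth_on V (A l i j)"
    and flat: "\<And>x i j. x \<in> V \<Longrightarrow> pd 1 (A 2 i j) x - pd 2 (A 1 i j) x
      + (\<Sum>k\<in>UNIV. A 2 i k x * A 1 k j x - A 1 i k x * A 2 k j x) = 0"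
  obtains S where "open S" "convex S" "p0 \<in> S" "S \<subseteq> V"
    "\<And>c. \<exists>W. (\<forall>i. smooth_on S (W i)) \<and> (\<forall>i. W i p0 = c i) \<and>
       (\<forall>l i. \<forall>x\<in>S. pd l (W i) x = (\<Sum>j\<in>UNIV. A l i j x * W j x))"
proof -
  define Q where "Q l s t = matrix_blinfun (\<lambda>i j. A l i j (vector [s, t]))" for l s t
  define Q' where "Q' l m s t = matrix_blinfun (\<lambda>i j. pd m (A l i j) (vector [s, t]))" for l m s t
  obtain r where r: "r > 0" "ball p0 r \<subseteq> V" using V open_contains_ball by blast
  \<comment> \<open>The closed square of half-width \<open>r / 3\<close> lies in the ball, since the
    norm is at most the sum of the coordinates' absolute values.\<close>
  define \<delta>0 where "\<delta>0 = r / 3"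
  have \<delta>0: "\<delta>0 > 0" using r by (simp add: \<delta>0_def)
  have inV: "vector [s, t] \<in> V" if "s \<in> {p0 $ 1 - \<delta>0..p0 $ 1 + \<delta>0}" "t \<in> {p0 $ 2 - \<delta>0..p0 $ 2 + \<delta>0}" for s t
  proof -
    have "norm (vector [s, t] - p0) \<le> (\<Sum>i\<in>UNIV. \<bar>(vector [s, t] - p0) $ i\<bar>)"
      by (rule norm_le_l1_cart)
    also have "\<dots> \<le> \<delta>0 + \<delta>0" using that by (simp add: sum_2 abs_le_iff) linarith
    also have "\<dots> < r" using r by (simp add: \<delta>0_def)
    finally show ?thesis using r(2) by (auto simp: dist_norm norm_minus_commute)
  qed
  have cont: "continuous_on (I \<times> J) (\<lambda>(s, t). matrix_blinfun (\<lambda>i j. f i j (vector [s, t])))"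
    if "\<And>i j. smooth_on V (f i j)" "\<And>s t. s \<in> I \<Longrightarrow> t \<in> J \<Longrightarrow> vector [s, t] \<in> V" for f :: "'n \<Rightarrow> 'n \<Rightarrow> scalar_field" and I J
  proof -
    have "continuous_on (I \<times> J) (\<lambda>z. f i j (vector [fst z, snd z]))" for i j
      using continuous_on_vector_2[OF smooth_on_continuous_on[OF that(1)] that(2), of I J] by (simp add: case_prod_unfold)
    then show ?thesis unfolding matrix_blinfun_def case_prod_unfold
      by (intro continuous_on_sum continuous_on_scaleR continuous_on_const)
  qed
  have sA: "smooth_on V (pd m (A l i j))" for m l i j by (rule smooth_on_pd[OF A])
  let ?I = "\<lambda>\<delta>. {p0 $ 1 - \<delta>..p0 $ 1 + \<delta>}" and ?J = "\<lambda>\<delta>. {p0 $ 2 - \<delta>..p0 $ 2 + \<delta>}"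
  have "\<exists>L. \<forall>s\<in>?I \<delta>0. \<forall>t\<in>?J \<delta>0. norm (P s t) \<le> L"
    if "continuous_on (?I \<delta>0 \<times> ?J \<delta>0) (\<lambda>(s, t). P s t)" for P :: "real \<Rightarrow> real \<Rightarrow> (real^'n) \<Rightarrow>\<^sub>L (real^'n)"
  proof -
    have "bounded ((\<lambda>(s, t). P s t) ` (?I \<delta>0 \<times> ?J \<delta>0))"
      by (intro compact_imp_bounded compact_continuous_image compact_Times compact_Icc that)
    then obtain L where "\<forall>x\<in>(\<lambda>(s, t). P s t) ` (?I \<delta>0 \<times> ?J \<delta>0). norm x \<le> L"
      by (auto simp: bounded_iff)
    then show ?thesis by (intro exI[of _ L]) auto
  qed
  note bd = this
  have cQ0: "continuous_on (?I \<delta>0 \<times> ?J \<delta>0) (\<lambda>(s, t). Q l s t)" for l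
    unfolding Q_def by (rule cont[OF A inV])
  have cQ0': "continuous_on (?I \<delta>0 \<times> ?J \<delta>0) (\<lambda>(s, t). Q' l m s t)" for l m
    unfolding Q'_def by (rule cont[OF sA inV])
  obtain L1 where L1: "\<And>s t. s \<in> ?I \<delta>0 \<Longrightarrow> t \<in> ?J \<delta>0 \<Longrightarrow> norm (Q 1 s t) \<le> L1"
    using bd[OF cQ0] by blast
  obtain L2 where L2: "\<And>s t. s \<in> ?I \<delta>0 \<Longrightarrow> t \<in> ?J \<delta>0 \<Longrightarrow> norm (Q 2 s t) \<le> L2"
    using bd[OF cQ0] by blast
  obtain L3 where L3: "\<And>s t. s \<in> ?I \<delta>0 \<Longrightarrow> t \<in> ?J \<delta>0 \<Longrightarrow> norm (Q' 2 1 s t) \<le> L3"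
    using bd[OF cQ0'] by blast
  define L where "L = max 1 (max L1 (max L2 L3))"
  have L: "L \<ge> 1" "L1 \<le> L" "L2 \<le> L" "L3 \<le> L" by (auto simp: L_def)
  \<comment> \<open>With \<open>\<delta> * L <= 1/8\<close> both the contraction constant
    \<open>4 * \<delta> * L\<close> and the factor
    \<open>2 * \<delta> * L * (1 + 2 * \<delta>)\<close> in the defect estimate are below 1.\<close>
  define \<delta> where "\<delta> = min \<delta>0 (1 / (8 * L))"
  have \<delta>: "\<delta> > 0" "\<delta> \<le> \<delta>0" using \<delta>0 L by (auto simp: \<delta>_def)
  have \<delta>L: "\<delta> * L \<le> 1 / 8"
  proof -
    have "\<delta> * L \<le> 1 / (8 * L) * L" using L by (intro mult_right_mono) (auto simp: \<delta>_def)
    then show ?thesis using L by simp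
  qed
  have \<delta>1: "\<delta> \<le> 1 / 8" using \<delta>L mult_left_mono[OF L(1), of \<delta>] \<delta> by linarith
  have sub: "s \<in> ?I \<delta>0" if "s \<in> ?I \<delta>" for s using that \<delta> by auto
  have sub': "t \<in> ?J \<delta>0" if "t \<in> ?J \<delta>" for t using that \<delta> by auto
  note inV' = inV[OF sub sub']
  have p0: "p0 $ 1 \<in> ?I \<delta>" "p0 $ 2 \<in> ?J \<delta>" using \<delta> by auto
  have small1: "((p0 $ 1 + \<delta> - (p0 $ 1 - \<delta>)) + (p0 $ 2 + \<delta> - (p0 $ 2 - \<delta>))) * L < 1"
    using \<delta>L by (simp add: algebra_simps)
  have small2: "(p0 $ 2 + \<delta> - (p0 $ 2 - \<delta>)) * (L + (p0 $ 1 + \<delta> - (p0 $ 1 - \<delta>)) * L) < 1"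
  proof -
    have "2 * (\<delta> * L) * (1 + 2 * \<delta>) \<le> 2 * (1 / 8) * (1 + 2 * (1 / 8))"
      using \<delta> \<delta>L \<delta>1 L by (intro mult_mono) auto
    then show ?thesis by (simp add: algebra_simps)
  qed
  define S where "S = {x :: real^2. \<bar>x $ 1 - p0 $ 1\<bar> < \<delta> \<and> \<bar>x $ 2 - p0 $ 2\<bar> < \<delta>}"
  have coords: "x $ 1 \<in> ?I \<delta>" "x $ 2 \<in> ?J \<delta>" if "x \<in> S" for x using that by (auto simp: S_def)
  have vec: "vector [x $ 1, x $ 2] = x" for x :: "real^2" by (simp add: vec_eq_iff forall_2)
  have "S \<subseteq> V"
  proof
    fix x assume "x \<in> S"
    then show "x \<in> V" using inV'[OF coords(1) coords(2), of x x] by (simp add: vec)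
  qed
  then have S: "open S" "convex S" "p0 \<in> S" "S \<subseteq> V"
    using open_coordinate_box convex_coordinate_box \<delta> by (auto simp: S_def)
  have main: "\<exists>W. (\<forall>i. smooth_on S (W i)) \<and> (\<forall>i. W i p0 = c i) \<and>
       (\<forall>l i. \<forall>x\<in>S. pd l (W i) x = (\<Sum>j\<in>UNIV. A l i j x * W j x))" for c
  proof -
    define c' where "c' = (\<chi> i. c i)"
    have cQ: "continuous_on (?I \<delta> \<times> ?J \<delta>) (\<lambda>(s, t). Q l s t)" for l
      unfolding Q_def by (rule cont[OF A inV'])
    have cQ': "continuous_on (?I \<delta> \<times> ?J \<delta>) (\<lambda>(s, t). Q' l m s t)" for l m
      unfolding Q'_def by (rule cont[OF sA inV'])
    have nQ: "norm (Q 1 s t) \<le> L" "norm (Q 2 s t) \<le> L" "norm (Q' 2 1 s t) \<le> L"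
      if "s \<in> ?I \<delta>" "t \<in> ?J \<delta>" for s t
      using L1[OF sub[OF that(1)] sub'[OF that(2)]] L2[OF sub[OF that(1)] sub'[OF that(2)]]
        L3[OF sub[OF that(1)] sub'[OF that(2)]] L by auto
    have "\<exists>w. continuous_on UNIV w \<and> (\<forall>s\<in>?I \<delta>. \<forall>t\<in>?J \<delta>.
        w (s, t) = c' + sint (p0 $ 1) (\<lambda>x. Q 1 x (p0 $ 2) (w (x, p0 $ 2))) s
         + sint (p0 $ 2) (\<lambda>y. Q 2 s y (w (s, y))) t)"
      by (rule path_integral_equation_solution[OF p0 cQ cQ _ _ small1]; rule nQ)
    then obtain w where w0: "continuous_on UNIV w"
      "\<forall>s\<in>?I \<delta>. \<forall>t\<in>?J \<delta>. w (s, t) = c' + sint (p0 $ 1) (\<lambda>x. Q 1 x (p0 $ 2) (w (x, p0 $ 2))) s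
         + sint (p0 $ 2) (\<lambda>y. Q 2 s y (w (s, y))) t"
      by (elim exE conjE)
    note w = w0(1) w0(2)[rule_format]
    have dQ: "((\<lambda>t. Q 1 s t) has_vector_derivative Q' 1 2 s t) (at t within ?J \<delta>)"
      "((\<lambda>s. Q 2 s t) has_vector_derivative Q' 2 1 s t) (at s within ?I \<delta>)"
      if "s \<in> ?I \<delta>" "t \<in> ?J \<delta>" for s t
      unfolding Q_def Q'_def
      by (rule has_vector_derivative_matrix_blinfun has_vector_derivative_coordinate[OF V(1) A inV'[OF that]])+
    have fl: "Q' 2 1 s t - Q' 1 2 s t + ((Q 2 s t o\<^sub>L Q 1 s t) - (Q 1 s t o\<^sub>L Q 2 s t)) = 0"
      if "s \<in> ?I \<delta>" "t \<in> ?J \<delta>" for s t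
      unfolding Q_def Q'_def matrix_blinfun_compose matrix_blinfun_add_diff
      using flat[OF inV'[OF that]] by (simp add: matrix_blinfun_def sum_subtractf)
    have w1: "w (s, t) = w (p0 $ 1, t) + sint (p0 $ 1) (\<lambda>x. Q 1 x t (w (x, t))) s"
      if "s \<in> ?I \<delta>" "t \<in> ?J \<delta>" for s t
      by (rule flat_integral_equation[OF p0 cQ cQ cQ' cQ' dQ fl nQ(2,3) small2 w that])
    have cQw: "continuous_on (?I \<delta> \<times> ?J \<delta>) (\<lambda>z. Q l (fst z) (snd z) (w z))" for l
      using cQ[of l] continuous_on_subset[OF w(1) subset_UNIV]
      by (intro blinfun.continuous_on) (auto simp: case_prod_unfold)
    have d1: "((\<lambda>s. w (s, t)) has_vector_derivative Q 1 s t (w (s, t))) (at s within ?I \<delta>)"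
      if st: "s \<in> ?I \<delta>" "t \<in> ?J \<delta>" for s t
    proof (rule has_vector_derivative_transform[OF st(1)])
      have "continuous_on (?I \<delta>) (\<lambda>x. Q 1 (fst (x, t)) (snd (x, t)) (w (x, t)))"
        by (rule continuous_on_compose2[OF cQw]) (use st in \<open>auto intro!: continuous_intros\<close>)
      then have "continuous_on (?I \<delta>) (\<lambda>x. Q 1 x t (w (x, t)))" by simp
      from has_vector_derivative_sint[OF this p0(1) st(1)]
      show "((\<lambda>s. w (p0 $ 1, t) + sint (p0 $ 1) (\<lambda>x. Q 1 x t (w (x, t))) s) has_vector_derivative
         Q 1 s t (w (s, t))) (at s within ?I \<delta>)"
        by (auto intro!: derivative_eq_intros)
    qed (rule w1[OF _ st(2)])
    have d2: "((\<lambda>t. w (s, t)) has_vector_derivative Q 2 s t (w (s, t))) (at t within ?J \<delta>)"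
      if st: "s \<in> ?I \<delta>" "t \<in> ?J \<delta>" for s t
    proof (rule has_vector_derivative_transform[OF st(2)])
      have "continuous_on (?J \<delta>) (\<lambda>y. Q 2 (fst (s, y)) (snd (s, y)) (w (s, y)))"
        by (rule continuous_on_compose2[OF cQw]) (use st in \<open>auto intro!: continuous_intros\<close>)
      then have "continuous_on (?J \<delta>) (\<lambda>y. Q 2 s y (w (s, y)))" by simp
      from has_vector_derivative_sint[OF this p0(2) st(2)]
      show "((\<lambda>t. c' + sint (p0 $ 1) (\<lambda>x. Q 1 x (p0 $ 2) (w (x, p0 $ 2))) s + sint (p0 $ 2) (\<lambda>y. Q 2 s y (w (s, y))) t)
         has_vector_derivative Q 2 s t (w (s, t))) (at t within ?J \<delta>)"
        by (auto intro!: derivative_eq_intros)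
    qed (rule w(2)[OF st(1)])
    define W where "W i x = w (x $ 1, x $ 2) $ i" for i and x :: "real^2"
    have dW: "(W i has_derivative (\<lambda>h. \<Sum>l\<in>UNIV. h $ l * (\<Sum>j\<in>UNIV. A l i j x * W j x))) (at x)"
      if x: "x \<in> S" for x i
    proof -
      define s t where "s = x $ 1" and "t = x $ 2"
      have st: "s \<in> ?I \<delta>" "t \<in> ?J \<delta>" using coords[OF x] by (auto simp: s_def t_def)
      have "((\<lambda>(s, t). w (s, t)) has_derivative
          (\<lambda>(tx, ty). tx *\<^sub>R Q 1 s t (w (s, t)) + blinfun_apply (blinfun_scaleR_left (Q 2 s t (w (s, t)))) ty))
          (at (s, t) within ?I \<delta> \<times> ?J \<delta>)"
      proof (rule has_derivative_partialsI)
        show "((\<lambda>s. w (s, t)) has_derivative (\<lambda>h. h *\<^sub>R Q 1 s t (w (s, t)))) (at s within ?I \<delta>)"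
          using d1[OF st] by (simp add: has_vector_derivative_def)
        show "((\<lambda>t. w (s, t)) has_derivative blinfun_apply (blinfun_scaleR_left (Q 2 s t (w (s, t))))) (at t within ?J \<delta>)"
          if "s \<in> ?I \<delta>" "t \<in> ?J \<delta>" for s t
          using d2[OF that] by (simp add: has_vector_derivative_def)
        have "continuous_on (?I \<delta> \<times> ?J \<delta>) (\<lambda>z. blinfun_scaleR_left (Q 2 (fst z) (snd z) (w z)))"
          by (rule bounded_linear.continuous_on[OF bounded_linear_blinfun_scaleR_left cQw])
        then show "continuous (at (s, t) within ?I \<delta> \<times> ?J \<delta>) (\<lambda>(s, t). blinfun_scaleR_left (Q 2 s t (w (s, t))))"
          using st by (simp add: continuous_on_eq_continuous_within case_prod_unfold)
      qed (use st in auto)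
      then have d: "(w has_derivative (\<lambda>z. fst z *\<^sub>R Q 1 s t (w (s, t)) + snd z *\<^sub>R Q 2 s t (w (s, t))))
          (at (s, t) within ?I \<delta> \<times> ?J \<delta>)"
        by (simp add: case_prod_unfold)
      have int: "(s, t) \<in> interior (?I \<delta> \<times> ?J \<delta>)"
      proof -
        have "s \<in> {p0 $ 1 - \<delta><..<p0 $ 1 + \<delta>}" "t \<in> {p0 $ 2 - \<delta><..<p0 $ 2 + \<delta>}"
          using x unfolding S_def s_def t_def mem_Collect_eq greaterThanLessThan_iff by linarith+
        then show ?thesis by (simp add: interior_Times)
      qed
      have "(w has_derivative (\<lambda>z. fst z *\<^sub>R Q 1 s t (w (s, t)) + snd z *\<^sub>R Q 2 s t (w (s, t)))) (at (x $ 1, x $ 2))"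
        using d unfolding at_within_interior[OF int] by (simp add: s_def t_def)
      moreover have "((\<lambda>x. (x $ 1, x $ 2)) has_derivative (\<lambda>h. (h $ 1, h $ 2))) (at x)"
        by (intro has_derivative_Pair bounded_linear_imp_has_derivative bounded_linear_vec_nth)
      ultimately have "((\<lambda>x. w (x $ 1, x $ 2)) has_derivative
          (\<lambda>h. fst (h $ 1, h $ 2) *\<^sub>R Q 1 s t (w (s, t)) + snd (h $ 1, h $ 2) *\<^sub>R Q 2 s t (w (s, t)))) (at x)"
        by (rule has_derivative_compose[where g=w and f="\<lambda>x. (x $ 1, x $ 2)", rotated])
      then have "((\<lambda>x. w (x $ 1, x $ 2)) has_derivative
          (\<lambda>h. h $ 1 *\<^sub>R Q 1 s t (w (s, t)) + h $ 2 *\<^sub>R Q 2 s t (w (s, t)))) (at x)" by simp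
      then have "((\<lambda>x. w (x $ 1, x $ 2) $ i) has_derivative
          (\<lambda>h. (h $ 1 *\<^sub>R Q 1 s t (w (s, t)) + h $ 2 *\<^sub>R Q 2 s t (w (s, t))) $ i)) (at x)"
        by (rule bounded_linear.has_derivative[OF bounded_linear_vec_nth])
      moreover have "(h $ 1 *\<^sub>R Q 1 s t (w (s, t)) + h $ 2 *\<^sub>R Q 2 s t (w (s, t))) $ i =
          (\<Sum>l\<in>UNIV. h $ l * (\<Sum>j\<in>UNIV. A l i j x * W j x))" for h :: "real^2"
        unfolding Q_def s_def t_def vec W_def by (simp add: matrix_blinfun_apply sum_2)
      ultimately show ?thesis by (simp add: W_def[abs_def])
    qed
    have pW: "pd l (W i) x = (\<Sum>j\<in>UNIV. A l i j x * W j x)" if "x \<in> S" for l i x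
    proof -
      have "pd l (W i) x = (\<Sum>m\<in>UNIV. axis l 1 $ m * (\<Sum>j\<in>UNIV. A m i j x * W j x))"
        by (rule pd_eqI[OF dW[OF that]])
      then show ?thesis using exhaust_2[of l] by (auto simp: sum_2 axis_def)
    qed
    have "W i differentiable_on S" for i
      unfolding differentiable_on_eq_differentiable_at[OF S(1)]
    proof
      show "W i differentiable (at x)" if "x \<in> S" for x by (rule differentiableI[OF dW[OF that]])
    qed
    from smooth_on_linear_system[OF S(1) smooth_on_subset[OF A S(4)] this pW]
    have "smooth_on S (W i)" for i .
    moreover have "W i p0 = c i" for i
      using w(2)[OF p0] by (simp add: W_def c'_def)
    ultimately show ?thesis using pW by blast
  qed
  show thesis by (rule that[OF S main])
qed

text \<open>Gronwall along the segment from \<open>x0\<close> to \<open>x\<close>: the squared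
  length \<open>N\<close> of the solution satisfies \<open>N' <= C * N\<close> and starts at 0, so
  \<open>N * exp (- C * t)\<close> cannot increase.\<close>

theorem linear_system_unique:
  fixes A :: "2 \<Rightarrow> 'n::finite \<Rightarrow> 'n \<Rightarrow> scalar_field"
  assumes S: "open S" "convex S" and A: "\<And>l i j. continuous_on S (A l i j)"
    and W: "\<And>i. W i differentiable_on S"
      "\<And>l i x. x \<in> S \<Longrightarrow> pd l (W i) x = (\<Sum>j\<in>UNIV. A l i j x * W j x)"
    and x0: "x0 \<in> S" "\<And>i. W i x0 = 0" and x: "x \<in> S"
  shows "W i x = 0"
proof -
  define \<gamma> where "\<gamma> t = x0 + t *\<^sub>R (x - x0)" for t :: real
  define h where "h = x - x0"
  have \<gamma>S: "\<gamma> t \<in> S" if "t \<in> {0..1}" for t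
    using convexD_alt[OF S(2) x0(1) x, of t] that by (simp add: \<gamma>_def algebra_simps)
  have c\<gamma>: "continuous_on {0..1} \<gamma>" unfolding \<gamma>_def by (intro continuous_intros)
  define B where "B i j t = (\<Sum>l\<in>UNIV. h $ l * A l i j (\<gamma> t))" for i j t
  have cB: "continuous_on {0..1} (B i j)" for i j
    unfolding B_def by (intro continuous_intros continuous_on_compose2[OF A c\<gamma>]) (use \<gamma>S in auto)
  have "\<exists>L. \<forall>t\<in>{0..1}. \<bar>B i j t\<bar> \<le> L" for i j
    using compact_imp_bounded[OF compact_continuous_image[OF cB compact_Icc]]
    by (auto simp: bounded_iff)
  then obtain LL where LL: "\<And>i j t. t \<in> {0..1} \<Longrightarrow> \<bar>B i j t\<bar> \<le> LL i j" by metis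
  define L where "L = (\<Sum>i\<in>UNIV. \<Sum>j\<in>UNIV. \<bar>LL i j\<bar>)"
  have L: "\<bar>B i j t\<bar> \<le> L" if "t \<in> {0..1}" for i j t
  proof -
    have "\<bar>B i j t\<bar> \<le> \<bar>LL i j\<bar>" using LL[OF that, of i j] by linarith
    also have "\<dots> \<le> (\<Sum>j\<in>UNIV. \<bar>LL i j\<bar>)" by (rule member_le_sum) auto
    also have "\<dots> \<le> L" unfolding L_def
      by (rule member_le_sum[of i UNIV "\<lambda>i. \<Sum>j\<in>UNIV. \<bar>LL i j\<bar>"]) (auto intro: sum_nonneg)
    finally show ?thesis .
  qed
  define y where "y i t = W i (\<gamma> t)" for i t
  have dy: "(y i has_real_derivative (\<Sum>j\<in>UNIV. B i j t * y j t)) (at t)" if t: "t \<in> {0..1}" for i t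
  proof -
    have "W i differentiable (at (\<gamma> t))"
      using W(1) \<gamma>S[OF t] S(1) by (simp add: differentiable_on_eq_differentiable_at)
    from has_derivative_pd[OF this]
    have d: "(W i has_derivative (\<lambda>v. \<Sum>l\<in>UNIV. v $ l * pd l (W i) (\<gamma> t))) (at (\<gamma> t))" .
    have "(\<gamma> has_derivative (\<lambda>s. s *\<^sub>R h)) (at t)"
      unfolding \<gamma>_def h_def by (auto intro!: derivative_eq_intros)
    from has_derivative_compose[where g="W i", OF this d]
    have "(y i has_derivative (\<lambda>s. \<Sum>l\<in>UNIV. (s *\<^sub>R h) $ l * pd l (W i) (\<gamma> t))) (at t)"
      by (simp add: y_def[abs_def])
    moreover have "(\<Sum>l\<in>UNIV. (s *\<^sub>R h) $ l * pd l (W i) (\<gamma> t)) = (\<Sum>j\<in>UNIV. B i j t * y j t) * s" for s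
    proof -
      have "(\<Sum>l\<in>UNIV. (s *\<^sub>R h) $ l * pd l (W i) (\<gamma> t)) = (\<Sum>l\<in>UNIV. \<Sum>j\<in>UNIV. s * (h $ l * A l i j (\<gamma> t) * y j t))"
        by (simp add: W(2)[OF \<gamma>S[OF t]] y_def sum_distrib_left mult.assoc)
      also have "\<dots> = (\<Sum>j\<in>UNIV. \<Sum>l\<in>UNIV. s * (h $ l * A l i j (\<gamma> t) * y j t))" by (rule sum.swap)
      also have "\<dots> = (\<Sum>j\<in>UNIV. B i j t * y j t) * s"
        by (simp add: B_def sum_distrib_left sum_distrib_right mult_ac)
      finally show ?thesis .
    qed
    ultimately show ?thesis by (simp add: has_field_derivative_def)
  qed
  define N where "N t = (\<Sum>i\<in>UNIV. (y i t)\<^sup>2)" for t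
  \<comment> \<open>From \<open>2 * |y i * y j| <= (y i)^2 + (y j)^2\<close>, summed over all pairs
    of indices.\<close>
  define C where "C = 2 * L * real CARD('n)"
  define N' where "N' t = (\<Sum>i\<in>UNIV. 2 * y i t * (\<Sum>j\<in>UNIV. B i j t * y j t))" for t
  have dN: "(N has_real_derivative N' t) (at t)" if t: "t \<in> {0..1}" for t
    unfolding N_def N'_def
    by (rule DERIV_sum) (auto intro!: derivative_eq_intros dy[OF t])
  have N': "N' t \<le> C * N t" if t: "t \<in> {0..1}" for t
  proof -
    have "N' t = (\<Sum>i\<in>UNIV. \<Sum>j\<in>UNIV. 2 * B i j t * (y i t * y j t))"
      by (simp add: N'_def sum_distrib_left mult_ac)
    also have "\<dots> \<le> (\<Sum>i\<in>(UNIV :: 'n set). \<Sum>j\<in>UNIV. L * ((y i t)\<^sup>2 + (y j t)\<^sup>2))"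
    proof (intro sum_mono)
      fix i j
      have "2 * \<bar>y i t * y j t\<bar> \<le> (y i t)\<^sup>2 + (y j t)\<^sup>2"
        using sum_squares_bound[of "\<bar>y i t\<bar>" "\<bar>y j t\<bar>"] by (simp add: abs_mult)
      then have "\<bar>B i j t\<bar> * (2 * \<bar>y i t * y j t\<bar>) \<le> L * ((y i t)\<^sup>2 + (y j t)\<^sup>2)"
        using L[OF t, of i j] by (intro mult_mono) auto
      moreover have "2 * B i j t * (y i t * y j t) \<le> \<bar>B i j t\<bar> * (2 * \<bar>y i t * y j t\<bar>)"
        using abs_ge_self[of "2 * B i j t * (y i t * y j t)"] by (simp add: abs_mult)
      ultimately show "2 * B i j t * (y i t * y j t) \<le> L * ((y i t)\<^sup>2 + (y j t)\<^sup>2)" by linarith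
    qed
    also have "\<dots> = C * N t"
      by (simp add: C_def N_def distrib_left sum.distrib flip: sum_distrib_left)
    finally show ?thesis .
  qed
  have "N 1 * exp (- C * 1) \<le> N 0 * exp (- C * 0)"
  proof (rule DERIV_nonpos_imp_nonincreasing[where f="\<lambda>t. N t * exp (- C * t)"])
    fix t :: real assume "0 \<le> t" "t \<le> 1"
    then have t: "t \<in> {0..1}" by simp
    have "((\<lambda>t. N t * exp (- C * t)) has_real_derivative (N' t - C * N t) * exp (- C * t)) (at t)"
      by (auto intro!: derivative_eq_intros dN[OF t] simp: algebra_simps)
    moreover have "(N' t - C * N t) * exp (- C * t) \<le> 0"
      using N'[OF t] by (simp add: mult_nonpos_nonneg)
    ultimately show "\<exists>y. ((\<lambda>t. N t * exp (- C * t)) has_real_derivative y) (at t) \<and> y \<le> 0" by blast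
  qed simp
  moreover have "N 0 = 0" using x0(2) by (simp add: N_def y_def \<gamma>_def)
  ultimately have "N 1 \<le> 0" by (simp add: mult_le_0_iff)
  then have "N 1 = 0" by (simp add: N_def antisym sum_nonneg)
  then have "\<forall>i. y i 1 = 0" by (simp add: N_def sum_nonneg_eq_0_iff)
  then show ?thesis by (simp add: y_def \<gamma>_def)
qed

section \<open>The Levi-Civita connection of a metric in a chart\<close>

lemma matrix_inv_eqI:
  fixes A B :: "real^'n^'n"
  assumes "A ** B = mat 1" "B ** A = mat 1"
  shows "matrix_inv A = B"
proof -
  have "A ** matrix_inv A = mat 1 \<and> matrix_inv A ** A = mat 1"
    unfolding matrix_inv_def by (rule someI[of _ B]) (use assms in simp)
  then show ?thesis using assms
    by (metis matrix_mul_assoc matrix_mul_lid matrix_mul_rid)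
qed

lemma matrix_inv_2:
  fixes A :: "real^2^2"
  assumes "det A \<noteq> 0"
  shows "matrix_inv A $ 1 $ 1 = A $ 2 $ 2 / det A" "matrix_inv A $ 1 $ 2 = - (A $ 1 $ 2) / det A"
    "matrix_inv A $ 2 $ 1 = - (A $ 2 $ 1) / det A" "matrix_inv A $ 2 $ 2 = A $ 1 $ 1 / det A"
proof -
  define B :: "real^2^2" where "B = vector [vector [A $ 2 $ 2 / det A, - (A $ 1 $ 2) / det A],
     vector [- (A $ 2 $ 1) / det A, A $ 1 $ 1 / det A]]"
  have d: "A $ 1 $ 1 * A $ 2 $ 2 = det A + A $ 1 $ 2 * A $ 2 $ 1" by (simp add: det_2)
  have "A ** B = mat 1" "B ** A = mat 1"
    using assms unfolding vec_eq_iff matrix_matrix_mult_def mat_def forall_2 B_def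
    by (simp_all add: sum_2 field_simps d)
  then have "matrix_inv A = B" by (rule matrix_inv_eqI)
  then show "matrix_inv A $ 1 $ 1 = A $ 2 $ 2 / det A" "matrix_inv A $ 1 $ 2 = - (A $ 1 $ 2) / det A"
    "matrix_inv A $ 2 $ 1 = - (A $ 2 $ 1) / det A" "matrix_inv A $ 2 $ 2 = A $ 1 $ 1 / det A"
    by (simp_all add: B_def)
qed

locale riemannian_chart =
  fixes V :: "(real^2) set" and g :: metric
  assumes open_V: "open V" and metric: "riemannian_metric_on V g"
begin

abbreviation smooth :: "scalar_field \<Rightarrow> bool" where "smooth \<equiv> smooth_on V"

definition smooth_field :: "vector_field \<Rightarrow> bool" where
  "smooth_field X \<longleftrightarrow> (\<forall>i. smooth (\<lambda>x. X x $ i))"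

lemmas smooth_intros = smooth_on_const[OF open_V] smooth_on_add[OF open_V] smooth_on_diff[OF open_V]
  smooth_on_minus[OF open_V] smooth_on_mult[OF open_V] smooth_on_power[OF open_V] smooth_on_sum[OF open_V] smooth_on_pd

lemma smooth_cong: "(\<And>x. x \<in> V \<Longrightarrow> f x = h x) \<Longrightarrow> smooth f \<longleftrightarrow> smooth h"
  by (rule smooth_on_cong[OF open_V])

lemma smooth_differentiable: "smooth f \<Longrightarrow> x \<in> V \<Longrightarrow> f differentiable (at x)"
  by (rule smooth_on_differentiable[OF _ open_V])

lemma smooth_metric: "smooth (\<lambda>x. g x $ i $ j)"
  using metric by (simp add: riemannian_metric_on_def)

lemma metric_sym: "x \<in> V \<Longrightarrow> g x $ i $ j = g x $ j $ i"
proof -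
  assume "x \<in> V"
  then have "transpose (g x) $ j $ i = g x $ j $ i" using metric by (simp add: riemannian_metric_on_def)
  then show ?thesis by (simp add: transpose_def)
qed

lemma metric_pos: "x \<in> V \<Longrightarrow> v \<noteq> 0 \<Longrightarrow> v \<bullet> (g x *v v) > 0"
  using metric by (simp add: riemannian_metric_on_def)

lemma det_metric: "x \<in> V \<Longrightarrow> det (g x) = g x $ 1 $ 1 * g x $ 2 $ 2 - g x $ 1 $ 2 * g x $ 1 $ 2"
  using metric_sym[of x 1 2] by (simp add: det_2)

lemma metric_11_pos:
  assumes x: "x \<in> V"
  shows "g x $ 1 $ 1 > 0"
proof -
  define v :: "real^2" where "v = vector [1, 0]"
  have "v \<noteq> 0" by (simp add: v_def vec_eq_iff forall_2)
  from metric_pos[OF x this] show ?thesis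
    by (simp add: v_def inner_vec_def matrix_vector_mult_def sum_2)
qed

lemma det_metric_pos:
  assumes x: "x \<in> V"
  shows "det (g x) > 0"
proof -
  define v :: "real^2" where "v = vector [- g x $ 1 $ 2, g x $ 1 $ 1]"
  have "v \<noteq> 0" using metric_11_pos[OF x] by (auto simp: v_def vec_eq_iff forall_2)
  from metric_pos[OF x this] have "g x $ 1 $ 1 * det (g x) > 0"
    by (simp add: v_def det_metric[OF x] metric_sym[OF x, of 2 1] inner_vec_def matrix_vector_mult_def sum_2 algebra_simps)
  then show ?thesis using metric_11_pos[OF x] by (simp add: zero_less_mult_iff)
qed

lemma smooth_det: "smooth (\<lambda>x. det (g x))"
  unfolding det_2 by (intro smooth_intros smooth_metric)

lemma smooth_matrix_inv: "smooth (\<lambda>x. matrix_inv (g x) $ i $ j)"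
proof -
  have *: "det (g x) \<noteq> 0" if "x \<in> V" for x using det_metric_pos[OF that] by simp
  have "smooth (\<lambda>x. f x / det (g x))" if "smooth f" for f
    by (rule smooth_on_divide[OF open_V that smooth_det *])
  note s = this[OF smooth_metric] this[OF smooth_on_minus[OF open_V smooth_metric]]
  have "smooth (\<lambda>x. matrix_inv (g x) $ 1 $ 1) \<longleftrightarrow> smooth (\<lambda>x. g x $ 2 $ 2 / det (g x))"
    "smooth (\<lambda>x. matrix_inv (g x) $ 1 $ 2) \<longleftrightarrow> smooth (\<lambda>x. - g x $ 1 $ 2 / det (g x))"
    "smooth (\<lambda>x. matrix_inv (g x) $ 2 $ 1) \<longleftrightarrow> smooth (\<lambda>x. - g x $ 2 $ 1 / det (g x))"
    "smooth (\<lambda>x. matrix_inv (g x) $ 2 $ 2) \<longleftrightarrow> smooth (\<lambda>x. g x $ 1 $ 1 / det (g x))"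
    by (intro smooth_cong matrix_inv_2 *; assumption)+
  then show ?thesis using exhaust_2[of i] exhaust_2[of j] s by auto
qed

lemma matrix_inv_metric:
  assumes x: "x \<in> V"
  shows "(\<Sum>k\<in>UNIV. g x $ m $ k * matrix_inv (g x) $ k $ l) = (if m = l then 1 else 0)"
proof -
  have d: "det (g x) \<noteq> 0" using det_metric_pos[OF x] by simp
  have "m = 1 \<or> m = 2" "l = 1 \<or> l = 2" by (auto simp: exhaust_2)
  moreover have "g x $ 1 $ 1 * g x $ 2 $ 2 = det (g x) + g x $ 1 $ 2 * g x $ 1 $ 2"
    by (simp add: det_metric[OF x])
  ultimately show ?thesis using d
    by (auto simp: sum_2 matrix_inv_2[OF d] metric_sym[OF x, of 2 1] field_simps)
qed

lemma pd_metric_sym: "x \<in> V \<Longrightarrow> pd l (\<lambda>y. g y $ i $ j) x = pd l (\<lambda>y. g y $ j $ i) x"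
  by (rule pd_cong[OF open_V]) (auto simp: metric_sym)

lemma smooth_christoffel: "smooth (christoffel g k i j)"
  unfolding christoffel_def[abs_def] by (intro smooth_intros smooth_metric smooth_matrix_inv)

lemma christoffel_sym: "x \<in> V \<Longrightarrow> christoffel g k i j x = christoffel g k j i x"
  unfolding christoffel_def
  by (intro arg_cong[where f="\<lambda>z. 1 / 2 * z"] sum.cong) (auto simp: pd_metric_sym[of x _ i j])

lemma christoffel_lowered:
  assumes x: "x \<in> V"
  shows "(\<Sum>k\<in>UNIV. g x $ m $ k * christoffel g k i j x)
    = (pd i (\<lambda>y. g y $ j $ m) x + pd j (\<lambda>y. g y $ i $ m) x - pd m (\<lambda>y. g y $ i $ j) x) / 2"
proof -
  define B where "B l = pd i (\<lambda>y. g y $ j $ l) x + pd j (\<lambda>y. g y $ i $ l) x - pd l (\<lambda>y. g y $ i $ j) x" for l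
  have "(\<Sum>k\<in>UNIV. g x $ m $ k * christoffel g k i j x)
      = (\<Sum>k\<in>UNIV. \<Sum>l\<in>UNIV. g x $ m $ k * matrix_inv (g x) $ k $ l * B l / 2)"
    by (simp add: christoffel_def B_def sum_2 field_simps)
  also have "\<dots> = (\<Sum>l\<in>UNIV. (\<Sum>k\<in>UNIV. g x $ m $ k * matrix_inv (g x) $ k $ l) * B l / 2)"
    by (subst sum.swap) (simp add: sum_distrib_right sum_divide_distrib)
  also have "\<dots> = (\<Sum>l\<in>UNIV. if m = l then B l / 2 else 0)"
    by (intro sum.cong) (simp_all add: matrix_inv_metric[OF x])
  also have "\<dots> = B m / 2" by simp
  finally show ?thesis by (simp add: B_def)
qed

text \<open>The coordinate form of \<nabla>g = 0: in the sum of the two lowered Christoffel symbols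
  the remaining derivatives of the metric cancel.\<close>

lemma pd_metric:
  assumes x: "x \<in> V"
  shows "pd l (\<lambda>y. g y $ i $ j) x
    = (\<Sum>k\<in>UNIV. g x $ j $ k * christoffel g k l i x) + (\<Sum>k\<in>UNIV. g x $ i $ k * christoffel g k l j x)"
  unfolding christoffel_lowered[OF x]
  by (simp add: pd_metric_sym[OF x, of _ j i] pd_metric_sym[OF x, of _ l] add_divide_distrib diff_divide_distrib)

lemma dir_deriv_smooth: "smooth f \<Longrightarrow> x \<in> V \<Longrightarrow> dir_deriv X f x = X x $ 1 * pd 1 f x + X x $ 2 * pd 2 f x"
  by (simp add: dir_deriv_eq_pd smooth_differentiable sum_2)

lemma smooth_dir_deriv:
  assumes "smooth_field X" "smooth f"
  shows "smooth (dir_deriv X f)"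
proof -
  have "smooth (\<lambda>x. X x $ 1 * pd 1 f x + X x $ 2 * pd 2 f x)"
    using assms by (intro smooth_intros) (auto simp: smooth_field_def)
  then show ?thesis
    by (rule smooth_cong[THEN iffD2, rotated]) (rule dir_deriv_smooth[OF assms(2)])
qed

lemma cov_deriv_component:
  "cov_deriv g X Y x $ k = dir_deriv X (\<lambda>y. Y y $ k) x +
     (\<Sum>i\<in>UNIV. \<Sum>j\<in>UNIV. christoffel g k i j x * X x $ i * Y x $ j)"
  by (simp add: cov_deriv_def)

lemma smooth_cov_deriv: "smooth_field X \<Longrightarrow> smooth_field Y \<Longrightarrow> smooth_field (cov_deriv g X Y)"
  unfolding smooth_field_def cov_deriv_component
  by (intro allI smooth_intros smooth_dir_deriv smooth_christoffel) (auto simp: smooth_field_def)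

lemma metric_inner_expand:
  "metric_inner g x v w = v $ 1 * (g x $ 1 $ 1 * w $ 1 + g x $ 1 $ 2 * w $ 2) + v $ 2 * (g x $ 2 $ 1 * w $ 1 + g x $ 2 $ 2 * w $ 2)"
  by (simp add: metric_inner_def inner_vec_def matrix_vector_mult_def sum_2)

lemma metric_inner_commute: "x \<in> V \<Longrightarrow> metric_inner g x v w = metric_inner g x w v"
  by (simp add: metric_inner_expand metric_sym[of x 2 1] algebra_simps)

lemma metric_inner_linear:
  "metric_inner g x (v + v') w = metric_inner g x v w + metric_inner g x v' w"
  "metric_inner g x (v - v') w = metric_inner g x v w - metric_inner g x v' w"
  "metric_inner g x (c *\<^sub>R v) w = c * metric_inner g x v w"
  "metric_inner g x w (v + v') = metric_inner g x w v + metric_inner g x w v'"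
  "metric_inner g x w (v - v') = metric_inner g x w v - metric_inner g x w v'"
  "metric_inner g x w (c *\<^sub>R v) = c * metric_inner g x w v"
  by (simp_all add: metric_inner_expand algebra_simps)

lemma smooth_metric_inner: "smooth_field X \<Longrightarrow> smooth_field Y \<Longrightarrow> smooth (\<lambda>x. metric_inner g x (X x) (Y x))"
  unfolding metric_inner_expand by (intro smooth_intros smooth_metric) (auto simp: smooth_field_def)

lemmas pd_simps = pd_add pd_diff pd_minus pd_mult pd_inverse smooth_differentiable smooth_intros smooth_metric
  differentiable_add differentiable_mult differentiable_diff differentiable_minus

lemma cov_deriv_metric_compat:
  assumes x: "x \<in> V" and Y: "smooth_field Y" and Z: "smooth_field Z"
  shows "dir_deriv X (\<lambda>y. metric_inner g y (Y y) (Z y)) x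
    = metric_inner g x (cov_deriv g X Y x) (Z x) + metric_inner g x (Y x) (cov_deriv g X Z x)"
proof -
  have s: "smooth (\<lambda>y. Y y $ i)" "smooth (\<lambda>y. Z y $ i)" for i using Y Z by (auto simp: smooth_field_def)
  have 1: "dir_deriv X (\<lambda>y. metric_inner g y (Y y) (Z y)) x
      = X x $ 1 * pd 1 (\<lambda>y. metric_inner g y (Y y) (Z y)) x + X x $ 2 * pd 2 (\<lambda>y. metric_inner g y (Y y) (Z y)) x"
    by (rule dir_deriv_smooth[OF smooth_metric_inner[OF Y Z] x])
  have 2: "pd l (\<lambda>y. metric_inner g y (Y y) (Z y)) x
     = (\<Sum>i\<in>UNIV. \<Sum>j\<in>UNIV. pd l (\<lambda>y. Y y $ i) x * g x $ i $ j * Z x $ j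
        + Y x $ i * pd l (\<lambda>y. g y $ i $ j) x * Z x $ j + Y x $ i * g x $ i $ j * pd l (\<lambda>y. Z y $ j) x)" for l
    unfolding metric_inner_expand using x s
    by (simp add: pd_simps sum_2 algebra_simps)
  show ?thesis
    unfolding 1
    unfolding 2
    unfolding pd_metric[OF x] metric_inner_expand cov_deriv_component dir_deriv_smooth[OF s(1) x] dir_deriv_smooth[OF s(2) x]
    by (simp add: sum_2 metric_sym[OF x, of 2 1] algebra_simps)
qed

lemma cov_deriv_torsion_free:
  "x \<in> V \<Longrightarrow> cov_deriv g X Y x - cov_deriv g Y X x = (\<chi> k. dir_deriv X (\<lambda>y. Y y $ k) x - dir_deriv Y (\<lambda>y. X y $ k) x)"
  by (simp add: vec_eq_iff cov_deriv_component sum_2 christoffel_sym[of x _ 2 1] algebra_simps)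

lemma cov_deriv_combination:
  assumes x: "x \<in> V" and s: "smooth f" "smooth h" "smooth_field Y" "smooth_field Z"
  shows "cov_deriv g X (\<lambda>y. f y *\<^sub>R Y y + h y *\<^sub>R Z y) x
    = dir_deriv X f x *\<^sub>R Y x + f x *\<^sub>R cov_deriv g X Y x + (dir_deriv X h x *\<^sub>R Z x + h x *\<^sub>R cov_deriv g X Z x)"
proof -
  have c: "smooth (\<lambda>y. Y y $ i)" "smooth (\<lambda>y. Z y $ i)" for i using s by (auto simp: smooth_field_def)
  have "dir_deriv X (\<lambda>y. (f y *\<^sub>R Y y + h y *\<^sub>R Z y) $ k) x = dir_deriv X f x * Y x $ k + f x * dir_deriv X (\<lambda>y. Y y $ k) x
      + (dir_deriv X h x * Z x $ k + h x * dir_deriv X (\<lambda>y. Z y $ k) x)" for k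
    using x s c by (simp add: dir_deriv_smooth smooth_intros pd_simps algebra_simps)
  then show ?thesis
    by (simp add: vec_eq_iff cov_deriv_component sum_2 algebra_simps)
qed

lemma dir_deriv_cong:
  assumes "x \<in> V" "\<And>y. y \<in> V \<Longrightarrow> f y = h y" "X x = X' x"
  shows "dir_deriv X f x = dir_deriv X' h x"
proof -
  have "(f has_derivative D) (at x) \<longleftrightarrow> (h has_derivative D) (at x)" for D
    by (intro iffI) (erule has_derivative_cong_open[OF open_V assms(1), rotated], simp add: assms)+
  then show ?thesis by (simp add: dir_deriv_def frechet_derivative_def assms(3))
qed

lemma cov_deriv_cong:
  assumes "x \<in> V" "\<And>y. y \<in> V \<Longrightarrow> Y y = Z y" "X x = X' x"
  shows "cov_deriv g X Y x = cov_deriv g X' Z x"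
proof -
  have "dir_deriv X (\<lambda>y. Y y $ k) x = dir_deriv X' (\<lambda>y. Z y $ k) x" for k
    by (rule dir_deriv_cong) (simp_all add: assms)
  then show ?thesis using assms by (simp add: cov_deriv_def)
qed

lemma dir_deriv_field_combination:
  "smooth f \<Longrightarrow> x \<in> V \<Longrightarrow> W x = c *\<^sub>R X x + d *\<^sub>R Y x \<Longrightarrow> dir_deriv W f x = c * dir_deriv X f x + d * dir_deriv Y f x"
  by (simp add: dir_deriv_smooth algebra_simps)

lemma cov_deriv_field_combination:
  assumes "smooth_field Z" "x \<in> V" "W x = c *\<^sub>R X x + d *\<^sub>R Y x"
  shows "cov_deriv g W Z x = c *\<^sub>R cov_deriv g X Z x + d *\<^sub>R cov_deriv g Y Z x"
proof -
  have "dir_deriv W (\<lambda>y. Z y $ k) x = c * dir_deriv X (\<lambda>y. Z y $ k) x + d * dir_deriv Y (\<lambda>y. Z y $ k) x" for k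
    using assms by (intro dir_deriv_field_combination) (auto simp: smooth_field_def)
  then show ?thesis using assms(3)
    by (simp add: vec_eq_iff[of "cov_deriv g W Z x"] cov_deriv_component sum_2 algebra_simps)
qed

end

section \<open>Moving frames: connection form, structure equations, curvature\<close>

locale orthonormal_frame = riemannian_chart +
  fixes e1 :: vector_field
  assumes smooth_e1: "smooth_field e1" and unit_e1: "\<And>x. x \<in> V \<Longrightarrow> metric_inner g x (e1 x) (e1 x) = 1"
begin

definition e2 :: vector_field where "e2 x = rot90 g x (e1 x)"

definition D1 :: "scalar_field \<Rightarrow> scalar_field" where "D1 = dir_deriv e1"
definition D2 :: "scalar_field \<Rightarrow> scalar_field" where "D2 = dir_deriv e2"

text \<open>\<open>a\<close> and \<open>b\<close> are the coefficients of the connection form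
  \<open>\<omega>\<close> in the dual coframe \<open>\<theta>1\<close>, \<open>\<theta>2\<close>; by
  \<open>cov_deriv_frame\<close> they carry the whole Levi-Civita connection.\<close>

definition a :: scalar_field where "a x = metric_inner g x (cov_deriv g e1 e1 x) (e2 x)"
definition b :: scalar_field where "b x = metric_inner g x (cov_deriv g e2 e1 x) (e2 x)"

definition \<theta>1 :: "2 \<Rightarrow> scalar_field" where "\<theta>1 i x = (g x *v e1 x) $ i"
definition \<theta>2 :: "2 \<Rightarrow> scalar_field" where "\<theta>2 i x = (g x *v e2 x) $ i"

lemma e2_component:
  "e2 x $ 1 = - \<theta>1 2 x / sqrt (det (g x))" "e2 x $ 2 = \<theta>1 1 x / sqrt (det (g x))"
  by (simp_all add: e2_def rot90_def \<theta>1_def)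

lemma smooth_theta1: "smooth (\<theta>1 i)"
  using smooth_e1 unfolding \<theta>1_def[abs_def] matrix_vector_mult_def vec_lambda_beta
  by (intro smooth_intros smooth_metric) (auto simp: smooth_field_def)

lemma smooth_e2: "smooth_field e2"
proof -
  have "smooth (\<lambda>x. f x / sqrt (det (g x)))" if "smooth f" for f
    by (intro smooth_on_divide smooth_on_sqrt open_V that smooth_det) (auto simp: det_metric_pos dest: det_metric_pos)
  from this[OF smooth_on_minus[OF open_V smooth_theta1]] this[OF smooth_theta1]
  have "smooth (\<lambda>x. e2 x $ 1)" "smooth (\<lambda>x. e2 x $ 2)" by (simp_all add: e2_component)
  then have "smooth (\<lambda>x. e2 x $ i)" for i using exhaust_2[of i] by auto
  then show ?thesis by (simp add: smooth_field_def)
qed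

lemma smooth_theta2: "smooth (\<theta>2 i)"
  using smooth_e2 unfolding \<theta>2_def[abs_def] matrix_vector_mult_def vec_lambda_beta
  by (intro smooth_intros smooth_metric) (auto simp: smooth_field_def)

lemma smooth_ab [simp]: "smooth a" "smooth b"
  unfolding a_def[abs_def] b_def[abs_def] by (intro smooth_metric_inner smooth_cov_deriv smooth_e1 smooth_e2)+

lemma theta_inner:
  assumes x: "x \<in> V"
  shows "metric_inner g x v (e1 x) = v $ 1 * \<theta>1 1 x + v $ 2 * \<theta>1 2 x"
    "metric_inner g x v (e2 x) = v $ 1 * \<theta>2 1 x + v $ 2 * \<theta>2 2 x"
  by (simp_all add: metric_inner_def inner_vec_def sum_2 \<theta>1_def \<theta>2_def)

text \<open>\<open>\<theta>2\<close> is the area form contracted with \<open>e1\<close>.\<close>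

lemma theta2_component:
  assumes x: "x \<in> V"
  shows "\<theta>2 1 x = - sqrt (det (g x)) * e1 x $ 2" "\<theta>2 2 x = sqrt (det (g x)) * e1 x $ 1"
proof -
  define s where "s = sqrt (det (g x))"
  have s: "s > 0" "s * s = det (g x)" using det_metric_pos[OF x] by (simp_all add: s_def)
  have e: "e2 x $ 1 = - \<theta>1 2 x / s" "e2 x $ 2 = \<theta>1 1 x / s" by (simp_all add: e2_component s_def)
  have d: "s * s = g x $ 1 $ 1 * g x $ 2 $ 2 - g x $ 1 $ 2 * g x $ 1 $ 2" using s(2) det_metric[OF x] by simp
  have t: "\<theta>1 1 x = g x $ 1 $ 1 * e1 x $ 1 + g x $ 1 $ 2 * e1 x $ 2" "\<theta>1 2 x = g x $ 1 $ 2 * e1 x $ 1 + g x $ 2 $ 2 * e1 x $ 2"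
    by (simp_all add: \<theta>1_def matrix_vector_mult_def sum_2 metric_sym[OF x, of 2 1])
  have "\<theta>2 1 x = (- g x $ 1 $ 1 * \<theta>1 2 x + g x $ 1 $ 2 * \<theta>1 1 x) / s"
    using s by (simp add: \<theta>2_def matrix_vector_mult_def sum_2 e field_simps)
  also have "- g x $ 1 $ 1 * \<theta>1 2 x + g x $ 1 $ 2 * \<theta>1 1 x = - (s * s) * e1 x $ 2" unfolding t d by (simp add: algebra_simps)
  finally show "\<theta>2 1 x = - sqrt (det (g x)) * e1 x $ 2" using s(1) by (simp add: s_def[symmetric])
  have "\<theta>2 2 x = (- g x $ 1 $ 2 * \<theta>1 2 x + g x $ 2 $ 2 * \<theta>1 1 x) / s"
    using s by (simp add: \<theta>2_def matrix_vector_mult_def sum_2 e metric_sym[OF x, of 2 1] field_simps)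
  also have "- g x $ 1 $ 2 * \<theta>1 2 x + g x $ 2 $ 2 * \<theta>1 1 x = (s * s) * e1 x $ 1" unfolding t d by (simp add: algebra_simps)
  finally show "\<theta>2 2 x = sqrt (det (g x)) * e1 x $ 1" using s(1) by (simp add: s_def[symmetric])
qed

lemma coframe:
  assumes x: "x \<in> V"
  shows "e1 x $ 1 * \<theta>1 1 x + e1 x $ 2 * \<theta>1 2 x = 1" "e2 x $ 1 * \<theta>1 1 x + e2 x $ 2 * \<theta>1 2 x = 0" (is "?A = 0")
    "e1 x $ 1 * \<theta>2 1 x + e1 x $ 2 * \<theta>2 2 x = 0" (is "?B = 0") "e2 x $ 1 * \<theta>2 1 x + e2 x $ 2 * \<theta>2 2 x = 1"
proof -
  have s: "sqrt (det (g x)) > 0" using det_metric_pos[OF x] by simp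
  show 1: "e1 x $ 1 * \<theta>1 1 x + e1 x $ 2 * \<theta>1 2 x = 1" using unit_e1[OF x] theta_inner(1)[OF x] by simp
  show "?A = 0" using s by (simp add: e2_component field_simps)
  show "?B = 0" by (simp add: theta2_component[OF x])
  show "e2 x $ 1 * \<theta>2 1 x + e2 x $ 2 * \<theta>2 2 x = 1" using 1 s by (simp add: theta2_component[OF x] e2_component algebra_simps)
qed

lemma coframe':
  assumes x: "x \<in> V"
  shows "\<theta>1 1 x * e1 x $ 1 + \<theta>2 1 x * e2 x $ 1 = 1" "\<theta>1 1 x * e1 x $ 2 + \<theta>2 1 x * e2 x $ 2 = 0"
    "\<theta>1 2 x * e1 x $ 1 + \<theta>2 2 x * e2 x $ 1 = 0" "\<theta>1 2 x * e1 x $ 2 + \<theta>2 2 x * e2 x $ 2 = 1"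
  using coframe(1)[OF x] det_metric_pos[OF x]
  by (simp_all add: theta2_component[OF x] e2_component algebra_simps)

lemma frame_expand:
  assumes x: "x \<in> V"
  shows "v = metric_inner g x v (e1 x) *\<^sub>R e1 x + metric_inner g x v (e2 x) *\<^sub>R e2 x"
proof -
  have "v $ 1 * (\<theta>1 1 x * e1 x $ i + \<theta>2 1 x * e2 x $ i) + v $ 2 * (\<theta>1 2 x * e1 x $ i + \<theta>2 2 x * e2 x $ i)
      = (metric_inner g x v (e1 x) *\<^sub>R e1 x + metric_inner g x v (e2 x) *\<^sub>R e2 x) $ i" for i
    unfolding theta_inner[OF x] by (simp add: algebra_simps)
  then show ?thesis using coframe'[OF x] unfolding vec_eq_iff forall_2 by (metis add.commute add_0 mult.right_neutral mult_zero_right)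
qed

lemma orthonormal:
  assumes x: "x \<in> V"
  shows "metric_inner g x (e1 x) (e1 x) = 1" "metric_inner g x (e1 x) (e2 x) = 0"
    "metric_inner g x (e2 x) (e1 x) = 0" "metric_inner g x (e2 x) (e2 x) = 1"
  using coframe[OF x] by (simp_all add: theta_inner[OF x])


definition \<omega> :: "vector_field \<Rightarrow> scalar_field" where
  "\<omega> X x = metric_inner g x (cov_deriv g X e1 x) (e2 x)"

lemma metric_inner_minus: "metric_inner g x (- v) w = - metric_inner g x v w"
  by (simp add: metric_inner_expand)

lemma dir_deriv_const_on: "x \<in> V \<Longrightarrow> (\<And>y. y \<in> V \<Longrightarrow> f y = c) \<Longrightarrow> dir_deriv X f x = 0"
  using dir_deriv_cong[of x f "\<lambda>y. c" X X] dir_deriv_smooth[OF smooth_on_const[OF open_V]] by simp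

text \<open>Differentiating the constant inner products of the frame fields leaves a single free
  component, the rotation speed \<open>\<omega> X\<close>.\<close>

lemma cov_deriv_frame:
  assumes x: "x \<in> V"
  shows "cov_deriv g X e1 x = \<omega> X x *\<^sub>R e2 x" "cov_deriv g X e2 x = - \<omega> X x *\<^sub>R e1 x"
proof -
  have 11: "metric_inner g x (cov_deriv g X e1 x) (e1 x) = 0"
    using cov_deriv_metric_compat[OF x smooth_e1 smooth_e1, of X] dir_deriv_const_on[OF x, of "\<lambda>y. metric_inner g y (e1 y) (e1 y)" 1 X] orthonormal(1)
    by (simp add: metric_inner_commute[OF x, of "e1 x"])
  have 22: "metric_inner g x (cov_deriv g X e2 x) (e2 x) = 0"
    using cov_deriv_metric_compat[OF x smooth_e2 smooth_e2, of X] dir_deriv_const_on[OF x, of "\<lambda>y. metric_inner g y (e2 y) (e2 y)" 1 X] orthonormal(4)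
    by (simp add: metric_inner_commute[OF x, of "e2 x"])
  have 12: "metric_inner g x (cov_deriv g X e2 x) (e1 x) = - \<omega> X x"
    using cov_deriv_metric_compat[OF x smooth_e1 smooth_e2, of X] dir_deriv_const_on[OF x, of "\<lambda>y. metric_inner g y (e1 y) (e2 y)" 0 X] orthonormal(2)
    by (simp add: metric_inner_commute[OF x, of "e1 x"] \<omega>_def)
  show "cov_deriv g X e1 x = \<omega> X x *\<^sub>R e2 x"
    using frame_expand[OF x, of "cov_deriv g X e1 x"] 11 by (simp add: \<omega>_def)
  show "cov_deriv g X e2 x = - \<omega> X x *\<^sub>R e1 x"
    using frame_expand[OF x, of "cov_deriv g X e2 x"] 12 22 by simp
qed

lemma omega_frame [simp]: "\<omega> e1 x = a x" "\<omega> e2 x = b x"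
  by (simp_all add: \<omega>_def a_def b_def)

lemma smooth_omega: "smooth_field X \<Longrightarrow> smooth (\<omega> X)"
  unfolding \<omega>_def[abs_def] by (intro smooth_metric_inner smooth_cov_deriv smooth_e1 smooth_e2)

text \<open>Torsion-freeness turns the bracket of \<open>e1\<close> and \<open>e2\<close> into a
  difference of covariant derivatives, which are known from \<open>\<omega>\<close>.\<close>

lemma bracket_frame:
  assumes x: "x \<in> V"
  shows "D1 (\<lambda>y. e2 y $ k) x - D2 (\<lambda>y. e1 y $ k) x = - a x * e1 x $ k - b x * e2 x $ k"
proof -
  have "(cov_deriv g e1 e2 x - cov_deriv g e2 e1 x) $ k = D1 (\<lambda>y. e2 y $ k) x - D2 (\<lambda>y. e1 y $ k) x"
    unfolding cov_deriv_torsion_free[OF x] by (simp add: D1_def D2_def)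
  then show ?thesis by (simp add: cov_deriv_frame[OF x])
qed

lemma smooth_D [intro]: "smooth f \<Longrightarrow> smooth (D1 f)" "smooth f \<Longrightarrow> smooth (D2 f)"
  unfolding D1_def D2_def by (auto intro: smooth_dir_deriv smooth_e1 smooth_e2)

lemma D_coordinate:
  "smooth f \<Longrightarrow> x \<in> V \<Longrightarrow> D1 f x = e1 x $ 1 * pd 1 f x + e1 x $ 2 * pd 2 f x"
  "smooth f \<Longrightarrow> x \<in> V \<Longrightarrow> D2 f x = e2 x $ 1 * pd 1 f x + e2 x $ 2 * pd 2 f x"
  by (simp_all add: D1_def D2_def dir_deriv_smooth)

lemma pd_frame:
  assumes f: "smooth f" and x: "x \<in> V"
  shows "pd 1 f x = \<theta>1 1 x * D1 f x + \<theta>2 1 x * D2 f x" "pd 2 f x = \<theta>1 2 x * D1 f x + \<theta>2 2 x * D2 f x"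
proof -
  have "\<theta>1 i x * D1 f x + \<theta>2 i x * D2 f x = (\<theta>1 i x * e1 x $ 1 + \<theta>2 i x * e2 x $ 1) * pd 1 f x
     + (\<theta>1 i x * e1 x $ 2 + \<theta>2 i x * e2 x $ 2) * pd 2 f x" for i
    by (simp add: D_coordinate[OF f x] algebra_simps)
  then show "pd 1 f x = \<theta>1 1 x * D1 f x + \<theta>2 1 x * D2 f x" "pd 2 f x = \<theta>1 2 x * D1 f x + \<theta>2 2 x * D2 f x"
    by (simp_all add: coframe'[OF x])
qed

lemma D_cong:
  assumes "x \<in> V" "\<And>y. y \<in> V \<Longrightarrow> f y = h y"
  shows "D1 f x = D1 h x" "D2 f x = D2 h x"
  unfolding D1_def D2_def by (rule dir_deriv_cong[OF assms(1)]; simp add: assms(2))+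

lemma D_const [simp]: "x \<in> V \<Longrightarrow> D1 (\<lambda>x. c) x = 0" "x \<in> V \<Longrightarrow> D2 (\<lambda>x. c) x = 0"
  by (simp_all add: D_coordinate smooth_intros)

lemma D_add:
  assumes "smooth f" "smooth h" "x \<in> V"
  shows "D1 (\<lambda>x. f x + h x) x = D1 f x + D1 h x" "D2 (\<lambda>x. f x + h x) x = D2 f x + D2 h x"
  using assms by (simp_all add: D_coordinate smooth_intros pd_add smooth_differentiable algebra_simps)

lemma D_diff:
  assumes "smooth f" "smooth h" "x \<in> V"
  shows "D1 (\<lambda>x. f x - h x) x = D1 f x - D1 h x" "D2 (\<lambda>x. f x - h x) x = D2 f x - D2 h x"
  using assms by (simp_all add: D_coordinate smooth_intros pd_diff smooth_differentiable algebra_simps)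

lemma D_minus:
  assumes "smooth f" "x \<in> V"
  shows "D1 (\<lambda>x. - f x) x = - D1 f x" "D2 (\<lambda>x. - f x) x = - D2 f x"
  using assms by (simp_all add: D_coordinate smooth_intros pd_minus smooth_differentiable algebra_simps)

lemma D_mult:
  assumes "smooth f" "smooth h" "x \<in> V"
  shows "D1 (\<lambda>x. f x * h x) x = f x * D1 h x + D1 f x * h x" "D2 (\<lambda>x. f x * h x) x = f x * D2 h x + D2 f x * h x"
  using assms by (simp_all add: D_coordinate smooth_intros pd_mult smooth_differentiable algebra_simps)

lemma D_power:
  assumes "smooth f" "x \<in> V"
  shows "D1 (\<lambda>x. f x ^ n) x = real n * f x ^ (n - 1) * D1 f x" "D2 (\<lambda>x. f x ^ n) x = real n * f x ^ (n - 1) * D2 f x"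
proof -
  have "D1 (\<lambda>x. f x ^ n) x = real n * f x ^ (n - 1) * D1 f x \<and> D2 (\<lambda>x. f x ^ n) x = real n * f x ^ (n - 1) * D2 f x"
  proof (induction n)
    case 0
    then show ?case using assms by simp
  next
    case (Suc n)
    show ?case
    proof (cases n)
      case 0
      then show ?thesis by simp
    next
      case m: (Suc m)
      show ?thesis
        using m Suc.IH D_mult[OF assms(1) smooth_on_power[OF open_V assms(1)] assms(2), of n]
        by (simp add: algebra_simps)
    qed
  qed
  then show "D1 (\<lambda>x. f x ^ n) x = real n * f x ^ (n - 1) * D1 f x" "D2 (\<lambda>x. f x ^ n) x = real n * f x ^ (n - 1) * D2 f x"
    by auto
qed

lemmas D_rules = D_add D_diff D_minus D_mult D_power

text \<open>The second partial derivatives cancel by \<open>pd_commute\<close> and the bracket of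
  the frame fields remains. Every integrability condition of the proof is an instance of this
  identity.\<close>

lemma D_commutator:
  assumes f: "smooth f" and x: "x \<in> V"
  shows "D1 (D2 f) x - D2 (D1 f) x = - a x * D1 f x - b x * D2 f x"
proof -
  have s: "smooth (\<lambda>y. e1 y $ i)" "smooth (\<lambda>y. e2 y $ i)" for i
    using smooth_e1 smooth_e2 by (auto simp: smooth_field_def)
  have 1: "D1 (D2 f) x = D1 (\<lambda>y. e2 y $ 1 * pd 1 f y + e2 y $ 2 * pd 2 f y) x"
    by (rule D_cong[OF x]) (rule D_coordinate[OF f])
  have 2: "D2 (D1 f) x = D2 (\<lambda>y. e1 y $ 1 * pd 1 f y + e1 y $ 2 * pd 2 f y) x"
    by (rule D_cong[OF x]) (rule D_coordinate[OF f])
  have c: "pd 1 (pd 2 f) x = pd 2 (pd 1 f) x" by (rule pd_commute[OF open_V f x])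
  have "D1 (D2 f) x - D2 (D1 f) x =
     (D1 (\<lambda>y. e2 y $ 1) x - D2 (\<lambda>y. e1 y $ 1) x) * pd 1 f x
     + (D1 (\<lambda>y. e2 y $ 2) x - D2 (\<lambda>y. e1 y $ 2) x) * pd 2 f x"
    unfolding 1 2
    by (simp add: D_rules smooth_intros s f x D_coordinate[OF smooth_on_pd[OF f] x] c algebra_simps)
  also have "\<dots> = - a x * D1 f x - b x * D2 f x"
    unfolding bracket_frame[OF x] D_coordinate[OF f x] by (simp add: algebra_simps)
  finally show ?thesis .
qed

lemma smooth_coord_field: "smooth_field (coord_field i)"
  unfolding smooth_field_def coord_field_def by (intro allI smooth_intros)

lemma dir_deriv_coord: "dir_deriv (coord_field i) f x = pd i f x"
  by (simp add: dir_deriv_def pd_def coord_field_def)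

lemma coord_inner:
  assumes x: "x \<in> V"
  shows "metric_inner g x (coord_field i x) (e1 x) = \<theta>1 i x" "metric_inner g x (coord_field i x) (e2 x) = \<theta>2 i x"
    "metric_inner g x (e1 x) (coord_field i x) = \<theta>1 i x" "metric_inner g x (e2 x) (coord_field i x) = \<theta>2 i x"
proof -
  show 1: "metric_inner g x (coord_field i x) (e1 x) = \<theta>1 i x" "metric_inner g x (coord_field i x) (e2 x) = \<theta>2 i x"
    using exhaust_2[of i] unfolding theta_inner[OF x] by (auto simp: coord_field_def axis_def)
  show "metric_inner g x (e1 x) (coord_field i x) = \<theta>1 i x" "metric_inner g x (e2 x) (coord_field i x) = \<theta>2 i x"
    using 1 metric_inner_commute[OF x] by metis+
qed

lemma omega_coord:
  assumes x: "x \<in> V"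
  shows "\<omega> (coord_field i) x = \<theta>1 i x * a x + \<theta>2 i x * b x"
proof -
  have "coord_field i x = \<theta>1 i x *\<^sub>R e1 x + \<theta>2 i x *\<^sub>R e2 x"
    using frame_expand[OF x, of "coord_field i x"] by (simp add: coord_inner[OF x])
  from cov_deriv_field_combination[where W="coord_field i" and X=e1 and Y=e2, OF smooth_e1 x this]
  show ?thesis unfolding \<omega>_def[of "coord_field i"]
    by (simp only:) (simp add: cov_deriv_frame[OF x] metric_inner_linear orthonormal[OF x])
qed

text \<open>Cartan's first structure equations evaluated on the coordinate fields; the common factor
  on the right is the area form on these fields. Metric compatibility expands both derivatives, and
  the terms with \<nabla> of a coordinate field cancel by symmetry of the connection.\<close>

lemma structure_equations:
  assumes x: "x \<in> V"
  shows "pd 1 (\<theta>1 2) x - pd 2 (\<theta>1 1) x = a x * (\<theta>1 1 x * \<theta>2 2 x - \<theta>1 2 x * \<theta>2 1 x)"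
    "pd 1 (\<theta>2 2) x - pd 2 (\<theta>2 1) x = b x * (\<theta>1 1 x * \<theta>2 2 x - \<theta>1 2 x * \<theta>2 1 x)"
proof -
  note t = coord_inner(3,4)
  have tf: "cov_deriv g (coord_field 1) (coord_field 2) x = cov_deriv g (coord_field 2) (coord_field 1) x"
  proof -
    have "cov_deriv g (coord_field 1) (coord_field 2) x - cov_deriv g (coord_field 2) (coord_field 1) x = 0"
      unfolding cov_deriv_torsion_free[OF x] dir_deriv_coord
      unfolding coord_field_def pd_const by (simp add: vec_eq_iff)
    then show ?thesis by simp
  qed
  have p: "pd i f x = metric_inner g x (cov_deriv g (coord_field i) E x) (coord_field j x)
      + metric_inner g x (E x) (cov_deriv g (coord_field i) (coord_field j) x)"
    if "smooth_field E" "\<And>y. y \<in> V \<Longrightarrow> metric_inner g y (E y) (coord_field j y) = f y" for E f i j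
  proof -
    have "pd i f x = dir_deriv (coord_field i) (\<lambda>y. metric_inner g y (E y) (coord_field j y)) x"
      unfolding dir_deriv_coord by (rule pd_cong[OF open_V x]) (simp add: that)
    then show ?thesis using cov_deriv_metric_compat[OF x that(1) smooth_coord_field] by simp
  qed
  have p1: "pd i (\<theta>1 j) x = metric_inner g x (cov_deriv g (coord_field i) e1 x) (coord_field j x)
      + metric_inner g x (e1 x) (cov_deriv g (coord_field i) (coord_field j) x)" for i j
    by (rule p[OF smooth_e1 t(1)])
  have p2: "pd i (\<theta>2 j) x = metric_inner g x (cov_deriv g (coord_field i) e2 x) (coord_field j x)
      + metric_inner g x (e2 x) (cov_deriv g (coord_field i) (coord_field j) x)" for i j
    by (rule p[OF smooth_e2 t(2)])
  show "pd 1 (\<theta>1 2) x - pd 2 (\<theta>1 1) x = a x * (\<theta>1 1 x * \<theta>2 2 x - \<theta>1 2 x * \<theta>2 1 x)"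
    unfolding p1 tf
    by (simp add: cov_deriv_frame[OF x] metric_inner_linear metric_inner_minus t[OF x] omega_coord[OF x] algebra_simps)
  show "pd 1 (\<theta>2 2) x - pd 2 (\<theta>2 1) x = b x * (\<theta>1 1 x * \<theta>2 2 x - \<theta>1 2 x * \<theta>2 1 x)"
    unfolding p2 tf
    by (simp add: cov_deriv_frame[OF x] metric_inner_linear metric_inner_minus t[OF x] omega_coord[OF x] algebra_simps)
qed

lemma coframe_det:
  assumes x: "x \<in> V"
  shows "\<theta>1 1 x * \<theta>2 2 x - \<theta>1 2 x * \<theta>2 1 x = sqrt (det (g x))"
proof -
  have "\<theta>1 1 x * \<theta>2 2 x - \<theta>1 2 x * \<theta>2 1 x = sqrt (det (g x)) * (e1 x $ 1 * \<theta>1 1 x + e1 x $ 2 * \<theta>1 2 x)"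
    by (simp add: theta2_component[OF x] algebra_simps)
  then show ?thesis by (simp add: coframe(1)[OF x])
qed

text \<open>Cartan's second structure equation, d\<omega> = - K \<theta>1 \<and> \<theta>2. Expanded
  in the frame, the curvature operator acts as an infinitesimal rotation by d\<omega>; then
  d\<omega> is computed from \<omega> = a \<theta>1 + b \<theta>2 and the first structure
  equations.\<close>

lemma gauss_curvature_frame:
  assumes x: "x \<in> V"
  shows "gauss_curvature g x = D2 a x - D1 b x - a x * a x - b x * b x"
proof -
  let ?c = coord_field
  define w where "w i = \<omega> (?c i)" for i
  have sw: "smooth (w i)" for i unfolding w_def by (intro smooth_omega smooth_coord_field)
  note st = smooth_theta1 smooth_theta2
  have lin: "cov_deriv g (?c i) (\<lambda>y. f y *\<^sub>R e1 y + h y *\<^sub>R e2 y) y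
      = (pd i f y - w i y * h y) *\<^sub>R e1 y + (pd i h y + w i y * f y) *\<^sub>R e2 y"
    if "smooth f" "smooth h" "y \<in> V" for f h i y
    unfolding cov_deriv_combination[OF that(3,1,2) smooth_e1 smooth_e2] dir_deriv_coord cov_deriv_frame[OF that(3)] w_def
    by (simp add: algebra_simps)
  have c2: "?c 2 y = \<theta>1 2 y *\<^sub>R e1 y + \<theta>2 2 y *\<^sub>R e2 y" if "y \<in> V" for y
    using frame_expand[OF that, of "?c 2 y"] by (simp add: coord_inner[OF that])
  define F where "F i y = pd i (\<theta>1 2) y - w i y * \<theta>2 2 y" for i y
  define H where "H i y = pd i (\<theta>2 2) y + w i y * \<theta>1 2 y" for i y
  have sF: "smooth (F i)" "smooth (H i)" for i
    unfolding F_def H_def by (intro smooth_intros st sw)+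
  have 1: "cov_deriv g (?c i) (?c 2) y = F i y *\<^sub>R e1 y + H i y *\<^sub>R e2 y" if "y \<in> V" for i y
  proof -
    have "cov_deriv g (?c i) (?c 2) y = cov_deriv g (?c i) (\<lambda>y. \<theta>1 2 y *\<^sub>R e1 y + \<theta>2 2 y *\<^sub>R e2 y) y"
      by (rule cov_deriv_cong[OF that c2 refl])
    then show ?thesis by (simp add: lin[OF st that] F_def H_def)
  qed
  have 2: "cov_deriv g (?c j) (cov_deriv g (?c i) (?c 2)) x
      = (pd j (F i) x - w j x * H i x) *\<^sub>R e1 x + (pd j (H i) x + w j x * F i x) *\<^sub>R e2 x" for i j
  proof -
    have "cov_deriv g (?c j) (cov_deriv g (?c i) (?c 2)) x = cov_deriv g (?c j) (\<lambda>y. F i y *\<^sub>R e1 y + H i y *\<^sub>R e2 y) x"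
      by (rule cov_deriv_cong[OF x 1 refl])
    then show ?thesis by (simp add: lin[OF sF x])
  qed
  have pF: "pd j (F i) x = pd j (pd i (\<theta>1 2)) x - (w i x * pd j (\<theta>2 2) x + pd j (w i) x * \<theta>2 2 x)" for i j
    unfolding F_def by (simp add: pd_diff pd_mult smooth_differentiable[OF _ x] smooth_intros st sw)
  have pH: "pd j (H i) x = pd j (pd i (\<theta>2 2)) x + (w i x * pd j (\<theta>1 2) x + pd j (w i) x * \<theta>1 2 x)" for i j
    unfolding H_def by (simp add: pd_add pd_mult smooth_differentiable[OF _ x] smooth_intros st sw)
  \<comment> \<open>The value of d\<omega> on the two coordinate fields.\<close>
  define \<Omega> where "\<Omega> = pd 1 (w 2) x - pd 2 (w 1) x"
  have cm: "pd 1 (pd 2 (\<theta>1 2)) x = pd 2 (pd 1 (\<theta>1 2)) x" "pd 1 (pd 2 (\<theta>2 2)) x = pd 2 (pd 1 (\<theta>2 2)) x"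
    by (intro pd_commute[OF open_V _ x] st)+
  have d: "cov_deriv g (?c 1) (cov_deriv g (?c 2) (?c 2)) x - cov_deriv g (?c 2) (cov_deriv g (?c 1) (?c 2)) x
      = (- \<Omega> * \<theta>2 2 x) *\<^sub>R e1 x + (\<Omega> * \<theta>1 2 x) *\<^sub>R e2 x"
    unfolding 2 pF pH cm by (simp add: F_def H_def \<Omega>_def algebra_simps)
  have K: "gauss_curvature g x * det (g x) = - \<Omega> * sqrt (det (g x))"
    using det_metric_pos[OF x]
    unfolding gauss_curvature_def Let_def
    unfolding d
    unfolding coframe_det[OF x, symmetric] metric_inner_linear coord_inner[OF x]
    by (simp add: field_simps)
  have pw: "pd j (w i) x = pd j (\<lambda>y. \<theta>1 i y * a y + \<theta>2 i y * b y) x" for i j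
    unfolding w_def by (rule pd_cong[OF open_V x omega_coord])
  have pw': "pd j (w i) x = (\<theta>1 i x * pd j a x + pd j (\<theta>1 i) x * a x) + (\<theta>2 i x * pd j b x + pd j (\<theta>2 i) x * b x)" for i j
    unfolding pw by (simp add: pd_add pd_mult smooth_differentiable[OF _ x] smooth_intros st)
  have "\<Omega> = (\<theta>1 1 x * \<theta>2 2 x - \<theta>1 2 x * \<theta>2 1 x) * (D1 b x - D2 a x)
      + a x * (pd 1 (\<theta>1 2) x - pd 2 (\<theta>1 1) x) + b x * (pd 1 (\<theta>2 2) x - pd 2 (\<theta>2 1) x)"
    unfolding \<Omega>_def pw' pd_frame[OF smooth_ab(1) x] pd_frame[OF smooth_ab(2) x] by (simp add: algebra_simps)
  also have "\<dots> = sqrt (det (g x)) * (D1 b x - D2 a x + a x * a x + b x * b x)"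
    unfolding structure_equations[OF x] coframe_det[OF x] by (simp add: algebra_simps)
  finally have \<Omega>: "\<Omega> = sqrt (det (g x)) * (D1 b x - D2 a x + a x * a x + b x * b x)" .
  have "gauss_curvature g x * det (g x)
      = (sqrt (det (g x)) * sqrt (det (g x))) * (D2 a x - D1 b x - a x * a x - b x * b x)"
    using K \<Omega> by algebra
  then have "gauss_curvature g x * det (g x) = det (g x) * (D2 a x - D1 b x - a x * a x - b x * b x)"
    using det_metric_pos[OF x] by (simp only: real_sqrt_mult_self abs_of_pos)
  then show ?thesis using det_metric_pos[OF x] by simp
qed

end

section \<open>Frobenius in a moving frame and tensoriality of iterated covariant
  differentials\<close>

context orthonormal_frame
begin

lemma orthonormal_frame_subset: "open S \<Longrightarrow> S \<subseteq> V \<Longrightarrow> orthonormal_frame S g e1"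
proof
  assume S: "open S" "S \<subseteq> V"
  show "open S" by fact
  show "riemannian_metric_on S g"
    using metric S(2) smooth_on_subset[OF _ S(2)] by (auto simp: riemannian_metric_on_def)
  have "smooth_on S (\<lambda>x. e1 x $ i)" for i
    using smooth_e1 smooth_on_subset[OF _ S(2)] by (auto simp: smooth_field_def)
  then show "riemannian_chart.smooth_field S e1"
    using riemannian_chart.smooth_field_def[OF riemannian_chart.intro[OF S(1) \<open>riemannian_metric_on S g\<close>]] by blast
  show "metric_inner g x (e1 x) (e1 x) = 1" if "x \<in> S" for x using unit_e1 that S(2) by blast
qed

text \<open>Converts to coordinates with the matrices
  \<open>\<theta>1 l * M1 + \<theta>2 l * M2\<close>. By the structure equations their curvature is
  the expression assumed to vanish, times the area form; the terms with \<open>a\<close> and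
  \<open>b\<close> come from the bracket of the frame.\<close>

theorem frame_frobenius:
  fixes M1 M2 :: "'n::finite \<Rightarrow> 'n \<Rightarrow> scalar_field"
  assumes p0: "p0 \<in> V" and M: "\<And>i j. smooth (M1 i j)" "\<And>i j. smooth (M2 i j)"
    and flat: "\<And>x i j. x \<in> V \<Longrightarrow> D1 (M2 i j) x - D2 (M1 i j) x
      + (\<Sum>k\<in>UNIV. M2 i k x * M1 k j x - M1 i k x * M2 k j x) + a x * M1 i j x + b x * M2 i j x = 0"
  obtains S where "open S" "convex S" "p0 \<in> S" "S \<subseteq> V"
    "\<And>c. \<exists>W. (\<forall>i. smooth_on S (W i)) \<and> (\<forall>i. W i p0 = c i) \<and>
       (\<forall>i. \<forall>x\<in>S. D1 (W i) x = (\<Sum>j\<in>UNIV. M1 i j x * W j x) \<and> D2 (W i) x = (\<Sum>j\<in>UNIV. M2 i j x * W j x))"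
proof -
  define A where "A l i j x = \<theta>1 l x * M1 i j x + \<theta>2 l x * M2 i j x" for l i j x
  note st = smooth_theta1 smooth_theta2
  have sA: "smooth (A l i j)" for l i j
    unfolding A_def by (intro smooth_intros st M)
  have flatA: "pd 1 (A 2 i j) x - pd 2 (A 1 i j) x + (\<Sum>k\<in>UNIV. A 2 i k x * A 1 k j x - A 1 i k x * A 2 k j x) = 0"
    if x: "x \<in> V" for x i j
  proof -
    define \<Delta> where "\<Delta> = \<theta>1 1 x * \<theta>2 2 x - \<theta>1 2 x * \<theta>2 1 x"
    have p: "pd m (A l i j) x = (\<theta>1 l x * pd m (M1 i j) x + pd m (\<theta>1 l) x * M1 i j x)
        + (\<theta>2 l x * pd m (M2 i j) x + pd m (\<theta>2 l) x * M2 i j x)" for m l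
      unfolding A_def by (simp add: pd_add pd_mult smooth_differentiable[OF _ x] smooth_intros st M)
    have "(\<Sum>k\<in>UNIV. A 2 i k x * A 1 k j x - A 1 i k x * A 2 k j x)
       = (\<Sum>k\<in>UNIV. \<Delta> * (M2 i k x * M1 k j x - M1 i k x * M2 k j x))"
      by (intro sum.cong refl) (simp add: A_def \<Delta>_def algebra_simps)
    then have s: "(\<Sum>k\<in>UNIV. A 2 i k x * A 1 k j x - A 1 i k x * A 2 k j x)
       = \<Delta> * (\<Sum>k\<in>UNIV. M2 i k x * M1 k j x - M1 i k x * M2 k j x)" by (simp add: sum_distrib_left)
    have "pd 1 (A 2 i j) x - pd 2 (A 1 i j) x =
       \<theta>1 2 x * pd 1 (M1 i j) x - \<theta>1 1 x * pd 2 (M1 i j) x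
       + (\<theta>2 2 x * pd 1 (M2 i j) x - \<theta>2 1 x * pd 2 (M2 i j) x)
       + (pd 1 (\<theta>1 2) x - pd 2 (\<theta>1 1) x) * M1 i j x + (pd 1 (\<theta>2 2) x - pd 2 (\<theta>2 1) x) * M2 i j x"
      unfolding p by (simp add: algebra_simps)
    also have "\<dots> = \<Delta> * (D1 (M2 i j) x - D2 (M1 i j) x + a x * M1 i j x + b x * M2 i j x)"
      unfolding structure_equations[OF x] pd_frame[OF M(1) x] pd_frame[OF M(2) x]
      by (simp add: \<Delta>_def algebra_simps)
    finally have "pd 1 (A 2 i j) x - pd 2 (A 1 i j) x + (\<Sum>k\<in>UNIV. A 2 i k x * A 1 k j x - A 1 i k x * A 2 k j x)
      = \<Delta> * (D1 (M2 i j) x - D2 (M1 i j) x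
      + (\<Sum>k\<in>UNIV. M2 i k x * M1 k j x - M1 i k x * M2 k j x) + a x * M1 i j x + b x * M2 i j x)"
      unfolding s by (simp add: algebra_simps)
    then show ?thesis using flat[OF x] by simp
  qed
  obtain S where S: "open S" "convex S" "p0 \<in> S" "S \<subseteq> V"
    and ex: "\<And>c. \<exists>W. (\<forall>i. smooth_on S (W i)) \<and> (\<forall>i. W i p0 = c i) \<and>
       (\<forall>l i. \<forall>x\<in>S. pd l (W i) x = (\<Sum>j\<in>UNIV. A l i j x * W j x))"
    using local_frobenius[OF open_V p0 sA flatA] by blast
  show thesis
  proof (rule that[OF S])
    fix c
    obtain W where W: "\<And>i. smooth_on S (W i)" "\<And>i. W i p0 = c i"
       "\<And>l i x. x \<in> S \<Longrightarrow> pd l (W i) x = (\<Sum>j\<in>UNIV. A l i j x * W j x)" using ex[of c] by blast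
    have "dir_deriv X (W i) x = (\<Sum>j\<in>UNIV. (X x $ 1 * \<theta>1 1 x + X x $ 2 * \<theta>1 2 x) * (M1 i j x * W j x)
        + (X x $ 1 * \<theta>2 1 x + X x $ 2 * \<theta>2 2 x) * (M2 i j x * W j x))" if x: "x \<in> S" for X i x
      using smooth_on_differentiable[OF W(1) S(1) x]
      by (simp add: dir_deriv_eq_pd sum_2 W(3)[OF x] A_def sum_distrib_left algebra_simps flip: sum.distrib)
    then have "D1 (W i) x = (\<Sum>j\<in>UNIV. M1 i j x * W j x) \<and> D2 (W i) x = (\<Sum>j\<in>UNIV. M2 i j x * W j x)"
      if x: "x \<in> S" for i x
      using x S(4) by (auto simp: D1_def D2_def coframe subset_iff)
    then show "\<exists>W. (\<forall>i. smooth_on S (W i)) \<and> (\<forall>i. W i p0 = c i) \<and>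
       (\<forall>i. \<forall>x\<in>S. D1 (W i) x = (\<Sum>j\<in>UNIV. M1 i j x * W j x) \<and> D2 (W i) x = (\<Sum>j\<in>UNIV. M2 i j x * W j x))"
      using W(1,2) by blast
  qed
qed

theorem frame_system_unique:
  fixes M1 M2 :: "'n::finite \<Rightarrow> 'n \<Rightarrow> scalar_field"
  assumes "convex V" and M: "\<And>i j. smooth (M1 i j)" "\<And>i j. smooth (M2 i j)"
    and W: "\<And>i. smooth (W i)"
    "\<And>i x. x \<in> V \<Longrightarrow> D1 (W i) x = (\<Sum>j\<in>UNIV. M1 i j x * W j x)"
    "\<And>i x. x \<in> V \<Longrightarrow> D2 (W i) x = (\<Sum>j\<in>UNIV. M2 i j x * W j x)"
    and x0: "x0 \<in> V" "\<And>i. W i x0 = 0" and x: "x \<in> V"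
  shows "W i x = 0"
proof -
  define A where "A l i j x = \<theta>1 l x * M1 i j x + \<theta>2 l x * M2 i j x" for l i j x
  have sA: "smooth (A l i j)" for l i j
    unfolding A_def by (intro smooth_intros smooth_theta1 smooth_theta2 M)
  have "pd l (W i) x = (\<Sum>j\<in>UNIV. A l i j x * W j x)" if x: "x \<in> V" for l i x
    using pd_frame[OF W(1) x] W(2,3)[OF x] exhaust_2[of l]
    by (auto simp: A_def sum_distrib_left algebra_simps simp flip: sum.distrib)
  from linear_system_unique[OF open_V assms(1) smooth_on_continuous_on[OF sA] smooth_on_differentiable_on[OF W(1)] this x0 x]
  show ?thesis .
qed

lemma smooth_cov_differential:
  "smooth f \<Longrightarrow> \<forall>X\<in>set Xs. smooth_field X \<Longrightarrow> smooth (cov_differential g f Xs)"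
\<comment> \<open>Induction on the length, since the Leibniz terms replace entries of the
  tail.\<close>
proof (induction "length Xs" arbitrary: Xs)
  case (Suc n)
  then obtain X Ys where Xs: "Xs = X # Ys" by (cases Xs) auto
  have "smooth (cov_differential g f (Ys[m := cov_deriv g X (Ys ! m)]))" if "m < length Ys" for m
    using Suc Xs that set_update_subset_insert[of Ys m] smooth_cov_deriv[of X "Ys ! m"]
    by (intro Suc.hyps(1)) (auto dest!: subsetD[OF set_update_subset_insert])
  moreover have "smooth (cov_differential g f Ys)" using Suc Xs by auto
  ultimately show ?case unfolding Xs cov_differential.simps
    using Suc.prems Xs by (intro smooth_intros smooth_dir_deriv) auto
qed auto

lemma cov_differential_cong:
  "length Xs = length Ys \<Longrightarrow> (\<And>i x. i < length Xs \<Longrightarrow> x \<in> V \<Longrightarrow> (Xs ! i) x = (Ys ! i) x) \<Longrightarrow> x \<in> V \<Longrightarrow>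
    cov_differential g f Xs x = cov_differential g f Ys x"
proof (induction "length Xs" arbitrary: Xs Ys x)
  case (Suc n)
  then obtain X Xs' where Xs: "Xs = X # Xs'" by (cases Xs) auto
  with Suc obtain Y Ys' where Ys: "Ys = Y # Ys'" by (cases Ys) auto
  have len: "length Xs' = length Ys'" "n = length Xs'" using Suc Xs Ys by auto
  have eq: "(Xs' ! i) x = (Ys' ! i) x" "X x = Y x" if "i < length Xs'" "x \<in> V" for i x
    using Suc.prems(2)[of "Suc i" x] Suc.prems(2)[of 0 x] that Xs Ys by auto
  have XY: "X x = Y x" if "x \<in> V" for x using Suc.prems(2)[of 0 x] that Xs Ys by auto
  have "cov_differential g f (Xs'[m := cov_deriv g X (Xs' ! m)]) x = cov_differential g f (Ys'[m := cov_deriv g Y (Ys' ! m)]) x"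
    if "m < length Xs'" for m
  proof (rule Suc.hyps(1))
    show "((Xs'[m := cov_deriv g X (Xs' ! m)]) ! i) y = ((Ys'[m := cov_deriv g Y (Ys' ! m)]) ! i) y"
      if "i < length (Xs'[m := cov_deriv g X (Xs' ! m)])" "y \<in> V" for i y
      using that \<open>m < length Xs'\<close> len cov_deriv_cong[OF that(2), of "Xs' ! m" "Ys' ! m" X Y] eq XY
      by (cases "i = m") auto
  qed (use len Suc.prems in auto)
  moreover have "dir_deriv X (cov_differential g f Xs') x = dir_deriv Y (cov_differential g f Ys') x"
    using Suc.prems(3) len XY eq by (intro dir_deriv_cong Suc.hyps(1)) auto
  ultimately show ?case unfolding Xs Ys cov_differential.simps using len by simp
qed auto

text \<open>Tensoriality: although defined by Leibniz on vector fields, the differential is linear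
  over functions in every slot. In the first slot this is linearity of \<nabla> in its direction. In
  a later slot the derivatives of \<open>f\<close> and \<open>h\<close> produced by the outer
  derivative cancel against those in the covariant derivative of \<open>W\<close>.\<close>

lemma cov_differential_linear:
  assumes "smooth \<phi>"
  shows "\<forall>X\<in>set Xs. smooth_field X \<Longrightarrow> m < length Xs \<Longrightarrow> smooth f \<Longrightarrow> smooth h \<Longrightarrow> smooth_field Y \<Longrightarrow> smooth_field Z \<Longrightarrow> x \<in> V \<Longrightarrow>
    (\<And>y. y \<in> V \<Longrightarrow> W y = f y *\<^sub>R Y y + h y *\<^sub>R Z y) \<Longrightarrow>
    cov_differential g \<phi> (Xs[m := W]) x
      = f x * cov_differential g \<phi> (Xs[m := Y]) x + h x * cov_differential g \<phi> (Xs[m := Z]) x"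
proof (induction "length Xs" arbitrary: Xs m f h Y Z W x)
  case (Suc n)
  then obtain X Ys where Xs: "Xs = X # Ys" by (cases Xs) auto
  have len: "n = length Ys" using Suc Xs by simp
  have sf: "smooth_field X" "\<forall>X\<in>set Ys. smooth_field X" using Suc Xs by auto
  have sY: "smooth_field (Ys ! i)" if "i < length Ys" for i using sf that by auto
  note IH = Suc.hyps(1)[OF len]
  note x = Suc.prems(7)
  let ?c = "cov_differential g \<phi>"
  have upd: "\<forall>X\<in>set (Ys[i := C]). smooth_field X" if "smooth_field C" for i C
    using that sf(2) by (auto dest!: subsetD[OF set_update_subset_insert])
  have sc: "smooth (?c (Ys[i := C]))" if "smooth_field C" for i C
    by (rule smooth_cov_differential[OF assms upd[OF that]])
  show ?case
  proof (cases m)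
    case 0
    have 1: "dir_deriv W (?c Ys) x = f x * dir_deriv Y (?c Ys) x + h x * dir_deriv Z (?c Ys) x"
      by (rule dir_deriv_field_combination[OF smooth_cov_differential[OF assms sf(2)] x]) (rule Suc.prems(8)[OF x])
    have 2: "?c (Ys[i := cov_deriv g W (Ys ! i)]) x
       = f x * ?c (Ys[i := cov_deriv g Y (Ys ! i)]) x + h x * ?c (Ys[i := cov_deriv g Z (Ys ! i)]) x"
      if "i < length Ys" for i
    proof (rule IH)
      show "cov_deriv g W (Ys ! i) y = f y *\<^sub>R cov_deriv g Y (Ys ! i) y + h y *\<^sub>R cov_deriv g Z (Ys ! i) y"
        if "y \<in> V" for y
        by (rule cov_deriv_field_combination[where W=W and X=Y and Y=Z, OF sY[OF \<open>i < length Ys\<close>] that Suc.prems(8)[OF that]])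
    qed (use that sf Suc.prems sY smooth_cov_deriv in auto)
    show ?thesis unfolding Xs 0 list_update.simps nat.case cov_differential.simps 1
      by (simp add: 2 sum.distrib sum_distrib_left algebra_simps)
  next
    case m: (Suc k)
    have k: "k < length Ys" using Suc.prems(2) Xs m by simp
    let ?L = "\<lambda>y. f y * ?c (Ys[k := Y]) y + h y * ?c (Ys[k := Z]) y"
    have 1: "dir_deriv X (?c (Ys[k := W])) x = dir_deriv X ?L x"
      by (rule dir_deriv_cong[OF x _ refl], rule IH) (use k sf Suc.prems in auto)
    have p1: "dir_deriv X ?L x = dir_deriv X f x * ?c (Ys[k := Y]) x + f x * dir_deriv X (?c (Ys[k := Y])) x
       + (dir_deriv X h x * ?c (Ys[k := Z]) x + h x * dir_deriv X (?c (Ys[k := Z])) x)"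
      using Suc.prems sc[of Y] sc[of Z] by (simp add: dir_deriv_smooth smooth_intros pd_simps algebra_simps)
    \<comment> \<open>The four terms are grouped into two fields with coefficients 1, so that the
      induction hypothesis can be used for the outer sum and then for each group.\<close>
    have W: "cov_deriv g X W y = 1 *\<^sub>R (dir_deriv X f y *\<^sub>R Y y + dir_deriv X h y *\<^sub>R Z y)
        + 1 *\<^sub>R (f y *\<^sub>R cov_deriv g X Y y + h y *\<^sub>R cov_deriv g X Z y)" if "y \<in> V" for y
    proof -
      have "cov_deriv g X W y = cov_deriv g X (\<lambda>y. f y *\<^sub>R Y y + h y *\<^sub>R Z y) y"
        by (rule cov_deriv_cong[OF that Suc.prems(8) refl])
      then show ?thesis unfolding cov_deriv_combination[OF that Suc.prems(3-6)] by simp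
    qed
    have sfc: "smooth_field (\<lambda>y. f y *\<^sub>R Y y + h y *\<^sub>R Z y)"
      if "smooth f" "smooth h" "smooth_field Y" "smooth_field Z" for f h Y Z
      using that unfolding smooth_field_def by (auto intro!: smooth_intros)
    have sW: "smooth_field (\<lambda>y. dir_deriv X f y *\<^sub>R Y y + dir_deriv X h y *\<^sub>R Z y)"
      "smooth_field (\<lambda>y. f y *\<^sub>R cov_deriv g X Y y + h y *\<^sub>R cov_deriv g X Z y)"
      using Suc.prems sf by (auto intro!: sfc smooth_dir_deriv smooth_cov_deriv)
    have 2: "?c (Ys[k := cov_deriv g X W]) x
       = dir_deriv X f x * ?c (Ys[k := Y]) x + dir_deriv X h x * ?c (Ys[k := Z]) x
         + (f x * ?c (Ys[k := cov_deriv g X Y]) x + h x * ?c (Ys[k := cov_deriv g X Z]) x)"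
    proof -
      have "?c (Ys[k := cov_deriv g X W]) x = 1 * ?c (Ys[k := (\<lambda>y. dir_deriv X f y *\<^sub>R Y y + dir_deriv X h y *\<^sub>R Z y)]) x
         + 1 * ?c (Ys[k := (\<lambda>y. f y *\<^sub>R cov_deriv g X Y y + h y *\<^sub>R cov_deriv g X Z y)]) x"
        by (rule IH[OF sf(2) k smooth_on_const[OF open_V] smooth_on_const[OF open_V] sW x W])
      also have "?c (Ys[k := (\<lambda>y. dir_deriv X f y *\<^sub>R Y y + dir_deriv X h y *\<^sub>R Z y)]) x
         = dir_deriv X f x * ?c (Ys[k := Y]) x + dir_deriv X h x * ?c (Ys[k := Z]) x"
        using sf k Suc.prems by (intro IH smooth_dir_deriv) auto
      also have "?c (Ys[k := (\<lambda>y. f y *\<^sub>R cov_deriv g X Y y + h y *\<^sub>R cov_deriv g X Z y)]) x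
         = f x * ?c (Ys[k := cov_deriv g X Y]) x + h x * ?c (Ys[k := cov_deriv g X Z]) x"
        using sf k Suc.prems by (intro IH smooth_cov_deriv) auto
      finally show ?thesis by simp
    qed
    have 3: "?c (Ys[k := W, i := cov_deriv g X (Ys ! i)]) x
       = f x * ?c (Ys[k := Y, i := cov_deriv g X (Ys ! i)]) x + h x * ?c (Ys[k := Z, i := cov_deriv g X (Ys ! i)]) x"
      if "i < length Ys" "i \<noteq> k" for i
    proof -
      have "smooth_field (cov_deriv g X (Ys ! i))" by (rule smooth_cov_deriv[OF sf(1) sY[OF that(1)]])
      then show ?thesis
        unfolding list_update_swap[OF that(2)[symmetric]]
        using k Suc.prems upd by (intro Suc.hyps(1)) (auto simp: len)
    qed
    \<comment> \<open>Isolates the correction at position \<open>k\<close>, the only one containing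
      derivatives of \<open>f\<close> and \<open>h\<close>.\<close>
    have S: "(\<Sum>i<length Ys. ?c (Ys[k := C, i := cov_deriv g X (Ys[k := C] ! i)]) x)
       = ?c (Ys[k := cov_deriv g X C]) x + (\<Sum>i\<in>{..<length Ys} - {k}. ?c (Ys[k := C, i := cov_deriv g X (Ys ! i)]) x)" for C
      using k by (subst sum.remove[of _ k]) (auto intro!: sum.cong)
    show ?thesis unfolding Xs m list_update.simps nat.case cov_differential.simps length_list_update S 1 p1 2
      by (simp add: 3 sum.distrib sum_distrib_left algebra_simps)
  qed
qed simp

end

section \<open>Frame components of covariant differentials and of quadratic integrals\<close>

lemma pd_inner_right [simp]: "pd i (\<lambda>p. u \<bullet> p) p = u $ i"
  using pd_eqI[OF bounded_linear_imp_has_derivative[OF bounded_linear_inner_right]] by (simp add: inner_axis)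

lemma differentiable_inner_right [simp]: "(\<lambda>p. u \<bullet> p) differentiable (at p)"
  by (rule differentiableI[OF bounded_linear_imp_has_derivative[OF bounded_linear_inner_right]])

context orthonormal_frame
begin

definition frame :: "bool \<Rightarrow> vector_field" where "frame s = (if s then e2 else e1)"

text \<open>In the list \<open>False\<close> stands for \<open>e1\<close> and \<open>True\<close>
  for \<open>e2\<close>; the head is the direction of the last differentiation.\<close>

definition comp :: "scalar_field \<Rightarrow> bool list \<Rightarrow> scalar_field" where
  "comp f bs = cov_differential g f (map frame bs)"

lemma smooth_frame: "smooth_field (frame s)"
  by (simp add: frame_def smooth_e1 smooth_e2)

lemma comp_Nil [simp]: "comp f [] = f"
  by (simp add: comp_def)

lemma smooth_comp [simp]: "smooth f \<Longrightarrow> smooth (comp f bs)"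
  unfolding comp_def by (rule smooth_cov_differential) (auto simp: smooth_frame)

text \<open>Covariant differentiation rotates \<open>e1\<close> and \<open>e2\<close> into each
  other, so each Leibniz correction flips one index, with sign -1 when the flipped index was
  \<open>e2\<close>.\<close>

lemma comp_Cons:
  assumes f: "smooth f" and x: "x \<in> V"
  shows "comp f (s # bs) x = dir_deriv (frame s) (comp f bs) x
    - \<omega> (frame s) x * (\<Sum>m<length bs. (if bs ! m then -1 else 1) * comp f (bs[m := \<not> bs ! m]) x)"
proof -
  have "cov_differential g f ((map frame bs)[m := cov_deriv g (frame s) (map frame bs ! m)]) x
      = \<omega> (frame s) x * ((if bs ! m then -1 else 1) * comp f (bs[m := \<not> bs ! m]) x)" if m: "m < length bs" for m
  proof -
    let ?c = "\<lambda>x. (if bs ! m then -1 else 1) * \<omega> (frame s) x"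
    have "cov_differential g f ((map frame bs)[m := cov_deriv g (frame s) (map frame bs ! m)]) x
      = ?c x * cov_differential g f ((map frame bs)[m := frame (\<not> bs ! m)]) x
        + 0 * cov_differential g f ((map frame bs)[m := frame (\<not> bs ! m)]) x"
    proof (rule cov_differential_linear[OF f])
      show "cov_deriv g (frame s) (map frame bs ! m) y = ?c y *\<^sub>R frame (\<not> bs ! m) y + 0 *\<^sub>R frame (\<not> bs ! m) y"
        if "y \<in> V" for y
        using m cov_deriv_frame[OF that, of "frame s"] by (auto simp: frame_def)
    qed (use m x in \<open>auto simp: smooth_frame intro!: smooth_intros smooth_omega\<close>)
    then show ?thesis by (simp add: comp_def map_update)
  qed
  then show ?thesis by (simp add: comp_def sum_distrib_left)
qed

lemma comp_frame:
  assumes "smooth f" "x \<in> V"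
  shows "comp f (False # bs) x = D1 (comp f bs) x
      - a x * (\<Sum>m<length bs. (if bs ! m then -1 else 1) * comp f (bs[m := \<not> bs ! m]) x)"
    "comp f (True # bs) x = D2 (comp f bs) x
      - b x * (\<Sum>m<length bs. (if bs ! m then -1 else 1) * comp f (bs[m := \<not> bs ! m]) x)"
  using comp_Cons[OF assms] by (simp_all add: frame_def D1_def D2_def)

text \<open>The prefix \<open>Xs\<close> collects the slots already treated, so that the factors can
  be pulled out one slot at a time.\<close>

lemma cov_differential_scale:
  assumes f: "smooth f" and k: "smooth k" and x: "x \<in> V"
  shows "\<forall>X\<in>set Xs. smooth_field X \<Longrightarrow> \<forall>X\<in>set Ys. smooth_field X \<Longrightarrow>
    cov_differential g f (Xs @ map (\<lambda>Y x. k x *\<^sub>R Y x) Ys) x = k x ^ length Ys * cov_differential g f (Xs @ Ys) x"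
proof (induction Ys arbitrary: Xs)
  case (Cons Y Ys)
  have sk: "smooth_field (\<lambda>x. k x *\<^sub>R Y x)"
    using k Cons.prems unfolding smooth_field_def by (auto intro!: smooth_intros)
  have "cov_differential g f ((Xs @ [\<lambda>x. k x *\<^sub>R Y x]) @ map (\<lambda>Y x. k x *\<^sub>R Y x) Ys) x
      = k x ^ length Ys * cov_differential g f ((Xs @ [\<lambda>x. k x *\<^sub>R Y x]) @ Ys) x"
    using Cons.prems sk by (intro Cons.IH) auto
  also have "cov_differential g f ((Xs @ Y # Ys)[length Xs := \<lambda>x. k x *\<^sub>R Y x]) x
      = k x * cov_differential g f ((Xs @ Y # Ys)[length Xs := Y]) x + 0 * cov_differential g f ((Xs @ Y # Ys)[length Xs := Y]) x"
    using Cons.prems x by (intro cov_differential_linear[OF f] k smooth_intros) auto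
  then have "cov_differential g f ((Xs @ [\<lambda>x. k x *\<^sub>R Y x]) @ Ys) x = k x * cov_differential g f (Xs @ Y # Ys) x"
    by simp
  finally show ?case by simp
qed simp

text \<open>The Killing equation for the form with trace \<tau> and trace-free part (v, \<beta>).
  With X = D1 \<beta> + 2 a v and Y = D2 \<beta> + 2 b v, the covariant derivatives of \<beta>,
  those of v are Y and - X, a Cauchy-Riemann system, and d\<tau> has components - 2 Y and - 2 X. The
  factors 2 in X and Y reflect that the trace-free part rotates at double speed.\<close>

definition killing_fields :: "scalar_field \<Rightarrow> scalar_field \<Rightarrow> scalar_field \<Rightarrow> bool" where
  "killing_fields v \<beta> \<tau> \<longleftrightarrow> smooth v \<and> smooth \<beta> \<and> smooth \<tau> \<and> (\<forall>x\<in>V.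
     D1 v x = 2 * a x * \<beta> x + (D2 \<beta> x + 2 * b x * v x) \<and>
     D2 v x = 2 * b x * \<beta> x - (D1 \<beta> x + 2 * a x * v x) \<and>
     D1 \<tau> x = - 2 * (D2 \<beta> x + 2 * b x * v x) \<and>
     D2 \<tau> x = - 2 * (D1 \<beta> x + 2 * a x * v x))"

definition quadratic :: "scalar_field \<Rightarrow> scalar_field \<Rightarrow> scalar_field \<Rightarrow> phase_function" where
  "quadratic \<alpha> \<beta> \<gamma> x p = \<alpha> x * ((e1 x \<bullet> p) * (e1 x \<bullet> p)) + 2 * \<beta> x * ((e1 x \<bullet> p) * (e2 x \<bullet> p))
     + \<gamma> x * ((e2 x \<bullet> p) * (e2 x \<bullet> p))"

lemma hamiltonian_frame:
  assumes x: "x \<in> V"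
  shows "hamiltonian g x p = (e1 x \<bullet> p) * (e1 x \<bullet> p) + (e2 x \<bullet> p) * (e2 x \<bullet> p)"
proof -
  define q where "q = matrix_inv (g x) *v p"
  have p: "g x *v q = p"
  proof -
    have "(g x *v q) $ i = (\<Sum>l\<in>UNIV. (\<Sum>k\<in>UNIV. g x $ i $ k * matrix_inv (g x) $ k $ l) * p $ l)" for i
      by (simp add: q_def matrix_vector_mult_def sum_2 algebra_simps)
    then show ?thesis using matrix_inv_metric[OF x] by (simp add: vec_eq_iff if_distrib[of "\<lambda>c. c * _"] cong: if_cong)
  qed
  have e: "metric_inner g x q (e1 x) = e1 x \<bullet> p" "metric_inner g x q (e2 x) = e2 x \<bullet> p"
    using metric_inner_commute[OF x, of q "e1 x"] metric_inner_commute[OF x, of q "e2 x"]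
    by (simp_all add: metric_inner_def p)
  have "hamiltonian g x p = metric_inner g x q q"
    by (simp add: hamiltonian_def metric_inner_def p flip: q_def) (simp add: inner_commute)
  also have "\<dots> = metric_inner g x q ((e1 x \<bullet> p) *\<^sub>R e1 x + (e2 x \<bullet> p) *\<^sub>R e2 x)"
    using frame_expand[OF x, of q] by (simp add: e)
  also have "\<dots> = (e1 x \<bullet> p) * (e1 x \<bullet> p) + (e2 x \<bullet> p) * (e2 x \<bullet> p)"
    by (simp add: metric_inner_linear e)
  finally show ?thesis .
qed

text \<open>The momentum gradients of H and F are combinations of \<open>e1\<close> and
  \<open>e2\<close>, so the bracket turns into frame derivatives, and everything becomes a cubic in
  the frame momenta.\<close>

lemma poisson_quadratic:
  assumes s: "smooth \<alpha>" "smooth \<beta>" "smooth \<gamma>" and F: "\<And>x p. x \<in> V \<Longrightarrow> F x p = quadratic \<alpha> \<beta> \<gamma> x p" and x: "x \<in> V"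
  shows "poisson (hamiltonian g) F x p =
    2 * ((e1 x \<bullet> p)^3 * (D1 \<alpha> x - 2 * a x * \<beta> x)
      + (e1 x \<bullet> p)^2 * (e2 x \<bullet> p) * (2 * D1 \<beta> x + D2 \<alpha> x - 2 * a x * \<gamma> x - 2 * b x * \<beta> x + 2 * a x * \<alpha> x)
      + (e1 x \<bullet> p) * (e2 x \<bullet> p)^2 * (D1 \<gamma> x + 2 * D2 \<beta> x - 2 * b x * \<gamma> x + 2 * b x * \<alpha> x + 2 * a x * \<beta> x)
      + (e2 x \<bullet> p)^3 * (D2 \<gamma> x + 2 * b x * \<beta> x))"
proof -
  define A B where "A y = e1 y \<bullet> p" and "B y = e2 y \<bullet> p" for y
  have sAB: "smooth A" "smooth B"
    using smooth_e1 smooth_e2 unfolding A_def B_def inner_vec_def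
    by (auto simp: smooth_field_def intro!: smooth_intros)
  define c1 c2 where "c1 = 2 * \<alpha> x * A x + 2 * \<beta> x * B x" and "c2 = 2 * \<beta> x * A x + 2 * \<gamma> x * B x"
  let ?Fp = "\<lambda>y. \<alpha> y * (A y * A y) + 2 * \<beta> y * (A y * B y) + \<gamma> y * (B y * B y)"
  let ?Hp = "\<lambda>y. A y * A y + B y * B y"
  have 1: "pd i (hamiltonian g x) p = 2 * A x * e1 x $ i + 2 * B x * e2 x $ i" for i
  proof -
    have "hamiltonian g x = (\<lambda>p. (e1 x \<bullet> p) * (e1 x \<bullet> p) + (e2 x \<bullet> p) * (e2 x \<bullet> p))"
      using hamiltonian_frame[OF x] by auto
    then show ?thesis by (simp add: pd_add pd_mult differentiable_mult A_def B_def algebra_simps)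
  qed
  have 2: "pd i (F x) p = c1 * e1 x $ i + c2 * e2 x $ i" for i
  proof -
    have "F x = (\<lambda>p. \<alpha> x * ((e1 x \<bullet> p) * (e1 x \<bullet> p)) + 2 * \<beta> x * ((e1 x \<bullet> p) * (e2 x \<bullet> p))
        + \<gamma> x * ((e2 x \<bullet> p) * (e2 x \<bullet> p)))"
      using F[OF x] by (auto simp: quadratic_def)
    then show ?thesis
      by (simp add: pd_add pd_mult differentiable_add differentiable_mult c1_def c2_def A_def B_def algebra_simps)
  qed
  have 3: "pd i (\<lambda>y. F y p) x = pd i ?Fp x" for i
    by (rule pd_cong[OF open_V x]) (simp add: F quadratic_def A_def B_def)
  have 4: "pd i (\<lambda>y. hamiltonian g y p) x = pd i ?Hp x" for i
    by (rule pd_cong[OF open_V x]) (simp add: hamiltonian_frame A_def B_def)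
  have sF: "smooth ?Fp" and sH: "smooth ?Hp" by (intro smooth_intros s sAB)+
  \<comment> \<open>The derivatives of the frame momenta enter the bracket only in this combination,
    the momentum of the commutator of \<open>e1\<close> and \<open>e2\<close>.\<close>
  have br: "D1 B x - D2 A x = - a x * A x - b x * B x"
  proof -
    have se: "smooth (\<lambda>y. e1 y $ i)" "smooth (\<lambda>y. e2 y $ i)" for i
      using smooth_e1 smooth_e2 by (auto simp: smooth_field_def)
    have "D1 B x - D2 A x = (D1 (\<lambda>y. e2 y $ 1) x - D2 (\<lambda>y. e1 y $ 1) x) * p $ 1 + (D1 (\<lambda>y. e2 y $ 2) x - D2 (\<lambda>y. e1 y $ 2) x) * p $ 2"
      unfolding A_def B_def inner_vec_def sum_2 inner_real_def
      by (simp add: D_rules smooth_intros se x algebra_simps)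
    then show ?thesis unfolding bracket_frame[OF x] by (simp add: A_def B_def inner_vec_def sum_2 algebra_simps)
  qed
  have "poisson (hamiltonian g) F x p = 2 * A x * D1 ?Fp x + 2 * B x * D2 ?Fp x - c1 * D1 ?Hp x - c2 * D2 ?Hp x"
    unfolding poisson_def sum_2 1 2 3 4 D_coordinate[OF sF x] D_coordinate[OF sH x] by (simp add: algebra_simps)
  also have "\<dots> = 2 * (A x^3 * D1 \<alpha> x + A x^2 * B x * (2 * D1 \<beta> x + D2 \<alpha> x) + A x * B x^2 * (D1 \<gamma> x + 2 * D2 \<beta> x) + B x^3 * D2 \<gamma> x
       + (A x * c2 - B x * c1) * (D1 B x - D2 A x))"
    by (simp add: D_rules smooth_intros s sAB x c1_def c2_def algebra_simps power2_eq_square power3_eq_cube)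
  finally show ?thesis unfolding br
    by (simp add: A_def B_def c1_def c2_def algebra_simps power2_eq_square power3_eq_cube)
qed

lemma frame_covector:
  assumes x: "x \<in> V"
  obtains p where "e1 x \<bullet> p = s" "e2 x \<bullet> p = t"
proof
  let ?p = "vector [s * \<theta>1 1 x + t * \<theta>2 1 x, s * \<theta>1 2 x + t * \<theta>2 2 x] :: real^2"
  have "e1 x \<bullet> ?p = s * (e1 x $ 1 * \<theta>1 1 x + e1 x $ 2 * \<theta>1 2 x) + t * (e1 x $ 1 * \<theta>2 1 x + e1 x $ 2 * \<theta>2 2 x)"
    by (simp add: inner_vec_def sum_2 algebra_simps)
  then show "e1 x \<bullet> ?p = s" by (simp add: coframe[OF x])
  have "e2 x \<bullet> ?p = s * (e2 x $ 1 * \<theta>1 1 x + e2 x $ 2 * \<theta>1 2 x) + t * (e2 x $ 1 * \<theta>2 1 x + e2 x $ 2 * \<theta>2 2 x)"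
    by (simp add: inner_vec_def sum_2 algebra_simps)
  then show "e2 x \<bullet> ?p = t" by (simp add: coframe[OF x])
qed

text \<open>A binary cubic vanishes iff its four coefficients do, as the arguments (1,0), (0,1),
  (1,1), (1,-1) show. Linear combinations of the four coefficient equations are the four equations
  of \<open>killing_fields\<close>.\<close>

theorem integral_iff_killing_fields:
  assumes s: "smooth v" "smooth \<beta>" "smooth \<tau>"
    and F: "\<And>x p. x \<in> V \<Longrightarrow> F x p = quadratic (\<lambda>x. \<tau> x / 2 + v x) \<beta> (\<lambda>x. \<tau> x / 2 - v x) x p"
  shows "(\<forall>x\<in>V. \<forall>p. poisson (hamiltonian g) F x p = 0) \<longleftrightarrow> killing_fields v \<beta> \<tau>"
proof -
  have sh: "smooth (\<lambda>x. \<tau> x / 2)" using smooth_on_mult[OF open_V s(3) smooth_on_const[OF open_V, of "1/2"]] by simp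
  have Dh: "D1 (\<lambda>x. \<tau> x / 2) x = D1 \<tau> x / 2" "D2 (\<lambda>x. \<tau> x / 2) x = D2 \<tau> x / 2" if "x \<in> V" for x
    using D_mult[OF s(3) smooth_on_const[OF open_V, of "1/2"] that] that by simp_all
  define \<alpha> \<gamma> where "\<alpha> x = \<tau> x / 2 + v x" and "\<gamma> x = \<tau> x / 2 - v x" for x
  have sm: "smooth \<alpha>" "smooth \<gamma>" unfolding \<alpha>_def \<gamma>_def by (intro smooth_intros sh s)+
  have D: "D1 \<alpha> x = D1 \<tau> x / 2 + D1 v x" "D2 \<alpha> x = D2 \<tau> x / 2 + D2 v x"
    "D1 \<gamma> x = D1 \<tau> x / 2 - D1 v x" "D2 \<gamma> x = D2 \<tau> x / 2 - D2 v x" if "x \<in> V" for x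
    unfolding \<alpha>_def \<gamma>_def by (simp_all add: D_rules sh s that Dh)
  note P = poisson_quadratic[OF sm(1) s(2) sm(2) F[folded \<alpha>_def \<gamma>_def]]
  have ptw: "(\<forall>p. poisson (hamiltonian g) F x p = 0) \<longleftrightarrow>
     D1 v x = 2 * a x * \<beta> x + (D2 \<beta> x + 2 * b x * v x) \<and>
     D2 v x = 2 * b x * \<beta> x - (D1 \<beta> x + 2 * a x * v x) \<and>
     D1 \<tau> x = - 2 * (D2 \<beta> x + 2 * b x * v x) \<and>
     D2 \<tau> x = - 2 * (D1 \<beta> x + 2 * a x * v x)" (is "?L \<longleftrightarrow> ?R") if x: "x \<in> V" for x
  proof -
    define d0 d1 d2 d3 where "d0 = D1 \<alpha> x - 2 * a x * \<beta> x"
      and "d1 = 2 * D1 \<beta> x + D2 \<alpha> x - 2 * a x * \<gamma> x - 2 * b x * \<beta> x + 2 * a x * \<alpha> x"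
      and "d2 = D1 \<gamma> x + 2 * D2 \<beta> x - 2 * b x * \<gamma> x + 2 * b x * \<alpha> x + 2 * a x * \<beta> x"
      and "d3 = D2 \<gamma> x + 2 * b x * \<beta> x"
    have P': "poisson (hamiltonian g) F x p = 2 * ((e1 x \<bullet> p)^3 * d0 + (e1 x \<bullet> p)^2 * (e2 x \<bullet> p) * d1
       + (e1 x \<bullet> p) * (e2 x \<bullet> p)^2 * d2 + (e2 x \<bullet> p)^3 * d3)" for p
      unfolding d0_def d1_def d2_def d3_def by (rule P) (use x in auto)
    have L: "?L \<longleftrightarrow> d0 = 0 \<and> d1 = 0 \<and> d2 = 0 \<and> d3 = 0"
    proof
      assume l: ?L
      have c: "s^3 * d0 + s^2 * t * d1 + s * t^2 * d2 + t^3 * d3 = 0" for s t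
      proof -
        obtain p where "e1 x \<bullet> p = s" "e2 x \<bullet> p = t" using frame_covector[OF x] by blast
        then show ?thesis using l P'[of p] by simp
      qed
      from c[of 1 0] c[of 0 1] c[of 1 1] c[of 1 "-1"] show "d0 = 0 \<and> d1 = 0 \<and> d2 = 0 \<and> d3 = 0" by simp
    qed (simp add: P')
    have v: "\<alpha> x = \<tau> x / 2 + v x" "\<gamma> x = \<tau> x / 2 - v x" by (simp_all add: \<alpha>_def \<gamma>_def)
    show ?thesis unfolding L unfolding d0_def d1_def d2_def d3_def D[OF x] v by (auto simp: algebra_simps)
  qed
  then show ?thesis using s by (auto simp: killing_fields_def)
qed

end

section \<open>The space of germs of quadratic integrals and its dimension\<close>

lemma dim_range_linear_inj:
  fixes \<phi> :: "real^'n \<Rightarrow> 'a::real_vector"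
  assumes "linear \<phi>" "inj \<phi>" "range \<phi> = J"
  shows "dim J = CARD('n)"
proof -
  have "independent (\<phi> ` Basis)"
    using assms by (intro linear_independent_injective_image independent_Basis) (auto intro: inj_on_subset)
  moreover have "span (\<phi> ` Basis) = J" using assms by (simp add: linear_span_image)
  ultimately have "card (\<phi> ` Basis) = dim J"
    using assms by (intro basis_card_eq_dim) auto
  moreover have "card (\<phi> ` Basis) = CARD('n)" using assms(2) by (simp add: card_image inj_on_subset)
  ultimately show ?thesis by simp
qed

text \<open>As \<open>dim\<close> is 0 for infinite-dimensional spaces, positivity is what
  guarantees a finite basis to compare with.\<close>

lemma dim_ge_linear_inj:
  fixes \<phi> :: "real^'n \<Rightarrow> 'a::real_vector"
  assumes "linear \<phi>" "inj \<phi>" "range \<phi> \<subseteq> J" "dim J > 0"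
  shows "CARD('n) \<le> dim J"
proof -
  obtain B where B: "B \<subseteq> J" "independent B" "J \<subseteq> span B" "card B = dim J" using basis_exists by blast
  then have "finite B" using assms(4) card_gt_0_iff by fastforce
  have "independent (\<phi> ` Basis)"
    using assms by (intro linear_independent_injective_image independent_Basis) (auto intro: inj_on_subset)
  then have "card (\<phi> ` Basis) \<le> card B"
    using independent_span_bound[OF \<open>finite B\<close>] assms(3) B(3) by blast
  moreover have "card (\<phi> ` Basis) = CARD('n)" using assms(2) by (simp add: card_image inj_on_subset)
  ultimately show ?thesis using B by simp
qed

lemma dim_3_obtain:
  fixes J :: "'a::real_vector set"
  assumes "dim J = 3"
  obtains G where "\<And>i::3. G i \<in> J" "\<And>c::real^3. (\<Sum>i\<in>UNIV. c $ i *\<^sub>R G i) = 0 \<Longrightarrow> c = 0"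
proof -
  obtain B where B: "B \<subseteq> J" "independent B" "J \<subseteq> span B" "card B = dim J" using basis_exists by blast
  then have B3: "card B = CARD(3)" "finite B" using assms card_ge_0_finite[of B] by auto
  then obtain G :: "3 \<Rightarrow> 'a" where G: "bij_betw G UNIV B"
    using finite_same_card_bij[of "UNIV :: 3 set" B] by auto
  show thesis
  proof (rule that)
    show "G i \<in> J" for i using G B(1) by (auto simp: bij_betw_def)
    fix c :: "real^3" assume c: "(\<Sum>i\<in>UNIV. c $ i *\<^sub>R G i) = 0"
    define u where "u g = c $ (inv_into UNIV G g)" for g
    have u: "u (G i) = c $ i" for i using G by (simp add: u_def bij_betw_def)
    have "(\<Sum>g\<in>B. u g *\<^sub>R g) = (\<Sum>i\<in>UNIV. c $ i *\<^sub>R G i)"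
      by (rule sum.reindex_bij_betw[OF G, of "\<lambda>g. u g *\<^sub>R g", symmetric, unfolded u])
    then have "(\<Sum>g\<in>B. u g *\<^sub>R g) = 0" using c by simp
    then have "\<forall>g\<in>B. u g = 0" using B(2) dependent_finite[OF B3(2)] by blast
    then show "c = 0" using G u by (auto simp: vec_eq_iff bij_betw_def)
  qed
qed

lemma germ_at_add: "germ_at p0 F + germ_at p0 G = germ_at p0 (\<lambda>x p. F x p + G x p)"
  by transfer simp

lemma germ_at_scaleR: "c *\<^sub>R germ_at p0 F = germ_at p0 (\<lambda>x p. c * F x p)"
  by transfer simp

lemma germ_at_zero: "0 = germ_at p0 (\<lambda>x p. 0)"
  by transfer simp

context orthonormal_frame
begin

abbreviation killing_on :: "(real^2) set \<Rightarrow> scalar_field \<Rightarrow> scalar_field \<Rightarrow> scalar_field \<Rightarrow> bool" where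
  "killing_on S \<equiv> orthonormal_frame.killing_fields S g e1"

definition qform :: "scalar_field \<Rightarrow> scalar_field \<Rightarrow> scalar_field \<Rightarrow> phase_function" where
  "qform v \<beta> \<tau> = quadratic (\<lambda>x. \<tau> x / 2 + v x) \<beta> (\<lambda>x. \<tau> x / 2 - v x)"

lemma qform_eq_0_iff:
  assumes x: "x \<in> V"
  shows "qform v \<beta> \<tau> x = (\<lambda>p. 0) \<longleftrightarrow> v x = 0 \<and> \<beta> x = 0 \<and> \<tau> x = 0"
proof
  assume q: "qform v \<beta> \<tau> x = (\<lambda>p. 0)"
  have "(\<tau> x / 2 + v x) * (s * s) + 2 * \<beta> x * (s * t) + (\<tau> x / 2 - v x) * (t * t) = 0" for s t
  proof -
    obtain p where "e1 x \<bullet> p = s" "e2 x \<bullet> p = t" using frame_covector[OF x] by blast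
    then show ?thesis using fun_cong[OF q, of p] by (simp add: qform_def quadratic_def)
  qed
  from this[of 1 0] this[of 0 1] this[of 1 1] show "v x = 0 \<and> \<beta> x = 0 \<and> \<tau> x = 0" by simp
qed (auto simp: qform_def quadratic_def)

lemma qform_linear:
  "qform (\<lambda>x. c * v x + d * v' x) (\<lambda>x. c * \<beta> x + d * \<beta>' x) (\<lambda>x. c * \<tau> x + d * \<tau>' x) x p
    = c * qform v \<beta> \<tau> x p + d * qform v' \<beta>' \<tau>' x p"
  by (simp add: qform_def quadratic_def algebra_simps add_divide_distrib)

lemma killing_fields_linear:
  assumes "killing_fields v \<beta> \<tau>" "killing_fields v' \<beta>' \<tau>'"
  shows "killing_fields (\<lambda>x. c * v x + d * v' x) (\<lambda>x. c * \<beta> x + d * \<beta>' x) (\<lambda>x. c * \<tau> x + d * \<tau>' x)"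
proof -
  have s: "smooth v" "smooth \<beta>" "smooth \<tau>" "smooth v'" "smooth \<beta>'" "smooth \<tau>'"
    using assms by (auto simp: killing_fields_def)
  show ?thesis unfolding killing_fields_def
  proof (intro conjI ballI)
    fix x assume x: "x \<in> V"
    have h: "D1 v x = 2 * a x * \<beta> x + (D2 \<beta> x + 2 * b x * v x)" "D2 v x = 2 * b x * \<beta> x - (D1 \<beta> x + 2 * a x * v x)"
      "D1 \<tau> x = - 2 * (D2 \<beta> x + 2 * b x * v x)" "D2 \<tau> x = - 2 * (D1 \<beta> x + 2 * a x * v x)"
      using assms(1) x unfolding killing_fields_def by blast+
    have h': "D1 v' x = 2 * a x * \<beta>' x + (D2 \<beta>' x + 2 * b x * v' x)" "D2 v' x = 2 * b x * \<beta>' x - (D1 \<beta>' x + 2 * a x * v' x)"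
      "D1 \<tau>' x = - 2 * (D2 \<beta>' x + 2 * b x * v' x)" "D2 \<tau>' x = - 2 * (D1 \<beta>' x + 2 * a x * v' x)"
      using assms(2) x unfolding killing_fields_def by blast+
    note D = D_rules smooth_intros s x D_const
    show "D1 (\<lambda>x. c * v x + d * v' x) x = 2 * a x * (c * \<beta> x + d * \<beta>' x) + (D2 (\<lambda>x. c * \<beta> x + d * \<beta>' x) x + 2 * b x * (c * v x + d * v' x))"
      "D2 (\<lambda>x. c * v x + d * v' x) x = 2 * b x * (c * \<beta> x + d * \<beta>' x) - (D1 (\<lambda>x. c * \<beta> x + d * \<beta>' x) x + 2 * a x * (c * v x + d * v' x))"
      "D1 (\<lambda>x. c * \<tau> x + d * \<tau>' x) x = - 2 * (D2 (\<lambda>x. c * \<beta> x + d * \<beta>' x) x + 2 * b x * (c * v x + d * v' x))"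
      "D2 (\<lambda>x. c * \<tau> x + d * \<tau>' x) x = - 2 * (D1 (\<lambda>x. c * \<beta> x + d * \<beta>' x) x + 2 * a x * (c * v x + d * v' x))"
      by (simp_all add: D h h' algebra_simps)
  qed (intro smooth_intros s)+
qed

lemma killing_fields_smooth: "killing_fields v \<beta> \<tau> \<Longrightarrow> smooth v \<and> smooth \<beta> \<and> smooth \<tau>"
  by (simp add: killing_fields_def)

lemma killing_on_subset:
  assumes "killing_fields v \<beta> \<tau>" "open S" "S \<subseteq> V"
  shows "killing_on S v \<beta> \<tau>"
proof -
  interpret S: orthonormal_frame S g e1 by (rule orthonormal_frame_subset[OF assms(2,3)])
  show ?thesis using assms unfolding S.killing_fields_def killing_fields_def
    by (auto intro: smooth_on_subset)
qed

text \<open>A change of fibre coordinates between canonical momenta and frame momenta, by the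
  coframe in one direction and the frame in the other. A ball serves as domain so that convexity is
  available for uniqueness arguments.\<close>

lemma integral_germs_iff:
  assumes p0: "p0 \<in> V"
  shows "G \<in> integral_germs g p0 2 \<longleftrightarrow>
    (\<exists>S v \<beta> \<tau>. open S \<and> convex S \<and> p0 \<in> S \<and> S \<subseteq> V \<and> killing_on S v \<beta> \<tau> \<and> G = germ_at p0 (qform v \<beta> \<tau>))"
proof
  assume "G \<in> integral_germs g p0 2"
  then obtain F V' u where F: "G = germ_at p0 F" and V': "open V'" "p0 \<in> V'" "\<And>i. i \<le> 2 \<Longrightarrow> smooth_on V' (u i)"
    "\<And>x p. x \<in> V' \<Longrightarrow> F x p = (\<Sum>i\<le>2. u i x * (p $ 1) ^ i * (p $ 2) ^ (2 - i))"
    "\<And>x p. x \<in> V' \<Longrightarrow> poisson (hamiltonian g) F x p = 0"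
    unfolding integral_germs_def homogeneous_integral_near_def by blast
  obtain r where r: "r > 0" "ball p0 r \<subseteq> V \<inter> V'"
    using open_contains_ball[of "V \<inter> V'"] open_V V'(1,2) p0 by blast
  define S where "S = ball p0 r"
  have S: "open S" "convex S" "p0 \<in> S" "S \<subseteq> V" "S \<subseteq> V'" using r by (auto simp: S_def)
  interpret S: orthonormal_frame S g e1 by (rule orthonormal_frame_subset[OF S(1,4)])
  have u: "S.smooth (u 0)" "S.smooth (u 1)" "S.smooth (u 2)" 
    using V'(3)[of 0] V'(3)[of 1] V'(3)[of 2] smooth_on_subset[OF _ S(5)] by auto
  have t: "S.smooth (\<theta>1 i)" "S.smooth (\<theta>2 i)" for i using smooth_theta1 smooth_theta2 S(4) smooth_on_subset by blast+
  \<comment> \<open>Substituting \<open>p = (e1 x \<bullet> p) \<theta>1 + (e2 x \<bullet> p)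
    \<theta>2\<close> into the form; \<open>u 2\<close> is the coefficient of the square of
    \<open>p $ 1\<close>.\<close>
  define \<alpha> where "\<alpha> x = u 2 x * \<theta>1 1 x * \<theta>1 1 x + u 1 x * \<theta>1 1 x * \<theta>1 2 x + u 0 x * \<theta>1 2 x * \<theta>1 2 x" for x
  define \<beta> where "\<beta> x = u 2 x * \<theta>1 1 x * \<theta>2 1 x + (1/2) * u 1 x * (\<theta>1 1 x * \<theta>2 2 x + \<theta>1 2 x * \<theta>2 1 x) + u 0 x * \<theta>1 2 x * \<theta>2 2 x" for x
  define \<gamma> where "\<gamma> x = u 2 x * \<theta>2 1 x * \<theta>2 1 x + u 1 x * \<theta>2 1 x * \<theta>2 2 x + u 0 x * \<theta>2 2 x * \<theta>2 2 x" for x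
  define v where "v x = (1/2) * (\<alpha> x - \<gamma> x)" for x
  define \<tau> where "\<tau> x = \<alpha> x + \<gamma> x" for x
  have s0: "S.smooth \<alpha>" "S.smooth \<beta>" "S.smooth \<gamma>" unfolding \<alpha>_def \<beta>_def \<gamma>_def by (intro S.smooth_intros u t)+
  have s: "S.smooth v" "S.smooth \<tau>" unfolding v_def \<tau>_def by (intro S.smooth_intros s0)+
  have Fq: "F x p = qform v \<beta> \<tau> x p" if "x \<in> S" for x p
  proof -
    have x: "x \<in> V" "x \<in> V'" using that S by auto
    have p1: "p $ 1 = (e1 x \<bullet> p) * \<theta>1 1 x + (e2 x \<bullet> p) * \<theta>2 1 x"
    proof -
      have "(e1 x \<bullet> p) * \<theta>1 1 x + (e2 x \<bullet> p) * \<theta>2 1 x = p $ 1 * (\<theta>1 1 x * e1 x $ 1 + \<theta>2 1 x * e2 x $ 1)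
         + p $ 2 * (\<theta>1 1 x * e1 x $ 2 + \<theta>2 1 x * e2 x $ 2)" by (simp add: inner_vec_def sum_2 algebra_simps)
      then show ?thesis by (simp add: coframe'[OF x(1)])
    qed
    have p2: "p $ 2 = (e1 x \<bullet> p) * \<theta>1 2 x + (e2 x \<bullet> p) * \<theta>2 2 x"
    proof -
      have "(e1 x \<bullet> p) * \<theta>1 2 x + (e2 x \<bullet> p) * \<theta>2 2 x = p $ 1 * (\<theta>1 2 x * e1 x $ 1 + \<theta>2 2 x * e2 x $ 1)
         + p $ 2 * (\<theta>1 2 x * e1 x $ 2 + \<theta>2 2 x * e2 x $ 2)" by (simp add: inner_vec_def sum_2 algebra_simps)
      then show ?thesis by (simp add: coframe'[OF x(1)])
    qed
    have "F x p = u 0 x * (p $ 2 * p $ 2) + u 1 x * (p $ 1 * p $ 2) + u 2 x * (p $ 1 * p $ 1)"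
      unfolding V'(4)[OF x(2)] by (simp add: eval_nat_numeral)
    also have "\<dots> = qform v \<beta> \<tau> x p"
      unfolding p1 p2 qform_def quadratic_def v_def \<tau>_def \<alpha>_def \<beta>_def \<gamma>_def
      by (simp add: field_simps)
    finally show ?thesis .
  qed
  have "S.killing_fields v \<beta> \<tau>"
    using S.integral_iff_killing_fields[OF s(1) s0(2) s(2), of F] Fq V'(5) S(5) by (auto simp: qform_def)
  moreover have "G = germ_at p0 (qform v \<beta> \<tau>)"
    unfolding F germ_at_eq_iff eventually_nhds using S(1,3) Fq by (intro exI[of _ S]) auto
  ultimately show "\<exists>S v \<beta> \<tau>. open S \<and> convex S \<and> p0 \<in> S \<and> S \<subseteq> V \<and> killing_on S v \<beta> \<tau> \<and> G = germ_at p0 (qform v \<beta> \<tau>)"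
    using S by blast
next
  assume "\<exists>S v \<beta> \<tau>. open S \<and> convex S \<and> p0 \<in> S \<and> S \<subseteq> V \<and> killing_on S v \<beta> \<tau> \<and> G = germ_at p0 (qform v \<beta> \<tau>)"
  then obtain S v \<beta> \<tau> where S: "open S" "p0 \<in> S" "S \<subseteq> V" and k: "killing_on S v \<beta> \<tau>"
    and G: "G = germ_at p0 (qform v \<beta> \<tau>)" by blast
  interpret S: orthonormal_frame S g e1 by (rule orthonormal_frame_subset[OF S(1,3)])
  have s: "S.smooth v" "S.smooth \<beta>" "S.smooth \<tau>" using S.killing_fields_smooth[OF k] by auto
  have e: "S.smooth (\<lambda>x. e1 x $ i)" "S.smooth (\<lambda>x. e2 x $ i)" for i
    using S.smooth_e1 S.smooth_e2 by (auto simp: S.smooth_field_def)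
  define \<alpha> \<gamma> where "\<alpha> x = (1/2) * \<tau> x + v x" and "\<gamma> x = (1/2) * \<tau> x - v x" for x
  have s': "S.smooth \<alpha>" "S.smooth \<gamma>" unfolding \<alpha>_def \<gamma>_def by (intro S.smooth_intros s)+
  define u :: "nat \<Rightarrow> scalar_field" where
    "u i = (if i = 0 then (\<lambda>x. \<alpha> x * (e1 x $ 2 * e1 x $ 2) + 2 * \<beta> x * (e1 x $ 2 * e2 x $ 2) + \<gamma> x * (e2 x $ 2 * e2 x $ 2))
      else if i = 1 then (\<lambda>x. 2 * \<alpha> x * (e1 x $ 1 * e1 x $ 2) + 2 * \<beta> x * (e1 x $ 1 * e2 x $ 2 + e1 x $ 2 * e2 x $ 1) + 2 * \<gamma> x * (e2 x $ 1 * e2 x $ 2))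
      else (\<lambda>x. \<alpha> x * (e1 x $ 1 * e1 x $ 1) + 2 * \<beta> x * (e1 x $ 1 * e2 x $ 1) + \<gamma> x * (e2 x $ 1 * e2 x $ 1)))" for i
  have "S.smooth (u i)" for i unfolding u_def by (auto intro!: S.smooth_intros s s' e)
  moreover have "qform v \<beta> \<tau> x p = (\<Sum>i\<le>2. u i x * (p $ 1) ^ i * (p $ 2) ^ (2 - i))" for x p
    by (simp add: eval_nat_numeral u_def qform_def quadratic_def \<alpha>_def \<gamma>_def inner_vec_def sum_2 algebra_simps)
  moreover have "\<forall>x\<in>S. \<forall>p. poisson (hamiltonian g) (qform v \<beta> \<tau>) x p = 0"
    using S.integral_iff_killing_fields[OF s, of "qform v \<beta> \<tau>"] k by (simp add: qform_def)
  ultimately have "homogeneous_integral_near g p0 2 (qform v \<beta> \<tau>)"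
    unfolding homogeneous_integral_near_def using S by blast
  then show "G \<in> integral_germs g p0 2" using G by (auto simp: integral_germs_def)
qed

lemma germ_qform_eq_0:
  assumes "p0 \<in> V" "germ_at p0 (qform v \<beta> \<tau>) = 0"
  shows "\<exists>S. open S \<and> p0 \<in> S \<and> S \<subseteq> V \<and> (\<forall>x\<in>S. v x = 0 \<and> \<beta> x = 0 \<and> \<tau> x = 0)"
proof -
  from assms(2) obtain T where T: "open T" "p0 \<in> T" "\<And>x. x \<in> T \<Longrightarrow> qform v \<beta> \<tau> x = (\<lambda>p. 0)"
    unfolding germ_at_zero[of p0] germ_at_eq_iff eventually_nhds by blast
  show ?thesis
  proof (intro exI[of _ "T \<inter> V"] conjI ballI)
    fix x assume "x \<in> T \<inter> V"
    then have "v x = 0 \<and> \<beta> x = 0 \<and> \<tau> x = 0"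
      using T(3)[of x] qform_eq_0_iff[of x v \<beta> \<tau>] by blast
    then show "v x = 0" "\<beta> x = 0" "\<tau> x = 0" by auto
  qed (use T(1,2) open_V assms(1) in auto)
qed

lemma killing_fields_sum:
  fixes c :: "real^'n"
  assumes "\<And>i::'n. killing_fields (v i) (\<beta> i) (\<tau> i)"
  shows "killing_fields (\<lambda>x. \<Sum>i\<in>UNIV. c $ i * v i x) (\<lambda>x. \<Sum>i\<in>UNIV. c $ i * \<beta> i x) (\<lambda>x. \<Sum>i\<in>UNIV. c $ i * \<tau> i x)"
proof -
  have "killing_fields (\<lambda>x. \<Sum>i\<in>I. c $ i * v i x) (\<lambda>x. \<Sum>i\<in>I. c $ i * \<beta> i x) (\<lambda>x. \<Sum>i\<in>I. c $ i * \<tau> i x)" if "finite I" for I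
    using that
  proof induction
    case empty
    then show ?case by (simp add: killing_fields_def smooth_intros)
  next
    case (insert i I)
    then show ?case using killing_fields_linear[OF assms[of i] insert.IH, of "c $ i" 1] by simp
  qed
  then show ?thesis by simp
qed

lemma germ_qform_sum:
  fixes c :: "real^'n"
  shows "(\<Sum>i\<in>UNIV. c $ i *\<^sub>R germ_at p0 (qform (v i) (\<beta> i) (\<tau> i)))
    = germ_at p0 (qform (\<lambda>x. \<Sum>i\<in>UNIV. c $ i * v i x) (\<lambda>x. \<Sum>i\<in>UNIV. c $ i * \<beta> i x) (\<lambda>x. \<Sum>i\<in>UNIV. c $ i * \<tau> i x))"
proof -
  have "(\<Sum>i\<in>I. c $ i *\<^sub>R germ_at p0 (qform (v i) (\<beta> i) (\<tau> i)))
    = germ_at p0 (qform (\<lambda>x. \<Sum>i\<in>I. c $ i * v i x) (\<lambda>x. \<Sum>i\<in>I. c $ i * \<beta> i x) (\<lambda>x. \<Sum>i\<in>I. c $ i * \<tau> i x))" if "finite I" for I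
    using that
  proof induction
    case empty
    then show ?case by (simp add: germ_at_zero[of p0] qform_def quadratic_def)
  next
    case (insert i I)
    have eq: "qform (\<lambda>x. \<Sum>i\<in>insert i I. c $ i * v i x) (\<lambda>x. \<Sum>i\<in>insert i I. c $ i * \<beta> i x) (\<lambda>x. \<Sum>i\<in>insert i I. c $ i * \<tau> i x)
      = (\<lambda>x p. c $ i * qform (v i) (\<beta> i) (\<tau> i) x p + 1 * qform (\<lambda>x. \<Sum>i\<in>I. c $ i * v i x) (\<lambda>x. \<Sum>i\<in>I. c $ i * \<beta> i x) (\<lambda>x. \<Sum>i\<in>I. c $ i * \<tau> i x) x p)"
      unfolding qform_linear[symmetric] using insert.hyps by simp
    show ?case unfolding eq unfolding sum.insert[OF insert.hyps] insert.IH
      by (simp only: germ_at_scaleR germ_at_add mult_1)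
  qed
  then show ?thesis by simp
qed

text \<open>Under these assumptions evaluation of v, \<beta>, \<tau> at \<open>p0\<close> is an
  isomorphism onto \<open>real^3\<close>; the map \<open>\<phi>\<close> built from three special
  solutions is its inverse.\<close>

theorem dim_integral_germs_eq_3:
  assumes p0: "p0 \<in> V"
    and ex: "\<And>v0 b0 t0. \<exists>v \<beta> \<tau>. killing_fields v \<beta> \<tau> \<and> v p0 = v0 \<and> \<beta> p0 = b0 \<and> \<tau> p0 = t0"
    and un: "\<And>S v \<beta> \<tau> x. open S \<Longrightarrow> convex S \<Longrightarrow> p0 \<in> S \<Longrightarrow> S \<subseteq> V \<Longrightarrow> killing_on S v \<beta> \<tau> \<Longrightarrow>
      v p0 = 0 \<Longrightarrow> \<beta> p0 = 0 \<Longrightarrow> \<tau> p0 = 0 \<Longrightarrow> x \<in> S \<Longrightarrow> v x = 0 \<and> \<beta> x = 0 \<and> \<tau> x = 0"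
  shows "dim (integral_germs g p0 2) = 3"
proof -
  have "\<exists>v \<beta> \<tau>. killing_fields v \<beta> \<tau> \<and> v p0 = axis i 1 $ 1 \<and> \<beta> p0 = axis i 1 $ 2 \<and> \<tau> p0 = axis i 1 $ 3" for i :: 3
    by (rule ex)
  then obtain v \<beta> \<tau> where w: "\<And>i::3. killing_fields (v i) (\<beta> i) (\<tau> i)"
    "\<And>i. v i p0 = axis i 1 $ 1" "\<And>i. \<beta> i p0 = axis i 1 $ 2" "\<And>i. \<tau> i p0 = axis i 1 $ 3" by metis
  define \<phi> where "\<phi> c = (\<Sum>i\<in>UNIV. c $ i *\<^sub>R germ_at p0 (qform (v i) (\<beta> i) (\<tau> i)))" for c :: "real^3"
  have lin: "linear \<phi>"
    by (rule linearI) (simp_all add: \<phi>_def scaleR_left_distrib sum.distrib scaleR_sum_right)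
  let ?v = "\<lambda>c x. \<Sum>i\<in>UNIV. c $ i * v i x" and ?\<beta> = "\<lambda>c x. \<Sum>i\<in>UNIV. c $ i * \<beta> i x" and ?\<tau> = "\<lambda>c x. \<Sum>i\<in>UNIV. c $ i * \<tau> i x"
  have \<phi>: "\<phi> c = germ_at p0 (qform (?v c) (?\<beta> c) (?\<tau> c))" for c
    unfolding \<phi>_def by (rule germ_qform_sum)
  have k: "killing_fields (?v c) (?\<beta> c) (?\<tau> c)" for c by (rule killing_fields_sum[OF w(1)])
  have val: "?v c p0 = c $ 1" "?\<beta> c p0 = c $ 2" "?\<tau> c p0 = c $ 3" for c
    by (simp_all add: w(2-4) sum_3 axis_def)
  obtain r where r: "r > 0" "ball p0 r \<subseteq> V" using open_V p0 open_contains_ball by blast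
  have "c = 0" if c0: "\<phi> c = 0" for c
  proof -
    have "?v c p0 = 0 \<and> ?\<beta> c p0 = 0 \<and> ?\<tau> c p0 = 0"
      using germ_qform_eq_0[OF p0 c0[unfolded \<phi>]] by (elim exE conjE) (erule bspec)
    then show ?thesis using val[of c] by (simp add: vec_eq_iff forall_3)
  qed
  then have "inj \<phi>" using lin by (simp add: linear_injective_0)
  moreover have "range \<phi> = integral_germs g p0 2"
  proof
    show "range \<phi> \<subseteq> integral_germs g p0 2"
    proof
      fix G assume "G \<in> range \<phi>"
      then obtain c where "G = \<phi> c" by blast
      moreover have "killing_on (ball p0 r) (?v c) (?\<beta> c) (?\<tau> c)"
        by (rule killing_on_subset[OF k open_ball r(2)])
      ultimately show "G \<in> integral_germs g p0 2"
        unfolding integral_germs_iff[OF p0] \<phi> using r by (intro exI[of _ "ball p0 r"]) auto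
    qed
    show "integral_germs g p0 2 \<subseteq> range \<phi>"
    proof
      fix G assume "G \<in> integral_germs g p0 2"
      then obtain S v' \<beta>' \<tau>' where S: "open S" "convex S" "p0 \<in> S" "S \<subseteq> V" and k': "killing_on S v' \<beta>' \<tau>'"
        and G: "G = germ_at p0 (qform v' \<beta>' \<tau>')" unfolding integral_germs_iff[OF p0] by blast
      interpret S: orthonormal_frame S g e1 by (rule orthonormal_frame_subset[OF S(1,4)])
      define c :: "real^3" where "c = vector [v' p0, \<beta>' p0, \<tau>' p0]"
      have c: "c $ 1 = v' p0" "c $ 2 = \<beta>' p0" "c $ 3 = \<tau>' p0" by (simp_all add: c_def)
      have kd: "killing_on S (\<lambda>x. 1 * v' x + (-1) * ?v c x) (\<lambda>x. 1 * \<beta>' x + (-1) * ?\<beta> c x) (\<lambda>x. 1 * \<tau>' x + (-1) * ?\<tau> c x)"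
        by (rule S.killing_fields_linear[OF k' killing_on_subset[OF k S(1,4)]])
      have "v' x = ?v c x \<and> \<beta>' x = ?\<beta> c x \<and> \<tau>' x = ?\<tau> c x" if "x \<in> S" for x
        using un[OF S kd _ _ _ that] val[of c] c by simp
      then have "G = \<phi> c"
        unfolding G \<phi> germ_at_eq_iff eventually_nhds qform_def quadratic_def
        using S by (intro exI[of _ S]) auto
      then show "G \<in> range \<phi>" by blast
    qed
  qed
  ultimately show ?thesis using dim_range_linear_inj[OF lin] by simp
qed

text \<open>Four data that can be prescribed freely yield four independent germs. The fourth is of
  first order, the covariant derivative Y of \<beta> at \<open>p0\<close>, and it too is read off
  from the germ.\<close>

theorem dim_integral_germs_neq_3:
  assumes p0: "p0 \<in> V"
    and ex: "\<And>v0 b0 t0 y0. \<exists>v \<beta> \<tau>. killing_fields v \<beta> \<tau> \<and> v p0 = v0 \<and> \<beta> p0 = b0 \<and> \<tau> p0 = t0 \<and> D2 \<beta> p0 + 2 * b p0 * v p0 = y0"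
  shows "dim (integral_germs g p0 2) \<noteq> 3"
proof
  assume d3: "dim (integral_germs g p0 2) = 3"
  have "\<exists>v \<beta> \<tau>. killing_fields v \<beta> \<tau> \<and> v p0 = axis i 1 $ 1 \<and> \<beta> p0 = axis i 1 $ 2 \<and> \<tau> p0 = axis i 1 $ 3 \<and>
     D2 \<beta> p0 + 2 * b p0 * v p0 = axis i 1 $ 4" for i :: 4
    by (rule ex)
  then obtain v \<beta> \<tau> where w: "\<And>i::4. killing_fields (v i) (\<beta> i) (\<tau> i)"
    "\<And>i. v i p0 = axis i 1 $ 1" "\<And>i. \<beta> i p0 = axis i 1 $ 2" "\<And>i. \<tau> i p0 = axis i 1 $ 3"
    "\<And>i. D2 (\<beta> i) p0 + 2 * b p0 * v i p0 = axis i 1 $ 4" by metis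
  define \<phi> where "\<phi> c = (\<Sum>i\<in>UNIV. c $ i *\<^sub>R germ_at p0 (qform (v i) (\<beta> i) (\<tau> i)))" for c :: "real^4"
  have lin: "linear \<phi>"
    by (rule linearI) (simp_all add: \<phi>_def scaleR_left_distrib sum.distrib scaleR_sum_right)
  let ?v = "\<lambda>c x. \<Sum>i\<in>UNIV. c $ i * v i x" and ?\<beta> = "\<lambda>c x. \<Sum>i\<in>UNIV. c $ i * \<beta> i x" and ?\<tau> = "\<lambda>c x. \<Sum>i\<in>UNIV. c $ i * \<tau> i x"
  have \<phi>: "\<phi> c = germ_at p0 (qform (?v c) (?\<beta> c) (?\<tau> c))" for c
    unfolding \<phi>_def by (rule germ_qform_sum)
  have k: "killing_fields (?v c) (?\<beta> c) (?\<tau> c)" for c by (rule killing_fields_sum[OF w(1)])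
  have val: "?v c p0 = c $ 1" "?\<beta> c p0 = c $ 2" "?\<tau> c p0 = c $ 3" for c
    by (simp_all add: w(2-4) sum_4 axis_def)
  have s\<beta>: "smooth (\<beta> i)" for i using killing_fields_smooth[OF w(1)] by blast
  have val4: "D2 (?\<beta> c) p0 + 2 * b p0 * ?v c p0 = c $ 4" for c
  proof -
    have "D2 (?\<beta> c) p0 + 2 * b p0 * ?v c p0 = (\<Sum>i\<in>UNIV. c $ i * (D2 (\<beta> i) p0 + 2 * b p0 * v i p0))"
      unfolding sum_4 by (simp add: D_rules smooth_intros s\<beta> p0 algebra_simps)
    then show ?thesis by (simp add: w(5) sum_4 axis_def)
  qed
  obtain r where r: "r > 0" "ball p0 r \<subseteq> V" using open_V p0 open_contains_ball by blast
  have "c = 0" if c0: "\<phi> c = 0" for c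
  proof -
    obtain S where S: "open S" "p0 \<in> S" "S \<subseteq> V" and z: "\<forall>x\<in>S. ?v c x = 0 \<and> ?\<beta> c x = 0 \<and> ?\<tau> c x = 0"
      using germ_qform_eq_0[OF p0 c0[unfolded \<phi>]] by (elim exE conjE)
    interpret S: orthonormal_frame S g e1 by (rule orthonormal_frame_subset[OF S(1,3)])
    have "D2 (?\<beta> c) p0 = D2 (\<lambda>x. 0) p0" by (rule S.D_cong[OF S(2)]) (use z in auto)
    then have "D2 (?\<beta> c) p0 = 0" using S.D_const(2)[OF S(2)] by simp
    then show ?thesis using val[of c] val4[of c] bspec[OF z S(2)] by (simp add: vec_eq_iff forall_4)
  qed
  then have "inj \<phi>" using lin by (simp add: linear_injective_0)
  moreover have "range \<phi> \<subseteq> integral_germs g p0 2"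
  proof
    fix G assume "G \<in> range \<phi>"
    then obtain c where "G = \<phi> c" by blast
    moreover have "killing_on (ball p0 r) (?v c) (?\<beta> c) (?\<tau> c)"
      by (rule killing_on_subset[OF k open_ball r(2)])
    ultimately show "G \<in> integral_germs g p0 2"
      unfolding integral_germs_iff[OF p0] \<phi> using r by (intro exI[of _ "ball p0 r"]) auto
  qed
  ultimately show False using dim_ge_linear_inj[OF lin, of "integral_germs g p0 2"] d3 by simp
qed

text \<open>Representatives of a basis on a common convex neighbourhood. Independence of germs means
  that no nontrivial combination vanishes on any neighbourhood \<open>T\<close> of
  \<open>p0\<close>, however small.\<close>

theorem dim_3_killing_fields:
  assumes p0: "p0 \<in> V" and d: "dim (integral_germs g p0 2) = 3"
  obtains S v \<beta> \<tau> where "open S" "convex S" "p0 \<in> S" "S \<subseteq> V" "\<And>i::3. killing_on S (v i) (\<beta> i) (\<tau> i)"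
    "\<And>(c::real^3) T. open T \<Longrightarrow> p0 \<in> T \<Longrightarrow> (\<And>x. x \<in> T \<Longrightarrow> (\<Sum>i\<in>UNIV. c $ i * v i x) = 0 \<and> (\<Sum>i\<in>UNIV. c $ i * \<beta> i x) = 0 \<and> (\<Sum>i\<in>UNIV. c $ i * \<tau> i x) = 0) \<Longrightarrow> c = 0"
proof -
  obtain G where G: "\<And>i::3. G i \<in> integral_germs g p0 2" "\<And>c::real^3. (\<Sum>i\<in>UNIV. c $ i *\<^sub>R G i) = 0 \<Longrightarrow> c = 0"
    using dim_3_obtain[OF d] by blast
  have "\<forall>i. \<exists>S v \<beta> \<tau>. open S \<and> convex S \<and> p0 \<in> S \<and> S \<subseteq> V \<and> killing_on S v \<beta> \<tau> \<and> G i = germ_at p0 (qform v \<beta> \<tau>)"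
    using G(1) unfolding integral_germs_iff[OF p0] by blast
  then obtain S' v \<beta> \<tau> where S': "\<And>i. open (S' i)" "\<And>i. convex (S' i)" "\<And>i. p0 \<in> S' i" "\<And>i. S' i \<subseteq> V"
    and k: "\<And>i. killing_on (S' i) (v i) (\<beta> i) (\<tau> i)" and Gq: "\<And>i. G i = germ_at p0 (qform (v i) (\<beta> i) (\<tau> i))" by metis
  define S where "S = (\<Inter>i\<in>UNIV. S' i)"
  have S: "open S" "convex S" "p0 \<in> S" "S \<subseteq> V" "\<And>i. S \<subseteq> S' i"
    using S'(1-3) S'(4)[of 1] unfolding S_def by (auto intro: convex_INT)
  show thesis
  proof (rule that[OF S(1-4)])
    show "killing_on S (v i) (\<beta> i) (\<tau> i)" for i
    proof -
      interpret i: orthonormal_frame "S' i" g e1 by (rule orthonormal_frame_subset[OF S'(1,4)])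
      show ?thesis by (rule i.killing_on_subset[OF k S(1,5)])
    qed
    fix c :: "real^3" and T
    assume T: "open T" "p0 \<in> T" "\<And>x. x \<in> T \<Longrightarrow> (\<Sum>i\<in>UNIV. c $ i * v i x) = 0 \<and> (\<Sum>i\<in>UNIV. c $ i * \<beta> i x) = 0 \<and> (\<Sum>i\<in>UNIV. c $ i * \<tau> i x) = 0"
    have "(\<Sum>i\<in>UNIV. c $ i *\<^sub>R G i) = 0"
      unfolding Gq germ_qform_sum unfolding germ_at_zero[of p0] germ_at_eq_iff eventually_nhds
      using T by (intro exI[of _ T]) (auto simp: qform_def quadratic_def)
    then show "c = 0" by (rule G(2))
  qed
qed

end

section \<open>Prolongation of the Killing equation to a closed system of rank 6\<close>

text \<open>Fibre coordinates of the prolonged system: the components of the quadratic form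
  (trace \<open>\<tau>\<close> and trace-free part \<open>v\<close>, \<open>\<beta>\<close>), the two first-order jets
  and the one second-order jet that are not determined by the equation.\<close>

datatype jet = Jt | Jv | Jb | Jx | Jy | Jr

lemma UNIV_jet: "UNIV = {Jt, Jv, Jb, Jx, Jy, Jr}"
  using jet.exhaust by auto

instance jet :: finite
  by standard (simp add: UNIV_jet)

lemma sum_jet: "sum f (UNIV :: jet set) = f Jt + f Jv + f Jb + f Jx + f Jy + f Jr"
  by (simp add: UNIV_jet add.assoc)

context orthonormal_frame
begin

definition curv :: scalar_field where "curv = gauss_curvature g"

lemma curv_eq: "x \<in> V \<Longrightarrow> curv x = D2 a x - D1 b x - a x * a x - b x * b x"
  by (simp add: curv_def gauss_curvature_frame)

lemma smooth_curv [simp]: "smooth curv"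
proof -
  have "smooth (\<lambda>x. D2 a x - D1 b x - a x * a x - b x * b x)"
    by (intro smooth_intros smooth_D smooth_ab)
  then show ?thesis by (rule smooth_cong[THEN iffD2, rotated]) (rule curv_eq)
qed

lemma D2_a: "x \<in> V \<Longrightarrow> D2 a x = curv x + D1 b x + a x * a x + b x * b x"
  by (simp add: curv_eq)

text \<open>The form in which \<open>D_commutator\<close> is applied: once both frame derivatives of
  \<open>f\<close> are known expressions, it is an integrability condition on these.\<close>

lemma D_commute_eq:
  assumes f: "smooth f" and x: "x \<in> V" and D: "\<And>x. x \<in> V \<Longrightarrow> D1 f x = f1 x" "\<And>x. x \<in> V \<Longrightarrow> D2 f x = f2 x"
  shows "D1 f2 x - D2 f1 x = - a x * f1 x - b x * f2 x"
  using D_commutator[OF f x] D_cong(1)[OF x D(2)] D_cong(2)[OF x D(1)] D[OF x] by simp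

text \<open>\<open>jet_x\<close> and \<open>jet_y\<close> are the covariant derivatives of the
  trace-free part; \<open>jet_r\<close> is the one second-order jet that the equations leave
  free.\<close>

definition jet_x :: "scalar_field \<Rightarrow> scalar_field \<Rightarrow> scalar_field" where
  "jet_x v \<beta> x = D1 \<beta> x + 2 * a x * v x"

definition jet_y :: "scalar_field \<Rightarrow> scalar_field \<Rightarrow> scalar_field" where
  "jet_y v \<beta> x = D2 \<beta> x + 2 * b x * v x"

definition jet_r :: "scalar_field \<Rightarrow> scalar_field \<Rightarrow> scalar_field" where
  "jet_r v \<beta> x = D1 (jet_y v \<beta>) x - a x * jet_x v \<beta> x + curv x * v x"

context
  fixes v \<beta> \<tau> :: scalar_field
  assumes kf: "killing_fields v \<beta> \<tau>"
begin

private abbreviation X where "X \<equiv> jet_x v \<beta>"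
private abbreviation Y where "Y \<equiv> jet_y v \<beta>"
private abbreviation R where "R \<equiv> jet_r v \<beta>"

lemma killing_smooth: "smooth v" "smooth \<beta>" "smooth \<tau>" "smooth X" "smooth Y" "smooth R"
proof -
  show s: "smooth v" "smooth \<beta>" "smooth \<tau>" using killing_fields_smooth[OF kf] by auto
  show xy: "smooth X" "smooth Y" unfolding jet_x_def[abs_def] jet_y_def[abs_def]
    by (intro smooth_intros smooth_D smooth_ab s)+
  show "smooth R" unfolding jet_r_def[abs_def] by (intro smooth_intros smooth_D smooth_ab smooth_curv s xy)
qed

lemma killing_D_0:
  assumes "x \<in> V"
  shows "D1 v x = 2 * a x * \<beta> x + Y x" "D2 v x = 2 * b x * \<beta> x - X x"
    "D1 \<beta> x = X x - 2 * a x * v x" "D2 \<beta> x = Y x - 2 * b x * v x"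
    "D1 \<tau> x = - 2 * Y x" "D2 \<tau> x = - 2 * X x"
  using kf assms unfolding killing_fields_def jet_x_def jet_y_def by auto

text \<open>Compatibility of \<tau>, v and \<beta> gives three linear equations for the four
  derivatives of X and Y; the remaining freedom is R.\<close>

lemma killing_D_1:
  assumes x: "x \<in> V"
  shows "D1 X x = - curv x * \<beta> x - a x * Y x" "D2 Y x = - curv x * \<beta> x + b x * X x"
    "D1 Y x = a x * X x + R x - curv x * v x" "D2 X x = - b x * Y x + R x + curv x * v x"
proof -
  note s = killing_smooth
  note D = D_rules smooth_intros smooth_ab s x D_const
  have c\<tau>: "D1 (\<lambda>x. - 2 * X x) x - D2 (\<lambda>x. - 2 * Y x) x = - a x * (- 2 * Y x) - b x * (- 2 * X x)"
    by (rule D_commute_eq[OF s(3) x killing_D_0(5,6)])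
  have cv: "D1 (\<lambda>x. 2 * b x * \<beta> x - X x) x - D2 (\<lambda>x. 2 * a x * \<beta> x + Y x) x
      = - a x * (2 * a x * \<beta> x + Y x) - b x * (2 * b x * \<beta> x - X x)"
    by (rule D_commute_eq[OF s(1) x killing_D_0(1,2)])
  have cb: "D1 (\<lambda>x. Y x - 2 * b x * v x) x - D2 (\<lambda>x. X x - 2 * a x * v x) x
      = - a x * (X x - 2 * a x * v x) - b x * (Y x - 2 * b x * v x)"
    by (rule D_commute_eq[OF s(2) x killing_D_0(3,4)])
  have 1: "D1 X x - D2 Y x + a x * Y x + b x * X x = 0" using c\<tau> by (simp add: D algebra_simps)
  have 2: "D1 X x + D2 Y x + 2 * curv x * \<beta> x + a x * Y x - b x * X x = 0"
    using cv by (simp add: D killing_D_0 D2_a algebra_simps)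
  have 3: "D1 Y x - D2 X x - a x * X x - b x * Y x + 2 * curv x * v x = 0"
    using cb by (simp add: D killing_D_0 D2_a algebra_simps)
  show "D1 X x = - curv x * \<beta> x - a x * Y x" "D2 Y x = - curv x * \<beta> x + b x * X x" using 1 2 by algebra+
  show 4: "D1 Y x = a x * X x + R x - curv x * v x" by (simp add: jet_r_def)
  show "D2 X x = - b x * Y x + R x + curv x * v x" using 3 4 by algebra
qed

text \<open>Compatibility of X and Y determines both derivatives of R, and the prolongation closes
  here.\<close>

lemma killing_D_2:
  assumes x: "x \<in> V"
  shows "D1 R x = - 3 * curv x * Y x - D1 curv x * v x - D2 curv x * \<beta> x"
    "D2 R x = - 3 * curv x * X x - D1 curv x * \<beta> x + D2 curv x * v x"
proof -
  note s = killing_smooth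
  note D = D_rules smooth_intros smooth_ab smooth_curv s x D_const
  have cx: "D1 (\<lambda>x. - b x * Y x + R x + curv x * v x) x - D2 (\<lambda>x. - curv x * \<beta> x - a x * Y x) x
      = - a x * (- curv x * \<beta> x - a x * Y x) - b x * (- b x * Y x + R x + curv x * v x)"
    by (rule D_commute_eq[OF s(4) x killing_D_1(1,4)])
  have cy: "D1 (\<lambda>x. - curv x * \<beta> x + b x * X x) x - D2 (\<lambda>x. a x * X x + R x - curv x * v x) x
      = - a x * (a x * X x + R x - curv x * v x) - b x * (- curv x * \<beta> x + b x * X x)"
    by (rule D_commute_eq[OF s(5) x killing_D_1(3,2)])
  show "D1 R x = - 3 * curv x * Y x - D1 curv x * v x - D2 curv x * \<beta> x"
    using cx by (simp add: D killing_D_0 killing_D_1 D2_a algebra_simps)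
  show "D2 R x = - 3 * curv x * X x - D1 curv x * \<beta> x + D2 curv x * v x"
    using cy by (simp add: D killing_D_0 killing_D_1 D2_a algebra_simps)
qed

end

definition jet_M1 :: "jet \<Rightarrow> jet \<Rightarrow> scalar_field" where
  "jet_M1 i j = (case i of
      Jt \<Rightarrow> (case j of Jy \<Rightarrow> (\<lambda>x. -2) | _ \<Rightarrow> (\<lambda>x. 0))
    | Jv \<Rightarrow> (case j of Jb \<Rightarrow> (\<lambda>x. 2 * a x) | Jy \<Rightarrow> (\<lambda>x. 1) | _ \<Rightarrow> (\<lambda>x. 0))
    | Jb \<Rightarrow> (case j of Jv \<Rightarrow> (\<lambda>x. - 2 * a x) | Jx \<Rightarrow> (\<lambda>x. 1) | _ \<Rightarrow> (\<lambda>x. 0))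
    | Jx \<Rightarrow> (case j of Jb \<Rightarrow> (\<lambda>x. - curv x) | Jy \<Rightarrow> (\<lambda>x. - a x) | _ \<Rightarrow> (\<lambda>x. 0))
    | Jy \<Rightarrow> (case j of Jv \<Rightarrow> (\<lambda>x. - curv x) | Jx \<Rightarrow> a | Jr \<Rightarrow> (\<lambda>x. 1) | _ \<Rightarrow> (\<lambda>x. 0))
    | Jr \<Rightarrow> (case j of Jv \<Rightarrow> (\<lambda>x. - D1 curv x) | Jb \<Rightarrow> (\<lambda>x. - D2 curv x) | Jy \<Rightarrow> (\<lambda>x. - 3 * curv x) | _ \<Rightarrow> (\<lambda>x. 0)))"

definition jet_M2 :: "jet \<Rightarrow> jet \<Rightarrow> scalar_field" where
  "jet_M2 i j = (case i of
      Jt \<Rightarrow> (case j of Jx \<Rightarrow> (\<lambda>x. -2) | _ \<Rightarrow> (\<lambda>x. 0))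
    | Jv \<Rightarrow> (case j of Jb \<Rightarrow> (\<lambda>x. 2 * b x) | Jx \<Rightarrow> (\<lambda>x. -1) | _ \<Rightarrow> (\<lambda>x. 0))
    | Jb \<Rightarrow> (case j of Jv \<Rightarrow> (\<lambda>x. - 2 * b x) | Jy \<Rightarrow> (\<lambda>x. 1) | _ \<Rightarrow> (\<lambda>x. 0))
    | Jx \<Rightarrow> (case j of Jv \<Rightarrow> curv | Jy \<Rightarrow> (\<lambda>x. - b x) | Jr \<Rightarrow> (\<lambda>x. 1) | _ \<Rightarrow> (\<lambda>x. 0))
    | Jy \<Rightarrow> (case j of Jb \<Rightarrow> (\<lambda>x. - curv x) | Jx \<Rightarrow> b | _ \<Rightarrow> (\<lambda>x. 0))
    | Jr \<Rightarrow> (case j of Jv \<Rightarrow> D2 curv | Jb \<Rightarrow> (\<lambda>x. - D1 curv x) | Jx \<Rightarrow> (\<lambda>x. - 3 * curv x) | _ \<Rightarrow> (\<lambda>x. 0)))"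

lemma smooth_jet_M: "smooth (jet_M1 i j)" "smooth (jet_M2 i j)"
  unfolding jet_M1_def jet_M2_def
  by (auto split: jet.split intro!: smooth_intros)

text \<open>The six jets solve a homogeneous linear total differential system, so they vanish
  throughout a convex domain once they vanish at a point.\<close>

lemma killing_fields_unique:
  assumes kf: "killing_fields v \<beta> \<tau>" and V: "convex V" and x0: "x0 \<in> V"
    and z: "v x0 = 0" "\<beta> x0 = 0" "\<tau> x0 = 0" "jet_x v \<beta> x0 = 0" "jet_y v \<beta> x0 = 0" "jet_r v \<beta> x0 = 0"
    and x: "x \<in> V"
  shows "v x = 0 \<and> \<beta> x = 0 \<and> \<tau> x = 0"
proof -
  define W where "W i = (case i of Jt \<Rightarrow> \<tau> | Jv \<Rightarrow> v | Jb \<Rightarrow> \<beta> | Jx \<Rightarrow> jet_x v \<beta> | Jy \<Rightarrow> jet_y v \<beta> | Jr \<Rightarrow> jet_r v \<beta>)" for i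
  have "W i x = 0" for i
  proof (rule frame_system_unique[OF V smooth_jet_M _ _ _ x0 _ x])
    show "smooth (W i)" for i using killing_smooth[OF kf] by (cases i) (auto simp: W_def)
    show "D1 (W i) y = (\<Sum>j\<in>UNIV. jet_M1 i j y * W j y)" if "y \<in> V" for i y
      unfolding sum_jet by (cases i) (simp_all add: W_def jet_M1_def killing_D_0[OF kf that] killing_D_1[OF kf that] killing_D_2[OF kf that])
    show "D2 (W i) y = (\<Sum>j\<in>UNIV. jet_M2 i j y * W j y)" if "y \<in> V" for i y
      unfolding sum_jet by (cases i) (simp_all add: W_def jet_M2_def killing_D_0[OF kf that] killing_D_1[OF kf that] killing_D_2[OF kf that])
    show "W i x0 = 0" for i using z by (cases i) (auto simp: W_def)
  qed
  from this[of Jv] this[of Jb] this[of Jt] show ?thesis by (simp add: W_def)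
qed

text \<open>With dK = 0 the prolonged system is flat and all six jets at \<open>p0\<close> can be
  prescribed; four of them already exclude dimension 3.\<close>

theorem dim_constant_curvature:
  assumes p0: "p0 \<in> V" and K: "\<And>x. x \<in> V \<Longrightarrow> D1 curv x = 0" "\<And>x. x \<in> V \<Longrightarrow> D2 curv x = 0"
  shows "dim (integral_germs g p0 2) \<noteq> 3"
proof -
  have DDK: "D1 (D2 curv) x = 0" "D2 (D1 curv) x = 0" "D1 (D1 curv) x = 0" "D2 (D2 curv) x = 0" if "x \<in> V" for x
    using D_cong[OF that, of "D1 curv" "\<lambda>x. 0"] D_cong[OF that, of "D2 curv" "\<lambda>x. 0"] K that by auto
  have flat: "D1 (jet_M2 i j) x - D2 (jet_M1 i j) x
      + (\<Sum>k\<in>UNIV. jet_M2 i k x * jet_M1 k j x - jet_M1 i k x * jet_M2 k j x) + a x * jet_M1 i j x + b x * jet_M2 i j x = 0"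
    if x: "x \<in> V" for x i j
  proof -
    have s: "smooth (D1 curv)" "smooth (D2 curv)" by auto
    show ?thesis unfolding sum_jet
      by (cases i; cases j) (simp_all add: jet_M1_def jet_M2_def D_rules smooth_intros s x D_const K DDK D2_a algebra_simps)
  qed
  obtain S where S: "open S" "convex S" "p0 \<in> S" "S \<subseteq> V"
    and ex: "\<And>c. \<exists>W. (\<forall>i. smooth_on S (W i)) \<and> (\<forall>i. W i p0 = c i) \<and>
       (\<forall>i. \<forall>x\<in>S. D1 (W i) x = (\<Sum>j\<in>UNIV. jet_M1 i j x * W j x) \<and> D2 (W i) x = (\<Sum>j\<in>UNIV. jet_M2 i j x * W j x))"
    using frame_frobenius[OF p0 smooth_jet_M flat] by blast
  interpret S: orthonormal_frame S g e1 by (rule orthonormal_frame_subset[OF S(1,4)])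
  show ?thesis
  proof (rule S.dim_integral_germs_neq_3[OF S(3)])
    fix v0 b0 t0 y0 :: real
    define c where "c i = (case i of Jt \<Rightarrow> t0 | Jv \<Rightarrow> v0 | Jb \<Rightarrow> b0 | Jy \<Rightarrow> y0 | _ \<Rightarrow> 0)" for i
    obtain W where W: "\<And>i. S.smooth (W i)" "\<And>i. W i p0 = c i"
       "\<And>i x. x \<in> S \<Longrightarrow> D1 (W i) x = (\<Sum>j\<in>UNIV. jet_M1 i j x * W j x)"
       "\<And>i x. x \<in> S \<Longrightarrow> D2 (W i) x = (\<Sum>j\<in>UNIV. jet_M2 i j x * W j x)"
      using ex[of c] by blast
    have "S.killing_fields (W Jv) (W Jb) (W Jt)"
      unfolding S.killing_fields_def using W(1)
      by (simp add: W(3,4) sum_jet jet_M1_def jet_M2_def)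
    moreover have "D2 (W Jb) p0 + 2 * b p0 * W Jv p0 = y0"
      using S(3) by (simp add: W(4) sum_jet jet_M2_def W(2) c_def)
    ultimately show "\<exists>v \<beta> \<tau>. S.killing_fields v \<beta> \<tau> \<and> v p0 = v0 \<and> \<beta> p0 = b0 \<and> \<tau> p0 = t0 \<and> D2 \<beta> p0 + 2 * b p0 * v p0 = y0"
      using W(2) by (intro exI[of _ "W Jv"] exI[of _ "W Jb"] exI[of _ "W Jt"]) (auto simp: c_def)
  qed
qed

end

section \<open>The frame along grad K and the components of the covariant derivatives of K\<close>

context orthonormal_frame
begin

lemma metric_inner_grad:
  assumes x: "x \<in> V"
  shows "metric_inner g x (grad g f x) w = w $ 1 * pd 1 f x + w $ 2 * pd 2 f x"
proof -
  have "metric_inner g x (grad g f x) w = metric_inner g x w (grad g f x)" by (rule metric_inner_commute[OF x])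
  also have "\<dots> = (\<Sum>i\<in>UNIV. w $ i * (\<Sum>l\<in>UNIV. (\<Sum>k\<in>UNIV. g x $ i $ k * matrix_inv (g x) $ k $ l) * pd l f x))"
    by (simp add: metric_inner_expand grad_def matrix_vector_mult_def sum_2 algebra_simps)
  finally show ?thesis by (simp add: matrix_inv_metric[OF x] sum_2)
qed

lemma grad_frame:
  assumes f: "smooth f" and x: "x \<in> V"
  shows "grad g f x = D1 f x *\<^sub>R e1 x + D2 f x *\<^sub>R e2 x"
  using frame_expand[OF x, of "grad g f x"] by (simp add: metric_inner_grad[OF x] D_coordinate[OF f x])

lemma inv3_frame: "x \<in> V \<Longrightarrow> inv3 g x = D1 curv x * D1 curv x + D2 curv x * D2 curv x"
  unfolding inv3_def Let_def curv_def[symmetric]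
  by (simp add: grad_frame metric_inner_linear orthonormal)

lemma smooth_grad: "smooth f \<Longrightarrow> smooth_field (grad g f)"
proof -
  assume f: "smooth f"
  have "smooth (\<lambda>x. D1 f x * e1 x $ i + D2 f x * e2 x $ i)" for i
    using smooth_e1 smooth_e2 f by (intro smooth_intros smooth_D) (auto simp: smooth_field_def)
  then have "smooth (\<lambda>x. grad g f x $ i)" for i
    by (rule smooth_cong[THEN iffD2, rotated]) (simp add: grad_frame[OF f])
  then show ?thesis by (simp add: smooth_field_def)
qed

end

context riemannian_chart
begin

lemma orthonormal_frame_normalize:
  assumes X: "smooth_field X" "\<And>x. x \<in> V \<Longrightarrow> X x \<noteq> 0"
  shows "orthonormal_frame V g (\<lambda>x. (1 / sqrt (metric_inner g x (X x) (X x))) *\<^sub>R X x)"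
proof
  have pos: "metric_inner g x (X x) (X x) > 0" if "x \<in> V" for x
    unfolding metric_inner_def by (rule metric_pos[OF that X(2)[OF that]])
  have n0: "sqrt (metric_inner g x (X x) (X x)) \<noteq> 0" if "x \<in> V" for x using pos[OF that] by simp
  have "smooth (\<lambda>x. X x $ i / sqrt (metric_inner g x (X x) (X x)))" for i
    using X(1) by (intro smooth_on_divide[OF open_V _ smooth_on_sqrt[OF open_V smooth_metric_inner[OF X(1) X(1)] pos] n0])
      (simp_all add: smooth_field_def)
  then show "smooth_field (\<lambda>x. (1 / sqrt (metric_inner g x (X x) (X x))) *\<^sub>R X x)"
    by (simp add: smooth_field_def)
  show "metric_inner g x ((1 / sqrt (metric_inner g x (X x) (X x))) *\<^sub>R X x) ((1 / sqrt (metric_inner g x (X x) (X x))) *\<^sub>R X x) = 1"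
    if "x \<in> V" for x
  proof -
    have "sqrt (metric_inner g x (X x) (X x)) * sqrt (metric_inner g x (X x) (X x)) = metric_inner g x (X x) (X x)"
      using pos[OF that] by simp
    then show ?thesis using pos[OF that] n0[OF that] by (simp add: metric_inner_linear field_simps)
  qed
qed

lemma orthonormal_frame_exists: "\<exists>e. orthonormal_frame V g e"
proof -
  have "smooth_field (coord_field 1)" unfolding smooth_field_def coord_field_def by (intro allI smooth_intros)
  moreover have "coord_field 1 x \<noteq> 0" for x by (simp add: coord_field_def axis_eq_0_iff)
  ultimately show ?thesis using orthonormal_frame_normalize by blast
qed

lemma riemannian_chart_subset: "open S \<Longrightarrow> S \<subseteq> V \<Longrightarrow> riemannian_chart S g"
  using metric smooth_on_subset[of V _ S] unfolding riemannian_metric_on_def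
  by unfold_locales (auto simp: riemannian_metric_on_def)

end

text \<open>The two conditions say that \<open>e1\<close> is grad K divided by its length, and hence
  \<open>e2\<close> is sgrad K divided by its length.\<close>

locale gradient_frame = orthonormal_frame +
  assumes D1_curv_pos: "\<And>x. x \<in> V \<Longrightarrow> D1 curv x > 0" and D2_curv: "\<And>x. x \<in> V \<Longrightarrow> D2 curv x = 0"
begin

text \<open>\<open>k\<close> is |grad K|; \<open>h\<close>, \<open>t\<close>, \<open>q\<close> are
  the components of the second, third and fourth covariant derivatives of K, with the
  \<open>e1\<close> slots first, as in the invariants. The numbering starts at 1 with no slot
  \<open>e2\<close>.\<close>

definition k :: scalar_field where "k = D1 curv"
definition h1 :: scalar_field where "h1 = comp curv [False, False]"
definition h2 :: scalar_field where "h2 = comp curv [False, True]"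
definition h3 :: scalar_field where "h3 = comp curv [True, True]"
definition t1 :: scalar_field where "t1 = comp curv [False, False, False]"
definition t2 :: scalar_field where "t2 = comp curv [False, False, True]"
definition t3 :: scalar_field where "t3 = comp curv [False, True, True]"
definition t4 :: scalar_field where "t4 = comp curv [True, True, True]"
definition q1 :: scalar_field where "q1 = comp curv [False, False, False, False]"
definition q2 :: scalar_field where "q2 = comp curv [False, False, False, True]"
definition q3 :: scalar_field where "q3 = comp curv [False, False, True, True]"
definition q4 :: scalar_field where "q4 = comp curv [False, True, True, True]"

lemma smooth_comps [simp]: "smooth k" "smooth h1" "smooth h2" "smooth h3" "smooth t1" "smooth t2" "smooth t3" "smooth t4"
  unfolding k_def h1_def h2_def h3_def t1_def t2_def t3_def t4_def by auto

lemma k_pos: "x \<in> V \<Longrightarrow> k x > 0"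
  by (simp add: k_def D1_curv_pos)

lemma comp_1: "x \<in> V \<Longrightarrow> comp curv [False] x = k x" "x \<in> V \<Longrightarrow> comp curv [True] x = 0"
  by (simp_all add: comp_frame[OF smooth_curv] k_def D2_curv)

lemma comp_expand_2:
  assumes x: "x \<in> V"
  shows "comp curv [False, p] x = D1 (comp curv [p]) x - a x * ((if p then -1 else 1) * comp curv [\<not> p] x)"
    "comp curv [True, p] x = D2 (comp curv [p]) x - b x * ((if p then -1 else 1) * comp curv [\<not> p] x)"
  using comp_frame[OF smooth_curv x, of "[p]"] by simp_all

lemma comp_expand_3:
  assumes x: "x \<in> V"
  shows "comp curv [False, p, q] x = D1 (comp curv [p, q]) x
      - a x * ((if p then -1 else 1) * comp curv [\<not> p, q] x + (if q then -1 else 1) * comp curv [p, \<not> q] x)"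
    "comp curv [True, p, q] x = D2 (comp curv [p, q]) x
      - b x * ((if p then -1 else 1) * comp curv [\<not> p, q] x + (if q then -1 else 1) * comp curv [p, \<not> q] x)"
  using comp_frame[OF smooth_curv x, of "[p, q]"] by (simp_all only: list.size lessThan_Suc One_nat_def add_0_right add_Suc_right) (simp_all add: add.commute)

lemma comp_expand_4:
  assumes x: "x \<in> V"
  shows "comp curv [False, p, q, r] x = D1 (comp curv [p, q, r]) x
      - a x * ((if p then -1 else 1) * comp curv [\<not> p, q, r] x + (if q then -1 else 1) * comp curv [p, \<not> q, r] x
        + (if r then -1 else 1) * comp curv [p, q, \<not> r] x)"
  using comp_frame(1)[OF smooth_curv x, of "[p, q, r]"] by (simp only: list.size lessThan_Suc One_nat_def add_0_right add_Suc_right) (simp add: add_ac)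

lemma D_curv: "x \<in> V \<Longrightarrow> D1 curv x = k x" "x \<in> V \<Longrightarrow> D2 curv x = 0"
  by (simp_all add: k_def D2_curv)

text \<open>Since D2 K vanishes identically, the Hessian components involving \<open>e2\<close>
  reduce to connection terms: \<open>a\<close> and \<open>b\<close> are \<open>h2 / k\<close> and
  \<open>h3 / k\<close>. The derivative of \<open>k\<close> along \<open>e2\<close> comes from
  commuting derivatives of K.\<close>

lemma connection_k:
  assumes x: "x \<in> V"
  shows "h1 x = D1 k x" "h2 x = a x * k x" "comp curv [True, False] x = D2 k x" "h3 x = b x * k x" "D2 k x = a x * k x"
proof -
  have c: "D1 (comp curv [False]) x = D1 k x" "D2 (comp curv [False]) x = D2 k x"
    "D1 (comp curv [True]) x = 0" "D2 (comp curv [True]) x = 0"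
    using D_cong[OF x comp_1(1)] D_cong[OF x comp_1(2)] D_const[OF x] by simp_all
  show "h1 x = D1 k x" "h2 x = a x * k x" "comp curv [True, False] x = D2 k x" "h3 x = b x * k x"
    unfolding h1_def h2_def h3_def
    using comp_expand_2[OF x, of False] comp_expand_2[OF x, of True] by (simp_all add: c comp_1 x)
  show "D2 k x = a x * k x"
    using D_commute_eq[OF smooth_curv x D_curv] x by simp
qed

lemma comp_2:
  assumes x: "x \<in> V"
  shows "comp curv [False, False] x = h1 x" "comp curv [False, True] x = h2 x"
    "comp curv [True, False] x = h2 x" "comp curv [True, True] x = h3 x"
  using connection_k[OF x] by (simp_all add: h1_def h2_def h3_def)

lemma D_k: "x \<in> V \<Longrightarrow> D1 k x = h1 x" "x \<in> V \<Longrightarrow> D2 k x = h2 x"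
  using connection_k by simp_all

lemma D_comp_2:
  assumes x: "x \<in> V"
  shows "D1 (comp curv [False, False]) x = D1 h1 x" "D2 (comp curv [False, False]) x = D2 h1 x"
    "D1 (comp curv [False, True]) x = D1 h2 x" "D2 (comp curv [False, True]) x = D2 h2 x"
    "D1 (comp curv [True, False]) x = D1 h2 x" "D2 (comp curv [True, False]) x = D2 h2 x"
    "D1 (comp curv [True, True]) x = D1 h3 x" "D2 (comp curv [True, True]) x = D2 h3 x"
  using D_cong[OF x comp_2(1)] D_cong[OF x comp_2(2)] D_cong[OF x comp_2(3)] D_cong[OF x comp_2(4)] by simp_all

text \<open>The derivatives along \<open>e1\<close> and \<open>D2 h3\<close> are read off from the
  components. \<open>D2 h1\<close> comes from commuting derivatives of \<open>k\<close>, and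
  \<open>D2 h2\<close> from differentiating \<open>a k = h2\<close> and \<open>b k = h3\<close> with
  the curvature equation; its term \<open>curv x * k x\<close> is the Ricci identity.\<close>

lemma D_h:
  assumes x: "x \<in> V"
  shows "D1 h1 x = t1 x + 2 * a x * h2 x" "D1 h2 x = t2 x + a x * h3 x - a x * h1 x" "D1 h3 x = t3 x - 2 * a x * h2 x"
    "D2 h1 x = t2 x + 2 * b x * h2 x" "D2 h2 x = t3 x + curv x * k x + b x * (h3 x - h1 x)" "D2 h3 x = t4 x - 2 * b x * h2 x"
proof -
  show 1: "D1 h1 x = t1 x + 2 * a x * h2 x" "D1 h2 x = t2 x + a x * h3 x - a x * h1 x" "D1 h3 x = t3 x - 2 * a x * h2 x"
    "D2 h3 x = t4 x - 2 * b x * h2 x"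
    unfolding t1_def t2_def t3_def t4_def
    using comp_expand_3(1)[OF x, of False False] comp_expand_3(1)[OF x, of False True]
      comp_expand_3(1)[OF x, of True True] comp_expand_3(2)[OF x, of True True]
    by (simp_all add: D_comp_2[OF x] comp_2[OF x] algebra_simps)
  have ab: "a x * k x = h2 x" "b x * k x = h3 x" using connection_k[OF x] by simp_all
  have "D1 h2 x - D2 h1 x = - a x * h1 x - b x * h2 x"
    by (rule D_commute_eq[OF _ x D_k]) simp
  moreover have "a x * h3 x = b x * h2 x" using connection_k[OF x] by simp
  ultimately show "D2 h1 x = t2 x + 2 * b x * h2 x" using 1 by algebra
  have d: "D1 h3 x = D1 (\<lambda>x. b x * k x) x" "D2 h2 x = D2 (\<lambda>x. a x * k x) x"
    by (rule D_cong[OF x], simp add: connection_k)+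
  have "D1 h3 x = b x * h1 x + D1 b x * k x" "D2 h2 x = a x * h2 x + D2 a x * k x"
    unfolding d by (simp_all add: D_rules x D_k)
  then show "D2 h2 x = t3 x + curv x * k x + b x * (h3 x - h1 x)"
    using 1(3) D2_a[OF x] ab by algebra
qed

lemma comp_3:
  assumes x: "x \<in> V"
  shows "comp curv [False, False, False] x = t1 x" "comp curv [False, False, True] x = t2 x"
    "comp curv [False, True, False] x = t2 x" "comp curv [True, False, False] x = t2 x"
    "comp curv [False, True, True] x = t3 x" "comp curv [True, False, True] x = t3 x + curv x * k x"
    "comp curv [True, True, False] x = t3 x + curv x * k x" "comp curv [True, True, True] x = t4 x"
  using comp_expand_3[OF x, of False False] comp_expand_3[OF x, of False True]
    comp_expand_3[OF x, of True False] comp_expand_3[OF x, of True True]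
  by (simp_all add: D_comp_2[OF x] comp_2[OF x] D_h[OF x] algebra_simps)

lemma D_comp_3:
  assumes x: "x \<in> V"
  shows "D1 (comp curv [False, False, False]) x = D1 t1 x" "D1 (comp curv [False, False, True]) x = D1 t2 x"
    "D1 (comp curv [False, True, True]) x = D1 t3 x" "D1 (comp curv [True, True, True]) x = D1 t4 x"
  by (simp_all add: t1_def t2_def t3_def t4_def)

lemma D1_t:
  assumes x: "x \<in> V"
  shows "D1 t1 x = q1 x + 3 * a x * t2 x" "D1 t2 x = q2 x + a x * (2 * t3 x + curv x * k x) - a x * t1 x"
    "D1 t3 x = q3 x + a x * t4 x - 2 * a x * t2 x" "D1 t4 x = q4 x - a x * (3 * t3 x + 2 * curv x * k x)"
  unfolding q1_def q2_def q3_def q4_def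
  using comp_expand_4[OF x, of False False False] comp_expand_4[OF x, of False False True]
    comp_expand_4[OF x, of False True True] comp_expand_4[OF x, of True True True]
  by (simp_all add: D_comp_3[OF x] comp_3[OF x] algebra_simps)

text \<open>Commuting derivatives of \<open>h1\<close>, \<open>h2\<close>, \<open>h3\<close> one
  order higher; the curvature terms enter through \<open>D2_a\<close>.\<close>

lemma D2_t:
  assumes x: "x \<in> V"
  shows "D2 t1 x = q2 x - 3 * curv x * h2 x + 3 * b x * t2 x"
    "D2 t2 x = q3 x + 2 * curv x * h1 x + k x * k x - b x * t1 x + 2 * b x * t3 x"
    "D2 t3 x = q4 x + 2 * curv x * h2 x - 2 * b x * t2 x + b x * t4 x"
proof -
  note D = D_rules smooth_intros smooth_ab smooth_curv x D_const
  have ab: "a x * k x = h2 x" "b x * k x = h3 x" "a x * h3 x = b x * h2 x" using connection_k[OF x] by simp_all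
  have "D1 (\<lambda>x. t2 x + 2 * b x * h2 x) x - D2 (\<lambda>x. t1 x + 2 * a x * h2 x) x
     = - a x * (t1 x + 2 * a x * h2 x) - b x * (t2 x + 2 * b x * h2 x)"
    by (rule D_commute_eq[OF _ x D_h(1,4)]) simp
  then have 1: "D1 t2 x + 2 * (b x * D1 h2 x + D1 b x * h2 x) - (D2 t1 x + 2 * (a x * D2 h2 x + D2 a x * h2 x))
     = - a x * (t1 x + 2 * a x * h2 x) - b x * (t2 x + 2 * b x * h2 x)"
    by (simp add: D algebra_simps)
  show "D2 t1 x = q2 x - 3 * curv x * h2 x + 3 * b x * t2 x"
    using 1 D1_t(2)[OF x] D_h(2,5)[OF x] D2_a[OF x] ab by algebra
  have "D1 (\<lambda>x. t3 x + curv x * k x + b x * (h3 x - h1 x)) x - D2 (\<lambda>x. t2 x + a x * h3 x - a x * h1 x) x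
     = - a x * (t2 x + a x * h3 x - a x * h1 x) - b x * (t3 x + curv x * k x + b x * (h3 x - h1 x))"
    by (rule D_commute_eq[OF _ x D_h(2,5)]) simp
  then have 2: "D1 t3 x + curv x * D1 k x + D1 curv x * k x + b x * (D1 h3 x - D1 h1 x) + D1 b x * (h3 x - h1 x)
     - (D2 t2 x + a x * D2 h3 x + D2 a x * h3 x - (a x * D2 h1 x + D2 a x * h1 x))
     = - a x * (t2 x + a x * h3 x - a x * h1 x) - b x * (t3 x + curv x * k x + b x * (h3 x - h1 x))"
    by (simp add: D algebra_simps)
  show "D2 t2 x = q3 x + 2 * curv x * h1 x + k x * k x - b x * t1 x + 2 * b x * t3 x"
    using 2 D1_t(3)[OF x] D_h[OF x] D_k[OF x] D_curv[OF x] D2_a[OF x] ab by algebra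
  have "D1 (\<lambda>x. t4 x - 2 * b x * h2 x) x - D2 (\<lambda>x. t3 x - 2 * a x * h2 x) x
     = - a x * (t3 x - 2 * a x * h2 x) - b x * (t4 x - 2 * b x * h2 x)"
    by (rule D_commute_eq[OF _ x D_h(3,6)]) simp
  then have 3: "D1 t4 x - 2 * (b x * D1 h2 x + D1 b x * h2 x) - (D2 t3 x - 2 * (a x * D2 h2 x + D2 a x * h2 x))
     = - a x * (t3 x - 2 * a x * h2 x) - b x * (t4 x - 2 * b x * h2 x)"
    by (simp add: D algebra_simps)
  show "D2 t3 x = q4 x + 2 * curv x * h2 x - 2 * b x * t2 x + b x * t4 x"
    using 3 D1_t(4)[OF x] D_h(2,5)[OF x] D2_a[OF x] ab by algebra
qed

lemma grad_sgrad_curv: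
  assumes x: "x \<in> V"
  shows "grad g curv x = k x *\<^sub>R e1 x" "sgrad g curv x = k x *\<^sub>R e2 x"
proof -
  show 1: "grad g curv x = k x *\<^sub>R e1 x" using grad_frame[OF smooth_curv x] by (simp add: D_curv x)
  show "sgrad g curv x = k x *\<^sub>R e2 x"
    by (simp add: sgrad_def 1 e2_def rot90_def matrix_vector_mult_scaleR vec_eq_iff forall_2)
qed

lemma inv3_eq: "x \<in> V \<Longrightarrow> inv3 g x = k x ^ 2"
  by (simp add: inv3_frame D_curv power2_eq_square)

text \<open>The arguments are grad K = k e1 and sgrad K = k e2, so tensoriality extracts one factor
  \<open>k\<close> from each slot.\<close>

lemma dinv_eq_comp:
  assumes x: "x \<in> V"
  shows "dinv g i j x = k x ^ (i - 2 - j + j) * comp curv (replicate (i - 2 - j) False @ replicate j True) x"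
proof -
  let ?fs = "map frame (replicate (i - 2 - j) False @ replicate j True)"
  have "dinv g i j x = cov_differential g curv (replicate (i - 2 - j) (grad g curv) @ replicate j (sgrad g curv)) x"
    by (simp add: dinv_def Let_def curv_def)
  also have "\<dots> = cov_differential g curv (map (\<lambda>Y x. k x *\<^sub>R Y x) ?fs) x"
    by (rule cov_differential_cong[OF _ _ x])
       (auto simp: nth_append frame_def grad_sgrad_curv)
  also have "\<dots> = k x ^ length ?fs * cov_differential g curv ?fs x"
  proof -
    have sf: "\<forall>X\<in>set ?fs. smooth_field X" by (auto simp: smooth_frame)
    show ?thesis
      using cov_differential_scale[OF smooth_curv smooth_comps(1) x _ sf, of "[]"] unfolding append_Nil by simp
  qed
  finally show ?thesis by (simp add: comp_def)
qed

lemma dinv_eq: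
  assumes x: "x \<in> V"
  shows "dinv g 4 0 x = k x ^ 2 * h1 x" "dinv g 4 1 x = k x ^ 2 * h2 x" "dinv g 4 2 x = k x ^ 2 * h3 x"
    "dinv g 5 0 x = k x ^ 3 * t1 x" "dinv g 5 1 x = k x ^ 3 * t2 x" "dinv g 5 2 x = k x ^ 3 * t3 x" "dinv g 5 3 x = k x ^ 3 * t4 x"
    "dinv g 6 0 x = k x ^ 4 * q1 x" "dinv g 6 1 x = k x ^ 4 * q2 x" "dinv g 6 2 x = k x ^ 4 * q3 x" "dinv g 6 3 x = k x ^ 4 * q4 x"
  unfolding dinv_eq_comp[OF x] h1_def h2_def h3_def t1_def t2_def t3_def t4_def q1_def q2_def q3_def q4_def
  by (simp_all add: eval_nat_numeral)

end

lemma (in riemannian_chart) gradient_frame_exists: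
  assumes "\<And>x. x \<in> V \<Longrightarrow> inv3 g x \<noteq> 0"
  shows "\<exists>e. gradient_frame V g e"
proof -
  obtain e where "orthonormal_frame V g e" using orthonormal_frame_exists by blast
  then interpret e: orthonormal_frame V g e .
  let ?G = "grad g (gauss_curvature g)"
  have G0: "?G x \<noteq> 0" if "x \<in> V" for x
    using assms[OF that] by (auto simp: inv3_def Let_def metric_inner_expand)
  let ?e = "\<lambda>x. (1 / sqrt (metric_inner g x (?G x) (?G x))) *\<^sub>R ?G x"
  have sG: "smooth_field ?G" using e.smooth_grad[OF e.smooth_curv] by (simp add: e.curv_def)
  interpret f: orthonormal_frame V g ?e by (rule orthonormal_frame_normalize[OF sG G0])
  have c: "e.curv = f.curv" by (simp add: e.curv_def f.curv_def)
  have "gradient_frame V g ?e"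
  proof
    fix x assume x: "x \<in> V"
    let ?n = "sqrt (metric_inner g x (?G x) (?G x))"
    have n: "?n > 0" using metric_pos[OF x G0[OF x]] by (simp add: metric_inner_def)
    have G: "metric_inner g x (?G x) w = ?n * metric_inner g x (?e x) w" for w
      using n by (simp add: metric_inner_linear)
    have eq: "metric_inner g x (?G x) w = dir_deriv W f.curv x" if "W x = w" for W w
      using that by (simp add: f.metric_inner_grad[OF x] dir_deriv_smooth[OF f.smooth_curv x] flip: f.curv_def)
    have "f.D1 f.curv x = metric_inner g x (?G x) (?e x)" unfolding f.D1_def by (rule eq[symmetric, OF refl])
    also have "\<dots> = ?n * metric_inner g x (?e x) (?e x)" by (rule G)
    finally show "f.D1 f.curv x > 0" using n f.orthonormal(1)[OF x] by simp
    have "f.D2 f.curv x = metric_inner g x (?G x) (f.e2 x)" unfolding f.D2_def by (rule eq[symmetric, OF refl])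
    also have "\<dots> = ?n * metric_inner g x (?e x) (f.e2 x)" by (rule G)
    finally show "f.D2 f.curv x = 0" using f.orthonormal(2)[OF x] by simp
  qed
  then show ?thesis by blast
qed

section \<open>Polynomial identities behind the four relations\<close>

text \<open>The four relations of the theorem, in the components of \<open>\<nabla>\<^sup>lK\<close> with respect to the
  orthonormal frame \<open>grad K / k\<close>, \<open>sgrad K / k\<close>, after clearing the denominator and dividing by \<open>k\<^sup>8\<close>.\<close>

definition rel_a :: "real \<Rightarrow> real \<Rightarrow> real \<Rightarrow> real \<Rightarrow> real \<Rightarrow> real \<Rightarrow> real \<Rightarrow> real \<Rightarrow> real \<Rightarrow> real \<Rightarrow> real" where
  "rel_a K k h1 h2 h3 t1 t2 t3 t4 q1 =
    -1550 * K * h1 * h2 * k^2 + 900 * K * h2 * h3 * k^2 + 825 * K * k^3 * t2 - 258 * h1 * h2 * h3^2 - 215 * h1 * h2 * k * t1 + 40 * h1 * h2 * k * t3 - 294 * h1 * h2^3 - 105 * h1 * h3 * k * t2 +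
    258 * h1^2 * h2 * h3 + 240 * h1^2 * k * t2 - 36 * h1^3 * h2 - 110 * h2 * h3 * k * t1 + 460 * h2 * h3 * k * t3 + 36 * h2 * h3^3 + 175 * h2 * k^2 * q1 - 700 * h2 * k^4 + 140 * h2^2 * k * t2 -
    385 * h2^2 * k * t4 + 294 * h2^3 * h3 - 135 * h3^2 * k * t2 - 200 * k^2 * t1 * t2 + 25 * k^2 * t2 * t3"

definition rel_b :: "real \<Rightarrow> real \<Rightarrow> real \<Rightarrow> real \<Rightarrow> real \<Rightarrow> real \<Rightarrow> real \<Rightarrow> real \<Rightarrow> real \<Rightarrow> real \<Rightarrow> real" where
  "rel_b K k h1 h2 h3 t1 t2 t3 t4 q2 =
    -1505 * K * h2^2 * k^2 + 330 * h1 * h2 * k * t2 + 444 * h1 * h2^2 * h3 - 72 * h1^2 * h2^2 - 405 * h2 * h3 * k * t2 + 175 * h2 * k^2 * q2 - 72 * h2^2 * h3^2 - 245 * h2^2 * k * t1 +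
    490 * h2^2 * k * t3 - 588 * h2^4 - 225 * k^2 * t2^2"

definition rel_c :: "real \<Rightarrow> real \<Rightarrow> real \<Rightarrow> real \<Rightarrow> real \<Rightarrow> real \<Rightarrow> real \<Rightarrow> real \<Rightarrow> real \<Rightarrow> real \<Rightarrow> real" where
  "rel_c K k h1 h2 h3 t1 t2 t3 t4 q3 =
    500 * K * h1 * h2 * k^2 - 900 * K * h2 * h3 * k^2 - 300 * K * k^3 * t2 + 258 * h1 * h2 * h3^2 - 30 * h1 * h2 * k * t1 + 30 * h1 * h2 * k * t3 + 294 * h1 * h2^3 + 210 * h1 * h3 * k * t2 -
    258 * h1^2 * h2 * h3 - 30 * h1^2 * k * t2 + 36 * h1^3 * h2 + 5 * h2 * h3 * k * t1 + 170 * h2 * h3 * k * t3 - 36 * h2 * h3^3 + 175 * h2 * k^2 * q3 + 175 * h2 * k^4 - 280 * h2^2 * k * t2 +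
    35 * h2^2 * k * t4 - 294 * h2^3 * h3 - 180 * h3^2 * k * t2 + 25 * k^2 * t1 * t2 - 200 * k^2 * t2 * t3"

definition rel_d :: "real \<Rightarrow> real \<Rightarrow> real \<Rightarrow> real \<Rightarrow> real \<Rightarrow> real \<Rightarrow> real \<Rightarrow> real \<Rightarrow> real \<Rightarrow> real \<Rightarrow> real" where
  "rel_d K k h1 h2 h3 t1 t2 t3 t4 q4 =
    1470 * K * h1 * h3 * k^2 - 510 * K * h1^2 * k^2 - 980 * K * h2^2 * k^2 - 960 * K * h3^2 * k^2 + 425 * K * k^3 * t1 - 1300 * K * k^3 * t3 - 1500 * K^2 * k^4 + 820 * h1 * h2 * k * t2 -
    245 * h1 * h2 * k * t4 + 1032 * h1 * h2^2 * h3 - 245 * h1 * h3 * k * t1 + 490 * h1 * h3 * k * t3 + 294 * h1 * h3^3 - 366 * h1^2 * h2^2 - 516 * h1^2 * h3^2 + 60 * h1^2 * k * t1 -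
    270 * h1^2 * k * t3 + 294 * h1^3 * h3 - 36 * h1^4 - 895 * h2 * h3 * k * t2 + 245 * h2 * h3 * k * t4 + 175 * h2 * k^2 * q4 - 366 * h2^2 * h3^2 - 245 * h2^2 * k * t1 + 490 * h2^2 * k * t3 -
    588 * h2^4 + 185 * h3^2 * k * t1 - 220 * h3^2 * k * t3 - 36 * h3^4 + 225 * k^2 * t1 * t3 - 25 * k^2 * t1^2 - 225 * k^2 * t2^2 - 200 * k^2 * t3^2"

lemmas rel_defs = rel_a_def rel_b_def rel_c_def rel_d_def

text \<open>Eliminates X, Y, R from \<open>F\<close>, the derivative of the second constraint along
  \<open>e1\<close>. \<open>E0\<close>, \<open>E1\<close>, \<open>E2\<close> are the constraints
  containing R, X, Y, and the last two premises replace \<open>a\<close> and \<open>b\<close>; the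
  displayed multipliers certify that the result lies in the ideal generated by the premises.\<close>

lemma relation_identity_1:
  fixes K k h1 h2 h3 t1 t2 t3 t4 q1 q2 q3 q4 a b v \<beta> X Y R :: real
  assumes F: "25 * K * X * k^2 - 40 * K * a * k^2 * v + 50 * K * \<beta> * h1 * k - 35 * K * h2 * k * v + 35 * R * h2 * k + 35 * X * a * h2 * k - 7 * X * h1 * h3 + 6 * X * h1^2 + X * h3^2 - 5 * X * k * t1 + 5 * X * k * t3
    - 35 * Y * a * h1 * k + 35 * Y * a * h3 * k + 23 * Y * h1 * h2 + 2 * Y * h2 * h3 + 45 * Y * k * t2 + 14 * a * \<beta> * h1 * h2 - 14 * a * \<beta> * h2 * h3 - 5 * a * \<beta> * k * t2 +
    5 * a * \<beta> * k * t4 - 28 * a * h2^2 * v + 10 * a * k * t3 * v + 7 * \<beta> * h1 * t1 - 2 * \<beta> * h1 * t3 - 7 * \<beta> * h3 * t1 + 2 * \<beta> * h3 * t3 - 5 * \<beta> * k * q1 +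
    5 * \<beta> * k * q3 + 25 * \<beta> * k^3 - 2 * h1 * t2 * v - 12 * h2 * t1 * v + 2 * h2 * t3 * v + 2 * h3 * t2 * v + 10 * k * q2 * v = 0" (is "?A = 0")
    and E0: "3 * K * k * v + 5 * R * k + 7 * X * h2 - 5 * Y * b * k + Y * h1 - Y * h3 + \<beta> * t2 - \<beta> * t4 - 2 * t3 * v = 0" (is "?B = 0")
    and E1: "5 * X * k + \<beta> * h1 - \<beta> * h3 - 2 * h2 * v = 0" (is "?C = 0")
    and E2: "25 * K * \<beta> * k^2 + 35 * Y * h2 * k - 7 * \<beta> * h1 * h3 + 6 * \<beta> * h1^2 + \<beta> * h3^2 - 5 * \<beta> * k * t1 + 5 * \<beta> * k * t3 - 12 * h1 * h2 * v + 2 * h2 * h3 * v +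
    10 * k * t2 * v = 0" (is "?D = 0")
    and E3: "a * k - h2 = 0"
    and E4: "b * k - h3 = 0"
  shows "2 * v * (rel_b K k h1 h2 h3 t1 t2 t3 t4 q2) + \<beta> * ((rel_c K k h1 h2 h3 t1 t2 t3 t4 q3) - (rel_a K k h1 h2 h3 t1 t2 t3 t4 q1)) = 0" (is "?E = 0")
proof -
  have "?E =
    35 * h2 * k * ?A
    - (245 * h2^2 * k) * ?B
    - (175 * K * h2 * k^2 + 245 * a * h2^2 * k - 49 * h1 * h2 * h3 + 42 * h1^2 * h2 + 7 * h2 * h3^2 - 35 * h2 * k * t1 + 35 * h2 * k * t3 - 343 * h2^3) * ?C
    - (-35 * a * h1 * k + 35 * a * h3 * k + 35 * b * h2 * k + 16 * h1 * h2 + 9 * h2 * h3 + 45 * k * t2) * ?D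
    - (875 * K * \<beta> * h1 * k^2 - 875 * K * \<beta> * h3 * k^2 - 1400 * K * h2 * k^2 * v + 245 * \<beta> * h1 * h2^2 + 280 * \<beta> * h1 * h3^2 - 175 * \<beta> * h1 * k * t1 +
    175 * \<beta> * h1 * k * t3 - 455 * \<beta> * h1^2 * h3 + 210 * \<beta> * h1^3 - 175 * \<beta> * h2 * k * t2 + 175 * \<beta> * h2 * k * t4 - 245 * \<beta> * h2^2 * h3 +
    175 * \<beta> * h3 * k * t1 - 175 * \<beta> * h3 * k * t3 - 35 * \<beta> * h3^3 + 490 * h1 * h2 * h3 * v + 350 * h1 * k * t2 * v - 420 * h1^2 * h2 * v - 70 * h2 * h3^2 * v + 350 * h2 * k * t3 * v
    - 490 * h2^3 * v - 350 * h3 * k * t2 * v) * (a * k - h2)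
    - (-875 * K * \<beta> * h2 * k^2 + 245 * \<beta> * h1 * h2 * h3 - 210 * \<beta> * h1^2 * h2 - 35 * \<beta> * h2 * h3^2 + 175 * \<beta> * h2 * k * t1 - 175 * \<beta> * h2 * k * t3 +
    420 * h1 * h2^2 * v - 350 * h2 * k * t2 * v - 70 * h2^2 * h3 * v) * (b * k - h3)"
    unfolding rel_defs by algebra
  then show ?thesis unfolding F E0 E1 E2 E3 E4 by simp
qed

text \<open>The same elimination for the derivative along \<open>e2\<close>, in which only X and Y
  occur.\<close>

lemma relation_identity_2:
  fixes K k h1 h2 h3 t1 t2 t3 t4 q1 q2 q3 q4 a b v \<beta> X Y R :: real
  assumes F: "60 * K * Y * k^2 - 50 * K * b * k^2 * v + 40 * K * \<beta> * h2 * k + 8 * K * h1 * k * v + 2 * K * h3 * k * v + 35 * X * b * h2 * k + 12 * X * h1 * h2 - 2 * X * h2 * h3 - 10 * X * k * t2 - 35 * Y * b * h1 * k +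
    35 * Y * b * h3 * k - 7 * Y * h1 * h3 + 6 * Y * h1^2 + 35 * Y * h2^2 + Y * h3^2 - 5 * Y * k * t1 + 40 * Y * k * t3 + 14 * b * \<beta> * h1 * h2 - 14 * b * \<beta> * h2 * h3 - 5 * b * \<beta> * k * t2
    + 5 * b * \<beta> * k * t4 - 28 * b * h2^2 * v + 10 * b * k * t3 * v + 12 * \<beta> * h1 * t2 - 7 * \<beta> * h1 * t4 - 5 * \<beta> * h2 * t1 + 5 * \<beta> * h2 * t3 - 7 * \<beta> * h3 * t2 +
    2 * \<beta> * h3 * t4 - 5 * \<beta> * k * q2 + 5 * \<beta> * k * q4 - 12 * h1 * t3 * v - 2 * h2 * t2 * v + 2 * h2 * t4 * v + 2 * h3 * t3 * v + 10 * k * q3 * v + 10 * k^3 * v = 0" (is "?A = 0")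
    and E0: "5 * X * k + \<beta> * h1 - \<beta> * h3 - 2 * h2 * v = 0" (is "?B = 0")
    and E1: "25 * K * \<beta> * k^2 + 35 * Y * h2 * k - 7 * \<beta> * h1 * h3 + 6 * \<beta> * h1^2 + \<beta> * h3^2 - 5 * \<beta> * k * t1 + 5 * \<beta> * k * t3 - 12 * h1 * h2 * v + 2 * h2 * h3 * v +
    10 * k * t2 * v = 0" (is "?C = 0")
    and E2: "b * k - h3 = 0"
  shows "2 * v * (rel_c K k h1 h2 h3 t1 t2 t3 t4 q3) + \<beta> * ((rel_d K k h1 h2 h3 t1 t2 t3 t4 q4) - (rel_b K k h1 h2 h3 t1 t2 t3 t4 q2)) = 0" (is "?D = 0")
proof -
  have "?D =
    35 * h2 * k * ?A
    - (245 * b * h2^2 * k + 84 * h1 * h2^2 - 70 * h2 * k * t2 - 14 * h2^2 * h3) * ?B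
    - (60 * K * k^2 - 35 * b * h1 * k + 35 * b * h3 * k - 7 * h1 * h3 + 6 * h1^2 + 35 * h2^2 + h3^2 - 5 * k * t1 + 40 * k * t3) * ?C
    - (875 * K * \<beta> * h1 * k^2 - 875 * K * \<beta> * h3 * k^2 - 1750 * K * h2 * k^2 * v + 245 * \<beta> * h1 * h2^2 + 280 * \<beta> * h1 * h3^2 - 175 * \<beta> * h1 * k * t1 +
    175 * \<beta> * h1 * k * t3 - 455 * \<beta> * h1^2 * h3 + 210 * \<beta> * h1^3 - 175 * \<beta> * h2 * k * t2 + 175 * \<beta> * h2 * k * t4 - 245 * \<beta> * h2^2 * h3 +
    175 * \<beta> * h3 * k * t1 - 175 * \<beta> * h3 * k * t3 - 35 * \<beta> * h3^3 + 490 * h1 * h2 * h3 * v + 350 * h1 * k * t2 * v - 420 * h1^2 * h2 * v - 70 * h2 * h3^2 * v + 350 * h2 * k * t3 * v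
    - 490 * h2^3 * v - 350 * h3 * k * t2 * v) * (b * k - h3)"
    unfolding rel_defs by algebra
  then show ?thesis unfolding F E0 E1 E2 by simp
qed

text \<open>The six flatness identities concern X = xv v + xb \<beta> and Y = yv v + yb \<beta>,
  solved from the first two constraints; a final 1 or 2 in \<open>xv1\<close>, \<open>yb2\<close>
  etc. marks the derivative along \<open>e1\<close> or \<open>e2\<close>. They are the v- and
  \<beta>-coefficients of the three compatibility conditions: (1) D1 X = - K \<beta> - a Y, (2) D2 Y
  = - K \<beta> + b X, (3) D1 Y - D2 X = a X + b Y - 2 K v. Condition (1) follows from the
  constraints themselves, because the second was obtained by differentiating the first along
  \<open>e1\<close>.\<close>

lemma flatness_identity_1v:
  fixes a h1 h2 h3 k t2 xb xv xv1 yv :: real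
  assumes nz: "k \<noteq> 0" "h2 \<noteq> 0"
    and rxv1: "2 * a * h1 - 2 * a * h3 + 5 * h1 * xv + 5 * k * xv1 - 2 * t2 = 0" (is "?A = 0")
    and ryv: "-12 * h1 * h2 + 2 * h2 * h3 + 35 * h2 * k * yv + 10 * k * t2 = 0" (is "?B = 0")
    and rxv: "-2 * h2 + 5 * k * xv = 0"
    and rxb: "h1 - h3 + 5 * k * xb = 0"
    and ea: "a * k - h2 = 0"
  shows "xv1 + xv * yv + xb * xv - 2 * a * xb + a * yv = 0" (is "?C = 0")
proof -
  have "175 * h2 * k^2 * ?C =
    (35 * h2 * k) * ?A
    + (5 * a * k + 5 * k * xv) * ?B
    + (-23 * h1 * h2 - 2 * h2 * h3 + 35 * h2 * k * xb - 10 * k * t2) * (-2 * h2 + 5 * k * xv)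
    + (-70 * a * h2 * k + 14 * h2^2) * (h1 - h3 + 5 * k * xb)
    + (60 * h1 * h2 - 10 * h2 * h3 - 50 * k * t2) * (a * k - h2)"
    unfolding rel_defs by algebra
  then have "175 * h2 * k^2 * ?C = 0"
    unfolding rxv1 ryv rxv rxb ea by simp
  then show ?thesis using nz by simp
qed

lemma flatness_identity_1b:
  fixes K a h1 h2 h3 k t1 t3 xb xb1 xv yb :: real
  assumes nz: "k \<noteq> 0" "h2 \<noteq> 0"
    and rxb1: "4 * a * h2 + 5 * h1 * xb + 5 * k * xb1 + t1 - t3 = 0" (is "?A = 0")
    and ryb: "25 * K * k^2 - 7 * h1 * h3 + 6 * h1^2 + 35 * h2 * k * yb + h3^2 - 5 * k * t1 + 5 * k * t3 = 0" (is "?B = 0")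
    and rxv: "-2 * h2 + 5 * k * xv = 0"
    and rxb: "h1 - h3 + 5 * k * xb = 0"
    and ea: "a * k - h2 = 0"
  shows "xb1 + 2 * a * xv + xv * yb + xb * xb + K + a * yb = 0" (is "?C = 0")
proof -
  have "175 * h2 * k^2 * ?C =
    (35 * h2 * k) * ?A
    + (5 * a * k + 5 * k * xv) * ?B
    + (-25 * K * k^2 + 70 * a * h2 * k + 7 * h1 * h3 - 6 * h1^2 - h3^2 + 5 * k * t1 - 5 * k * t3) * (-2 * h2 + 5 * k * xv)
    + (-42 * h1 * h2 + 7 * h2 * h3 + 35 * h2 * k * xb) * (h1 - h3 + 5 * k * xb)
    + (-125 * K * k^2 + 35 * h1 * h3 - 30 * h1^2 - 5 * h3^2 + 25 * k * t1 - 25 * k * t3) * (a * k - h2)"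
    unfolding rel_defs by algebra
  then have "175 * h2 * k^2 * ?C = 0"
    unfolding rxb1 ryb rxv rxb ea by simp
  then show ?thesis using nz by simp
qed

text \<open>Up to the factor \<open>1225 * h2^2 * k^2\<close> and modulo the constraints, the
  obstruction is \<open>-2\<close> times \<open>rel_c\<close>.\<close>

lemma flatness_identity_2v:
  fixes K b h1 h2 h3 k q3 t1 t2 t3 t4 xv yb yv yv2 :: real
  assumes nz: "k \<noteq> 0" "h2 \<noteq> 0"
    and ryv2: "8 * K * h1 * k + 2 * K * h3 * k + 35 * K * k^2 * yv - 14 * b * h1 * h3 - 35 * b * h1 * k * yv + 12 * b * h1^2 - 28 * b * h2^2 + 35 * b * h3 * k * yv + 2 * b * h3^2 - 10 * b * k * t1 + 20 * b * k * t3 -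
    12 * h1 * t3 + 35 * h2 * k * yv2 - 2 * h2 * t2 + 2 * h2 * t4 + 35 * h2^2 * yv + 2 * h3 * t3 + 10 * k * q3 + 35 * k * t3 * yv + 10 * k^3 = 0" (is "?A = 0")
    and ryv: "-12 * h1 * h2 + 2 * h2 * h3 + 35 * h2 * k * yv + 10 * k * t2 = 0" (is "?B = 0")
    and ryb: "25 * K * k^2 - 7 * h1 * h3 + 6 * h1^2 + 35 * h2 * k * yb + h3^2 - 5 * k * t1 + 5 * k * t3 = 0" (is "?C = 0")
    and rxv: "-2 * h2 + 5 * k * xv = 0"
    and eb: "b * k - h3 = 0"
    and P3: "rel_c K k h1 h2 h3 t1 t2 t3 t4 q3 = 0" (is "?D = 0")
  shows "yv2 - yv * xv + yb * yv - 2 * b * yb - b * xv = 0" (is "?E = 0")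
proof -
  have "1225 * h2^2 * k^2 * ?E =
    (35 * h2 * k) * ?A
    + (-35 * K * k^2 + 35 * b * h1 * k - 35 * b * h3 * k - 35 * h2 * k * xv + 35 * h2 * k * yb - 35 * h2^2 - 35 * k * t3) * ?B
    + (-70 * b * h2 * k + 12 * h1 * h2 - 2 * h2 * h3 - 10 * k * t2) * ?C
    + (-245 * b * h2^2 * k - 84 * h1 * h2^2 + 70 * h2 * k * t2 + 14 * h2^2 * h3) * (-2 * h2 + 5 * k * xv)
    + (1750 * K * h2 * k^2 - 490 * h1 * h2 * h3 - 350 * h1 * k * t2 + 420 * h1^2 * h2 + 70 * h2 * h3^2 - 350 * h2 * k * t3 + 490 * h2^3 + 350 * h3 * k * t2) * (b * k - h3)
    + (-2) * ?D"
    unfolding rel_defs by algebra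
  then have "1225 * h2^2 * k^2 * ?E = 0"
    unfolding ryv2 ryv ryb rxv eb P3 by simp
  then show ?thesis using nz by simp
qed

text \<open>Here the obstruction is \<open>rel_b\<close> minus \<open>rel_d\<close>, the other
  coefficient in \<open>relation_identity_2\<close> up to sign.\<close>

lemma flatness_identity_2b:
  fixes K b h1 h2 h3 k q2 q4 t1 t2 t3 t4 xb yb yb2 yv :: real
  assumes nz: "k \<noteq> 0" "h2 \<noteq> 0"
    and ryb2: "75 * K * h2 * k + 35 * K * k^2 * yb + 38 * b * h1 * h2 - 35 * b * h1 * k * yb - 18 * b * h2 * h3 + 35 * b * h3 * k * yb - 25 * b * k * t2 + 5 * b * k * t4 + 12 * h1 * t2 - 7 * h1 * t4 + 35 * h2 * k * yb2 -
    5 * h2 * t1 + 5 * h2 * t3 + 35 * h2^2 * yb - 7 * h3 * t2 + 2 * h3 * t4 - 5 * k * q2 + 5 * k * q4 + 35 * k * t3 * yb = 0" (is "?A = 0")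
    and ryv: "-12 * h1 * h2 + 2 * h2 * h3 + 35 * h2 * k * yv + 10 * k * t2 = 0" (is "?B = 0")
    and ryb: "25 * K * k^2 - 7 * h1 * h3 + 6 * h1^2 + 35 * h2 * k * yb + h3^2 - 5 * k * t1 + 5 * k * t3 = 0" (is "?C = 0")
    and rxb: "h1 - h3 + 5 * k * xb = 0"
    and eb: "b * k - h3 = 0"
    and P2: "rel_b K k h1 h2 h3 t1 t2 t3 t4 q2 = 0" (is "?D = 0")
    and P4: "rel_d K k h1 h2 h3 t1 t2 t3 t4 q4 = 0" (is "?E = 0")
  shows "yb2 + yv * (2 * b - xb) + yb * yb + K - b * xb = 0" (is "?F = 0")
proof -
  have "1225 * h2^2 * k^2 * ?F =
    (35 * h2 * k) * ?A
    + (70 * b * h2 * k - 35 * h2 * k * xb) * ?B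
    + (-60 * K * k^2 + 35 * b * h1 * k - 35 * b * h3 * k + 7 * h1 * h3 - 6 * h1^2 + 35 * h2 * k * yb - 35 * h2^2 - h3^2 + 5 * k * t1 - 40 * k * t3) * ?C
    + (-245 * b * h2^2 * k - 84 * h1 * h2^2 + 70 * h2 * k * t2 + 14 * h2^2 * h3) * (h1 - h3 + 5 * k * xb)
    + (-875 * K * h1 * k^2 + 875 * K * h3 * k^2 - 245 * h1 * h2^2 - 280 * h1 * h3^2 + 175 * h1 * k * t1 - 175 * h1 * k * t3 + 455 * h1^2 * h3 - 210 * h1^3 + 175 * h2 * k * t2 - 175 * h2 * k * t4 +
    245 * h2^2 * h3 - 175 * h3 * k * t1 + 175 * h3 * k * t3 + 35 * h3^3) * (b * k - h3)
    + (1) * ?D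
    + (-1) * ?E"
    unfolding rel_defs by algebra
  then have "1225 * h2^2 * k^2 * ?F = 0"
    unfolding ryb2 ryv ryb rxb eb P2 P4 by simp
  then show ?thesis using nz by simp
qed

text \<open>The obstruction is \<open>-2\<close> times \<open>rel_b\<close>, matching the
  v-coefficient of \<open>relation_identity_1\<close>.\<close>

lemma flatness_identity_3v:
  fixes K a b h1 h2 h3 k q2 t1 t2 t3 t4 xb xv xv2 yb yv yv1 :: real
  assumes nz: "k \<noteq> 0" "h2 \<noteq> 0"
    and ryv1: "10 * K * a * k^2 - 14 * a * h1 * h3 - 35 * a * h1 * k * yv + 12 * a * h1^2 - 28 * a * h2^2 + 35 * a * h3 * k * yv + 2 * a * h3^2 - 10 * a * k * t1 + 20 * a * k * t3 + 35 * h1 * h2 * yv - 2 * h1 * t2 +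
    35 * h2 * k * yv1 - 12 * h2 * t1 + 2 * h2 * t3 + 2 * h3 * t2 + 10 * k * q2 + 35 * k * t2 * yv = 0" (is "?A = 0")
    and rxv2: "-2 * K * k + 2 * b * h1 - 2 * b * h3 + 5 * h2 * xv + 5 * k * xv2 - 2 * t3 = 0" (is "?B = 0")
    and ryv: "-12 * h1 * h2 + 2 * h2 * h3 + 35 * h2 * k * yv + 10 * k * t2 = 0" (is "?C = 0")
    and ryb: "25 * K * k^2 - 7 * h1 * h3 + 6 * h1^2 + 35 * h2 * k * yb + h3^2 - 5 * k * t1 + 5 * k * t3 = 0" (is "?D = 0")
    and rxv: "-2 * h2 + 5 * k * xv = 0"
    and rxb: "h1 - h3 + 5 * k * xb = 0"
    and ea: "a * k - h2 = 0"
    and eb: "b * k - h3 = 0"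
    and P2: "rel_b K k h1 h2 h3 t1 t2 t3 t4 q2 = 0" (is "?E = 0")
  shows "yv1 + yv * yv + yb * (xv - 2 * a) - (xv2 - xv * xv + xb * (yv - 2 * b)) - a * xv - b * yv + 2 * K = 0" (is "?F = 0")
proof -
  have "1225 * h2^2 * k^2 * ?F =
    (35 * h2 * k) * ?A
    + (-245 * h2^2 * k) * ?B
    + (35 * a * h1 * k - 35 * a * h3 * k - 35 * b * h2 * k - 23 * h1 * h2 - 2 * h2 * h3 - 35 * h2 * k * xb + 35 * h2 * k * yv - 45 * k * t2) * ?C
    + (-70 * a * h2 * k + 35 * h2 * k * xv) * ?D
    + (-175 * K * h2 * k^2 - 245 * a * h2^2 * k + 49 * h1 * h2 * h3 - 42 * h1^2 * h2 - 7 * h2 * h3^2 + 35 * h2 * k * t1 - 35 * h2 * k * t3 + 245 * h2^2 * k * xv + 343 * h2^3) * (-2 * h2 + 5 * k * xv)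
    + (490 * b * h2^2 * k - 84 * h1 * h2^2 + 70 * h2 * k * t2 + 14 * h2^2 * h3) * (h1 - h3 + 5 * k * xb)
    + (1400 * K * h2 * k^2 - 490 * h1 * h2 * h3 - 350 * h1 * k * t2 + 420 * h1^2 * h2 + 70 * h2 * h3^2 - 350 * h2 * k * t3 + 490 * h2^3 + 350 * h3 * k * t2) * (a * k - h2)
    + (-420 * h1 * h2^2 + 350 * h2 * k * t2 + 70 * h2^2 * h3) * (b * k - h3)
    + (-2) * ?E"
    unfolding rel_defs by algebra
  then have "1225 * h2^2 * k^2 * ?F = 0"
    unfolding ryv1 rxv2 ryv ryb rxv rxb ea eb P2 by simp
  then show ?thesis using nz by simp
qed

text \<open>The obstruction is \<open>rel_a\<close> minus \<open>rel_c\<close>, matching the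
  \<beta>-coefficient of \<open>relation_identity_1\<close>.\<close>

lemma flatness_identity_3b:
  fixes K a b h1 h2 h3 k q1 q3 t1 t2 t3 t4 xb xb2 xv yb yb1 yv :: real
  assumes nz: "k \<noteq> 0" "h2 \<noteq> 0"
    and ryb1: "50 * K * h1 * k + 38 * a * h1 * h2 - 35 * a * h1 * k * yb - 18 * a * h2 * h3 + 35 * a * h3 * k * yb - 25 * a * k * t2 + 5 * a * k * t4 + 35 * h1 * h2 * yb + 7 * h1 * t1 - 2 * h1 * t3 + 35 * h2 * k * yb1 -
    7 * h3 * t1 + 2 * h3 * t3 - 5 * k * q1 + 5 * k * q3 + 35 * k * t2 * yb + 25 * k^3 = 0" (is "?A = 0")
    and rxb2: "4 * b * h2 + 5 * h2 * xb + 5 * k * xb2 + t2 - t4 = 0" (is "?B = 0")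
    and ryv: "-12 * h1 * h2 + 2 * h2 * h3 + 35 * h2 * k * yv + 10 * k * t2 = 0" (is "?C = 0")
    and ryb: "25 * K * k^2 - 7 * h1 * h3 + 6 * h1^2 + 35 * h2 * k * yb + h3^2 - 5 * k * t1 + 5 * k * t3 = 0" (is "?D = 0")
    and rxv: "-2 * h2 + 5 * k * xv = 0"
    and rxb: "h1 - h3 + 5 * k * xb = 0"
    and ea: "a * k - h2 = 0"
    and eb: "b * k - h3 = 0"
    and P1: "rel_a K k h1 h2 h3 t1 t2 t3 t4 q1 = 0" (is "?E = 0")
    and P3: "rel_c K k h1 h2 h3 t1 t2 t3 t4 q3 = 0" (is "?F = 0")
  shows "yb1 + yv * (2 * a + yb) + yb * xb - (xb2 + xv * (2 * b - xb) + xb * yb) - a * xb - b * yb = 0" (is "?G = 0")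
proof -
  have "1225 * h2^2 * k^2 * ?G =
    (35 * h2 * k) * ?A
    + (-245 * h2^2 * k) * ?B
    + (70 * a * h2 * k + 35 * h2 * k * yb) * ?C
    + (35 * a * h1 * k - 35 * a * h3 * k - 35 * b * h2 * k - 23 * h1 * h2 - 2 * h2 * h3 - 45 * k * t2) * ?D
    + (-490 * b * h2^2 * k + 245 * h2^2 * k * xb) * (-2 * h2 + 5 * k * xv)
    + (-245 * a * h2^2 * k + 343 * h2^3) * (h1 - h3 + 5 * k * xb)
    + (-875 * K * h1 * k^2 + 875 * K * h3 * k^2 - 245 * h1 * h2^2 - 280 * h1 * h3^2 + 175 * h1 * k * t1 - 175 * h1 * k * t3 + 455 * h1^2 * h3 - 210 * h1^3 + 175 * h2 * k * t2 - 175 * h2 * k * t4 +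
    245 * h2^2 * h3 - 175 * h3 * k * t1 + 175 * h3 * k * t3 + 35 * h3^3) * (a * k - h2)
    + (875 * K * h2 * k^2 - 245 * h1 * h2 * h3 + 210 * h1^2 * h2 + 35 * h2 * h3^2 - 175 * h2 * k * t1 + 175 * h2 * k * t3) * (b * k - h3)
    + (1) * ?E
    + (-1) * ?F"
    unfolding rel_defs by algebra
  then have "1225 * h2^2 * k^2 * ?G = 0"
    unfolding ryb1 rxb2 ryv ryb rxv rxb ea eb P1 P3 by simp
  then show ?thesis using nz by simp
qed

section \<open>Constraints on integrals for nonconstant curvature, and necessity of the
  relations\<close>

context gradient_frame
begin

lemma connection_eqs: "x \<in> V \<Longrightarrow> a x * k x - h2 x = 0" "x \<in> V \<Longrightarrow> b x * k x - h3 x = 0"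
  using connection_k by simp_all

lemma D_zero:
  assumes "x \<in> V" "\<And>y. y \<in> V \<Longrightarrow> f y = 0"
  shows "D1 f x = 0" "D2 f x = 0"
  using D_cong[OF assms(1), of f "\<lambda>x. 0"] assms by simp_all

context
  fixes v \<beta> \<tau> :: scalar_field
  assumes kf: "killing_fields v \<beta> \<tau>"
begin

private abbreviation JX where "JX \<equiv> jet_x v \<beta>"
private abbreviation JY where "JY \<equiv> jet_y v \<beta>"
private abbreviation JR where "JR \<equiv> jet_r v \<beta>"

text \<open>The integrability condition for R: the rank 6 system fails to be flat by this one linear
  form in X, v and \<beta>.\<close>

lemma first_constraint:
  assumes x: "x \<in> V"
  shows "5 * JX x * k x + \<beta> x * h1 x - \<beta> x * h3 x - 2 * h2 x * v x = 0"
proof -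
  have "D1 JR y = - 3 * curv y * JY y - k y * v y" "D2 JR y = - 3 * curv y * JX y - k y * \<beta> y" if "y \<in> V" for y
    using killing_D_2[OF kf that] by (simp_all add: D_curv that)
  from D_commute_eq[OF killing_smooth(6)[OF kf] x this]
  have "D1 (\<lambda>y. - 3 * curv y * JX y - k y * \<beta> y) x - D2 (\<lambda>y. - 3 * curv y * JY y - k y * v y) x
    = - a x * (- 3 * curv x * JY x - k x * v x) - b x * (- 3 * curv x * JX x - k x * \<beta> x)" .
  then have "5 * JX x * k x + \<beta> x * h1 x - \<beta> x * (b x * k x) - h2 x * v x - (a x * k x) * v x = 0"
    by (simp add: D_rules smooth_intros killing_smooth[OF kf] x D_const D_curv D_k
        killing_D_0[OF kf x] killing_D_1[OF kf x] algebra_simps)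
  then show ?thesis using connection_eqs[OF x] by (simp add: algebra_simps)
qed

text \<open>The two frame derivatives of the first constraint. The first contains Y through D1 X,
  the second contains R through D2 X with coefficient \<open>5 * k x\<close>.\<close>

lemma derived_constraints:
  assumes x: "x \<in> V"
  shows "- 5 * curv x * \<beta> x * k x + 6 * JX x * h1 x - JX x * h3 x - 5 * JY x * a x * k x - 2 * JY x * h2 x + \<beta> x * t1 x -
      \<beta> x * t3 x - 2 * t2 x * v x = 0" (is "?A = 0")
    and "3 * curv x * k x * v x + 5 * JR x * k x + 7 * JX x * h2 x - 5 * JY x * b x * k x + JY x * h1 x - JY x * h3 x + \<beta> x * t2 x -
      \<beta> x * t4 x - 2 * t3 x * v x = 0" (is "?B = 0")
proof -
  let ?C = "\<lambda>x. 5 * JX x * k x + \<beta> x * h1 x - \<beta> x * h3 x - 2 * h2 x * v x"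
  note D = D_rules smooth_intros killing_smooth[OF kf] x D_const D_curv[OF x] D_k[OF x] D_h[OF x]
     killing_D_0[OF kf x] killing_D_1[OF kf x] power2_eq_square power3_eq_cube
  have "D1 ?C x = 0" "D2 ?C x = 0"
    by (rule D_zero[OF x first_constraint], assumption)+
  moreover have "D1 ?C x = ?A"
    by (simp add: D algebra_simps)
  moreover have "D2 ?C x = ?B"
    by (simp add: D algebra_simps)
  ultimately show "?A = 0"
    and "?B = 0"
    by simp_all
qed

text \<open>The derivative along \<open>e1\<close> with X eliminated by the first constraint and
  \<open>a k\<close> replaced by \<open>h2\<close>. The coefficient of Y becomes
  \<open>35 * h2 x * k x\<close>, so Y is determined exactly where I4b is nonzero.\<close>

lemma second_constraint:
  assumes x: "x \<in> V"
  shows "25 * curv x * \<beta> x * k x^2 + 35 * JY x * h2 x * k x - 7 * \<beta> x * h1 x * h3 x + 6 * \<beta> x * h1 x^2 + \<beta> x * h3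
      x^2 - 5 * \<beta> x * k x * t1 x + 5 * \<beta> x * k x * t3 x - 12 * h1 x * h2 x * v x + 2 * h2 x * h3 x * v x + 10 * k x * t2 x *
      v x = 0" (is "?A = 0")
proof -
  have "?A
    = - 5 * k x * (- 5 * curv x * \<beta> x * k x + 6 * JX x * h1 x - JX x * h3 x - 5 * JY x * a x * k x - 2 * JY x * h2 x + \<beta> x * t1 x -
      \<beta> x * t3 x - 2 * t2 x * v x)
      + (6 * h1 x - h3 x) * (5 * JX x * k x + \<beta> x * h1 x - \<beta> x * h3 x - 2 * h2 x * v x) - 25 * JY x * k x * (a x * k x - h2 x)"
    by (simp add: algebra_simps power2_eq_square)
  then show ?thesis unfolding first_constraint[OF x] derived_constraints(1)[OF x] connection_eqs[OF x] by simp
qed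

lemma third_constraints:
  assumes x: "x \<in> V"
  shows "25 * curv x * JX x * k x^2 - 40 * curv x * a x * k x^2 * v x + 50 * curv x * \<beta> x * h1 x * k x - 35 * curv x * h2 x * k x * v
      x + 35 * JR x * h2 x * k x + 35 * JX x * a x * h2 x * k x - 7 * JX x * h1 x * h3 x + 6 * JX x * h1 x^2 + JX x * h3 x^2 - 5 * JX x
      * k x * t1 x + 5 * JX x * k x * t3 x - 35 * JY x * a x * h1 x * k x + 35 * JY x * a x * h3 x * k x + 23 * JY x * h1 x * h2 x + 2 *
      JY x * h2 x * h3 x + 45 * JY x * k x * t2 x + 14 * a x * \<beta> x * h1 x * h2 x - 14 * a x * \<beta> x * h2 x * h3 x - 5 * a x *
      \<beta> x * k x * t2 x + 5 * a x * \<beta> x * k x * t4 x - 28 * a x * h2 x^2 * v x + 10 * a x * k x * t3 x * v x + 7 * \<beta> x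
      * h1 x * t1 x - 2 * \<beta> x * h1 x * t3 x - 7 * \<beta> x * h3 x * t1 x + 2 * \<beta> x * h3 x * t3 x - 5 * \<beta> x * k x * q1
      x + 5 * \<beta> x * k x * q3 x + 25 * \<beta> x * k x^3 - 2 * h1 x * t2 x * v x - 12 * h2 x * t1 x * v x + 2 * h2 x * t3 x * v x +
      2 * h3 x * t2 x * v x + 10 * k x * q2 x * v x = 0" (is "?A = 0")
    and "60 * curv x * JY x * k x^2 - 50 * curv x * b x * k x^2 * v x + 40 * curv x * \<beta> x * h2 x * k x + 8 * curv x * h1 x * k x * v
      x + 2 * curv x * h3 x * k x * v x + 35 * JX x * b x * h2 x * k x + 12 * JX x * h1 x * h2 x - 2 * JX x * h2 x * h3 x - 10 * JX x *
      k x * t2 x - 35 * JY x * b x * h1 x * k x + 35 * JY x * b x * h3 x * k x - 7 * JY x * h1 x * h3 x + 6 * JY x * h1 x^2 + 35 * JY x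
      * h2 x^2 + JY x * h3 x^2 - 5 * JY x * k x * t1 x + 40 * JY x * k x * t3 x + 14 * b x * \<beta> x * h1 x * h2 x - 14 * b x *
      \<beta> x * h2 x * h3 x - 5 * b x * \<beta> x * k x * t2 x + 5 * b x * \<beta> x * k x * t4 x - 28 * b x * h2 x^2 * v x + 10 * b x
      * k x * t3 x * v x + 12 * \<beta> x * h1 x * t2 x - 7 * \<beta> x * h1 x * t4 x - 5 * \<beta> x * h2 x * t1 x + 5 * \<beta> x * h2
      x * t3 x - 7 * \<beta> x * h3 x * t2 x + 2 * \<beta> x * h3 x * t4 x - 5 * \<beta> x * k x * q2 x + 5 * \<beta> x * k x * q4 x -
      12 * h1 x * t3 x * v x - 2 * h2 x * t2 x * v x + 2 * h2 x * t4 x * v x + 2 * h3 x * t3 x * v x + 10 * k x * q3 x * v x + 10 * k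
      x^3 * v x = 0" (is "?B = 0")
proof -
  let ?C = "\<lambda>x. 25 * curv x * \<beta> x * k x^2 + 35 * JY x * h2 x * k x - 7 * \<beta> x * h1 x * h3 x + 6 * \<beta> x * h1 x^2 + \<beta> x * h3 x^2 - 5 * \<beta> x * k x * t1 x + 5 * \<beta> x * k x * t3 x - 12 * h1 x * h2 x * v x + 2 * h2 x * h3 x * v x + 10 * k x * t2 x * v x"
  note D = D_rules smooth_intros killing_smooth[OF kf] x D_const D_curv[OF x] D_k[OF x] D_h[OF x] D1_t[OF x] D2_t[OF x]
     killing_D_0[OF kf x] killing_D_1[OF kf x] power2_eq_square power3_eq_cube
  have "D1 ?C x = 0" "D2 ?C x = 0"
    by (rule D_zero[OF x second_constraint], assumption)+
  moreover have "D1 ?C x = ?A"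
    by (simp add: D algebra_simps)
  moreover have "D2 ?C x = ?B"
    by (simp add: D algebra_simps)
  ultimately show "?A = 0"
    and "?B = 0"
    by simp_all
qed

text \<open>After elimination only v and \<beta> remain, with coefficients that depend on the metric
  alone.\<close>

lemma relations_at_killing_fields:
  assumes x: "x \<in> V"
  shows "2 * v x * (rel_b (curv x) (k x) (h1 x) (h2 x) (h3 x) (t1 x) (t2 x) (t3 x) (t4 x) (q2 x))
      + \<beta> x * ((rel_c (curv x) (k x) (h1 x) (h2 x) (h3 x) (t1 x) (t2 x) (t3 x) (t4 x) (q3 x))
             - (rel_a (curv x) (k x) (h1 x) (h2 x) (h3 x) (t1 x) (t2 x) (t3 x) (t4 x) (q1 x))) = 0"
    and "2 * v x * (rel_c (curv x) (k x) (h1 x) (h2 x) (h3 x) (t1 x) (t2 x) (t3 x) (t4 x) (q3 x))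
      + \<beta> x * ((rel_d (curv x) (k x) (h1 x) (h2 x) (h3 x) (t1 x) (t2 x) (t3 x) (t4 x) (q4 x))
             - (rel_b (curv x) (k x) (h1 x) (h2 x) (h3 x) (t1 x) (t2 x) (t3 x) (t4 x) (q2 x))) = 0"
  using relation_identity_1[OF third_constraints(1)[OF x] derived_constraints(2)[OF x] first_constraint[OF x]
      second_constraint[OF x] connection_eqs(1)[OF x] connection_eqs(2)[OF x]]
    relation_identity_2[OF third_constraints(2)[OF x] first_constraint[OF x]
      second_constraint[OF x] connection_eqs(2)[OF x]]
  by simp_all

text \<open>Where \<open>I\<^sub>4\<^sub>b \<noteq> 0\<close>, the constraints determine all jets from \<open>v\<close> and \<open>\<beta>\<close>.\<close>

lemma killing_fields_unique_generic:
  assumes V: "convex V" and x0: "x0 \<in> V" "h2 x0 \<noteq> 0" and z: "v x0 = 0" "\<beta> x0 = 0" "\<tau> x0 = 0" and x: "x \<in> V"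
  shows "v x = 0 \<and> \<beta> x = 0 \<and> \<tau> x = 0"
proof (rule killing_fields_unique[OF kf V x0(1) z _ _ _ x])
  have kp: "k x0 \<noteq> 0" using k_pos[OF x0(1)] by simp
  show X: "JX x0 = 0" using first_constraint[OF x0(1)] z kp by simp
  show Y: "JY x0 = 0" using second_constraint[OF x0(1)] z kp x0(2) by simp
  show "JR x0 = 0" using derived_constraints(2)[OF x0(1)] z kp X Y by simp
qed

end

text \<open>Where \<open>h2\<close> is nonzero, v, \<beta>, \<tau> at a point determine the
  integral. Evaluation of the combinations of three independent integrals at \<open>x\<close> is
  therefore injective on \<open>real^3\<close>, hence onto.\<close>

theorem relations_necessary:
  fixes v \<beta> \<tau> :: "3 \<Rightarrow> scalar_field"
  assumes V: "convex V" and h2: "\<And>x. x \<in> V \<Longrightarrow> h2 x \<noteq> 0"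
    and kf: "\<And>i. killing_fields (v i) (\<beta> i) (\<tau> i)"
    and ind: "\<And>c::real^3. (\<And>x. x \<in> V \<Longrightarrow> (\<Sum>i\<in>UNIV. c $ i * v i x) = 0 \<and> (\<Sum>i\<in>UNIV. c $ i * \<beta> i x) = 0
        \<and> (\<Sum>i\<in>UNIV. c $ i * \<tau> i x) = 0) \<Longrightarrow> c = 0"
    and x: "x \<in> V"
  shows "rel_a (curv x) (k x) (h1 x) (h2 x) (h3 x) (t1 x) (t2 x) (t3 x) (t4 x) (q1 x) = 0" (is "?A = 0")
    "rel_b (curv x) (k x) (h1 x) (h2 x) (h3 x) (t1 x) (t2 x) (t3 x) (t4 x) (q2 x) = 0" (is "?B = 0")
    "rel_c (curv x) (k x) (h1 x) (h2 x) (h3 x) (t1 x) (t2 x) (t3 x) (t4 x) (q3 x) = 0" (is "?C = 0")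
    "rel_d (curv x) (k x) (h1 x) (h2 x) (h3 x) (t1 x) (t2 x) (t3 x) (t4 x) (q4 x) = 0" (is "?D = 0")
proof -
  let ?v = "\<lambda>c x. \<Sum>i\<in>UNIV. c $ i * v i x" and ?\<beta> = "\<lambda>c x. \<Sum>i\<in>UNIV. c $ i * \<beta> i x" and ?\<tau> = "\<lambda>c x. \<Sum>i\<in>UNIV. c $ i * \<tau> i x"
  have k: "killing_fields (?v c) (?\<beta> c) (?\<tau> c)" for c :: "real^3" by (rule killing_fields_sum[OF kf])
  define \<phi> :: "real^3 \<Rightarrow> real^3" where "\<phi> c = vector [?v c x, ?\<beta> c x, ?\<tau> c x]" for c
  have lin: "linear \<phi>"
    by (rule linearI) (simp_all add: \<phi>_def vec_eq_iff forall_3 sum_3 algebra_simps)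
  have "c = 0" if "\<phi> c = 0" for c
  proof (rule ind)
    have "?v c x = 0" "?\<beta> c x = 0" "?\<tau> c x = 0" using that by (simp_all add: \<phi>_def vec_eq_iff forall_3)
    from killing_fields_unique_generic[OF k V x h2[OF x] this]
    show "?v c y = 0 \<and> ?\<beta> c y = 0 \<and> ?\<tau> c y = 0" if "y \<in> V" for y using that .
  qed
  then have "inj \<phi>" using lin by (simp add: linear_injective_0)
  then have "surj \<phi>" using lin linear_injective_imp_surjective by blast
  \<comment> \<open>With (v, \<beta>) equal to (1, 0) and to (0, 1), the two linear equations
    separate into their four coefficients.\<close>
  then obtain c d where "\<phi> c = vector [1, 0, 0]" "\<phi> d = vector [0, 1, 0]" by (metis surjD)
  then have "?v c x = 1" "?\<beta> c x = 0" "?v d x = 0" "?\<beta> d x = 1" by (simp_all add: \<phi>_def vec_eq_iff forall_3)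
  then show "?A = 0"
    "?B = 0"
    "?C = 0"
    "?D = 0"
    using relations_at_killing_fields[OF k x, of c] relations_at_killing_fields[OF k x, of d] by simp_all
qed

end

section \<open>Integrals from flat subsystems, and the case where I4b vanishes identically\<close>

context orthonormal_frame
begin

text \<open>Rank 3 or 4 systems are embedded in the rank 6 index type with zero rows and columns.\<close>

lemma killing_fields_from_flat:
  fixes M1 M2 :: "jet \<Rightarrow> jet \<Rightarrow> scalar_field"
  assumes p0: "p0 \<in> V" and M: "\<And>i j. smooth (M1 i j)" "\<And>i j. smooth (M2 i j)"
    and flat: "\<And>x i j. x \<in> V \<Longrightarrow> D1 (M2 i j) x - D2 (M1 i j) x
      + (\<Sum>k\<in>UNIV. M2 i k x * M1 k j x - M1 i k x * M2 k j x) + a x * M1 i j x + b x * M2 i j x = 0"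
    and kill: "\<And>S W. open S \<Longrightarrow> S \<subseteq> V \<Longrightarrow> (\<And>i. smooth_on S (W i)) \<Longrightarrow>
      (\<And>i x. x \<in> S \<Longrightarrow> D1 (W i) x = (\<Sum>j\<in>UNIV. M1 i j x * W j x)) \<Longrightarrow>
      (\<And>i x. x \<in> S \<Longrightarrow> D2 (W i) x = (\<Sum>j\<in>UNIV. M2 i j x * W j x)) \<Longrightarrow> killing_on S (W Jv) (W Jb) (W Jt)"
  shows "\<exists>S. open S \<and> convex S \<and> p0 \<in> S \<and> S \<subseteq> V \<and> (\<forall>c. \<exists>W. killing_on S (W Jv) (W Jb) (W Jt) \<and>
       (\<forall>i. W i p0 = c i) \<and> (\<forall>x\<in>S. D2 (W Jb) x = (\<Sum>j\<in>UNIV. M2 Jb j x * W j x)))"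
proof -
  obtain S where S: "open S" "convex S" "p0 \<in> S" "S \<subseteq> V"
    and ex: "\<And>c. \<exists>W. (\<forall>i. smooth_on S (W i)) \<and> (\<forall>i. W i p0 = c i) \<and>
       (\<forall>i. \<forall>x\<in>S. D1 (W i) x = (\<Sum>j\<in>UNIV. M1 i j x * W j x) \<and> D2 (W i) x = (\<Sum>j\<in>UNIV. M2 i j x * W j x))"
    using frame_frobenius[OF p0 M flat] by blast
  show ?thesis
  proof (intro exI[of _ S] conjI allI S)
    fix c
    obtain W where W: "\<And>i. smooth_on S (W i)" "\<And>i. W i p0 = c i"
       "\<And>i x. x \<in> S \<Longrightarrow> D1 (W i) x = (\<Sum>j\<in>UNIV. M1 i j x * W j x)"
       "\<And>i x. x \<in> S \<Longrightarrow> D2 (W i) x = (\<Sum>j\<in>UNIV. M2 i j x * W j x)"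
      using ex[of c] by blast
    then show "\<exists>W. killing_on S (W Jv) (W Jb) (W Jt) \<and> (\<forall>i. W i p0 = c i) \<and>
       (\<forall>x\<in>S. D2 (W Jb) x = (\<Sum>j\<in>UNIV. M2 Jb j x * W j x))"
      using kill[OF S(1,4) W(1,3,4)] by blast
  qed
qed

end

context gradient_frame
begin

lemma gradient_frame_subset: "open S \<Longrightarrow> S \<subseteq> V \<Longrightarrow> gradient_frame S g e1"
  using orthonormal_frame_subset[of S] D1_curv_pos D2_curv
  unfolding gradient_frame_def gradient_frame_axioms_def by blast

text \<open>Where \<open>f\<close> is nonzero every \<beta> vanishes, and the two numbers v, \<tau>
  at \<open>x0\<close> cannot separate three integrals. Some nontrivial combination then has all
  jets zero at \<open>x0\<close>, contradicting independence.\<close>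

lemma common_factor_zero:
  fixes v \<beta> \<tau> :: "3 \<Rightarrow> scalar_field"
  assumes V: "convex V" and kf: "\<And>i. killing_fields (v i) (\<beta> i) (\<tau> i)"
    and ind: "\<And>c::real^3. (\<And>x. x \<in> V \<Longrightarrow> (\<Sum>i\<in>UNIV. c $ i * v i x) = 0 \<and> (\<Sum>i\<in>UNIV. c $ i * \<beta> i x) = 0
        \<and> (\<Sum>i\<in>UNIV. c $ i * \<tau> i x) = 0) \<Longrightarrow> c = 0"
    and f: "smooth f" "\<And>i x. x \<in> V \<Longrightarrow> f x * \<beta> i x = 0" and x0: "x0 \<in> V"
  shows "f x0 = 0"
proof (rule ccontr)
  assume f0: "f x0 \<noteq> 0"
  let ?v = "\<lambda>c x. \<Sum>i\<in>UNIV. c $ i * v i x" and ?\<beta> = "\<lambda>c x. \<Sum>i\<in>UNIV. c $ i * \<beta> i x" and ?\<tau> = "\<lambda>c x. \<Sum>i\<in>UNIV. c $ i * \<tau> i x"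
  have k: "killing_fields (?v c) (?\<beta> c) (?\<tau> c)" for c :: "real^3" by (rule killing_fields_sum[OF kf])
  define T where "T = V \<inter> f -` (- {0})"
  have T: "open T" "T \<subseteq> V" "x0 \<in> T"
    using continuous_open_preimage[OF smooth_on_continuous_on[OF f(1)] open_V, of "- {0}"] x0 f0 by (auto simp: T_def)
  interpret T: orthonormal_frame T g e1 by (rule orthonormal_frame_subset[OF T(1,2)])
  have \<beta>0: "\<beta> i x = 0" if "x \<in> T" for i x using f(2)[of x i] that by (auto simp: T_def)
  \<comment> \<open>The padding zero makes this an endomorphism of \<open>real^3\<close>; it is not
    onto, so it has a kernel.\<close>
  define \<psi> :: "real^3 \<Rightarrow> real^3" where "\<psi> c = vector [?v c x0, ?\<tau> c x0, 0]" for c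
  have lin: "linear \<psi>"
    by (rule linearI) (simp_all add: \<psi>_def vec_eq_iff forall_3 sum_3 algebra_simps)
  have "\<not> surj \<psi>"
  proof
    assume "surj \<psi>"
    then obtain c where "\<psi> c = vector [0, 0, 1]" by (metis surjD)
    then show False by (simp add: \<psi>_def vec_eq_iff forall_3)
  qed
  then have "\<not> inj \<psi>" using lin linear_injective_imp_surjective by blast
  then obtain c where c: "c \<noteq> 0" "\<psi> c = 0" using lin by (auto simp: linear_injective_0)
  have z: "?v c x0 = 0" "?\<beta> c x0 = 0" "?\<tau> c x0 = 0" using c(2) \<beta>0[OF T(3)] by (simp_all add: \<psi>_def vec_eq_iff forall_3)
  \<comment> \<open>As \<beta> vanishes on a whole neighbourhood, so do its derivatives, which gives
    X = Y = 0 at \<open>x0\<close>; R follows from the derived constraint.\<close>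
  have "D1 (?\<beta> c) x0 = D1 (\<lambda>x. 0) x0" "D2 (?\<beta> c) x0 = D2 (\<lambda>x. 0) x0"
    by (rule T.D_cong[OF T(3)], simp add: \<beta>0)+
  then have "jet_x (?v c) (?\<beta> c) x0 = 0" "jet_y (?v c) (?\<beta> c) x0 = 0"
    using z x0 by (simp_all add: jet_x_def jet_y_def)
  moreover from this have "jet_r (?v c) (?\<beta> c) x0 = 0"
    using derived_constraints(2)[OF k x0, of c] z k_pos[OF x0] by simp
  ultimately have "?v c x = 0 \<and> ?\<beta> c x = 0 \<and> ?\<tau> c x = 0" if "x \<in> V" for x
    using killing_fields_unique[OF k V x0 z] that by blast
  then show False using ind c(1) by blast
qed

text \<open>Where \<open>h2\<close> is zero, the first constraint reads X = u \<beta>.\<close>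

definition u :: scalar_field where "u x = (h3 x - h1 x) / (5 * k x)"

lemma smooth_u: "smooth u"
  unfolding u_def[abs_def]
  by (intro smooth_on_divide[OF open_V] smooth_intros smooth_comps) (use k_pos in force)

text \<open>The system for \<tau>, v, \<beta> and Y that remains after substituting X = u \<beta>,
  with \<open>a = 0\<close>. R has been eliminated by D2 X = D2 (u \<beta>).\<close>

definition deg_M1 :: "jet \<Rightarrow> jet \<Rightarrow> scalar_field" where
  "deg_M1 i j = (case i of
      Jt \<Rightarrow> (case j of Jy \<Rightarrow> (\<lambda>x. -2) | _ \<Rightarrow> (\<lambda>x. 0))
    | Jv \<Rightarrow> (case j of Jy \<Rightarrow> (\<lambda>x. 1) | _ \<Rightarrow> (\<lambda>x. 0))
    | Jb \<Rightarrow> (case j of Jb \<Rightarrow> u | _ \<Rightarrow> (\<lambda>x. 0))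
    | Jy \<Rightarrow> (case j of Jv \<Rightarrow> (\<lambda>x. - 2 * b x * u x - 2 * curv x) | Jy \<Rightarrow> (\<lambda>x. u x + b x) | _ \<Rightarrow> (\<lambda>x. 0))
    | _ \<Rightarrow> (\<lambda>x. 0))"

definition deg_M2 :: "jet \<Rightarrow> jet \<Rightarrow> scalar_field" where
  "deg_M2 i j = (case i of
      Jt \<Rightarrow> (case j of Jb \<Rightarrow> (\<lambda>x. - 2 * u x) | _ \<Rightarrow> (\<lambda>x. 0))
    | Jv \<Rightarrow> (case j of Jb \<Rightarrow> (\<lambda>x. 2 * b x - u x) | _ \<Rightarrow> (\<lambda>x. 0))
    | Jb \<Rightarrow> (case j of Jv \<Rightarrow> (\<lambda>x. - 2 * b x) | Jy \<Rightarrow> (\<lambda>x. 1) | _ \<Rightarrow> (\<lambda>x. 0))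
    | Jy \<Rightarrow> (case j of Jb \<Rightarrow> (\<lambda>x. b x * u x - curv x) | _ \<Rightarrow> (\<lambda>x. 0))
    | _ \<Rightarrow> (\<lambda>x. 0))"

lemma smooth_deg_M: "smooth (deg_M1 i j)" "smooth (deg_M2 i j)"
  unfolding deg_M1_def deg_M2_def
  by (auto split: jet.split intro!: smooth_intros smooth_u)

text \<open>If \<open>I\<^sub>4\<^sub>b = 0\<close>, the third constraint reads \<open>f \<beta> = 0\<close>.  Three independent integrals force
  \<open>f = 0\<close>, and then the remaining rank 4 system is flat, so there are at least four.\<close>

lemma degenerate_flat:
  fixes v \<beta> \<tau> :: "3 \<Rightarrow> scalar_field"
  assumes V: "convex V" and h2: "\<And>x. x \<in> V \<Longrightarrow> h2 x = 0"
    and kf: "\<And>i. killing_fields (v i) (\<beta> i) (\<tau> i)"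
    and ind: "\<And>c::real^3. (\<And>x. x \<in> V \<Longrightarrow> (\<Sum>i\<in>UNIV. c $ i * v i x) = 0 \<and> (\<Sum>i\<in>UNIV. c $ i * \<beta> i x) = 0
        \<and> (\<Sum>i\<in>UNIV. c $ i * \<tau> i x) = 0) \<Longrightarrow> c = 0"
    and x: "x \<in> V"
  shows "a x = 0" "D1 (deg_M2 i j) x - D2 (deg_M1 i j) x
      + (\<Sum>k\<in>UNIV. deg_M2 i k x * deg_M1 k j x - deg_M1 i k x * deg_M2 k j x) + a x * deg_M1 i j x + b x * deg_M2 i j x = 0" (is "?A = 0")
proof -
  have cfz: "f x = 0" if "smooth f" "\<And>i x. x \<in> V \<Longrightarrow> f x * \<beta> i x = 0" "x \<in> V" for f x
    by (rule common_factor_zero[where v=v and \<beta>=\<beta> and \<tau>=\<tau>, OF V kf _ that]) (rule ind)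
  have a0: "a x = 0" if "x \<in> V" for x using connection_eqs(1)[OF that] h2[OF that] k_pos[OF that] by simp
  note ks = killing_smooth[OF kf]
  note D = D_rules smooth_intros ks smooth_u smooth_ab smooth_curv smooth_comps D_const D_curv D_k
  have X: "jet_x (v i) (\<beta> i) x = u x * \<beta> i x" if "x \<in> V" for i x
    using first_constraint[OF kf that, of i] h2[OF that] k_pos[OF that] by (simp add: u_def field_simps)
  have D1b: "D1 b x = - curv x - b x * b x" if "x \<in> V" for x
    using D2_a[OF that] D_zero(2)[OF that a0] a0[OF that] by simp
  \<comment> \<open>Differentiating X = u \<beta> along \<open>e1\<close> and comparing with the
    prolonged system leaves a multiple of \<beta>, whose factor must vanish.\<close>
  have D1u: "D1 u x = - u x * u x - curv x" if x: "x \<in> V" for x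
  proof -
    have "(D1 u x + u x * u x + curv x) * \<beta> i x = 0" if x: "x \<in> V" for i x
    proof -
      have "D1 (jet_x (v i) (\<beta> i)) x = D1 (\<lambda>x. u x * \<beta> i x) x" by (rule D_cong[OF x X])
      then show ?thesis using X[OF x, of i]
        by (simp add: D x killing_D_0[OF kf x] killing_D_1[OF kf x] a0[OF x] algebra_simps)
    qed
    moreover have "smooth (\<lambda>x. D1 u x + u x * u x + curv x)"
      by (intro smooth_intros smooth_D smooth_u smooth_curv)
    ultimately have "D1 u x + u x * u x + curv x = 0"
      using cfz[of "\<lambda>x. D1 u x + u x * u x + curv x" x] x by blast
    then show ?thesis by simp
  qed
  \<comment> \<open>The function \<open>c = D2 b\<close> satisfies D1 c = - 3 b c and D2 u = c / 5.
    Commuting derivatives of u gives c (u - b) = 0; differentiating this along \<open>e2\<close> and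
    multiplying by c gives c^3 = 0.\<close>
  have c0: "D2 b x = 0" if x: "x \<in> V" for x
  proof -
    define c where "c = D2 b"
    have sc: "smooth c" unfolding c_def by auto
    have D2u: "D2 u x = c x / 5" if x: "x \<in> V" for x
    proof -
      have "5 * (k x * u x) = b x * k x - h1 x" if "x \<in> V" for x
        using k_pos[OF that] connection_eqs(2)[OF that] by (simp add: u_def field_simps)
      then have "D2 (\<lambda>x. 5 * (k x * u x)) x = D2 (\<lambda>x. b x * k x - h1 x) x" by (intro D_cong[OF x])
      moreover have "D2 h1 x = 0"
        using D_h(2,4)[OF x] D_zero(1)[OF x h2] a0[OF x] h2[OF x] by simp
      ultimately have "5 * (k x * D2 u x) = D2 b x * k x" by (simp add: D x h2)
      then show ?thesis using k_pos[OF x] by (simp add: c_def)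
    qed
    have D1c: "D1 c x = - 3 * b x * c x" if x: "x \<in> V" for x
    proof -
      have "D1 c x - D2 (\<lambda>x. - curv x - b x * b x) x = - a x * (- curv x - b x * b x) - b x * c x"
        by (rule D_commute_eq[OF smooth_ab(2) x D1b]) (auto simp: c_def)
      then have "D1 c x + 3 * (c x * b x) = 0" by (simp add: D x a0 algebra_simps flip: c_def)
      then show ?thesis by algebra
    qed
    have cu: "c x * (u x - b x) = 0" if x: "x \<in> V" for x
    proof -
      have "D1 c x - D2 (\<lambda>x. 5 * (- u x * u x - curv x)) x = - a x * (5 * (- u x * u x - curv x)) - b x * c x"
        by (rule D_commute_eq[of "\<lambda>x. 5 * u x"]) (auto simp: D x D1u D2u)
      then show ?thesis by (simp add: D x a0 sc D1c D2u algebra_simps)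
    qed
    have "D2 (\<lambda>x. c x * (u x - b x)) x = 0" by (rule D_zero[OF x cu])
    then have e: "D2 c x * (u x - b x) + c x * (c x / 5 - c x) = 0"
      by (simp add: D x sc D2u algebra_simps flip: c_def)
    have "c x * (D2 c x * (u x - b x) + c x * (c x / 5 - c x))
      = D2 c x * (c x * (u x - b x)) - 4 / 5 * (c x * c x * c x)"
      by (simp add: field_simps)
    then have "c x = 0" unfolding e cu[OF x] by simp
    then show ?thesis by (simp add: c_def)
  qed
  have D2u: "D2 u x = 0" if x: "x \<in> V" for x
  proof -
    have "5 * (k x * u x) = b x * k x - h1 x" if "x \<in> V" for x
      using k_pos[OF that] connection_eqs(2)[OF that] by (simp add: u_def field_simps)
    then have "D2 (\<lambda>x. 5 * (k x * u x)) x = D2 (\<lambda>x. b x * k x - h1 x) x" by (intro D_cong[OF x])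
    moreover have "D2 h1 x = 0"
      using D_h(2,4)[OF x] D_zero(1)[OF x h2] a0[OF x] h2[OF x] by simp
    ultimately show ?thesis using k_pos[OF x] by (simp add: D x h2 c0)
  qed
  \<comment> \<open>The coefficient of \<beta> in the integrability condition for Y, the last
    obstruction to flatness of the rank 4 system.\<close>
  define \<mu> where "\<mu> x = - k x - curv x * u x + (- curv x - b x * b x) * u x + b x * (- curv x - u x * u x) + b x * u x * u x
      - (u x * ((b x * u x - curv x) - 2 * b x * (2 * b x - u x)) + b x * (b x * u x - curv x) - 2 * curv x * (2 * b x - u x))
      + b x * (b x * u x - curv x)" for x
  have \<mu>: "\<mu> x = 0" if x: "x \<in> V" for x
  proof (rule cfz[OF _ _ x])
    show "smooth \<mu>" unfolding \<mu>_def by (intro smooth_intros smooth_u smooth_ab smooth_curv smooth_comps)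
    show "\<mu> x * \<beta> i x = 0" if x: "x \<in> V" for i x
    proof -
      let ?Y = "jet_y (v i) (\<beta> i)"
      have DY: "D1 ?Y x = u x * (?Y x - 2 * b x * v i x) + b x * ?Y x - 2 * curv x * v i x"
        "D2 ?Y x = (b x * u x - curv x) * \<beta> i x" if x: "x \<in> V" for x
      proof -
        have "D2 (jet_x (v i) (\<beta> i)) x = D2 (\<lambda>x. u x * \<beta> i x) x" by (rule D_cong[OF x X])
        then have "D2 (jet_x (v i) (\<beta> i)) x = u x * (?Y x - 2 * b x * v i x)"
          by (simp add: D x D2u killing_D_0[OF kf x])
        then show "D1 ?Y x = u x * (?Y x - 2 * b x * v i x) + b x * ?Y x - 2 * curv x * v i x"
          using killing_D_1[OF kf x, of i] a0[OF x] by simp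
        show "D2 ?Y x = (b x * u x - curv x) * \<beta> i x"
          using killing_D_1(2)[OF kf x, of i] X[OF x, of i] by (simp add: algebra_simps)
      qed
      have "D1 (\<lambda>x. (b x * u x - curv x) * \<beta> i x) x - D2 (\<lambda>x. u x * (?Y x - 2 * b x * v i x) + b x * ?Y x - 2 * curv x * v i x) x
        = - a x * (u x * (?Y x - 2 * b x * v i x) + b x * ?Y x - 2 * curv x * v i x) - b x * ((b x * u x - curv x) * \<beta> i x)"
        by (rule D_commute_eq[OF ks(5) x DY])
      then show ?thesis
        by (simp add: D x a0 D2u c0 D1b D1u DY killing_D_0[OF kf x] X \<mu>_def algebra_simps)
    qed
  qed
  show "a x = 0" by (rule a0[OF x])
  show "?A = 0"
    unfolding sum_jet using \<mu>[OF x]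
    by (cases i; cases j) (simp_all add: deg_M1_def deg_M2_def D x a0 D1b D1u D2u c0 \<mu>_def algebra_simps)
qed

theorem dim_degenerate:
  assumes p0: "p0 \<in> V" and h2: "\<And>x. x \<in> V \<Longrightarrow> h2 x = 0"
  shows "dim (integral_germs g p0 2) \<noteq> 3"
proof
  assume d: "dim (integral_germs g p0 2) = 3"
  show False
  proof (rule dim_3_killing_fields[OF p0 d])
    fix S and v \<beta> \<tau> :: "3 \<Rightarrow> scalar_field"
    assume S: "open S" "convex S" "p0 \<in> S" "S \<subseteq> V" and kf: "\<And>i. killing_on S (v i) (\<beta> i) (\<tau> i)"
      and ind: "\<And>(c::real^3) T. open T \<Longrightarrow> p0 \<in> T \<Longrightarrow> (\<And>x. x \<in> T \<Longrightarrow> (\<Sum>i\<in>UNIV. c $ i * v i x) = 0 \<and> (\<Sum>i\<in>UNIV. c $ i * \<beta> i x) = 0 \<and> (\<Sum>i\<in>UNIV. c $ i * \<tau> i x) = 0) \<Longrightarrow> c = 0"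
    interpret S: gradient_frame S g e1 by (rule gradient_frame_subset[OF S(1,4)])
    have flat: "a x = 0" "D1 (deg_M2 i j) x - D2 (deg_M1 i j) x
        + (\<Sum>k\<in>UNIV. deg_M2 i k x * deg_M1 k j x - deg_M1 i k x * deg_M2 k j x) + a x * deg_M1 i j x + b x * deg_M2 i j x = 0"
      if "x \<in> S" for x i j
    proof -
      have h: "S.h2 y = 0" if "y \<in> S" for y using h2 that S(4) by blast
      show "a x = 0" "D1 (deg_M2 i j) x - D2 (deg_M1 i j) x
        + (\<Sum>k\<in>UNIV. deg_M2 i k x * deg_M1 k j x - deg_M1 i k x * deg_M2 k j x) + a x * deg_M1 i j x + b x * deg_M2 i j x = 0"
        by (rule S.degenerate_flat[where v=v and \<beta>=\<beta> and \<tau>=\<tau>, OF S(2) h kf _ that]; assumption?; rule ind[OF S(1,3)]; assumption)+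
    qed
    have "\<exists>T. open T \<and> convex T \<and> p0 \<in> T \<and> T \<subseteq> S \<and> (\<forall>c. \<exists>W. killing_on T (W Jv) (W Jb) (W Jt) \<and>
         (\<forall>i. W i p0 = c i) \<and> (\<forall>x\<in>T. D2 (W Jb) x = (\<Sum>j\<in>UNIV. deg_M2 Jb j x * W j x)))"
    proof (rule S.killing_fields_from_flat[OF S(3) S.smooth_deg_M flat(2)])
      fix T W assume T: "open T" "T \<subseteq> S" and W: "\<And>i. smooth_on T (W i)"
        "\<And>i x. x \<in> T \<Longrightarrow> D1 (W i) x = (\<Sum>j\<in>UNIV. deg_M1 i j x * W j x)"
        "\<And>i x. x \<in> T \<Longrightarrow> D2 (W i) x = (\<Sum>j\<in>UNIV. deg_M2 i j x * W j x)"
      interpret T: gradient_frame T g e1 by (rule S.gradient_frame_subset[OF T])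
      have "a x = 0" if "x \<in> T" for x using flat(1) that T(2) by blast
      then show "killing_on T (W Jv) (W Jb) (W Jt)"
        unfolding T.killing_fields_def using W(1)
        by (simp add: W(2,3) sum_jet deg_M1_def deg_M2_def algebra_simps)
    qed
    then obtain T where T: "open T" "convex T" "p0 \<in> T" "T \<subseteq> S"
      and ex: "\<And>c. \<exists>W. killing_on T (W Jv) (W Jb) (W Jt) \<and> (\<forall>i. W i p0 = c i) \<and>
         (\<forall>x\<in>T. D2 (W Jb) x = (\<Sum>j\<in>UNIV. deg_M2 Jb j x * W j x))" by blast
    interpret T: gradient_frame T g e1 by (rule S.gradient_frame_subset[OF T(1,4)])
    have "dim (integral_germs g p0 2) \<noteq> 3"
    proof (rule T.dim_integral_germs_neq_3[OF T(3)])
      fix v0 b0 t0 y0 :: real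
      obtain W where W: "killing_on T (W Jv) (W Jb) (W Jt)" "\<And>i. W i p0 = (case i of Jt \<Rightarrow> t0 | Jv \<Rightarrow> v0 | Jb \<Rightarrow> b0 | Jy \<Rightarrow> y0 | _ \<Rightarrow> 0)"
        "\<And>x. x \<in> T \<Longrightarrow> D2 (W Jb) x = (\<Sum>j\<in>UNIV. deg_M2 Jb j x * W j x)"
        using ex[of "\<lambda>i. case i of Jt \<Rightarrow> t0 | Jv \<Rightarrow> v0 | Jb \<Rightarrow> b0 | Jy \<Rightarrow> y0 | _ \<Rightarrow> 0"] by blast
      have "D2 (W Jb) p0 + 2 * b p0 * W Jv p0 = y0"
        using T(3) by (simp add: W(3) sum_jet deg_M2_def W(2))
      then show "\<exists>v \<beta> \<tau>. killing_on T v \<beta> \<tau> \<and> v p0 = v0 \<and> \<beta> p0 = b0 \<and> \<tau> p0 = t0 \<and> D2 \<beta> p0 + 2 * b p0 * v p0 = y0"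
        using W(1,2) by (intro exI[of _ "W Jv"] exI[of _ "W Jb"] exI[of _ "W Jt"]) auto
    qed
    then show False using d by simp
  qed
qed

end

section \<open>Translation of the relations between invariants and frame components\<close>

text \<open>Clears the denominator \<open>c\<close>, here 175 I3^2 I4b, and then cancels the common
  power \<open>m = k^8\<close>.\<close>

lemma eq_quotient_iff:
  fixes c q N m r :: real
  assumes "c * q - N = m * r" "c \<noteq> 0" "m \<noteq> 0"
  shows "q = 1 / c * N \<longleftrightarrow> r = 0"
proof -
  have "q = 1 / c * N \<longleftrightarrow> c * q - N = 0" using assms(2) by (simp add: field_simps)
  then show ?thesis using assms by simp
qed

text \<open>The relation for I6a with I3 = k^2 and with k^2 h, k^3 t, k^4 q in place of the
  invariants of index 4, 5, 6.\<close>

lemma relation_a_iff: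
  fixes K k h1 h2 h3 t1 t2 t3 t4 q1 :: real
  assumes "k \<noteq> 0" "h2 \<noteq> 0"
  shows "k^4 * q1 = 1 / (175 * (k^2)^2 * (k^2 * h2)) *
      (700 * (k^2)^5 * (k^2 * h2) - 825 * K * (k^2)^4 * (k^3 * t2) + 50 * K * (k^2)^3 * (k^2 * h2) * (31 * (k^2 * h1) - 18 * (k^2 * h3))
      + 6 * (k^2 * h2) * ((k^2 * h1) - (k^2 * h3)) * (6 * (k^2 * h1)^2 + 49 * (k^2 * h2)^2 - 37 * (k^2 * h1) * (k^2 * h3) + 6 * (k^2 * h3)^2)
      - 25 * (k^2)^2 * (k^3 * t2) * (-8 * (k^3 * t1) + (k^3 * t3))
      - 5 * (k^2) * (48 * (k^2 * h1)^2 * (k^3 * t2) - 27 * (k^3 * t2) * (k^2 * h3)^2 + 2 * (k^2 * h2) * (k^2 * h3) * (-11 * (k^3 * t1) + 46 * (k^3 * t3))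
      + (k^2 * h1) * (-43 * (k^3 * t1) * (k^2 * h2) - 21 * (k^3 * t2) * (k^2 * h3) + 8 * (k^2 * h2) * (k^3 * t3)) + 7 * (k^2 * h2)^2 * (4 * (k^3 * t2) - 11 * (k^3 * t4))))
    \<longleftrightarrow> rel_a K k h1 h2 h3 t1 t2 t3 t4 q1 = 0"
proof (rule eq_quotient_iff[where m="k^8"], goal_cases)
  case 1
  show ?case unfolding rel_defs by algebra
qed (use assms in auto)

lemma relation_b_iff:
  fixes K k h1 h2 h3 t1 t2 t3 t4 q2 :: real
  assumes "k \<noteq> 0" "h2 \<noteq> 0"
  shows "k^4 * q2 = 1 / (175 * (k^2)^2 * (k^2 * h2)) *
      (1505 * K * (k^2)^3 * (k^2 * h2)^2 + 72 * (k^2 * h1)^2 * (k^2 * h2)^2 + 245 * (k^2) * (k^3 * t1) * (k^2 * h2)^2 + 588 * (k^2 * h2)^4 + 225 * (k^2)^2 * (k^3 * t2)^2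
      + 405 * (k^2) * (k^2 * h2) * (k^3 * t2) * (k^2 * h3) + 72 * (k^2 * h2)^2 * (k^2 * h3)^2 - 6 * (k^2 * h1) * (k^2 * h2) * (55 * (k^2) * (k^3 * t2) + 74 * (k^2 * h2) * (k^2 * h3))
      - 490 * (k^2) * (k^2 * h2)^2 * (k^3 * t3))
    \<longleftrightarrow> rel_b K k h1 h2 h3 t1 t2 t3 t4 q2 = 0"
proof (rule eq_quotient_iff[where m="k^8"], goal_cases)
  case 1
  show ?case unfolding rel_defs by algebra
qed (use assms in auto)

lemma relation_c_iff:
  fixes K k h1 h2 h3 t1 t2 t3 t4 q3 :: real
  assumes "k \<noteq> 0" "h2 \<noteq> 0"
  shows "k^4 * q3 = 1 / (175 * (k^2)^2 * (k^2 * h2)) *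
      (-175 * (k^2)^5 * (k^2 * h2) + 300 * K * (k^2)^4 * (k^3 * t2) - 25 * (k^2)^2 * (k^3 * t1) * (k^3 * t2) - 100 * K * (k^2)^3 * (k^2 * h2) * (5 * (k^2 * h1) - 9 * (k^2 * h3))
      - 6 * (k^2 * h2) * ((k^2 * h1) - (k^2 * h3)) * (6 * (k^2 * h1)^2 + 49 * (k^2 * h2)^2 - 37 * (k^2 * h1) * (k^2 * h3) + 6 * (k^2 * h3)^2)
      + 200 * (k^2)^2 * (k^3 * t2) * (k^3 * t3)
      + 5 * (k^2) * (6 * (k^2 * h1)^2 * (k^3 * t2) + 36 * (k^3 * t2) * (k^2 * h3)^2 - (k^2 * h2) * (k^2 * h3) * ((k^3 * t1) + 34 * (k^3 * t3))
      + 6 * (k^2 * h1) * ((k^3 * t1) * (k^2 * h2) - 7 * (k^3 * t2) * (k^2 * h3) - (k^2 * h2) * (k^3 * t3)) + 7 * (k^2 * h2)^2 * (8 * (k^3 * t2) - (k^3 * t4))))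
    \<longleftrightarrow> rel_c K k h1 h2 h3 t1 t2 t3 t4 q3 = 0"
proof (rule eq_quotient_iff[where m="k^8"], goal_cases)
  case 1
  show ?case unfolding rel_defs by algebra
qed (use assms in auto)

lemma relation_d_iff:
  fixes K k h1 h2 h3 t1 t2 t3 t4 q4 :: real
  assumes "k \<noteq> 0" "h2 \<noteq> 0"
  shows "k^4 * q4 = 1 / (175 * (k^2)^2 * (k^2 * h2)) *
      (1500 * K^2 * (k^2)^6 + 36 * (k^2 * h1)^4 + 25 * (k^2)^2 * (k^3 * t1)^2 + 245 * (k^2) * (k^3 * t1) * (k^2 * h2)^2 + 588 * (k^2 * h2)^4
      + 225 * (k^2)^2 * (k^3 * t2)^2 - 294 * (k^2 * h1)^3 * (k^2 * h3) + 895 * (k^2) * (k^2 * h2) * (k^3 * t2) * (k^2 * h3) - 185 * (k^2) * (k^3 * t1) * (k^2 * h3)^2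
      + 366 * (k^2 * h2)^2 * (k^2 * h3)^2 + 36 * (k^2 * h3)^4
      + 6 * (k^2 * h1)^2 * (61 * (k^2 * h2)^2 + 86 * (k^2 * h3)^2 - 5 * (k^2) * (2 * (k^3 * t1) - 9 * (k^3 * t3)))
      - 225 * (k^2)^2 * (k^3 * t1) * (k^3 * t3) - 490 * (k^2) * (k^2 * h2)^2 * (k^3 * t3) + 220 * (k^2) * (k^2 * h3)^2 * (k^3 * t3) + 200 * (k^2)^2 * (k^3 * t3)^2
      + 5 * K * (k^2)^3 * (102 * (k^2 * h1)^2 - 294 * (k^2 * h1) * (k^2 * h3) + 4 * (49 * (k^2 * h2)^2 + 48 * (k^2 * h3)^2)
      + (k^2) * (-85 * (k^3 * t1) + 260 * (k^3 * t3)))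
      - 245 * (k^2) * (k^2 * h2) * (k^2 * h3) * (k^3 * t4)
      - (k^2 * h1) * (6 * (k^2 * h3) * (172 * (k^2 * h2)^2 + 49 * (k^2 * h3)^2)
      + 5 * (k^2) * (-49 * (k^2 * h3) * ((k^3 * t1) - 2 * (k^3 * t3)) + (k^2 * h2) * (164 * (k^3 * t2) - 49 * (k^3 * t4)))))
    \<longleftrightarrow> rel_d K k h1 h2 h3 t1 t2 t3 t4 q4 = 0"
proof (rule eq_quotient_iff[where m="k^8"], goal_cases)
  case 1
  show ?case unfolding rel_defs by algebra
qed (use assms in auto)

section \<open>Sufficiency of the relations\<close>

context gradient_frame
begin

text \<open>X = xv v + xb \<beta> and Y = yv v + yb \<beta> are the solutions of the first and
  second constraints, where \<open>h2\<close> is nonzero.\<close>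

definition xv :: scalar_field where "xv x = 2 * h2 x / (5 * k x)"
definition xb :: scalar_field where "xb x = (h3 x - h1 x) / (5 * k x)"
definition yv :: scalar_field where
  "yv x = (12 * h1 x * h2 x - 2 * h2 x * h3 x - 10 * k x * t2 x) / (35 * h2 x * k x)"
definition yb :: scalar_field where
  "yb x = - (25 * curv x * k x * k x - 7 * h1 x * h3 x + 6 * h1 x * h1 x + h3 x * h3 x - 5 * k x * t1 x + 5 * k x * t3 x) / (35 * h2 x * k x)"

text \<open>The Killing equations with these X and Y inserted: a system of rank 3 for \<tau>, v,
  \<beta>.\<close>

definition gen_M1 :: "jet \<Rightarrow> jet \<Rightarrow> scalar_field" where
  "gen_M1 i j = (case i of
      Jt \<Rightarrow> (case j of Jv \<Rightarrow> (\<lambda>x. - 2 * yv x) | Jb \<Rightarrow> (\<lambda>x. - 2 * yb x) | _ \<Rightarrow> (\<lambda>x. 0))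
    | Jv \<Rightarrow> (case j of Jv \<Rightarrow> yv | Jb \<Rightarrow> (\<lambda>x. 2 * a x + yb x) | _ \<Rightarrow> (\<lambda>x. 0))
    | Jb \<Rightarrow> (case j of Jv \<Rightarrow> (\<lambda>x. xv x - 2 * a x) | Jb \<Rightarrow> xb | _ \<Rightarrow> (\<lambda>x. 0))
    | _ \<Rightarrow> (\<lambda>x. 0))"

definition gen_M2 :: "jet \<Rightarrow> jet \<Rightarrow> scalar_field" where
  "gen_M2 i j = (case i of
      Jt \<Rightarrow> (case j of Jv \<Rightarrow> (\<lambda>x. - 2 * xv x) | Jb \<Rightarrow> (\<lambda>x. - 2 * xb x) | _ \<Rightarrow> (\<lambda>x. 0))
    | Jv \<Rightarrow> (case j of Jv \<Rightarrow> (\<lambda>x. - xv x) | Jb \<Rightarrow> (\<lambda>x. 2 * b x - xb x) | _ \<Rightarrow> (\<lambda>x. 0))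
    | Jb \<Rightarrow> (case j of Jv \<Rightarrow> (\<lambda>x. yv x - 2 * b x) | Jb \<Rightarrow> yb | _ \<Rightarrow> (\<lambda>x. 0))
    | _ \<Rightarrow> (\<lambda>x. 0))"

lemma k_nonzero: "x \<in> V \<Longrightarrow> k x \<noteq> 0"
  using k_pos by force

context
  assumes h2: "\<And>x. x \<in> V \<Longrightarrow> h2 x \<noteq> 0"
    and rel: "\<And>x. x \<in> V \<Longrightarrow> rel_a (curv x) (k x) (h1 x) (h2 x) (h3 x) (t1 x) (t2 x) (t3 x) (t4 x) (q1 x) = 0"
      "\<And>x. x \<in> V \<Longrightarrow> rel_b (curv x) (k x) (h1 x) (h2 x) (h3 x) (t1 x) (t2 x) (t3 x) (t4 x) (q2 x) = 0"
      "\<And>x. x \<in> V \<Longrightarrow> rel_c (curv x) (k x) (h1 x) (h2 x) (h3 x) (t1 x) (t2 x) (t3 x) (t4 x) (q3 x) = 0"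
      "\<And>x. x \<in> V \<Longrightarrow> rel_d (curv x) (k x) (h1 x) (h2 x) (h3 x) (t1 x) (t2 x) (t3 x) (t4 x) (q4 x) = 0"
begin

lemma smooth_gen: "smooth xv" "smooth xb" "smooth yv" "smooth yb"
  unfolding xv_def[abs_def] xb_def[abs_def] yv_def[abs_def] yb_def[abs_def]
  by (intro smooth_on_divide[OF open_V] smooth_intros smooth_comps smooth_curv; simp add: k_nonzero h2)+

lemma gen_equations:
  assumes x: "x \<in> V"
  shows "-2 * h2 x + 5 * k x * xv x = 0" "h1 x - h3 x + 5 * k x * xb x = 0" "-12 * h1 x * h2 x + 2 * h2 x * h3 x + 35 * h2 x * k x * yv x + 10 * k x * t2 x = 0" "25 * curv x * k x^2 - 7 * h1 x * h3 x + 6 * h1 x^2 + 35 * h2 x * k x * yb x + h3 x^2 - 5 * k x * t1 x + 5 * k x * t3 x = 0"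
  using k_nonzero[OF x] h2[OF x]
  by (simp_all add: xv_def xb_def yv_def yb_def field_simps power2_eq_square)

text \<open>Obtained by differentiating \<open>gen_equations\<close> rather than the quotients, so
  that everything stays polynomial, as the flatness identities require.\<close>

lemma gen_derivatives:
  assumes x: "x \<in> V"
  shows "2 * a x * h1 x - 2 * a x * h3 x + 5 * h1 x * xv x + 5 * k x * D1 xv x - 2 * t2 x = 0" (is "?A = 0")
    "4 * a x * h2 x + 5 * h1 x * xb x + 5 * k x * D1 xb x + t1 x - t3 x = 0" (is "?B = 0")
    "10 * curv x * a x * k x^2 - 14 * a x * h1 x * h3 x - 35 * a x * h1 x * k x * yv x + 12 * a x * h1 x^2 - 28 * a x * h2 x^2 + 35 * a
      x * h3 x * k x * yv x + 2 * a x * h3 x^2 - 10 * a x * k x * t1 x + 20 * a x * k x * t3 x + 35 * h1 x * h2 x * yv x - 2 * h1 x * t2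
      x + 35 * h2 x * k x * D1 yv x - 12 * h2 x * t1 x + 2 * h2 x * t3 x + 2 * h3 x * t2 x + 10 * k x * q2 x + 35 * k x * t2 x * yv x = 0" (is "?C = 0")
    "50 * curv x * h1 x * k x + 38 * a x * h1 x * h2 x - 35 * a x * h1 x * k x * yb x - 18 * a x * h2 x * h3 x + 35 * a x * h3 x * k x
      * yb x - 25 * a x * k x * t2 x + 5 * a x * k x * t4 x + 35 * h1 x * h2 x * yb x + 7 * h1 x * t1 x - 2 * h1 x * t3 x + 35 * h2 x *
      k x * D1 yb x - 7 * h3 x * t1 x + 2 * h3 x * t3 x - 5 * k x * q1 x + 5 * k x * q3 x + 35 * k x * t2 x * yb x + 25 * k x^3 = 0" (is "?D = 0")
    "-2 * curv x * k x + 2 * b x * h1 x - 2 * b x * h3 x + 5 * h2 x * xv x + 5 * k x * D2 xv x - 2 * t3 x = 0" (is "?E = 0")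
    "4 * b x * h2 x + 5 * h2 x * xb x + 5 * k x * D2 xb x + t2 x - t4 x = 0" (is "?F = 0")
    "8 * curv x * h1 x * k x + 2 * curv x * h3 x * k x + 35 * curv x * k x^2 * yv x - 14 * b x * h1 x * h3 x - 35 * b x * h1 x * k x *
      yv x + 12 * b x * h1 x^2 - 28 * b x * h2 x^2 + 35 * b x * h3 x * k x * yv x + 2 * b x * h3 x^2 - 10 * b x * k x * t1 x + 20 * b x
      * k x * t3 x - 12 * h1 x * t3 x + 35 * h2 x * k x * D2 yv x - 2 * h2 x * t2 x + 2 * h2 x * t4 x + 35 * h2 x^2 * yv x + 2 * h3 x *
      t3 x + 10 * k x * q3 x + 35 * k x * t3 x * yv x + 10 * k x^3 = 0" (is "?G = 0")
    "75 * curv x * h2 x * k x + 35 * curv x * k x^2 * yb x + 38 * b x * h1 x * h2 x - 35 * b x * h1 x * k x * yb x - 18 * b x * h2 x *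
      h3 x + 35 * b x * h3 x * k x * yb x - 25 * b x * k x * t2 x + 5 * b x * k x * t4 x + 12 * h1 x * t2 x - 7 * h1 x * t4 x + 35 * h2
      x * k x * D2 yb x - 5 * h2 x * t1 x + 5 * h2 x * t3 x + 35 * h2 x^2 * yb x - 7 * h3 x * t2 x + 2 * h3 x * t4 x - 5 * k x * q2 x +
      5 * k x * q4 x + 35 * k x * t3 x * yb x = 0" (is "?H = 0")
proof -
  let ?J = "\<lambda>x. 25 * curv x * k x^2 - 7 * h1 x * h3 x + 6 * h1 x^2 + 35 * h2 x * k x * yb x + h3 x^2 - 5 * k x * t1 x + 5 * k x * t3 x"
  let ?I = "\<lambda>x. -12 * h1 x * h2 x + 2 * h2 x * h3 x + 35 * h2 x * k x * yv x + 10 * k x * t2 x"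
    note D = D_rules smooth_intros smooth_gen x D_const D_curv[OF x] D_k[OF x] D_h[OF x] D1_t[OF x] D2_t[OF x] power2_eq_square power3_eq_cube
    have z0: "D1 (\<lambda>x. -2 * h2 x + 5 * k x * xv x) x = 0" "D2 (\<lambda>x. -2 * h2 x + 5 * k x * xv x) x = 0"
      by (rule D_zero[OF x gen_equations(1)], assumption)+
    have z1: "D1 (\<lambda>x. h1 x - h3 x + 5 * k x * xb x) x = 0" "D2 (\<lambda>x. h1 x - h3 x + 5 * k x * xb x) x = 0"
      by (rule D_zero[OF x gen_equations(2)], assumption)+
    have z2: "D1 ?I x = 0" "D2 ?I x = 0"
      by (rule D_zero[OF x gen_equations(3)], assumption)+
    have z3: "D1 ?J x = 0" "D2 ?J x = 0"
      by (rule D_zero[OF x gen_equations(4)], assumption)+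
    show "?A = 0" using z0(1) by (simp add: D algebra_simps)
    show "?B = 0" using z1(1) by (simp add: D algebra_simps)
    show "?C = 0" using z2(1) by (simp add: D algebra_simps)
    show "?D = 0" using z3(1) by (simp add: D algebra_simps)
    show "?E = 0" using z0(2) by (simp add: D algebra_simps)
    show "?F = 0" using z1(2) by (simp add: D algebra_simps)
    show "?G = 0" using z2(2) by (simp add: D algebra_simps)
    show "?H = 0" using z3(2) by (simp add: D algebra_simps)
qed

text \<open>The curvature of the rank 3 system is made up of the compatibility conditions for X and
  Y, which the six flatness identities supply; this is where the four relations are used.\<close>

lemma gen_flat:
  assumes x: "x \<in> V"
  shows "D1 (gen_M2 i j) x - D2 (gen_M1 i j) x
      + (\<Sum>l\<in>UNIV. gen_M2 i l x * gen_M1 l j x - gen_M1 i l x * gen_M2 l j x) + a x * gen_M1 i j x + b x * gen_M2 i j x = 0"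
proof -
    let ?C = "\<lambda>i j. D1 (gen_M2 i j) x - D2 (gen_M1 i j) x
      + (gen_M2 i Jt x * gen_M1 Jt j x - gen_M1 i Jt x * gen_M2 Jt j x
       + (gen_M2 i Jv x * gen_M1 Jv j x - gen_M1 i Jv x * gen_M2 Jv j x)
       + (gen_M2 i Jb x * gen_M1 Jb j x - gen_M1 i Jb x * gen_M2 Jb j x)
       + (gen_M2 i Jx x * gen_M1 Jx j x - gen_M1 i Jx x * gen_M2 Jx j x)
       + (gen_M2 i Jy x * gen_M1 Jy j x - gen_M1 i Jy x * gen_M2 Jy j x)
       + (gen_M2 i Jr x * gen_M1 Jr j x - gen_M1 i Jr x * gen_M2 Jr j x)) + a x * gen_M1 i j x + b x * gen_M2 i j x"
    note c = connection_eqs[OF x] and d0 = gen_equations[OF x] and d1 = gen_derivatives[OF x] and nz = k_nonzero[OF x] h2[OF x]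
    note g1v = flatness_identity_1v[OF nz d1(1) d0(3) d0(1) d0(2) c(1)]
    note g1b = flatness_identity_1b[OF nz d1(2) d0(4) d0(1) d0(2) c(1)]
    note g2v = flatness_identity_2v[OF nz d1(7) d0(3) d0(4) d0(1) c(2) rel(3)[OF x]]
    note g2b = flatness_identity_2b[OF nz d1(8) d0(3) d0(4) d0(2) c(2) rel(2)[OF x] rel(4)[OF x]]
    note g3v = flatness_identity_3v[OF nz d1(3) d1(5) d0(3) d0(4) d0(1) d0(2) c(1) c(2) rel(2)[OF x]]
    note g3b = flatness_identity_3b[OF nz d1(4) d1(6) d0(3) d0(4) d0(1) d0(2) c(1) c(2) rel(1)[OF x] rel(3)[OF x]]
    note E = gen_M1_def gen_M2_def D_rules smooth_intros smooth_gen x D_const D2_a[OF x] algebra_simps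
    have "?C Jt Jv = 0" using g1v g2v by (simp add: E)
    moreover have "?C Jt Jb = 0" using g1b g2b by (simp add: E)
    moreover have "?C Jv Jv = 0" using g1v g2v g3v by (simp add: E)
    moreover have "?C Jv Jb = 0" using g1b g2b g3b by (simp add: E)
    moreover have "?C Jb Jv = 0" using g1v g2v g3v by (simp add: E)
    moreover have "?C Jb Jb = 0" using g1b g2b g3b by (simp add: E)
    \<comment> \<open>No equation contains \<tau> itself, and the rows of X, Y, R are zero.\<close>
    moreover have "?C i j = 0" if "i \<notin> {Jt, Jv, Jb} \<or> j \<notin> {Jv, Jb}"
      using that by (cases i; cases j; simp add: gen_M1_def gen_M2_def D_const x)
    ultimately show ?thesis unfolding sum_jet by (cases i; cases j; blast)
qed

lemma smooth_gen_M: "smooth (gen_M1 i j)" "smooth (gen_M2 i j)"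
  unfolding gen_M1_def gen_M2_def by (auto split: jet.split intro!: smooth_intros smooth_gen)

text \<open>Flatness gives an integral for each value of (v, \<beta>, \<tau>) at \<open>p0\<close>;
  since \<open>h2\<close> is nonzero at \<open>p0\<close>, these values also determine it on every
  smaller convex neighbourhood.\<close>

theorem relations_sufficient:
  assumes p0: "p0 \<in> V"
  shows "dim (integral_germs g p0 2) = 3"
proof -
  have "\<exists>S. open S \<and> convex S \<and> p0 \<in> S \<and> S \<subseteq> V \<and> (\<forall>c. \<exists>W. killing_on S (W Jv) (W Jb) (W Jt) \<and>
       (\<forall>i. W i p0 = c i) \<and> (\<forall>x\<in>S. D2 (W Jb) x = (\<Sum>j\<in>UNIV. gen_M2 Jb j x * W j x)))"
  proof (rule killing_fields_from_flat[OF p0 smooth_gen_M gen_flat])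
    fix T W assume T: "open T" "T \<subseteq> V" and W: "\<And>i. smooth_on T (W i)"
      "\<And>i x. x \<in> T \<Longrightarrow> D1 (W i) x = (\<Sum>j\<in>UNIV. gen_M1 i j x * W j x)"
      "\<And>i x. x \<in> T \<Longrightarrow> D2 (W i) x = (\<Sum>j\<in>UNIV. gen_M2 i j x * W j x)"
    interpret T: gradient_frame T g e1 by (rule gradient_frame_subset[OF T])
    show "killing_on T (W Jv) (W Jb) (W Jt)"
      unfolding T.killing_fields_def
    proof (intro conjI ballI W(1))
      fix x assume x: "x \<in> T"
      note D = W(2)[OF x, unfolded sum_jet] W(3)[OF x, unfolded sum_jet]
      show "D1 (W Jv) x = 2 * a x * W Jb x + (D2 (W Jb) x + 2 * b x * W Jv x)"
        "D2 (W Jv) x = 2 * b x * W Jb x - (D1 (W Jb) x + 2 * a x * W Jv x)"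
        "D1 (W Jt) x = - 2 * (D2 (W Jb) x + 2 * b x * W Jv x)"
        "D2 (W Jt) x = - 2 * (D1 (W Jb) x + 2 * a x * W Jv x)"
        unfolding D gen_M1_def gen_M2_def jet.case by algebra+
    qed
  qed
  then obtain S where S: "open S" "convex S" "p0 \<in> S" "S \<subseteq> V"
    and ex: "\<forall>c. \<exists>W. killing_on S (W Jv) (W Jb) (W Jt) \<and> (\<forall>i. W i p0 = c i) \<and>
       (\<forall>x\<in>S. D2 (W Jb) x = (\<Sum>j\<in>UNIV. gen_M2 Jb j x * W j x))"
    by (elim exE conjE)
  interpret S: gradient_frame S g e1 by (rule gradient_frame_subset[OF S(1,4)])
  show ?thesis
  proof (rule S.dim_integral_germs_eq_3[OF S(3)])
    fix v0 b0 t0 :: real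
    obtain W where "killing_on S (W Jv) (W Jb) (W Jt)" "\<And>i. W i p0 = (case i of Jt \<Rightarrow> t0 | Jv \<Rightarrow> v0 | Jb \<Rightarrow> b0 | _ \<Rightarrow> 0)"
      using spec[OF ex, of "\<lambda>i. case i of Jt \<Rightarrow> t0 | Jv \<Rightarrow> v0 | Jb \<Rightarrow> b0 | _ \<Rightarrow> 0"] by (elim exE conjE) (simp only:)
    then show "\<exists>v \<beta> \<tau>. killing_on S v \<beta> \<tau> \<and> v p0 = v0 \<and> \<beta> p0 = b0 \<and> \<tau> p0 = t0"
      by (intro exI[of _ "W Jv"] exI[of _ "W Jb"] exI[of _ "W Jt"]) auto
  next
    fix T v \<beta> \<tau> x
    assume T: "open T" "convex T" "p0 \<in> T" "T \<subseteq> S" and kf: "killing_on T v \<beta> \<tau>"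
      and z: "v p0 = 0" "\<beta> p0 = 0" "\<tau> p0 = 0" and x: "x \<in> T"
    interpret T: gradient_frame T g e1 by (rule S.gradient_frame_subset[OF T(1,4)])
    show "v x = 0 \<and> \<beta> x = 0 \<and> \<tau> x = 0"
      by (rule T.killing_fields_unique_generic[OF kf T(2,3) h2[OF p0] z x])
  qed
qed

end
end

section \<open>Localisation near p0 and conclusion\<close>

context riemannian_chart
begin

lemma continuous_inv3: "continuous_on V (inv3 g)"
proof -
  obtain e where "orthonormal_frame V g e" using orthonormal_frame_exists by blast
  then interpret e: orthonormal_frame V g e .
  have "continuous_on V (\<lambda>x. e.D1 e.curv x * e.D1 e.curv x + e.D2 e.curv x * e.D2 e.curv x)"
    by (intro smooth_on_continuous_on smooth_intros e.smooth_D e.smooth_curv)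
  then show ?thesis by (rule continuous_on_cong[THEN iffD2, OF refl, rotated]) (rule e.inv3_frame)
qed

lemma local_gradient_frame:
  assumes p0: "p0 \<in> V" "inv3 g p0 \<noteq> 0" and P: "\<forall>\<^sub>F x in nhds p0. P x"
  shows "\<exists>W e. p0 \<in> W \<and> gradient_frame W g e \<and> (\<forall>x\<in>W. P x)"
proof -
  obtain S where S: "open S" "p0 \<in> S" "\<forall>x\<in>S. P x" using P unfolding eventually_nhds by blast
  let ?W = "S \<inter> (V \<inter> inv3 g -` (- {0}))"
  have "open ?W" using S(1) continuous_open_preimage[OF continuous_inv3 open_V, of "- {0}"] by auto
  then interpret W: riemannian_chart ?W g by (rule riemannian_chart_subset) blast
  have "\<exists>e. gradient_frame ?W g e" by (rule W.gradient_frame_exists) simp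
  then obtain e where "gradient_frame ?W g e" by (elim exE)
  then show ?thesis using S(2,3) p0 by (intro exI[of _ ?W] exI[of _ e]) simp
qed

text \<open>I3 is the squared length of grad K, so K is locally constant here.\<close>

lemma dim_inv3_zero:
  assumes p0: "p0 \<in> V" and z: "\<forall>\<^sub>F x in nhds p0. inv3 g x = 0"
  shows "dim (integral_germs g p0 2) \<noteq> 3"
proof -
  obtain S where S: "open S" "p0 \<in> S" "\<forall>x\<in>S. inv3 g x = 0" using z unfolding eventually_nhds by blast
  have "open (S \<inter> V)" using S(1) open_V by blast
  then interpret S: riemannian_chart "S \<inter> V" g by (rule riemannian_chart_subset) blast
  obtain e where "orthonormal_frame (S \<inter> V) g e" using S.orthonormal_frame_exists by blast
  then interpret e: orthonormal_frame "S \<inter> V" g e .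
  have "e.D1 e.curv x = 0 \<and> e.D2 e.curv x = 0" if "x \<in> S \<inter> V" for x
    using e.inv3_frame[OF that] S(3) that by (simp add: sum_squares_eq_zero_iff)
  then show ?thesis using S(2) p0 by (intro e.dim_constant_curvature) simp_all
qed

end

context gradient_frame
begin

lemma eventually_dinv_4b_nonzero:
  assumes p0: "p0 \<in> V" "dinv g 4 1 p0 \<noteq> 0"
  shows "\<forall>\<^sub>F x in nhds p0. dinv g 4 1 x \<noteq> 0"
proof -
  have "open (V \<inter> h2 -` (- {0}))"
    by (intro continuous_open_preimage smooth_on_continuous_on smooth_comps open_V open_Compl closed_singleton)
  moreover have "p0 \<in> V \<inter> h2 -` (- {0})" using p0 dinv_eq(2) by auto
  moreover have "dinv g 4 1 x \<noteq> 0" if "x \<in> V \<inter> h2 -` (- {0})" for x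
    using that k_nonzero[of x] dinv_eq(2)[of x] by auto
  ultimately show ?thesis unfolding eventually_nhds by blast
qed

text \<open>Three independent germs are realised on one neighbourhood of \<open>p0\<close>, and the
  pointwise argument of \<open>relations_necessary\<close> applies at each of its points.\<close>

lemma relations_necessary_dim:
  assumes p0: "p0 \<in> V" and h2: "\<And>x. x \<in> V \<Longrightarrow> h2 x \<noteq> 0" and d: "dim (integral_germs g p0 2) = 3"
  shows "\<forall>\<^sub>F x in nhds p0. x \<in> V
      \<and> rel_a (curv x) (k x) (h1 x) (h2 x) (h3 x) (t1 x) (t2 x) (t3 x) (t4 x) (q1 x) = 0
      \<and> rel_b (curv x) (k x) (h1 x) (h2 x) (h3 x) (t1 x) (t2 x) (t3 x) (t4 x) (q2 x) = 0
      \<and> rel_c (curv x) (k x) (h1 x) (h2 x) (h3 x) (t1 x) (t2 x) (t3 x) (t4 x) (q3 x) = 0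
      \<and> rel_d (curv x) (k x) (h1 x) (h2 x) (h3 x) (t1 x) (t2 x) (t3 x) (t4 x) (q4 x) = 0"
proof (rule dim_3_killing_fields[OF p0 d])
  fix S and v \<beta> \<tau> :: "3 \<Rightarrow> scalar_field"
  assume S: "open S" "convex S" "p0 \<in> S" "S \<subseteq> V" and kf: "\<And>i. killing_on S (v i) (\<beta> i) (\<tau> i)"
    and ind: "\<And>(c::real^3) T. open T \<Longrightarrow> p0 \<in> T \<Longrightarrow> (\<And>x. x \<in> T \<Longrightarrow> (\<Sum>i\<in>UNIV. c $ i * v i x) = 0 \<and> (\<Sum>i\<in>UNIV. c $ i * \<beta> i x) = 0 \<and> (\<Sum>i\<in>UNIV. c $ i * \<tau> i x) = 0) \<Longrightarrow> c = 0"
  interpret S: gradient_frame S g e1 by (rule gradient_frame_subset[OF S(1,4)])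
  have h: "S.h2 y \<noteq> 0" if "y \<in> S" for y using h2 that S(4) by blast
  have rel: "rel_a (curv x) (k x) (h1 x) (h2 x) (h3 x) (t1 x) (t2 x) (t3 x) (t4 x) (q1 x) = 0"
    "rel_b (curv x) (k x) (h1 x) (h2 x) (h3 x) (t1 x) (t2 x) (t3 x) (t4 x) (q2 x) = 0"
    "rel_c (curv x) (k x) (h1 x) (h2 x) (h3 x) (t1 x) (t2 x) (t3 x) (t4 x) (q3 x) = 0"
    "rel_d (curv x) (k x) (h1 x) (h2 x) (h3 x) (t1 x) (t2 x) (t3 x) (t4 x) (q4 x) = 0" if x: "x \<in> S" for x
  proof -
    have ind_S: "c = 0" if "\<And>x. x \<in> S \<Longrightarrow> (\<Sum>i\<in>UNIV. c $ i * v i x) = 0 \<and> (\<Sum>i\<in>UNIV. c $ i * \<beta> i x) = 0 \<and> (\<Sum>i\<in>UNIV. c $ i * \<tau> i x) = 0" for c :: "real^3"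
      by (rule ind[OF S(1,3) that])
    show "rel_a (curv x) (k x) (h1 x) (h2 x) (h3 x) (t1 x) (t2 x) (t3 x) (t4 x) (q1 x) = 0"
      "rel_b (curv x) (k x) (h1 x) (h2 x) (h3 x) (t1 x) (t2 x) (t3 x) (t4 x) (q2 x) = 0"
      "rel_c (curv x) (k x) (h1 x) (h2 x) (h3 x) (t1 x) (t2 x) (t3 x) (t4 x) (q3 x) = 0"
      "rel_d (curv x) (k x) (h1 x) (h2 x) (h3 x) (t1 x) (t2 x) (t3 x) (t4 x) (q4 x) = 0"
      by (rule S.relations_necessary[where v=v and \<beta>=\<beta> and \<tau>=\<tau> and x=x];
        (rule S(2) | rule kf | rule x | rule h, assumption | rule ind_S, assumption))+
  qed
  show ?thesis unfolding eventually_nhds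
    by (intro exI[of _ S] conjI ballI S(1,3) rel subsetD[OF S(4)])
qed

end

theorem theorem4:
  fixes U :: "(real^2) set" and g :: metric and p0 :: "real^2"
  assumes "open U" and "p0 \<in> U" and "riemannian_metric_on U g"
    and "(\<forall>\<^sub>F x in nhds p0. inv3 g x = 0) \<or> inv3 g p0 \<noteq> 0"
    and "(\<forall>\<^sub>F x in nhds p0. dinv g 4 1 x = 0) \<or> dinv g 4 1 p0 \<noteq> 0"
  shows "dim (integral_germs g p0 2) = 3 \<longleftrightarrow>
    inv3 g p0 \<noteq> 0 \<and> dinv g 4 1 p0 \<noteq> 0 \<and>
    (\<forall>\<^sub>F x in nhds p0.
      let I2 = inv2 g x; I3 = inv3 g x;
          I4a = dinv g 4 0 x; I4b = dinv g 4 1 x; I4c = dinv g 4 2 x;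
          I5a = dinv g 5 0 x; I5b = dinv g 5 1 x; I5c = dinv g 5 2 x; I5d = dinv g 5 3 x;
          I6a = dinv g 6 0 x; I6b = dinv g 6 1 x; I6c = dinv g 6 2 x; I6d = dinv g 6 3 x
      in
        I6a = 1 / (175*I3^2*I4b) *
          (700*I3^5*I4b - 825*I2*I3^4*I5b + 50*I2*I3^3*I4b*(31*I4a - 18*I4c)
           + 6*I4b*(I4a - I4c)*(6*I4a^2 + 49*I4b^2 - 37*I4a*I4c + 6*I4c^2)
           - 25*I3^2*I5b*(-8*I5a + I5c)
           - 5*I3*(48*I4a^2*I5b - 27*I5b*I4c^2 + 2*I4b*I4c*(-11*I5a + 46*I5c)
               + I4a*(-43*I5a*I4b - 21*I5b*I4c + 8*I4b*I5c) + 7*I4b^2*(4*I5b - 11*I5d)))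
      \<and> I6b = 1 / (175*I3^2*I4b) *
          (1505*I2*I3^3*I4b^2 + 72*I4a^2*I4b^2 + 245*I3*I5a*I4b^2 + 588*I4b^4 + 225*I3^2*I5b^2
           + 405*I3*I4b*I5b*I4c + 72*I4b^2*I4c^2 - 6*I4a*I4b*(55*I3*I5b + 74*I4b*I4c)
           - 490*I3*I4b^2*I5c)
      \<and> I6c = 1 / (175*I3^2*I4b) *
          (-175*I3^5*I4b + 300*I2*I3^4*I5b - 25*I3^2*I5a*I5b - 100*I2*I3^3*I4b*(5*I4a - 9*I4c)
           - 6*I4b*(I4a - I4c)*(6*I4a^2 + 49*I4b^2 - 37*I4a*I4c + 6*I4c^2)
           + 200*I3^2*I5b*I5c
           + 5*I3*(6*I4a^2*I5b + 36*I5b*I4c^2 - I4b*I4c*(I5a + 34*I5c)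
               + 6*I4a*(I5a*I4b - 7*I5b*I4c - I4b*I5c) + 7*I4b^2*(8*I5b - I5d)))
      \<and> I6d = 1 / (175*I3^2*I4b) *
          (1500*I2^2*I3^6 + 36*I4a^4 + 25*I3^2*I5a^2 + 245*I3*I5a*I4b^2 + 588*I4b^4
           + 225*I3^2*I5b^2 - 294*I4a^3*I4c + 895*I3*I4b*I5b*I4c - 185*I3*I5a*I4c^2
           + 366*I4b^2*I4c^2 + 36*I4c^4
           + 6*I4a^2*(61*I4b^2 + 86*I4c^2 - 5*I3*(2*I5a - 9*I5c))
           - 225*I3^2*I5a*I5c - 490*I3*I4b^2*I5c + 220*I3*I4c^2*I5c + 200*I3^2*I5c^2
           + 5*I2*I3^3*(102*I4a^2 - 294*I4a*I4c + 4*(49*I4b^2 + 48*I4c^2)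
               + I3*(-85*I5a + 260*I5c))
           - 245*I3*I4b*I4c*I5d
           - I4a*(6*I4c*(172*I4b^2 + 49*I4c^2)
               + 5*I3*(-49*I4c*(I5a - 2*I5c) + I4b*(164*I5b - 49*I5d)))))"
proof -
  \<comment> \<open>\<open>?R x\<close> stands for the conjunction of the four relations at
    \<open>x\<close>.\<close>
  let "_ \<longleftrightarrow> _ \<and> _ \<and> (\<forall>\<^sub>F x in nhds p0. ?R x)" = ?thesis
  interpret U: riemannian_chart U g using assms(1,3) by unfold_locales
  note p0 = \<open>p0 \<in> U\<close>
  have degenerate: "dim (integral_germs g p0 2) \<noteq> 3"
    if z: "inv3 g p0 \<noteq> 0" "\<forall>\<^sub>F x in nhds p0. dinv g 4 1 x = 0"
  proof -
    obtain W e where W: "p0 \<in> W" "gradient_frame W g e" "\<forall>x\<in>W. dinv g 4 1 x = 0"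
      using U.local_gradient_frame[OF p0 z] by (elim exE conjE)
    interpret G: gradient_frame W g e by (rule W(2))
    have "G.h2 x = 0" if "x \<in> W" for x
      using W(3) that G.dinv_eq(2)[OF that] G.k_nonzero[OF that] by simp
    then show ?thesis using W(1) by (intro G.dim_degenerate)
  qed
  have generic: "dim (integral_germs g p0 2) = 3 \<longleftrightarrow> (\<forall>\<^sub>F x in nhds p0. ?R x)"
    if n: "inv3 g p0 \<noteq> 0" "dinv g 4 1 p0 \<noteq> 0"
  proof -
    have "\<forall>\<^sub>F x in nhds p0. dinv g 4 1 x \<noteq> 0"
    proof -
      obtain W e where W: "p0 \<in> W" "gradient_frame W g e"
        using U.local_gradient_frame[OF p0 n(1) eventually_True] by (elim exE conjE)
      then show ?thesis using gradient_frame.eventually_dinv_4b_nonzero n(2) by blast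
    qed
    \<comment> \<open>A second choice of gradient frame, now on a neighbourhood where I4b has no
      zero.\<close>
    from U.local_gradient_frame[OF p0 n(1) this]
    obtain W e where W: "p0 \<in> W" "gradient_frame W g e" "\<forall>x\<in>W. dinv g 4 1 x \<noteq> 0"
      by (elim exE conjE)
    interpret G: gradient_frame W g e by (rule W(2))
    have h2: "G.h2 x \<noteq> 0" if "x \<in> W" for x
      using W(3) that G.dinv_eq(2)[OF that] by auto
    have R: "?R x \<longleftrightarrow>
        rel_a (G.curv x) (G.k x) (G.h1 x) (G.h2 x) (G.h3 x) (G.t1 x) (G.t2 x) (G.t3 x) (G.t4 x) (G.q1 x) = 0
      \<and> rel_b (G.curv x) (G.k x) (G.h1 x) (G.h2 x) (G.h3 x) (G.t1 x) (G.t2 x) (G.t3 x) (G.t4 x) (G.q2 x) = 0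
      \<and> rel_c (G.curv x) (G.k x) (G.h1 x) (G.h2 x) (G.h3 x) (G.t1 x) (G.t2 x) (G.t3 x) (G.t4 x) (G.q3 x) = 0
      \<and> rel_d (G.curv x) (G.k x) (G.h1 x) (G.h2 x) (G.h3 x) (G.t1 x) (G.t2 x) (G.t3 x) (G.t4 x) (G.q4 x) = 0"
      if x: "x \<in> W" for x
    proof -
      have c: "inv2 g x = G.curv x" by (simp add: inv2_def G.curv_def)
      note nz = G.k_nonzero[OF x] h2[OF x]
      show ?thesis
        unfolding Let_def c G.inv3_eq[OF x] G.dinv_eq[OF x]
        by (intro conj_cong relation_a_iff[OF nz] relation_b_iff[OF nz] relation_c_iff[OF nz] relation_d_iff[OF nz])
    qed
    show ?thesis
    proof
      assume d: "dim (integral_germs g p0 2) = 3"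
      show "\<forall>\<^sub>F x in nhds p0. ?R x"
        by (rule eventually_mono[OF G.relations_necessary_dim[OF W(1) _ d]], rule h2, assumption,
          rule R[THEN iffD2, OF conjunct1 conjunct2]; assumption)
    next
      assume "\<forall>\<^sub>F x in nhds p0. ?R x"
      then obtain S where S: "open S" "p0 \<in> S" "\<forall>x\<in>S. ?R x" unfolding eventually_nhds by (elim exE conjE)
      have "open (S \<inter> W)" "S \<inter> W \<subseteq> W" using S(1) G.open_V by auto
      then interpret S: gradient_frame "S \<inter> W" g e by (rule G.gradient_frame_subset)
      have "rel_a (G.curv x) (G.k x) (G.h1 x) (G.h2 x) (G.h3 x) (G.t1 x) (G.t2 x) (G.t3 x) (G.t4 x) (G.q1 x) = 0
      \<and> rel_b (G.curv x) (G.k x) (G.h1 x) (G.h2 x) (G.h3 x) (G.t1 x) (G.t2 x) (G.t3 x) (G.t4 x) (G.q2 x) = 0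
      \<and> rel_c (G.curv x) (G.k x) (G.h1 x) (G.h2 x) (G.h3 x) (G.t1 x) (G.t2 x) (G.t3 x) (G.t4 x) (G.q3 x) = 0
      \<and> rel_d (G.curv x) (G.k x) (G.h1 x) (G.h2 x) (G.h3 x) (G.t1 x) (G.t2 x) (G.t3 x) (G.t4 x) (G.q4 x) = 0"
        if "x \<in> S \<inter> W" for x
        by (rule R[THEN iffD1, OF IntD2[OF that] bspec[OF S(3) IntD1[OF that]]])
      then show "dim (integral_germs g p0 2) = 3"
        using S(2) W(1) h2 by (intro S.relations_sufficient) simp_all
    qed
  qed
  \<comment> \<open>By the alternatives assumed for I3 and I4b three cases remain: constant
    curvature, I4b identically zero, and both nonzero at \<open>p0\<close>.\<close>
  show ?thesis
    using assms(4,5) U.dim_inv3_zero[OF p0] degenerate generic by argo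
qed

end
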